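(* Let $\mathcal VM$ be a relative tractor bundle, induced by a representation $\mathbb V$ of $P$, on a parabolic geometry of type $(G,Q)$. The Laplacians $\square^{d^{\mathcal V}}_k=\partial^*_\rho d^{\mathcal V}+d^{\mathcal V}\partial^*_\rho$ on $\Omega^k_\rho(M,\mathcal VM)$ associated to the relative twisted exterior derivative are given by $$\square^{d^{\mathcal V}}_k=\tfrac12\bigl(\mathcal C_\rho-\mathrm{id}_{\Lambda^kT^*_\rho M}\otimes C_0\bigr).$$ In particular, if $\mathcal VM$ is induced by a complex irreducible representation $\mathbb V$, then $\square^{d^{\mathcal V}}_k=\tfrac12(\mathcal C_\rho-c_0\,\mathrm{id})$, where $c_0\in\mathbb C$ is the eigenvalue of $C_0$ on $\mathbb V$.
   Context: $G$ is a real or complex semisimple Lie group with Lie algebra $\mathfrak g$; $\mathfrak q\subset\mathfrak p\subset\mathfrak g$ are nested parabolic subalgebras ($\mathfrak p=\mathfrak g$ allowed); $P\subset G$ is a parabolic subgroup with Lie algebra $\mathfrak p$, $Q\subset P$ the normalizer of $\mathfrak q$ in $P$. Nilradicals: $\mathfrak p_+\subset\mathfrak q_+\subset\mathfrak q\subset\mathfrak p$; $P_+=\exp(\mathfrak p_+)$. A parabolic geometry of type $(G,Q)$ is a principal $Q$-bundle $\mathcal G\to M$ with a Cartan connection $\omega\in\Omega^1(\mathcal G,\mathfrak g)$. A relative natural bundle is $\mathcal G\times_Q\mathbb W$ with $\mathbb W$ a $Q$-representation on which $P_+$ acts trivially; a relative tractor bundle is $\mathcal VM=\mathcal G\times_Q\mathbb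 V$ for a finite dimensional representation $\mathbb V$ of $P$ on which $P_+$ acts trivially. The Killing form of $\mathfrak g$ descends to a non-degenerate invariant bilinear form $B$ on $\mathfrak p/\mathfrak p_+$ and identifies $(\mathfrak p/\mathfrak q)^*$ with $\mathfrak q_+/\mathfrak p_+$. $T_\rho M=\mathcal G\times_Q(\mathfrak p/\mathfrak q)$, $T^*_\rho M=\mathcal G\times_Q(\mathfrak q_+/\mathfrak p_+)$; $\Omega^k_\rho(M,\mathcal VM)=\Gamma(\Lambda^kT^*_\rho M\otimes\mathcal VM)$. $\mathcal AM=\mathcal G\times_Q\mathfrak g$, $\mathcal A_\rho M=\mathcal G\times_Q(\mathfrak p/\mathfrak p_+)$, $\mathcal A^0_\rho M=\mathcal G\times_Q(\mathfrak q/\mathfrak p_+)$, $\mathcal A_\rho M/\mathcal A^0_\rho M=T_\rho M$; relative $k$-forms are the elements of $\Gamma(\Lambda^k\mathcal A^*_\rho M\otimes\mathcal VM)$ vanishing upon insertion of one section of $\mathcal A^0_\rho M$. The bracket of $\mathfrak p/\mathfrak p_+$ and its action on $\mathbb V$ induce $\{\ ,\ \}$ on $\mathcal A_\rho M$ and $\bullet:\mathcal A_\rho M\times\mathcal VM\to\mathcal VM$. Relative fundamental derivative: for a relative natural bundle $E$, $D^\rho_s\sigma$ ($s\in\Gamma(\mathcal A_\rho M)$, $\sigma\in\Gamma(E)$) is the derivative of the $Q$-equivariant function corresponding to $\sigma$ along the $Q$-invariant vector field on $\mathcal G$ corresponding via $\omega$ to any $\tilde s\in\Gamma(\mathcal G\times_Q\mathfrak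 p)\subset\Gamma(\mathcal AM)$ projecting to $s$; viewed as $\Gamma(E)\to\Gamma(\mathcal A^*_\rho M\otimes E)$ it can be iterated. The relative curved Casimir operator is $\mathcal C_\rho(\sigma)=(B^{-1}\otimes\mathrm{id})(D^\rho D^\rho\sigma)$, where $B^{-1}:\mathcal A_\rho^*M\otimes\mathcal A_\rho^*M\to\mathbb R$ (or $\mathbb C$) is the form inverse to $B$. $d^{\mathcal V}$ is the restriction to relative forms of $$\tilde d^{\mathcal V}\varphi(s_0,\dots,s_k)=\sum_{i}(-1)^i(D^\rho_{s_i}\varphi)(s_0,\dots,\widehat{s_i},\dots,s_k)+\sum_i(-1)^is_i\bullet\varphi(s_0,\dots,\widehat{s_i},\dots,s_k)+\sum_{i<j}(-1)^{i+j}\varphi(\{s_i,s_j\},s_0,\dots,\widehat{s_i},\dots,\widehat{s_j},\dots,s_k).$$ $\partial^*_\rho$ is induced by $\partial^*_\rho(Z_1\wedge\dots\wedge Z_k\otimes v)=\sum_i(-1)^iZ_1\wedge\dots\widehat{Z_i}\dots\wedge Z_k\otimes Z_i\cdot v+\sum_{i<j}(-1)^{i+j}[Z_i,Z_j]\wedge\dots\widehat{Z_i}\dots\widehat{Z_j}\dots\wedge Z_k\otimes v$ for $Z_i\in\mathfrak q_+/\mathfrak p_+$, $v\in\mathbb V$. $C_0$ is the Casimir operator of $\mathfrak p/\mathfrak p_+$ with respect to $B$: on a representation of $\mathfrak p/\mathfrak p_+$ it acts as $\sum_\ell\eta_\ell\cdot\xi_\ell\cdot$ for $B$-dual bases $\{\xi_\ell\}$,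 $\{\eta_\ell\}$ of $\mathfrak p/\mathfrak p_+$; it also denotes the induced endomorphism of $\mathcal VM$. *)

theory Defs
  imports "HOL-Analysis.Analysis" "HOL-Combinatorics.Permutations"
begin

text \<open>
  The ground field is a type \<open>'k::{real_normed_field,euclidean_space}\<close>, i.e. a finite-dimensional
  normed field extension of the reals; by the theorem of Frobenius these are exactly
  \<open>real\<close> and \<open>complex\<close>. For \<open>complex\<close> all manifolds, maps, forms and sections are holomorphic.
\<close>

section \<open>Smooth and holomorphic maps\<close>

definition kspace :: "('k::real_normed_field \<Rightarrow> 'e::real_vector \<Rightarrow> 'e) \<Rightarrow> bool" where
  "kspace s \<longleftrightarrow> vector_space s \<and> (\<forall>r v. s (of_real r) v = r *\<^sub>R v)"

primrec Ck_on :: "nat \<Rightarrow> ('e::real_normed_vector \<Rightarrow> 'f::real_normed_vector) \<Rightarrow> 'e set \<Rightarrow> bool" where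
  "Ck_on 0 f S \<longleftrightarrow> continuous_on S f"
| "Ck_on (Suc n) f S \<longleftrightarrow> (\<forall>x\<in>S. f differentiable (at x)) \<and>
     (\<forall>v. Ck_on n (\<lambda>x. frechet_derivative f (at x) v) S)"

text \<open>For open \<open>S\<close>: $C^\infty$ with \<open>'k\<close>-linear derivative. The second condition is vacuous over the
  reals and is the Cauchy--Riemann condition over the complex numbers.\<close>

definition ksmooth_on :: "('k \<Rightarrow> 'e \<Rightarrow> 'e) \<Rightarrow> ('k \<Rightarrow> 'f \<Rightarrow> 'f) \<Rightarrow>
    ('e::real_normed_vector \<Rightarrow> 'f::real_normed_vector) \<Rightarrow> 'e set \<Rightarrow> bool" where
  "ksmooth_on s t f S \<longleftrightarrow> (\<forall>n. Ck_on n f S) \<and>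
     (\<forall>x\<in>S. \<forall>a v. frechet_derivative f (at x) (s a v) = t a (frechet_derivative f (at x) v))"

section \<open>Manifolds\<close>

type_synonym ('x, 'e) atlas = "('x set \<times> ('x \<Rightarrow> 'e)) set"

record ('k, 'e, 'x) manifold =
  mscale :: "'k \<Rightarrow> 'e \<Rightarrow> 'e"
  charts :: "('x, 'e) atlas"

definition is_manifold ::
    "('k::real_normed_field, 'e::real_normed_vector, 'x::{t2_space,second_countable_topology}, 'z)
      manifold_scheme \<Rightarrow> bool" where
  "is_manifold M \<longleftrightarrow>
     kspace (mscale M) \<and> (\<exists>B::'e set. finite B \<and> span B = UNIV) \<and>
     (\<forall>(U, c)\<in>charts M. open U \<and> open (c ` U) \<and> homeomorphism U (c ` U) c (inv_into U c)) \<and>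
     (\<Union>(U, c)\<in>charts M. U) = UNIV \<and>
     (\<forall>(U, c)\<in>charts M. \<forall>(V, d)\<in>charts M.
        ksmooth_on (mscale M) (mscale M) (d \<circ> inv_into U c) (c ` (U \<inter> V)))"

definition vec_atlas :: "('v, 'v) atlas" where
  "vec_atlas = {(UNIV, \<lambda>v. v)}"

definition vec_manifold :: "('k \<Rightarrow> 'v \<Rightarrow> 'v) \<Rightarrow> ('k, 'v, 'v) manifold" where
  "vec_manifold s = \<lparr>mscale = s, charts = vec_atlas\<rparr>"

definition prod_manifold ::
    "('k, 'e, 'x, 'z) manifold_scheme \<Rightarrow> ('k, 'f, 'y, 'w) manifold_scheme \<Rightarrow>
      ('k, 'e \<times> 'f, 'x \<times> 'y) manifold" where
  "prod_manifold M N =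
     \<lparr>mscale = (\<lambda>a (v, w). (mscale M a v, mscale N a w)),
      charts = {(U \<times> V, map_prod c d) | U c V d. (U, c) \<in> charts M \<and> (V, d) \<in> charts N}\<rparr>"

text \<open>Smoothness on an arbitrary subset \<open>S\<close> means that the map extends locally to a smooth map on
  an open set. On embedded submanifolds this is smoothness for the induced structure.\<close>

definition smooth_map ::
    "('k, 'e::real_normed_vector, 'x::topological_space, 'z) manifold_scheme \<Rightarrow>
      ('k, 'f::real_normed_vector, 'y::topological_space, 'w) manifold_scheme \<Rightarrow>
      'x set \<Rightarrow> ('x \<Rightarrow> 'y) \<Rightarrow> bool" where
  "smooth_map M N S f \<longleftrightarrow>
     (\<forall>x\<in>S. \<exists>W F. open W \<and> x \<in> W \<and> (\<forall>y\<in>S \<inter> W. F y = f y) \<and> continuous_on W F \<and>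
        (\<forall>(U, c)\<in>charts M. \<forall>(V, d)\<in>charts N.
           ksmooth_on (mscale M) (mscale N) (d \<circ> F \<circ> inv_into U c) (c ` (W \<inter> U \<inter> F -` V))))"

text \<open>The tangent space at \<open>x\<close> is realized as the model space, through the chart
  \<open>chart_at A x\<close>; tangent maps are expressed accordingly.\<close>

definition chart_at :: "('x, 'e) atlas \<Rightarrow> 'x \<Rightarrow> 'x set \<times> ('x \<Rightarrow> 'e)" where
  "chart_at A x = (SOME C. C \<in> A \<and> x \<in> fst C)"

definition coord :: "('x, 'e) atlas \<Rightarrow> 'x \<Rightarrow> 'x \<Rightarrow> 'e" where
  "coord A x = snd (chart_at A x)"

definition coord_inv :: "('x, 'e) atlas \<Rightarrow> 'x \<Rightarrow> 'e \<Rightarrow> 'x" where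
  "coord_inv A x = inv_into (fst (chart_at A x)) (snd (chart_at A x))"

definition mderiv :: "('x, 'e::real_normed_vector) atlas \<Rightarrow> ('y, 'f::real_normed_vector) atlas \<Rightarrow>
    ('x \<Rightarrow> 'y) \<Rightarrow> 'x \<Rightarrow> 'e \<Rightarrow> 'f" where
  "mderiv A B f x =
     frechet_derivative (coord B (f x) \<circ> f \<circ> coord_inv A x) (at (coord A x x))"

definition has_velocity :: "('x::topological_space, 'e::real_normed_vector) atlas \<Rightarrow>
    (real \<Rightarrow> 'x) \<Rightarrow> real \<Rightarrow> 'e \<Rightarrow> bool" where
  "has_velocity A c t v \<longleftrightarrow> isCont c t \<and> ((coord A (c t) \<circ> c) has_vector_derivative v) (at t)"

section \<open>Lie groups\<close>

record ('k, 'd, 'x) lie_group = "('k, 'k ^ 'd, 'x) manifold" +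
  gmul :: "'x \<Rightarrow> 'x \<Rightarrow> 'x"
  gone :: 'x
  ginv :: "'x \<Rightarrow> 'x"

definition is_lie_group ::
    "('k::{real_normed_field,euclidean_space}, 'd::finite, 'x::{t2_space,second_countable_topology})
      lie_group \<Rightarrow> bool" where
  "is_lie_group G \<longleftrightarrow>
     is_manifold G \<and> mscale G = (*s) \<and> Groups.group (gmul G) (gone G) (ginv G) \<and>
     smooth_map (prod_manifold G G) G UNIV (\<lambda>(g, h). gmul G g h) \<and>
     smooth_map G G UNIV (ginv G)"

text \<open>The Lie algebra is the tangent space \<open>'k ^ 'd\<close> at the unit, with \<open>[X, Y]\<close> obtained by
  differentiating \<open>Ad\<close>.\<close>

definition Ad :: "('k::{real_normed_field,euclidean_space}, 'd::finite, 'x::topological_space)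
    lie_group \<Rightarrow> 'x \<Rightarrow> 'k ^ 'd \<Rightarrow> 'k ^ 'd" where
  "Ad G g = mderiv (charts G) (charts G) (\<lambda>h. gmul G (gmul G g h) (ginv G g)) (gone G)"

definition br :: "('k::{real_normed_field,euclidean_space}, 'd::finite, 'x::topological_space)
    lie_group \<Rightarrow> 'k ^ 'd \<Rightarrow> 'k ^ 'd \<Rightarrow> 'k ^ 'd" where
  "br G X Y = mderiv (charts G) vec_atlas (\<lambda>g. Ad G g Y) (gone G) X"

definition exp_image :: "('k::{real_normed_field,euclidean_space}, 'd::finite, 'x::topological_space)
    lie_group \<Rightarrow> (('k, 'd) vec) set \<Rightarrow> 'x set" where
  "exp_image G \<aa> = {\<gamma> 1 | \<gamma>. (\<forall>s t. \<gamma> (s + t) = gmul G (\<gamma> s) (\<gamma> t)) \<and>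
     (\<exists>X\<in>\<aa>. has_velocity (charts G) \<gamma> 0 X)}"

text \<open>Embedded Lie subgroup \<open>H\<close> (given by a slice chart at the unit) with Lie algebra \<open>\<hh>\<close>.\<close>

definition lie_subgroup :: "('k::{real_normed_field,euclidean_space}, 'd::finite,
    'x::topological_space) lie_group \<Rightarrow> 'x set \<Rightarrow> (('k, 'd) vec) set \<Rightarrow> bool" where
  "lie_subgroup G H \<hh> \<longleftrightarrow>
     gone G \<in> H \<and> (\<forall>g\<in>H. \<forall>h\<in>H. gmul G g h \<in> H) \<and> (\<forall>g\<in>H. ginv G g \<in> H) \<and>
     (\<exists>U (c :: 'x \<Rightarrow> 'k ^ 'd) T.
        open U \<and> gone G \<in> U \<and> open (c ` U) \<and> inj_on c U \<and>
        smooth_map G (vec_manifold (*s)) U c \<and>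
        smooth_map (vec_manifold (*s)) G (c ` U) (inv_into U c) \<and>
        c (gone G) = 0 \<and> vec.subspace T \<and> c ` (H \<inter> U) = c ` U \<inter> T \<and>
        \<hh> = {X. mderiv (charts G) vec_atlas c (gone G) X \<in> T})"

section \<open>Semisimple Lie algebras and parabolic subalgebras\<close>

definition killing :: "('k::{real_normed_field,euclidean_space}, 'd::finite, 'x::topological_space)
    lie_group \<Rightarrow> 'k ^ 'd \<Rightarrow> 'k ^ 'd \<Rightarrow> 'k" where
  "killing G X Y = trace (matrix (\<lambda>Z. br G X (br G Y Z)))"

text \<open>Semisimplicity as in Helgason, \<^emph>\<open>Differential Geometry, Lie Groups, and Symmetric Spaces\<close>,
  II.6: the Killing form is non-degenerate.\<close>

definition semisimple :: "('k::{real_normed_field,euclidean_space}, 'd::finite,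
    'x::topological_space) lie_group \<Rightarrow> bool" where
  "semisimple G \<longleftrightarrow> (\<forall>X. (\<forall>Y. killing G X Y = 0) \<longrightarrow> X = 0)"

definition subalgebra :: "('k::{real_normed_field,euclidean_space}, 'd::finite,
    'x::topological_space) lie_group \<Rightarrow> (('k, 'd) vec) set \<Rightarrow> bool" where
  "subalgebra G \<aa> \<longleftrightarrow> vec.subspace \<aa> \<and> (\<forall>X\<in>\<aa>. \<forall>Y\<in>\<aa>. br G X Y \<in> \<aa>)"

text \<open>Parabolic subalgebras as in Cap--Slovak, \<^emph>\<open>Parabolic Geometries I\<close>, 3.1:
  the non-negative part of a \<open>|k|\<close>-grading, whose negative part is generated by the component of
  degree -1. Since \<open>k = 0\<close> and simple ideals contained in degree 0 are permitted, the subalgebra may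
  be all of \<open>\<gg>\<close> or contain simple factors of \<open>\<gg>\<close>. This applies to the real and the complex
  case alike.\<close>

definition k_grading :: "('k::{real_normed_field,euclidean_space}, 'd::finite,
    'x::topological_space) lie_group \<Rightarrow> nat \<Rightarrow> (int \<Rightarrow> (('k, 'd) vec) set) \<Rightarrow> bool" where
  "k_grading G k \<gg> \<longleftrightarrow>
     (\<forall>i. vec.subspace (\<gg> i)) \<and> (\<forall>i. \<bar>i\<bar> > int k \<longrightarrow> \<gg> i = {0}) \<and>
     (\<forall>X. \<exists>!x. (\<forall>i. x i \<in> \<gg> i) \<and> X = (\<Sum>i\<in>{- int k..int k}. x i)) \<and>
     (\<forall>i j. \<forall>X\<in>\<gg> i. \<forall>Y\<in>\<gg> j. br G X Y \<in> \<gg> (i + j)) \<and>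
     (\<forall>\<aa>. subalgebra G \<aa> \<and> \<gg> (- 1) \<subseteq> \<aa> \<longrightarrow> (\<forall>i<0. \<gg> i \<subseteq> \<aa>))"

definition parabolic :: "('k::{real_normed_field,euclidean_space}, 'd::finite,
    'x::topological_space) lie_group \<Rightarrow> (('k, 'd) vec) set \<Rightarrow> bool" where
  "parabolic G \<pp> \<longleftrightarrow> (\<exists>k \<gg>. k_grading G k \<gg> \<and> \<pp> = vec.span (\<Union>i\<in>{0..}. \<gg> i))"

primrec lower_central :: "('k::{real_normed_field,euclidean_space}, 'd::finite,
    'x::topological_space) lie_group \<Rightarrow> (('k, 'd) vec) set \<Rightarrow> nat \<Rightarrow> (('k, 'd) vec) set" where
  "lower_central G \<nn> 0 = \<nn>"
| "lower_central G \<nn> (Suc i) = vec.span {br G X Y | X Y. X \<in> \<nn> \<and> Y \<in> lower_central G \<nn> i}"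

definition nilpotent_ideal :: "('k::{real_normed_field,euclidean_space}, 'd::finite,
    'x::topological_space) lie_group \<Rightarrow> (('k, 'd) vec) set \<Rightarrow> (('k, 'd) vec) set \<Rightarrow> bool" where
  "nilpotent_ideal G \<pp> \<nn> \<longleftrightarrow> vec.subspace \<nn> \<and> \<nn> \<subseteq> \<pp> \<and> (\<forall>X\<in>\<pp>. \<forall>Y\<in>\<nn>. br G X Y \<in> \<nn>) \<and>
     (\<exists>i. lower_central G \<nn> i = {0})"

text \<open>The largest nilpotent ideal, as the sum of all nilpotent ideals.\<close>

definition nilradical :: "('k::{real_normed_field,euclidean_space}, 'd::finite,
    'x::topological_space) lie_group \<Rightarrow> (('k, 'd) vec) set \<Rightarrow> (('k, 'd) vec) set" where
  "nilradical G \<pp> = vec.span (\<Union>{\<nn>. nilpotent_ideal G \<pp> \<nn>})"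

definition normalizer :: "('k::{real_normed_field,euclidean_space}, 'd::finite,
    'x::topological_space) lie_group \<Rightarrow> 'x set \<Rightarrow> (('k, 'd) vec) set \<Rightarrow> 'x set" where
  "normalizer G P \<qq> = {g\<in>P. Ad G g ` \<qq> = \<qq>}"

text \<open>The standing data \<open>G\<close>, \<open>\<qq> \<subseteq> \<pp>\<close>, \<open>P\<close>. That \<open>Q\<close> and \<open>P\<^sub>+ = exp \<pp>\<^sub>+\<close> are Lie subgroups with
  Lie algebras \<open>\<qq>\<close> and \<open>\<pp>\<^sub>+\<close>, and \<open>P\<^sub>+ \<subseteq> P\<close>, is the usual structure theory.\<close>

definition relative_type :: "('k::{real_normed_field,euclidean_space}, 'd::finite,
    'x::{t2_space,second_countable_topology}) lie_group \<Rightarrow>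
    (('k, 'd) vec) set \<Rightarrow> (('k, 'd) vec) set \<Rightarrow> 'x set \<Rightarrow> bool" where
  "relative_type G \<pp> \<qq> P \<longleftrightarrow>
     is_lie_group G \<and> semisimple G \<and> parabolic G \<pp> \<and> parabolic G \<qq> \<and> \<qq> \<subseteq> \<pp> \<and>
     lie_subgroup G P \<pp> \<and>
     lie_subgroup G (normalizer G P \<qq>) \<qq> \<and>
     lie_subgroup G (exp_image G (nilradical G \<pp>)) (nilradical G \<pp>) \<and>
     exp_image G (nilradical G \<pp>) \<subseteq> P"

section \<open>Parabolic geometries\<close>

definition principal_bundle ::
    "('k::{real_normed_field,euclidean_space}, 'd::finite, 'x::{t2_space,second_countable_topology})
      lie_group \<Rightarrow> 'x set \<Rightarrow>
     ('k, 'k ^ 'd, 't::{t2_space,second_countable_topology}) manifold \<Rightarrow>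
     ('k, 'e::real_normed_vector, 'm::{t2_space,second_countable_topology}) manifold \<Rightarrow>
     ('t \<Rightarrow> 'm) \<Rightarrow> ('t \<Rightarrow> 'x \<Rightarrow> 't) \<Rightarrow> bool" where
  "principal_bundle G Q E M \<pi> act \<longleftrightarrow>
     is_manifold E \<and> mscale E = (*s) \<and> is_manifold M \<and> smooth_map E M UNIV \<pi> \<and>
     (\<forall>u. act u (gone G) = u) \<and>
     (\<forall>u. \<forall>g\<in>Q. \<forall>h\<in>Q. act (act u g) h = act u (gmul G g h)) \<and>
     (\<forall>u. \<forall>g\<in>Q. \<pi> (act u g) = \<pi> u) \<and>
     smooth_map (prod_manifold E G) E (UNIV \<times> Q) (\<lambda>(u, g). act u g) \<and>
     (\<forall>x. \<exists>U \<psi>. open U \<and> x \<in> U \<and> bij_betw \<psi> (\<pi> -` U) (U \<times> Q) \<and>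
        smooth_map E (prod_manifold M G) (\<pi> -` U) \<psi> \<and>
        smooth_map (prod_manifold M G) E (U \<times> Q) (inv_into (\<pi> -` U) \<psi>) \<and>
        (\<forall>u\<in>\<pi> -` U. fst (\<psi> u) = \<pi> u \<and>
           (\<forall>g\<in>Q. \<psi> (act u g) = (\<pi> u, gmul G (snd (\<psi> u)) g))))"

text \<open>\<open>\<omega> u\<close> is the value of the one-form at \<open>u\<close>, on the tangent space at \<open>u\<close>. In the last condition
  the velocity of \<open>t \<mapsto> u \<cdot> g(t)\<close> is the value at \<open>u\<close> of the fundamental vector field of \<open>A\<close>.\<close>

definition cartan_connection ::
    "('k::{real_normed_field,euclidean_space}, 'd::finite, 'x::{t2_space,second_countable_topology})
      lie_group \<Rightarrow> 'x set \<Rightarrow> (('k, 'd) vec) set \<Rightarrow>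
     ('k, 'k ^ 'd, 't::{t2_space,second_countable_topology}) manifold \<Rightarrow>
     ('t \<Rightarrow> 'x \<Rightarrow> 't) \<Rightarrow> ('t \<Rightarrow> 'k ^ 'd \<Rightarrow> 'k ^ 'd) \<Rightarrow> bool" where
  "cartan_connection G Q \<qq> E act \<omega> \<longleftrightarrow>
     (\<forall>u. Vector_Spaces.linear (*s) (*s) (\<omega> u) \<and> bij (\<omega> u)) \<and>
     (\<forall>(U, c)\<in>charts E. \<forall>v. ksmooth_on (*s) (*s)
        (\<lambda>y. \<omega> (inv_into U c y) (mderiv vec_atlas (charts E) (inv_into U c) y v)) (c ` U)) \<and>
     (\<forall>u. \<forall>g\<in>Q. \<forall>\<xi>. \<omega> (act u g) (mderiv (charts E) (charts E) (\<lambda>u. act u g) u \<xi>) =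
        Ad G (ginv G g) (\<omega> u \<xi>)) \<and>
     (\<forall>u. \<forall>A\<in>\<qq>. \<forall>g. (\<forall>t. g t \<in> Q) \<and> g 0 = gone G \<and> has_velocity (charts G) g 0 A \<longrightarrow>
        has_velocity (charts E) (\<lambda>t. act u (g t)) 0 (inv (\<omega> u) A))"

definition parabolic_geometry ::
    "('k::{real_normed_field,euclidean_space}, 'd::finite, 'x::{t2_space,second_countable_topology})
      lie_group \<Rightarrow> 'x set \<Rightarrow> (('k, 'd) vec) set \<Rightarrow>
     ('k, 'k ^ 'd, 't::{t2_space,second_countable_topology}) manifold \<Rightarrow>
     ('k, 'e::real_normed_vector, 'm::{t2_space,second_countable_topology}) manifold \<Rightarrow>
     ('t \<Rightarrow> 'm) \<Rightarrow> ('t \<Rightarrow> 'x \<Rightarrow> 't) \<Rightarrow> ('t \<Rightarrow> 'k ^ 'd \<Rightarrow> 'k ^ 'd) \<Rightarrow> bool" where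
  "parabolic_geometry G Q \<qq> E M \<pi> act \<omega> \<longleftrightarrow>
     principal_bundle G Q E M \<pi> act \<and> cartan_connection G Q \<qq> E act \<omega>"

section \<open>Representations\<close>

definition representation ::
    "('k::{real_normed_field,euclidean_space}, 'd::finite, 'x::{t2_space,second_countable_topology})
      lie_group \<Rightarrow> 'x set \<Rightarrow> ('k \<Rightarrow> 'v \<Rightarrow> 'v) \<Rightarrow> ('x \<Rightarrow> 'v::euclidean_space \<Rightarrow> 'v) \<Rightarrow> bool" where
  "representation G P s \<rho> \<longleftrightarrow>
     kspace s \<and> (\<forall>g\<in>P. Vector_Spaces.linear s s (\<rho> g)) \<and>
     \<rho> (gone G) = id \<and> (\<forall>g\<in>P. \<forall>h\<in>P. \<rho> (gmul G g h) = \<rho> g \<circ> \<rho> h) \<and>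
     (\<forall>v. smooth_map G (vec_manifold s) P (\<lambda>g. \<rho> g v))"

definition relative_tractor ::
    "('k::{real_normed_field,euclidean_space}, 'd::finite, 'x::{t2_space,second_countable_topology})
      lie_group \<Rightarrow> (('k, 'd) vec) set \<Rightarrow> 'x set \<Rightarrow> ('k \<Rightarrow> 'v \<Rightarrow> 'v) \<Rightarrow>
      ('x \<Rightarrow> 'v::euclidean_space \<Rightarrow> 'v) \<Rightarrow> bool" where
  "relative_tractor G \<pp> P s \<rho> \<longleftrightarrow>
     representation G P s \<rho> \<and> (\<forall>g\<in>exp_image G (nilradical G \<pp>). \<rho> g = id)"

text \<open>\<open>sC\<close> is a complex structure on the representation space, extending the given \<open>'k\<close>-structure \<open>s\<close>,
  for which the representation is complex and irreducible.\<close>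

definition complex_irreducible ::
    "'x set \<Rightarrow> ('k \<Rightarrow> 'v \<Rightarrow> 'v) \<Rightarrow> ('x \<Rightarrow> 'v::euclidean_space \<Rightarrow> 'v) \<Rightarrow>
      (complex \<Rightarrow> 'v \<Rightarrow> 'v) \<Rightarrow> bool" where
  "complex_irreducible P s \<rho> sC \<longleftrightarrow>
     kspace sC \<and> (\<forall>a. \<exists>c. s a = sC c) \<and> (\<forall>g\<in>P. Vector_Spaces.linear sC sC (\<rho> g)) \<and>
     (\<exists>v::'v. v \<noteq> 0) \<and>
     (\<forall>S. module.subspace sC S \<and> (\<forall>g\<in>P. \<rho> g ` S \<subseteq> S) \<longrightarrow> S = {0} \<or> S = UNIV)"

definition inf_action ::
    "('k::{real_normed_field,euclidean_space}, 'd::finite, 'x::topological_space) lie_group \<Rightarrow>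
      'x set \<Rightarrow> ('x \<Rightarrow> 'v::euclidean_space \<Rightarrow> 'v) \<Rightarrow> 'k ^ 'd \<Rightarrow> 'v \<Rightarrow> 'v" where
  "inf_action G P \<rho> X v = (THE w. \<forall>g. (\<forall>t. g t \<in> P) \<and> g 0 = gone G \<and> has_velocity (charts G) g 0 X
     \<longrightarrow> ((\<lambda>t. \<rho> (g t) v) has_vector_derivative w) (at 0))"

section \<open>Casimir operators\<close>

text \<open>Lists of representatives in \<open>\<pp>\<close> of bases of \<open>\<pp>/\<pp>\<^sub>+\<close> that are dual for the form \<open>B\<close> induced by the
  Killing form.\<close>

definition is_dual_bases ::
    "('k::{real_normed_field,euclidean_space}, 'd::finite, 'x::topological_space) lie_group \<Rightarrow>
      (('k, 'd) vec) set \<Rightarrow> (('k, 'd) vec) list \<Rightarrow> (('k, 'd) vec) list \<Rightarrow> bool" where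
  "is_dual_bases G \<pp> \<xi> \<eta> \<longleftrightarrow> length \<xi> = length \<eta> \<and> set \<xi> \<subseteq> \<pp> \<and> set \<eta> \<subseteq> \<pp> \<and>
     vec.span (set \<xi> \<union> nilradical G \<pp>) = \<pp> \<and> vec.span (set \<eta> \<union> nilradical G \<pp>) = \<pp> \<and>
     (\<forall>i<length \<xi>. \<forall>j<length \<eta>. killing G (\<xi> ! i) (\<eta> ! j) = (if i = j then 1 else 0))"

definition dual_bases ::
    "('k::{real_normed_field,euclidean_space}, 'd::finite, 'x::topological_space) lie_group \<Rightarrow>
      (('k, 'd) vec) set \<Rightarrow> (('k, 'd) vec) list \<times> (('k, 'd) vec) list" where
  "dual_bases G \<pp> = (SOME (\<xi>, \<eta>). is_dual_bases G \<pp> \<xi> \<eta>)"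

definition B_inv ::
    "('k::{real_normed_field,euclidean_space}, 'd::finite, 'x::topological_space) lie_group \<Rightarrow>
      (('k, 'd) vec) set \<Rightarrow> ('k ^ 'd \<Rightarrow> 'k ^ 'd \<Rightarrow> 'v::comm_monoid_add) \<Rightarrow> 'v" where
  "B_inv G \<pp> b = (let (\<xi>, \<eta>) = dual_bases G \<pp> in \<Sum>l<length \<xi>. b (\<xi> ! l) (\<eta> ! l))"

definition casimir_rep ::
    "('k::{real_normed_field,euclidean_space}, 'd::finite, 'x::topological_space) lie_group \<Rightarrow>
      (('k, 'd) vec) set \<Rightarrow> 'x set \<Rightarrow> ('x \<Rightarrow> 'v::euclidean_space \<Rightarrow> 'v) \<Rightarrow> 'v \<Rightarrow> 'v" where
  "casimir_rep G \<pp> P \<rho> v = B_inv G \<pp> (\<lambda>X Y. inf_action G P \<rho> Y (inf_action G P \<rho> X v))"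

text \<open>Sections of associated bundles are equivariant functions on the total space. The fibre is
  always a space of functions \<open>'i \<Rightarrow> 'v\<close>: e.g. \<open>k\<close>-linear maps are functions on lists of length
  \<open>k\<close>, and one more factor \<open>\<A>\<^sub>\<rho>\<^sup>*\<close> turns \<open>'i\<close> into \<open>('k, 'd) vec \<times> 'i\<close>. Elements of \<open>\<pp>/\<pp>\<^sub>+\<close> are
  represented by elements of \<open>\<pp>\<close>. \<open>fund_deriv E \<omega> \<sigma> u (X, _)\<close> is the derivative of \<open>\<sigma>\<close> at \<open>u\<close> along the
  vector field \<open>\<omega>\<^sup>-\<^sup>1(X)\<close>, computed in each component.\<close>

definition fund_deriv :: "('k, 'k ^ 'd, 't) manifold \<Rightarrow> ('t \<Rightarrow> 'k ^ 'd \<Rightarrow> 'k ^ 'd) \<Rightarrow>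
    ('t \<Rightarrow> 'i \<Rightarrow> 'v::euclidean_space) \<Rightarrow>
    't \<Rightarrow> (('k::{real_normed_field,euclidean_space}, 'd::finite) vec) \<times> 'i \<Rightarrow> 'v" where
  "fund_deriv E \<omega> \<sigma> u = (\<lambda>(X, i). mderiv (charts E) vec_atlas (\<lambda>u. \<sigma> u i) u (inv (\<omega> u) X))"

definition curved_casimir ::
    "('k::{real_normed_field,euclidean_space}, 'd::finite, 'x::topological_space) lie_group \<Rightarrow>
      (('k, 'd) vec) set \<Rightarrow> ('k, 'k ^ 'd, 't) manifold \<Rightarrow> ('t \<Rightarrow> 'k ^ 'd \<Rightarrow> 'k ^ 'd) \<Rightarrow>
      ('t \<Rightarrow> 'i \<Rightarrow> 'v::euclidean_space) \<Rightarrow> 't \<Rightarrow> 'i \<Rightarrow> 'v" where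
  "curved_casimir G \<pp> E \<omega> \<sigma> u i =
     B_inv G \<pp> (\<lambda>X Y. fund_deriv E \<omega> (fund_deriv E \<omega> \<sigma>) u (X, (Y, i)))"

section \<open>Relative forms\<close>

text \<open>$\Lambda^k(\mathfrak p/\mathfrak q)^*\otimes\mathbb V$, as alternating \<open>k\<close>-linear maps on \<open>\<pp>\<close> that vanish upon
  insertion of an element of \<open>\<qq>\<close>. They are extended by 0 to all lists, so that equality of forms is
  equality of functions.\<close>

definition forms :: "(('k::field, 'd::finite) vec) set \<Rightarrow> (('k, 'd) vec) set \<Rightarrow>
    ('k \<Rightarrow> 'v \<Rightarrow> 'v) \<Rightarrow> nat \<Rightarrow> ((('k, 'd) vec) list \<Rightarrow> 'v::ab_group_add) set" where
  "forms \<pp> \<qq> s k = {\<phi>.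
     (\<forall>xs. \<not> (length xs = k \<and> set xs \<subseteq> \<pp>) \<longrightarrow> \<phi> xs = 0) \<and>
     (\<forall>xs. length xs = k \<and> set xs \<subseteq> \<pp> \<longrightarrow>
        (\<forall>i<k. \<forall>X\<in>\<pp>. \<forall>Y\<in>\<pp>. \<phi> (xs[i := X + Y]) = \<phi> (xs[i := X]) + \<phi> (xs[i := Y])) \<and>
        (\<forall>i<k. \<forall>X\<in>\<pp>. \<forall>a. \<phi> (xs[i := a *s X]) = s a (\<phi> (xs[i := X]))) \<and>
        (\<forall>i<k. \<forall>j<k. i \<noteq> j \<and> xs ! i = xs ! j \<longrightarrow> \<phi> xs = 0) \<and>
        (set xs \<inter> \<qq> \<noteq> {} \<longrightarrow> \<phi> xs = 0))}"

text \<open>$\Omega^k_\rho(M,\mathcal VM)$.\<close>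

definition rel_forms ::
    "('k::{real_normed_field,euclidean_space}, 'd::finite, 'x::{t2_space,second_countable_topology})
      lie_group \<Rightarrow> (('k, 'd) vec) set \<Rightarrow> (('k, 'd) vec) set \<Rightarrow> 'x set \<Rightarrow>
     ('k, 'k ^ 'd, 't::{t2_space,second_countable_topology}) manifold \<Rightarrow>
     ('t \<Rightarrow> 'x \<Rightarrow> 't) \<Rightarrow> ('k \<Rightarrow> 'v \<Rightarrow> 'v) \<Rightarrow> ('x \<Rightarrow> 'v::euclidean_space \<Rightarrow> 'v) \<Rightarrow> nat \<Rightarrow>
     ('t \<Rightarrow> (('k, 'd) vec) list \<Rightarrow> 'v) set" where
  "rel_forms G \<pp> \<qq> P E act s \<rho> k = {\<phi>.
     (\<forall>u. \<phi> u \<in> forms \<pp> \<qq> s k) \<and>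
     (\<forall>xs. smooth_map E (vec_manifold s) UNIV (\<lambda>u. \<phi> u xs)) \<and>
     (\<forall>u. \<forall>g\<in>normalizer G P \<qq>. \<forall>xs. set xs \<subseteq> \<pp> \<longrightarrow>
        \<phi> (act u g) xs = \<rho> (ginv G g) (\<phi> u (map (Ad G g) xs)))}"

definition omit :: "nat set \<Rightarrow> 'a list \<Rightarrow> 'a list" where
  "omit I xs = nths xs (- I)"

text \<open>The relative twisted exterior derivative. All terms of the defining formula are tensorial in
  the \<open>s\<^sub>i\<close>, so it is written for the values of these sections at \<open>u\<close>.\<close>

definition d_twisted ::
    "('k::{real_normed_field,euclidean_space}, 'd::finite, 'x::topological_space) lie_group \<Rightarrow>
      (('k, 'd) vec) set \<Rightarrow> 'x set \<Rightarrow> ('k, 'k ^ 'd, 't) manifold \<Rightarrow>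
      ('t \<Rightarrow> 'k ^ 'd \<Rightarrow> 'k ^ 'd) \<Rightarrow> ('x \<Rightarrow> 'v::euclidean_space \<Rightarrow> 'v) \<Rightarrow>
      ('t \<Rightarrow> (('k, 'd) vec) list \<Rightarrow> 'v) \<Rightarrow> 't \<Rightarrow> (('k, 'd) vec) list \<Rightarrow> 'v" where
  "d_twisted G \<pp> P E \<omega> \<rho> \<phi> u xs = (if set xs \<subseteq> \<pp> then
     (\<Sum>i<length xs. (- 1) ^ i *\<^sub>R fund_deriv E \<omega> \<phi> u (xs ! i, omit {i} xs)) +
     (\<Sum>i<length xs. (- 1) ^ i *\<^sub>R inf_action G P \<rho> (xs ! i) (\<phi> u (omit {i} xs))) +
     (\<Sum>j<length xs. \<Sum>i<j. (- 1) ^ (i + j) *\<^sub>R \<phi> u (br G (xs ! i) (xs ! j) # omit {i, j} xs))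
     else 0)"

text \<open>$Z_1\wedge\dots\wedge Z_k\otimes v$ for representatives \<open>Z\<^sub>i \<in> \<qq>\<^sub>+\<close> of elements of
  $\mathfrak q_+/\mathfrak p_+\cong(\mathfrak p/\mathfrak q)^*$, as the multilinear map
  $(X_1,\dots,X_k)\mapsto\det(B(Z_i,X_j))\,v$.\<close>

definition wedge ::
    "('k::{real_normed_field,euclidean_space}, 'd::finite, 'x::topological_space) lie_group \<Rightarrow>
      (('k, 'd) vec) set \<Rightarrow> ('k \<Rightarrow> 'v \<Rightarrow> 'v) \<Rightarrow> (('k, 'd) vec) list \<Rightarrow> 'v \<Rightarrow>
      (('k, 'd) vec) list \<Rightarrow> 'v::ab_group_add" where
  "wedge G \<pp> s Zs v = (\<lambda>xs. if length xs = length Zs \<and> set xs \<subseteq> \<pp> then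
     s (\<Sum>\<sigma> | \<sigma> permutes {..<length Zs}.
          of_int (sign \<sigma>) * (\<Prod>i<length Zs. killing G (Zs ! i) (xs ! \<sigma> i))) v
     else 0)"

text \<open>The value of $\partial^*_\rho$ on $Z_1\wedge\dots\wedge Z_k\otimes v$; list positions start at 0, which
  accounts for the exponent \<open>Suc i\<close>.\<close>

definition codiff_wedge ::
    "('k::{real_normed_field,euclidean_space}, 'd::finite, 'x::topological_space) lie_group \<Rightarrow>
      (('k, 'd) vec) set \<Rightarrow> 'x set \<Rightarrow> ('k \<Rightarrow> 'v \<Rightarrow> 'v) \<Rightarrow>
      ('x \<Rightarrow> 'v::euclidean_space \<Rightarrow> 'v) \<Rightarrow> (('k, 'd) vec) list \<Rightarrow> 'v \<Rightarrow> (('k, 'd) vec) list \<Rightarrow> 'v" where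
  "codiff_wedge G \<pp> P s \<rho> Zs v = (\<lambda>xs.
     (\<Sum>i<length Zs. (- 1) ^ Suc i *\<^sub>R wedge G \<pp> s (omit {i} Zs) (inf_action G P \<rho> (Zs ! i) v) xs) +
     (\<Sum>j<length Zs. \<Sum>i<j.
        (- 1) ^ (i + j) *\<^sub>R wedge G \<pp> s (br G (Zs ! i) (Zs ! j) # omit {i, j} Zs) v xs))"

text \<open>$\partial^*_\rho$ is the linear map on $\Lambda^k(\mathfrak p/\mathfrak q)^*\otimes\mathbb V$ with these values on the
  (spanning) decomposable elements.\<close>

definition codiff ::
    "('k::{real_normed_field,euclidean_space}, 'd::finite, 'x::topological_space) lie_group \<Rightarrow>
      (('k, 'd) vec) set \<Rightarrow> (('k, 'd) vec) set \<Rightarrow> 'x set \<Rightarrow> ('k \<Rightarrow> 'v \<Rightarrow> 'v) \<Rightarrow>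
      ('x \<Rightarrow> 'v::euclidean_space \<Rightarrow> 'v) \<Rightarrow> nat \<Rightarrow>
      ((('k, 'd) vec) list \<Rightarrow> 'v) \<Rightarrow> (('k, 'd) vec) list \<Rightarrow> 'v" where
  "codiff G \<pp> \<qq> P s \<rho> k = (SOME \<delta>.
     (\<forall>\<phi>\<in>forms \<pp> \<qq> s k. \<forall>\<psi>\<in>forms \<pp> \<qq> s k.
        \<delta> (\<lambda>xs. \<phi> xs + \<psi> xs) = (\<lambda>xs. \<delta> \<phi> xs + \<delta> \<psi> xs)) \<and>
     (\<forall>\<phi>\<in>forms \<pp> \<qq> s k. \<forall>a. \<delta> (\<lambda>xs. s a (\<phi> xs)) = (\<lambda>xs. s a (\<delta> \<phi> xs))) \<and>
     (\<forall>Zs v. length Zs = k \<and> set Zs \<subseteq> nilradical G \<qq> \<longrightarrow>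
        \<delta> (wedge G \<pp> s Zs v) = codiff_wedge G \<pp> P s \<rho> Zs v))"

definition laplacian ::
    "('k::{real_normed_field,euclidean_space}, 'd::finite, 'x::topological_space) lie_group \<Rightarrow>
      (('k, 'd) vec) set \<Rightarrow> (('k, 'd) vec) set \<Rightarrow> 'x set \<Rightarrow> ('k, 'k ^ 'd, 't) manifold \<Rightarrow>
      ('t \<Rightarrow> 'k ^ 'd \<Rightarrow> 'k ^ 'd) \<Rightarrow> ('k \<Rightarrow> 'v \<Rightarrow> 'v) \<Rightarrow>
      ('x \<Rightarrow> 'v::euclidean_space \<Rightarrow> 'v) \<Rightarrow> nat \<Rightarrow>
      ('t \<Rightarrow> (('k, 'd) vec) list \<Rightarrow> 'v) \<Rightarrow> 't \<Rightarrow> (('k, 'd) vec) list \<Rightarrow> 'v" where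
  "laplacian G \<pp> \<qq> P E \<omega> s \<rho> k \<phi> u xs =
     codiff G \<pp> \<qq> P s \<rho> (Suc k) (d_twisted G \<pp> P E \<omega> \<rho> \<phi> u) xs +
     d_twisted G \<pp> P E \<omega> \<rho> (\<lambda>u. codiff G \<pp> \<qq> P s \<rho> k (\<phi> u)) u xs"

end

theory Submission
  imports Defs "HOL-Computational_Algebra.Fundamental_Theorem_Algebra"
begin

text \<open>
  Let \<open>e\<close>, \<open>e*\<close> run through dual bases of \<open>\<pp>/\<pp>\<^sub>+\<close>, let \<open>L\<^sub>X\<close> be the action of \<open>X\<close> on
  $\Lambda^k(\mathfrak p/\mathfrak p_+)^*\otimes\mathbb V$, \<open>R\<^sub>X\<close> the action on the coefficients only, \<open>\<iota>\<^sub>X\<close> the insertion of \<open>X\<close> and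
  \<open>D\<^sub>X\<close> the derivative along \<open>\<omega>\<^sup>-\<^sup>1(X)\<close>. Then \<open>\<iota>\<^sub>X d + d \<iota>\<^sub>X = D\<^sub>X + L\<^sub>X\<close>, and the codifferential is
  \<open>- 1/2 \<Sum> (L\<^sub>e\<^sub>* + R\<^sub>e\<^sub>*) \<iota>\<^sub>e\<close>. The commutator of \<open>d\<close> with \<open>L + R\<close> involves no curvature, and the invariance of \<open>\<Sum> e \<otimes> e*\<close>
  turns twice the negative of the Laplacian into \<open>\<Sum> (2 L\<^sub>e\<^sub>* D\<^sub>e + L\<^sub>e\<^sub>* L\<^sub>e + R\<^sub>e\<^sub>* R\<^sub>e)\<close>.

  By equivariance \<open>D\<^sub>X + L\<^sub>X\<close> annihilates relative forms for \<open>X \<in> \<qq>\<close>. With dual bases \<open>X\<^sub>l\<close>, \<open>Z\<^sub>l\<close> of \<open>\<pp>/\<qq>\<close> and \<open>\<qq>\<^sub>+/\<pp>\<^sub>+\<close>,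
  the sum \<open>\<Sum> (D\<^sub>e + L\<^sub>e) (D\<^sub>e\<^sub>* + L\<^sub>e\<^sub>*)\<close> therefore reduces to \<open>D\<^sub>H + L\<^sub>H\<close> for \<open>H = \<Sum> [Z\<^sub>l, X\<^sub>l]\<close>, and \<open>H \<in> \<qq>\<close> because the trace
  of a nilpotent map vanishes. Hence this sum is zero, so \<open>\<Sum> (2 L\<^sub>e\<^sub>* D\<^sub>e + L\<^sub>e\<^sub>* L\<^sub>e)\<close> is the negative of the curved
  Casimir operator, while \<open>\<Sum> R\<^sub>e\<^sub>* R\<^sub>e\<close> is the Casimir operator of the coefficients.
\<close>

section \<open>Linear algebra\<close>

text \<open>The curved Casimir operator is written with two derivatives, while the Laplacian
  contains only one. They can agree because B pairs p/q with q_+/p_+: in a contraction one of the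
  two directions may be taken in q, where equivariance trades the derivative for an algebraic
  action. No Levi factor and no complement of q has to be chosen.

  The operator R compensates an asymmetry: a sum over dual bases of p/p_+ meets every bracket of two
  factors twice, but every action of a factor on V once. The commutator of d with L + R then leaves
  two terms. The one with a derivative completes (L + R) D to 2 L D; the one with R cancels the
  mixed terms, so that just the Casimir operator of V survives.

  Curvature does not appear because two derivatives along constant fields are never exchanged;
  derivatives only meet actions with constant coefficients. Over the complex numbers the
  contractions are independent of bases only if all maps are complex linear in each slot, including
  derivatives of derivatives, hence the attention to holomorphy. As P may be disconnected, the
  scalar c_0 rests on invariance under the group, not only under p.\<close>

lemma trace_representation:
  fixes f :: "'a::field ^ 'n \<Rightarrow> 'a ^ 'n"
  assumes f: "Vector_Spaces.linear (*s) (*s) f"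
    and B: "vec.independent B" "vec.span B = UNIV"
  shows "trace (matrix f) = (\<Sum>b\<in>B. vec.representation B (f b) b)"
proof -
  interpret f: Vector_Spaces.linear "(*s)" "(*s)" f by (rule f)
  have fin: "finite B" using vec.finiteI_independent[OF B(1)] .
  let ?r = "vec.representation B"
  have e: "(\<Sum>b\<in>B. ?r x b *s b) = x" for x
    by (rule vec.sum_representation_eq) (use B fin in auto)
  have exp: "(\<Sum>j\<in>UNIV. x $ j *s axis j 1) = x" for x :: "'a ^ 'n"
    by (rule basis_expansion)
  have rlin: "?r (\<Sum>j\<in>UNIV. c j *s axis j 1) b = (\<Sum>j\<in>UNIV. c j * ?r (axis j 1) b)" for c :: "'n \<Rightarrow> 'a" and b
    by (simp add: vec.representation_sum vec.representation_scale B)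
  have "trace (matrix f) = (\<Sum>j\<in>UNIV. f (\<Sum>b\<in>B. ?r (axis j 1) b *s b) $ j)"
    by (simp add: trace_def matrix_def e)
  also have "\<dots> = (\<Sum>j\<in>UNIV. \<Sum>b\<in>B. ?r (axis j 1) b * f b $ j)"
    by (simp add: f.sum f.scale)
  also have "\<dots> = (\<Sum>b\<in>B. \<Sum>j\<in>UNIV. f b $ j * ?r (axis j 1) b)"
    by (subst sum.swap) (simp add: mult.commute)
  also have "\<dots> = (\<Sum>b\<in>B. ?r (f b) b)"
    by (simp add: rlin[symmetric] exp)
  finally show ?thesis .
qed

text \<open>The basis is built along the flag of the kernels of the powers of \<open>f\<close>, which makes the matrix of
  \<open>f\<close> strictly triangular.\<close>

lemma trace_nilpotent:
  fixes f :: "'a::field ^ 'n \<Rightarrow> 'a ^ 'n"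
  assumes f: "Vector_Spaces.linear (*s) (*s) f" and nil: "\<And>x. (f ^^ m) x = 0"
  shows "trace (matrix f) = 0"
proof -
  interpret f: Vector_Spaces.linear "(*s)" "(*s)" f by (rule f)
  have sub: "vec.subspace {x. (f ^^ i) x = 0}" for i
  proof (induction i)
    case (Suc i)
    have "{x. (f ^^ Suc i) x = 0} = f -` {x. (f ^^ i) x = 0}"
      by (auto simp: funpow_Suc_right simp del: funpow.simps)
    then show ?case
      using f.subspace_vimage[OF Suc] by simp
  qed simp
  have "\<exists>B. vec.independent B \<and> vec.span B = {x. (f ^^ i) x = 0} \<and>
      (\<forall>b\<in>B. vec.representation B (f b) b = 0)" for i
  proof (induction i)
    case 0
    then show ?case by (intro exI[of _ "{}"]) (auto simp: vec.independent_empty)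
  next
    case (Suc i)
    then obtain B where B: "vec.independent B" "vec.span B = {x. (f ^^ i) x = 0}"
      "\<And>b. b \<in> B \<Longrightarrow> vec.representation B (f b) b = 0" by blast
    have fN: "f x \<in> vec.span B" if "(f ^^ Suc i) x = 0" for x
      using that unfolding B(2) by (simp add: funpow_Suc_right del: funpow.simps)
    have "B \<subseteq> {x. (f ^^ Suc i) x = 0}"
      using vec.span_superset[of B] unfolding B(2) by (auto simp: f.zero)
    then obtain C where C: "B \<subseteq> C" "C \<subseteq> {x. (f ^^ Suc i) x = 0}" "vec.independent C"
      "{x. (f ^^ Suc i) x = 0} \<subseteq> vec.span C"
      using vec.maximal_independent_subset_extend[OF _ B(1)] by blast
    have "vec.span C = {x. (f ^^ Suc i) x = 0}"
      using vec.span_minimal[OF C(2) sub] C(4) by blast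
    moreover have "vec.representation C (f b) b = 0" if "b \<in> C" for b
    proof -
      \<comment> \<open>\<open>f\<close> lowers the flag, so \<open>f b\<close> lies in
        \<open>span B\<close> and has the coordinates it had in B. The one at an old b vanishes by
        induction, the one at a new b because b is not in B.\<close>
      have eq: "vec.representation C (f b) = vec.representation B (f b)"
        by (rule vec.representation_extend[OF C(3) _ C(1)]) (use fN C(2) that in auto)
      show ?thesis
      proof (cases "b \<in> B")
        case True
        then show ?thesis using B(3) eq by simp
      next
        case False
        then show ?thesis unfolding eq using vec.representation_ne_zero by blast
      qed
    qed
    ultimately show ?case using C(3) by blast
  qed
  then obtain B where B: "vec.independent B" "vec.span B = {x. (f ^^ m) x = 0}"
      "\<And>b. b \<in> B \<Longrightarrow> vec.representation B (f b) b = 0" by blast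
  show ?thesis
    by (subst trace_representation[OF f B(1)]) (use B nil in auto)
qed

section \<open>Dual lists for a bilinear pairing\<close>

locale bilinear_pairing =
  fixes K :: "'a::field ^ 'n \<Rightarrow> 'a ^ 'n \<Rightarrow> 'a"
  assumes K_add_left: "K (x + y) z = K x z + K y z"
    and K_add_right: "K x (y + z) = K x y + K x z"
    and K_scale_left: "K (a *s x) z = a * K x z"
    and K_scale_right: "K x (a *s z) = a * K x z"
begin

lemma K_zero_left [simp]: "K 0 z = 0"
  using K_scale_left[of 0 0 z] by simp

lemma K_zero_right [simp]: "K x 0 = 0"
  using K_scale_right[of x 0 0] by simp

lemma K_minus_left [simp]: "K (- x) z = - K x z"
  using K_add_left[of "- x" x z] by (simp add: eq_neg_iff_add_eq_0)

lemma K_minus_right [simp]: "K x (- z) = - K x z"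
  using K_add_right[of x "- z" z] by (simp add: eq_neg_iff_add_eq_0)

lemma K_diff_left: "K (x - y) z = K x z - K y z"
  using K_add_left[of x "- y" z] by simp

lemma K_diff_right: "K x (y - z) = K x y - K x z"
  using K_add_right[of x y "- z"] by simp

lemma K_sum_left: "K (sum f A) z = (\<Sum>i\<in>A. K (f i) z)"
  by (induction A rule: infinite_finite_induct) (auto simp: K_add_left)

lemma K_sum_right: "K x (sum f A) = (\<Sum>i\<in>A. K x (f i))"
  by (induction A rule: infinite_finite_induct) (auto simp: K_add_right)

lemma K_span_left: "x \<in> vec.span A \<Longrightarrow> (\<And>x. x \<in> A \<Longrightarrow> K x z = 0) \<Longrightarrow> K x z = 0"
  by (induction rule: vec.span_induct_alt) (auto simp: K_add_left K_scale_left)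

lemma K_span_right: "x \<in> vec.span A \<Longrightarrow> (\<And>x. x \<in> A \<Longrightarrow> K z x = 0) \<Longrightarrow> K z x = 0"
  by (induction rule: vec.span_induct_alt) (auto simp: K_add_right K_scale_right)

definition dual_lists :: "('a ^ 'n) list \<Rightarrow> ('a ^ 'n) list \<Rightarrow> bool" where
  "dual_lists xs zs \<longleftrightarrow> length xs = length zs \<and>
     (\<forall>i<length xs. \<forall>j<length xs. K (xs ! i) (zs ! j) = (if i = j then 1 else 0))"

text \<open>Duality forces linear independence. The bound makes it possible to choose a dual pair of
  maximal length below.\<close>

lemma dual_lists_length_le:
  assumes "dual_lists xs zs"
  shows "length xs \<le> CARD('n)"
proof -
  have len: "length xs = length zs"
    and d: "\<And>i j. i < length xs \<Longrightarrow> j < length xs \<Longrightarrow> K (xs ! i) (zs ! j) = (if i = j then 1 else 0)"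
    using assms by (auto simp: dual_lists_def)
  have dist: "distinct xs"
    unfolding distinct_conv_nth using d by (metis zero_neq_one)
  have "vec.independent (set xs)"
  proof (rule vec.independent_if_scalars_zero)
    fix c x assume 0: "(\<Sum>x\<in>set xs. c x *s x) = 0" and "x \<in> set xs"
    then obtain i where i: "i < length xs" "x = xs ! i" by (auto simp: in_set_conv_nth)
    have "K y (zs ! i) = (if y = x then 1 else 0)" if "y \<in> set xs" for y
      using that d i dist by (auto simp: in_set_conv_nth nth_eq_iff_index_eq)
    then have "K (\<Sum>y\<in>set xs. c y *s y) (zs ! i) = (\<Sum>y\<in>set xs. if y = x then c x else 0)"
      unfolding K_sum_left K_scale_left by (intro sum.cong) auto
    then show "c x = 0" using 0 \<open>x \<in> set xs\<close> by (simp add: sum.delta)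
  qed simp
  then have "card (set xs) \<le> vec.dim (UNIV :: ('a ^ 'n) set)"
    by (intro vec.independent_card_le_dim) auto
  then show ?thesis
    unfolding distinct_card[OF dist] vec_dim_card .
qed

lemma dual_lists_expand:
  assumes "dual_lists xs zs" "j < length xs"
  shows "K (\<Sum>i<length xs. c i *s xs ! i) (zs ! j) = c j"
    and "K (xs ! j) (\<Sum>i<length xs. c i *s zs ! i) = c j"
proof -
  have "K (\<Sum>i<length xs. c i *s xs ! i) (zs ! j) = (\<Sum>i<length xs. if i = j then c j else 0)"
    unfolding K_sum_left K_scale_left using assms by (intro sum.cong) (auto simp: dual_lists_def)
  then show "K (\<Sum>i<length xs. c i *s xs ! i) (zs ! j) = c j"
    using assms(2) by simp
  have "K (xs ! j) (\<Sum>i<length xs. c i *s zs ! i) = (\<Sum>i<length xs. if i = j then c j else 0)"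
    unfolding K_sum_right K_scale_right using assms by (intro sum.cong) (auto simp: dual_lists_def)
  then show "K (xs ! j) (\<Sum>i<length xs. c i *s zs ! i) = c j"
    using assms(2) by simp
qed

text \<open>A dual pair of lists of maximal length spans both quotients, as any further vectors that pair
  non-trivially could be normalized and appended.\<close>

lemma exists_dual_lists:
  assumes S: "vec.subspace S" "vec.subspace S0" "S0 \<subseteq> S"
    and T: "vec.subspace T" "vec.subspace T0" "T0 \<subseteq> T"
    and rad1: "\<And>x z. x \<in> S0 \<Longrightarrow> z \<in> T \<Longrightarrow> K x z = 0"
    and nd1: "\<And>x. x \<in> S \<Longrightarrow> (\<And>z. z \<in> T \<Longrightarrow> K x z = 0) \<Longrightarrow> x \<in> S0"
    and nd2: "\<And>z. z \<in> T \<Longrightarrow> (\<And>x. x \<in> S \<Longrightarrow> K x z = 0) \<Longrightarrow> z \<in> T0"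
  obtains xs zs where "dual_lists xs zs" "set xs \<subseteq> S" "set zs \<subseteq> T"
    "vec.span (set xs \<union> S0) = S" "vec.span (set zs \<union> T0) = T"
proof -
  let ?P = "\<lambda>n. \<exists>xs zs. length xs = n \<and> dual_lists xs zs \<and> set xs \<subseteq> S \<and> set zs \<subseteq> T"
  have "?P 0" by (auto simp: dual_lists_def)
  moreover have "\<forall>n. ?P n \<longrightarrow> n \<le> CARD('n)" using dual_lists_length_le by blast
  ultimately obtain n where n: "?P n" and max: "\<And>m. ?P m \<Longrightarrow> m \<le> n"
    using Nat.ex_has_greatest_nat[of ?P 0 "CARD('n)"] by blast
  then obtain xs zs where xz: "length xs = n" "dual_lists xs zs" "set xs \<subseteq> S" "set zs \<subseteq> T" by blast
  have len: "length zs = n" using xz by (simp add: dual_lists_def)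
  have inS: "(\<Sum>i<n. c i *s xs ! i) \<in> S" for c
    using xz S(1) by (intro vec.subspace_sum vec.subspace_scale) (auto simp: subset_iff)
  have inT: "(\<Sum>i<n. c i *s zs ! i) \<in> T" for c
    using xz T(1) len by (intro vec.subspace_sum vec.subspace_scale) (auto simp: subset_iff)
  have key: "v - (\<Sum>i<n. K v (zs ! i) *s xs ! i) \<in> S0" if v: "v \<in> S" for v
  proof (rule ccontr)
    define w where "w = v - (\<Sum>i<n. K v (zs ! i) *s xs ! i)"
    assume "v - (\<Sum>i<n. K v (zs ! i) *s xs ! i) \<notin> S0"
    moreover have wS: "w \<in> S" unfolding w_def using v inS S(1) by (intro vec.subspace_diff)
    ultimately obtain z where z: "z \<in> T" "K w z \<noteq> 0" using nd1[OF wS] w_def by blast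
    \<comment> \<open>Correcting z by the zs makes it pair to zero with every entry of xs. As w
      pairs to zero with the zs, the correction does not change \<open>K w z\<close>, and the factor
      normalizes this to 1.\<close>
    define y where "y = (1 / K w z) *s (z - (\<Sum>i<n. K (xs ! i) z *s zs ! i))"
    have yT: "y \<in> T" unfolding y_def
      using z inT T(1) by (intro vec.subspace_scale vec.subspace_diff)
    have w0: "K w (zs ! j) = 0" if "j < n" for j
      unfolding w_def K_diff_left using dual_lists_expand(1)[OF xz(2)] that xz(1) by simp
    have y0: "K (xs ! j) y = 0" if "j < n" for j
      unfolding y_def K_diff_right K_scale_right using dual_lists_expand(2)[OF xz(2)] that xz(1) by simp
    have wy: "K w y = 1"
      using z by (simp add: y_def K_diff_right K_scale_right K_sum_right w0)
    have "dual_lists (xs @ [w]) (zs @ [y])"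
      using xz(1,2) len w0 y0 wy
      by (auto simp: dual_lists_def nth_append less_Suc_eq)
    moreover have "length (xs @ [w]) = Suc n" using xz by simp
    ultimately have "?P (Suc n)"
      using wS yT xz by (intro exI[of _ "xs @ [w]"] exI[of _ "zs @ [y]"]) auto
    then show False using max[of "Suc n"] by simp
  qed
  \<comment> \<open>No second extension argument is required: modulo S0, which pairs to zero with T,
    every v in S is a combination of the xs, and the corrected vector is orthogonal to
    these.\<close>
  have key2: "z - (\<Sum>i<n. K (xs ! i) z *s zs ! i) \<in> T0" if z: "z \<in> T" for z
  proof (rule nd2)
    define y where "y = z - (\<Sum>i<n. K (xs ! i) z *s zs ! i)"
    show yT: "z - (\<Sum>i<n. K (xs ! i) z *s zs ! i) \<in> T" using z inT T(1) by (intro vec.subspace_diff)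
    have y0: "K (xs ! j) y = 0" if "j < n" for j
      unfolding y_def K_diff_right K_scale_right using dual_lists_expand(2)[OF xz(2)] that xz(1) by simp
    fix v assume "v \<in> S"
    then have "K (v - (\<Sum>i<n. K v (zs ! i) *s xs ! i)) y = 0"
      using key rad1 yT y_def by blast
    then show "K v (z - (\<Sum>i<n. K (xs ! i) z *s zs ! i)) = 0"
      unfolding y_def[symmetric] by (simp add: K_diff_left K_sum_left K_scale_left y0)
  qed
  have sp: "vec.span (set as \<union> U0) = U" if U: "vec.subspace U" "U0 \<subseteq> U" "set as \<subseteq> U" "length as = n"
    and k: "\<And>v. v \<in> U \<Longrightarrow> \<exists>c. v - (\<Sum>i<n. c i *s as ! i) \<in> U0" for as U U0
  proof
    show "vec.span (set as \<union> U0) \<subseteq> U" using U by (intro vec.span_minimal) auto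
    show "U \<subseteq> vec.span (set as \<union> U0)"
    proof
      fix v assume "v \<in> U"
      then obtain c where "v - (\<Sum>i<n. c i *s as ! i) \<in> U0" using k by blast
      then have "(v - (\<Sum>i<n. c i *s as ! i)) + (\<Sum>i<n. c i *s as ! i) \<in> vec.span (set as \<union> U0)"
        using U by (intro vec.span_add vec.span_sum vec.span_scale vec.span_base) auto
      then show "v \<in> vec.span (set as \<union> U0)" by simp
    qed
  qed
  show thesis
  proof
    show "dual_lists xs zs" "set xs \<subseteq> S" "set zs \<subseteq> T" using xz by auto
    show "vec.span (set xs \<union> S0) = S" by (rule sp[OF S(1,3) xz(3,1)], rule exI, erule key)
    show "vec.span (set zs \<union> T0) = T" by (rule sp[OF T(1,3) xz(4) len], rule exI, erule key2)
  qed
qed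

end

section \<open>Killing form and parabolic subalgebras\<close>

abbreviation tr :: "('a::field ^ 'n \<Rightarrow> 'a ^ 'n) \<Rightarrow> 'a" where
  "tr f \<equiv> trace (matrix f)"

lemma tr_comm:
  fixes f g :: "'a::field ^ 'n \<Rightarrow> 'a ^ 'n"
  assumes "Vector_Spaces.linear (*s) (*s) f" "Vector_Spaces.linear (*s) (*s) g"
  shows "tr (\<lambda>x. f (g x)) = tr (\<lambda>x. g (f x))"
proof -
  have "tr (f \<circ> g) = tr (g \<circ> f)"
    by (subst (1 2) matrix_compose_gen) (simp_all add: assms trace_mul_sym[of "matrix f"])
  then show ?thesis by (simp add: o_def)
qed

lemma tr_add: "tr (\<lambda>x. f x + g x) = tr f + tr (g :: 'a::field ^ 'n \<Rightarrow> 'a ^ 'n)"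
  by (simp add: trace_def matrix_def sum.distrib)

lemma tr_diff: "tr (\<lambda>x. f x - g x) = tr f - tr (g :: 'a::field ^ 'n \<Rightarrow> 'a ^ 'n)"
  by (simp add: trace_def matrix_def sum_subtractf)

lemma tr_scale: "tr (\<lambda>x. a *s f x) = a * tr (f :: 'a::field ^ 'n \<Rightarrow> 'a ^ 'n)"
  by (simp add: trace_def matrix_def sum_distrib_left)

lemma tr_zero [simp]: "tr (\<lambda>x. 0 :: 'a::field ^ 'n) = 0"
  by (simp add: trace_def matrix_def)

lemma tr_sum: "tr (\<lambda>x. \<Sum>i\<in>A. f i x) = (\<Sum>i\<in>A. tr (f i :: 'a::field ^ 'n \<Rightarrow> 'a ^ 'n))"
  by (induction A rule: infinite_finite_induct) (simp_all add: tr_add)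

lemma linear_funpow:
  fixes f :: "'a::field ^ 'n \<Rightarrow> 'a ^ 'n"
  assumes "Vector_Spaces.linear (*s) (*s) f"
  shows "Vector_Spaces.linear (*s) (*s) (f ^^ m)"
proof (induction m)
  case 0
  show ?case unfolding funpow.simps by (rule vec.linear_id)
next
  case (Suc m)
  show ?case unfolding funpow.simps by (rule Vector_Spaces.linear_compose[OF Suc assms])
qed

text \<open>The properties of the bracket that differentiating \<open>Ad\<close> yields directly.
  Antisymmetry, and with it homogeneity in the first slot, is derived by way of the Killing
  form.\<close>

locale leibniz_bracket =
  fixes G :: "('k::{real_normed_field,euclidean_space}, 'd::finite, 'x::topological_space) lie_group"
  assumes linear_br: "Vector_Spaces.linear (*s) (*s) (br G X)"
    and br_add_left: "br G (X + Y) Z = br G X Z + br G Y Z"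
    and leibniz: "br G X (br G Y Z) = br G (br G X Y) Z + br G Y (br G X Z)"
    and semisimple: "semisimple G"
begin

abbreviation bracket ("\<lbrakk>_, _\<rbrakk>") where "\<lbrakk>X, Y\<rbrakk> \<equiv> br G X Y"
abbreviation K where "K \<equiv> killing G"

lemma br_add_right: "\<lbrakk>X, Y + Z\<rbrakk> = \<lbrakk>X, Y\<rbrakk> + \<lbrakk>X, Z\<rbrakk>"
  using Vector_Spaces.linear.axioms(3)[OF linear_br] module_hom.add[OF module_hom_iff_linear[THEN iffD2, OF linear_br]]
  by blast

lemma br_scale_right: "\<lbrakk>X, a *s Y\<rbrakk> = a *s \<lbrakk>X, Y\<rbrakk>"
  using module_hom.scale[OF module_hom_iff_linear[THEN iffD2, OF linear_br]] by blast

lemma linear_br_br: "Vector_Spaces.linear (*s) (*s) (\<lambda>Z. \<lbrakk>X, \<lbrakk>Y, Z\<rbrakk>\<rbrakk>)"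
  using Vector_Spaces.linear_compose[OF linear_br[of Y] linear_br[of X]] by (simp add: o_def)

lemma br_zero_right [simp]: "\<lbrakk>X, 0\<rbrakk> = 0"
  using br_scale_right[of X 0 0] by simp

text \<open>By the Leibniz rule \<open>ad [X, X]\<close> vanishes, so \<open>[X, X]\<close> lies in the radical of the Killing form; this spares
  the symmetry of the second derivative of the multiplication.\<close>

lemma br_self [simp]: "\<lbrakk>X, X\<rbrakk> = 0"
proof -
  have "K \<lbrakk>X, X\<rbrakk> Y = 0" for Y
  proof -
    have "\<lbrakk>\<lbrakk>X, X\<rbrakk>, Z\<rbrakk> = 0" for Z using leibniz[of X X Z] by simp
    then show ?thesis by (simp add: killing_def)
  qed
  then show ?thesis using semisimple unfolding semisimple_def by blast
qed

lemma br_anticomm: "\<lbrakk>X, Y\<rbrakk> = - \<lbrakk>Y, X\<rbrakk>"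
  using br_self[of "X + Y"] unfolding br_add_left br_add_right
  by (simp add: eq_neg_iff_add_eq_0 add.commute)

lemma br_zero_left [simp]: "\<lbrakk>0, X\<rbrakk> = 0"
  using br_anticomm[of 0 X] by simp

lemma br_scale_left: "\<lbrakk>a *s X, Y\<rbrakk> = a *s \<lbrakk>X, Y\<rbrakk>"
  using br_anticomm[of "a *s X" Y] br_anticomm[of X Y] by (simp add: br_scale_right)

lemma br_minus_right [simp]: "\<lbrakk>X, - Y\<rbrakk> = - \<lbrakk>X, Y\<rbrakk>"
  using br_scale_right[of X "- 1" Y] by simp

lemma br_diff_right: "\<lbrakk>X, Y - Z\<rbrakk> = \<lbrakk>X, Y\<rbrakk> - \<lbrakk>X, Z\<rbrakk>"
  using br_add_right[of X Y "- Z"] by simp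

sublocale bilinear_pairing K
proof
  show "K (X + Y) Z = K X Z + K Y Z" for X Y Z
    by (simp add: killing_def br_add_left tr_add)
  show "K X (Y + Z) = K X Y + K X Z" for X Y Z
    by (simp add: killing_def br_add_left br_add_right tr_add)
  show "K (a *s X) Z = a * K X Z" for X Z a
    by (simp add: killing_def br_scale_left tr_scale)
  show "K X (a *s Z) = a * K X Z" for X Z a
    by (simp add: killing_def br_scale_left br_scale_right tr_scale)
qed

lemma K_sym: "K X Y = K Y X"
  unfolding killing_def by (rule tr_comm[OF linear_br linear_br])

lemma K_nondeg: "(\<And>Y. K X Y = 0) \<Longrightarrow> X = 0"
  using semisimple unfolding semisimple_def by blast

lemma K_invariant: "K \<lbrakk>X, Y\<rbrakk> Z = K X \<lbrakk>Y, Z\<rbrakk>"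
proof -
  have 1: "\<lbrakk>\<lbrakk>X, Y\<rbrakk>, W\<rbrakk> = \<lbrakk>X, \<lbrakk>Y, W\<rbrakk>\<rbrakk> - \<lbrakk>Y, \<lbrakk>X, W\<rbrakk>\<rbrakk>" for X Y W
    using leibniz[of X Y W] by simp
  have "tr (\<lambda>W. \<lbrakk>Y, \<lbrakk>X, \<lbrakk>Z, W\<rbrakk>\<rbrakk>\<rbrakk>) = tr (\<lambda>W. \<lbrakk>X, \<lbrakk>Z, \<lbrakk>Y, W\<rbrakk>\<rbrakk>\<rbrakk>)"
    by (rule tr_comm[OF linear_br linear_br_br])
  then show ?thesis
    unfolding killing_def 1 br_diff_right tr_diff by simp
qed

lemma K_invariant': "K \<lbrakk>X, Y\<rbrakk> Z = - K Y \<lbrakk>X, Z\<rbrakk>"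
  using K_invariant[of Y X Z] br_anticomm[of X Y] by simp

definition perp where "perp S = {X. \<forall>Y\<in>S. K X Y = 0}"

lemma subspace_perp: "vec.subspace (perp S)"
  by (auto simp: vec.subspace_def perp_def K_add_left K_scale_left)

section \<open>The filtration of a grading and its Killing orthogonals\<close>

context
  fixes k \<gg> assumes grading: "k_grading G k \<gg>"
begin

definition filt :: "int \<Rightarrow> (('k, 'd) vec) set" where
  "filt i = vec.span (\<Union>j\<in>{i..}. \<gg> j)"

lemma grade_outside: "\<bar>i\<bar> > int k \<Longrightarrow> \<gg> i = {0}"
  using grading by (simp add: k_grading_def)

lemma br_grade: "X \<in> \<gg> i \<Longrightarrow> Y \<in> \<gg> j \<Longrightarrow> \<lbrakk>X, Y\<rbrakk> \<in> \<gg> (i + j)"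
  using grading by (simp add: k_grading_def)

lemma grade_decomp:
  obtains x where "\<And>i. x i \<in> \<gg> i" "X = (\<Sum>i\<in>{- int k..int k}. x i)"
  using grading unfolding k_grading_def by metis

lemma grade_subset_filt: "i \<le> j \<Longrightarrow> \<gg> j \<subseteq> filt i"
  unfolding filt_def by (rule order_trans[OF _ vec.span_superset]) auto

lemma subspace_filt: "vec.subspace (filt i)"
  by (simp add: filt_def)

lemma br_filt: "X \<in> filt i \<Longrightarrow> Y \<in> filt j \<Longrightarrow> \<lbrakk>X, Y\<rbrakk> \<in> filt (i + j)"
proof -
  assume X: "X \<in> filt i" and Y: "Y \<in> filt j"
  have 1: "\<lbrakk>U, Y\<rbrakk> \<in> filt (i + j)" if U: "U \<in> \<gg> l" "i \<le> l" for U l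
    using Y unfolding filt_def[of j]
  proof (induction rule: vec.span_induct_alt)
    case base
    then show ?case by (simp add: subspace_filt vec.subspace_0)
  next
    case (step c x y)
    then obtain l' where "x \<in> \<gg> l'" "j \<le> l'" by auto
    then have "\<lbrakk>U, x\<rbrakk> \<in> filt (i + j)"
      using br_grade[OF U(1)] grade_subset_filt[of "i + j" "l + l'"] U(2) by auto
    then show ?case
      using step by (simp add: br_add_right br_scale_right vec.subspace_add vec.subspace_scale subspace_filt)
  qed
  show ?thesis
    using X unfolding filt_def[of i]
  proof (induction rule: vec.span_induct_alt)
    case base
    then show ?case by (simp add: subspace_filt vec.subspace_0)
  next
    case (step c x y)
    then show ?case
      using 1 by (auto simp: br_add_left br_scale_left intro!: vec.subspace_add vec.subspace_scale subspace_filt)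
  qed
qed

lemma filt_top: "i > int k \<Longrightarrow> filt i = {0}"
proof -
  assume "i > int k"
  then have "(\<Union>j\<in>{i..}. \<gg> j) \<subseteq> {0}" using grade_outside by auto
  then have "filt i \<subseteq> {0}" unfolding filt_def by (intro vec.span_minimal) auto
  then show ?thesis using vec.subspace_0[OF subspace_filt] by auto
qed

lemma filt_bot: "filt (- int k) = UNIV"
proof -
  have "X \<in> filt (- int k)" for X
  proof -
    obtain x where x: "\<And>i. x i \<in> \<gg> i" "X = (\<Sum>i\<in>{- int k..int k}. x i)" using grade_decomp by blast
    show ?thesis unfolding x(2)
      using x(1) grade_subset_filt by (intro vec.subspace_sum subspace_filt) auto
  qed
  then show ?thesis by auto
qed

lemma filt_mono: "i \<le> j \<Longrightarrow> filt j \<subseteq> filt i"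
  unfolding filt_def by (intro vec.span_mono UN_mono) auto

text \<open>\<open>ad X ad Y\<close> shifts degrees by i + j, which is not zero. Only the 2k + 1
  degrees from -k to k occur, so 2k + 1 applications leave this range; the operator is nilpotent and
  its trace vanishes.\<close>

lemma K_grade:
  assumes X: "X \<in> \<gg> i" and Y: "Y \<in> \<gg> j" and ij: "i + j \<noteq> 0"
  shows "K X Y = 0"
proof -
  let ?T = "\<lambda>Z. \<lbrakk>X, \<lbrakk>Y, Z\<rbrakk>\<rbrakk>"
  interpret T: Vector_Spaces.linear "(*s)" "(*s)" ?T by (rule linear_br_br)
  have 1: "(?T ^^ m) Z \<in> \<gg> (l + int m * (i + j))" if Z: "Z \<in> \<gg> l" for m Z l
  proof (induction m)
    case (Suc m)
    have "\<lbrakk>X, \<lbrakk>Y, (?T ^^ m) Z\<rbrakk>\<rbrakk> \<in> \<gg> (i + (j + (l + int m * (i + j))))"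
      by (intro br_grade X Y Suc)
    then show ?case by (simp add: algebra_simps)
  qed (use Z in simp)
  have lin: "Vector_Spaces.linear (*s) (*s) (?T ^^ m)" for m
    by (rule linear_funpow[OF linear_br_br])
  have 2: "(?T ^^ (2 * k + 1)) Z = 0" if Z: "Z \<in> \<gg> l" for Z l
  proof (cases "\<bar>l\<bar> > int k")
    case True
    then have "Z = 0" using Z grade_outside by blast
    then show ?thesis
      using module_hom.zero[OF module_hom_iff_linear[THEN iffD2, OF lin]] by simp
  next
    case False
    have "\<bar>int (2 * k + 1) * (i + j)\<bar> \<ge> int (2 * k + 1)"
      using ij mult_left_mono[of 1 "\<bar>i + j\<bar>" "int (2 * k + 1)"] by (simp add: abs_mult)
    then have "\<bar>l + int (2 * k + 1) * (i + j)\<bar> > int k"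
      using False by linarith
    then show ?thesis using 1[OF Z, of "2 * k + 1"] grade_outside by blast
  qed
  have "(?T ^^ (2 * k + 1)) Z = 0" for Z
  proof -
    obtain x where x: "\<And>i. x i \<in> \<gg> i" "Z = (\<Sum>i\<in>{- int k..int k}. x i)" using grade_decomp by blast
    show ?thesis
      unfolding x(2) module_hom.sum[OF module_hom_iff_linear[THEN iffD2, OF lin]]
      using 2[OF x(1)] by (intro sum.neutral) blast
  qed
  then show ?thesis
    unfolding killing_def by (rule trace_nilpotent[OF linear_br_br])
qed

text \<open>Degree i pairs with degree -i only. If X is orthogonal to \<open>filt j\<close>, its
  component of a degree i up to -j is orthogonal to the component of degree -i, hence to everything,
  and vanishes by non-degeneracy. The cases j = 0 and j = 1 describe a parabolic and its nilradical
  as orthogonals of each other.\<close>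

lemma perp_filt: "perp (filt j) = filt (1 - j)"
proof
  show "filt (1 - j) \<subseteq> perp (filt j)"
  proof
    fix X assume X: "X \<in> filt (1 - j)"
    have "K X Y = 0" if Y: "Y \<in> filt j" for Y
      using X unfolding filt_def[of "1 - j"]
    proof (rule K_span_left)
      fix U assume "U \<in> (\<Union>j\<in>{1 - j..}. \<gg> j)"
      then obtain i where i: "U \<in> \<gg> i" "1 - j \<le> i" by auto
      show "K U Y = 0"
        using Y unfolding filt_def[of j]
      proof (rule K_span_right)
        fix W assume "W \<in> (\<Union>j\<in>{j..}. \<gg> j)"
        then obtain i' where "W \<in> \<gg> i'" "j \<le> i'" by auto
        then show "K U W = 0" using K_grade[OF i(1)] i(2) by force
      qed
    qed
    then show "X \<in> perp (filt j)" by (simp add: perp_def)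
  qed
  show "perp (filt j) \<subseteq> filt (1 - j)"
  proof
    fix X assume X: "X \<in> perp (filt j)"
    obtain x where x: "\<And>i. x i \<in> \<gg> i" "X = (\<Sum>i\<in>{- int k..int k}. x i)" using grade_decomp by blast
    have K1: "K X Y = K (x i) Y" if Y: "Y \<in> \<gg> (- i)" and i: "i \<in> {- int k..int k}" for Y i
    proof -
      have "K X Y = (\<Sum>l\<in>{- int k..int k}. if l = i then K (x i) Y else 0)"
        unfolding x(2) K_sum_left using K_grade[OF x(1) Y] by (intro sum.cong) auto
      then show ?thesis using i by simp
    qed
    have x0: "x i = 0" if i: "i \<le> - j" "i \<in> {- int k..int k}" for i
    proof (rule K_nondeg)
      fix Y
      obtain y where y: "\<And>i. y i \<in> \<gg> i" "Y = (\<Sum>i\<in>{- int k..int k}. y i)" using grade_decomp by blast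
      have "K (x i) (y l) = 0" for l
      proof (cases "l = - i")
        case True
        then have "y l \<in> filt j" using y(1)[of l] grade_subset_filt[of j l] i by auto
        then have "K X (y l) = 0" using X by (simp add: perp_def)
        then show ?thesis using K1[OF _ i(2), of "y l"] y(1)[of l] True by simp
      next
        case False
        then show ?thesis using K_grade[OF x(1) y(1)] by simp
      qed
      then show "K (x i) Y = 0" by (simp add: y(2) K_sum_right)
    qed
    show "X \<in> filt (1 - j)"
      unfolding x(2)
    proof (intro vec.subspace_sum subspace_filt)
      fix i assume i: "i \<in> {- int k..int k}"
      show "x i \<in> filt (1 - j)"
      proof (cases "i \<le> - j")
        case True
        then show ?thesis using x0 i vec.subspace_0[OF subspace_filt] by simp
      next
        case False
        then show ?thesis using x(1)[of i] grade_subset_filt[of "1 - j" i] by auto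
      qed
    qed
  qed
qed

lemma br_pow_filt: "Z \<in> filt 1 \<Longrightarrow> W \<in> filt i \<Longrightarrow> (br G Z ^^ m) W \<in> filt (i + int m)"
proof (induction m)
  case (Suc m)
  then have "\<lbrakk>Z, (br G Z ^^ m) W\<rbrakk> \<in> filt (1 + (i + int m))" by (intro br_filt) auto
  then show ?case by (simp add: add.assoc add.left_commute)
qed simp

text \<open>The lowest degree is -k, so 2k + 1 steps lead beyond degree k; one exponent serves all Z
  and W.\<close>

lemma br_pow_filt_1: "Z \<in> filt 1 \<Longrightarrow> (br G Z ^^ (2 * k + 1)) W = 0"
  using br_pow_filt[of Z W "- int k" "2 * k + 1"] filt_top[of "- int k + int (2 * k + 1)"] filt_bot
  by auto

lemma lower_central_filt: "lower_central G (filt 1) i \<subseteq> filt (1 + int i)"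
proof (induction i)
  case (Suc i)
  have "{\<lbrakk>X, Y\<rbrakk> | X Y. X \<in> filt 1 \<and> Y \<in> lower_central G (filt 1) i} \<subseteq> filt (1 + (1 + int i))"
    using Suc br_filt by blast
  then show ?case by (simp add: vec.span_minimal subspace_filt)
qed simp

lemma nilpotent_ideal_filt: "nilpotent_ideal G (filt 0) (filt 1)"
proof -
  have "lower_central G (filt 1) k = {0}"
  proof
    show "lower_central G (filt 1) k \<subseteq> {0}"
      using lower_central_filt[of k] filt_top[of "1 + int k"] by auto
    show "{0} \<subseteq> lower_central G (filt 1) k"
      by (cases k) (auto simp: vec.span_zero subspace_filt vec.subspace_0)
  qed
  then show ?thesis
    unfolding nilpotent_ideal_def
    using br_filt[of _ 0 _ 1] filt_mono[of 0 1] subspace_filt by auto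
qed

end

text \<open>For X in the ideal and Y in p, \<open>ad X ad Y\<close> is nilpotent on p, because its
  powers descend the lower central series. The same holds for its Killing adjoint
  \<open>ad Y ad X\<close>. Hence a power of \<open>ad X ad Y\<close> maps the whole Lie algebra
  into the orthogonal of p, which lies in p, and a further power gives zero. So the trace
  vanishes.\<close>

lemma nilpotent_ideal_subset_perp:
  assumes p: "subalgebra G \<pp>" and pp: "perp \<pp> \<subseteq> \<pp>" and n: "nilpotent_ideal G \<pp> \<nn>"
  shows "\<nn> \<subseteq> perp \<pp>"
proof -
  have n: "vec.subspace \<nn>" "\<nn> \<subseteq> \<pp>" "\<And>X Y. X \<in> \<pp> \<Longrightarrow> Y \<in> \<nn> \<Longrightarrow> \<lbrakk>X, Y\<rbrakk> \<in> \<nn>"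
    using n by (auto simp: nilpotent_ideal_def)
  obtain m where m: "lower_central G \<nn> m = {0}" using assms(3) by (auto simp: nilpotent_ideal_def)
  have lc_sub: "vec.subspace (lower_central G \<nn> i)" for i
    by (cases i) (auto simp: n)
  have ideal: "\<lbrakk>Y, W\<rbrakk> \<in> lower_central G \<nn> i" if Y: "Y \<in> \<pp>" and W: "W \<in> lower_central G \<nn> i" for i Y W
    using W
  proof (induction i arbitrary: W)
    case (Suc i)
    from Suc.prems show ?case unfolding lower_central.simps
    proof (induction rule: vec.span_induct_alt)
      case (step c x y)
      then obtain U V where UV: "x = \<lbrakk>U, V\<rbrakk>" "U \<in> \<nn>" "V \<in> lower_central G \<nn> i" by blast
      have "\<lbrakk>Y, x\<rbrakk> = \<lbrakk>\<lbrakk>Y, U\<rbrakk>, V\<rbrakk> + \<lbrakk>U, \<lbrakk>Y, V\<rbrakk>\<rbrakk>" unfolding UV by (rule leibniz)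
      moreover have "\<lbrakk>\<lbrakk>Y, U\<rbrakk>, V\<rbrakk> \<in> lower_central G \<nn> (Suc i)"
        using n(3)[OF Y UV(2)] UV(3) by (auto intro: vec.span_base)
      moreover have "\<lbrakk>U, \<lbrakk>Y, V\<rbrakk>\<rbrakk> \<in> lower_central G \<nn> (Suc i)"
        using UV(2) Suc.IH[OF UV(3)] by (auto intro: vec.span_base)
      ultimately have "\<lbrakk>Y, x\<rbrakk> \<in> lower_central G \<nn> (Suc i)"
        using vec.subspace_add[OF lc_sub] by metis
      then show ?case using step(2) by (simp add: br_add_right br_scale_right vec.span_add vec.span_scale)
    qed (simp add: vec.span_zero)
  qed (use n(3)[OF Y] in simp)
  have lc_step: "\<lbrakk>X, W\<rbrakk> \<in> lower_central G \<nn> (Suc i)" if "X \<in> \<nn>" "W \<in> lower_central G \<nn> i" for X W i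
    using that by (auto intro: vec.span_base)
  have "K X Y = 0" if X: "X \<in> \<nn>" and Y: "Y \<in> \<pp>" for X Y
  proof -
    let ?T = "\<lambda>Z. \<lbrakk>X, \<lbrakk>Y, Z\<rbrakk>\<rbrakk>" and ?S = "\<lambda>Z. \<lbrakk>Y, \<lbrakk>X, Z\<rbrakk>\<rbrakk>"
    have brp: "\<lbrakk>Y, Z\<rbrakk> \<in> \<pp>" if "Z \<in> \<pp>" for Z using p Y that by (auto simp: subalgebra_def)
    have XZ: "\<lbrakk>X, Z\<rbrakk> \<in> \<nn>" if "Z \<in> \<pp>" for Z
      using n(3)[OF that X] br_anticomm[of X Z] vec.subspace_neg[OF n(1)] by simp
    have T: "(?T ^^ Suc i) Z \<in> lower_central G \<nn> i" if Z: "Z \<in> \<pp>" for Z i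
    proof (induction i)
      case 0
      show ?case using XZ[OF brp[OF Z]] by simp
    next
      case (Suc i)
      then show ?case using lc_step[OF X ideal[OF Y Suc]] by simp
    qed
    have S: "(?S ^^ Suc i) Z \<in> lower_central G \<nn> i" if Z: "Z \<in> \<pp>" for Z i
    proof (induction i)
      case 0
      show ?case using n(3)[OF Y XZ[OF Z]] by simp
    next
      case (Suc i)
      then show ?case using ideal[OF Y lc_step[OF X Suc]] by simp
    qed
    have KT: "K ((?T ^^ i) Z) W = K Z ((?S ^^ i) W)" for i Z W
    proof (induction i arbitrary: W)
      case (Suc i)
      have "K ((?T ^^ Suc i) Z) W = K ((?T ^^ i) Z) (?S W)"
        by (simp add: K_invariant')
      then show ?case by (simp add: Suc funpow_Suc_right del: funpow.simps)
    qed simp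
    have "(?T ^^ (Suc m + Suc m)) Z = 0" for Z
    proof -
      have "(?T ^^ Suc m) Z \<in> perp \<pp>"
        using KT[of "Suc m" Z] S[of _ m] m by (auto simp: perp_def simp del: funpow.simps)
      then have "(?T ^^ Suc m) ((?T ^^ Suc m) Z) \<in> {0}" using T[of _ m] m pp by blast
      then show ?thesis unfolding funpow_add by simp
    qed
    then show ?thesis
      unfolding killing_def by (rule trace_nilpotent[OF linear_br_br])
  qed
  then show ?thesis by (auto simp: perp_def)
qed

text \<open>From here on a parabolic subalgebra is seen only through these facts; the grading does
  not occur again.\<close>

lemma parabolicD:
  assumes "parabolic G \<pp>"
  shows "subalgebra G \<pp>" and "nilradical G \<pp> = perp \<pp>" and "perp (perp \<pp>) = \<pp>" and "perp \<pp> \<subseteq> \<pp>"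
    and "\<exists>m. \<forall>Z\<in>perp \<pp>. \<forall>W. (br G Z ^^ m) W = 0"
    and "X \<in> \<pp> \<Longrightarrow> Z \<in> perp \<pp> \<Longrightarrow> \<lbrakk>X, Z\<rbrakk> \<in> perp \<pp>"
proof -
  obtain k \<gg> where g: "k_grading G k \<gg>" and "\<pp> = vec.span (\<Union>i\<in>{0..}. \<gg> i)"
    using assms by (auto simp: parabolic_def)
  then have p: "\<pp> = filt \<gg> 0" by (simp add: filt_def[OF g])
  have pp: "perp \<pp> = filt \<gg> 1" using perp_filt[OF g, of 0] p by simp
  show 1: "subalgebra G \<pp>"
    using br_filt[OF g, of _ 0 _ 0] by (auto simp: subalgebra_def p subspace_filt[OF g])
  show "perp (perp \<pp>) = \<pp>" using perp_filt[OF g, of 1] p pp by simp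
  show 2: "perp \<pp> \<subseteq> \<pp>" unfolding pp using filt_mono[OF g, of 0 1] p by simp
  show "\<exists>m. \<forall>Z\<in>perp \<pp>. \<forall>W. (br G Z ^^ m) W = 0"
    unfolding pp using br_pow_filt_1[OF g] by blast
  have nil: "nilpotent_ideal G \<pp> (perp \<pp>)"
    unfolding pp using nilpotent_ideal_filt[OF g] p by simp
  then show "X \<in> \<pp> \<Longrightarrow> Z \<in> perp \<pp> \<Longrightarrow> \<lbrakk>X, Z\<rbrakk> \<in> perp \<pp>"
    by (auto simp: nilpotent_ideal_def)
  show "nilradical G \<pp> = perp \<pp>"
  proof
    show "nilradical G \<pp> \<subseteq> perp \<pp>"
      unfolding nilradical_def using nilpotent_ideal_subset_perp[OF 1 2]
      by (intro vec.span_minimal subspace_perp) auto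
    show "perp \<pp> \<subseteq> nilradical G \<pp>"
      unfolding nilradical_def using nil by (auto intro: vec.span_base)
  qed
qed

end

section \<open>Contraction with the inverse of the invariant form\<close>

lemma B_inv_add: "B_inv G \<pp> (\<lambda>X Y. b X Y + c X Y) = B_inv G \<pp> b + B_inv G \<pp> c"
  by (simp add: B_inv_def Let_def sum.distrib split: prod.split)

lemma B_inv_hom:
  assumes "f 0 = 0" "\<And>v w. f (v + w) = f v + f w"
  shows "B_inv G \<pp> (\<lambda>X Y. f (b X Y)) = f (B_inv G \<pp> b)"
proof -
  have "(\<Sum>i\<in>A. f (g i)) = f (sum g A)" for g :: "nat \<Rightarrow> _" and A
    by (induction A rule: infinite_finite_induct) (simp_all add: assms)
  then show ?thesis by (simp add: B_inv_def Let_def split: prod.split)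
qed

lemma B_inv_uminus: "B_inv G \<pp> (\<lambda>X Y. - b X Y) = - (B_inv G \<pp> b :: 'v::ab_group_add)"
  by (rule B_inv_hom) simp_all

lemma B_inv_diff: "B_inv G \<pp> (\<lambda>X Y. b X Y - c X Y) = B_inv G \<pp> b - (B_inv G \<pp> c :: 'v::ab_group_add)"
  using B_inv_add[of G \<pp> b "\<lambda>X Y. - c X Y"] by (simp add: B_inv_uminus)

lemma B_inv_zero [simp]: "B_inv G \<pp> (\<lambda>X Y. 0) = 0"
  by (simp add: B_inv_def Let_def split: prod.split)

text \<open>\<open>r\<close> stands for the infinitesimal action of \<open>\<pp>\<close> on the representation space.\<close>

locale rel_algebra = leibniz_bracket G
  for G :: "('k::{real_normed_field,euclidean_space}, 'd::finite, 'x::topological_space) lie_group" +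
  fixes \<pp> \<qq> :: "('k ^ 'd) set" and s :: "'k \<Rightarrow> 'v::euclidean_space \<Rightarrow> 'v"
    and r :: "'k ^ 'd \<Rightarrow> 'v \<Rightarrow> 'v"
  assumes parabolic_p: "parabolic G \<pp>" and parabolic_q: "parabolic G \<qq>" and q_subset: "\<qq> \<subseteq> \<pp>"
    and kspace_s: "kspace s"
    and r_add: "X \<in> \<pp> \<Longrightarrow> r X (v + w) = r X v + r X w"
    and r_scale: "X \<in> \<pp> \<Longrightarrow> r X (s a v) = s a (r X v)"
    and r_add_left: "X \<in> \<pp> \<Longrightarrow> Y \<in> \<pp> \<Longrightarrow> r (X + Y) v = r X v + r Y v"
    and r_scale_left: "X \<in> \<pp> \<Longrightarrow> r (a *s X) v = s a (r X v)"
    and r_null: "X \<in> nilradical G \<pp> \<Longrightarrow> r X v = 0"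
    and r_br: "X \<in> \<pp> \<Longrightarrow> Y \<in> \<pp> \<Longrightarrow> r (br G X Y) v = r X (r Y v) - r Y (r X v)"
begin

sublocale S: vector_space s
  using kspace_s by (simp add: kspace_def)

abbreviation \<nn> where "\<nn> \<equiv> nilradical G \<pp>"

lemma s_real: "s (of_real c) v = c *\<^sub>R v"
  using kspace_s by (simp add: kspace_def)

lemma s_scaleR: "s a (c *\<^sub>R v) = c *\<^sub>R s a v"
  unfolding s_real[symmetric] S.scale_scale by (simp add: mult.commute)

lemma p_subspace: "vec.subspace \<pp>"
  and p_br [intro]: "X \<in> \<pp> \<Longrightarrow> Y \<in> \<pp> \<Longrightarrow> \<lbrakk>X, Y\<rbrakk> \<in> \<pp>"
  using parabolicD(1)[OF parabolic_p] by (auto simp: subalgebra_def)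

lemma q_subspace: "vec.subspace \<qq>"
  using parabolicD(1)[OF parabolic_q] by (auto simp: subalgebra_def)

lemma p_add [intro]: "X \<in> \<pp> \<Longrightarrow> Y \<in> \<pp> \<Longrightarrow> X + Y \<in> \<pp>"
  and p_scale [intro]: "X \<in> \<pp> \<Longrightarrow> a *s X \<in> \<pp>"
  and p_zero [simp]: "0 \<in> \<pp>"
  using p_subspace by (auto simp: vec.subspace_def)

lemma p_sum: "(\<And>i. i \<in> A \<Longrightarrow> f i \<in> \<pp>) \<Longrightarrow> sum f A \<in> \<pp>"
  using vec.subspace_sum[OF p_subspace] by blast

lemma nil_perp: "\<nn> = perp \<pp>"
  by (rule parabolicD(2)[OF parabolic_p])

lemma nil_subset: "\<nn> \<subseteq> \<pp>"
  unfolding nil_perp by (rule parabolicD(4)[OF parabolic_p])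

lemma nil_subspace: "vec.subspace \<nn>"
  unfolding nil_perp by (rule subspace_perp)

lemma nil_br: "X \<in> \<pp> \<Longrightarrow> Z \<in> \<nn> \<Longrightarrow> \<lbrakk>X, Z\<rbrakk> \<in> \<nn>"
  unfolding nil_perp by (rule parabolicD(6)[OF parabolic_p])

lemma nil_br': "Z \<in> \<nn> \<Longrightarrow> X \<in> \<pp> \<Longrightarrow> \<lbrakk>Z, X\<rbrakk> \<in> \<nn>"
  using nil_br[of X Z] br_anticomm[of Z X] vec.subspace_neg[OF nil_subspace] by simp

lemma K_nil: "Z \<in> \<nn> \<Longrightarrow> X \<in> \<pp> \<Longrightarrow> K Z X = 0" "Z \<in> \<nn> \<Longrightarrow> X \<in> \<pp> \<Longrightarrow> K X Z = 0"
  unfolding nil_perp perp_def using K_sym by auto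

lemma perp_antimono: "\<qq> \<subseteq> \<pp> \<Longrightarrow> perp \<pp> \<subseteq> perp \<qq>"
  by (auto simp: perp_def)

lemma nilq_perp: "nilradical G \<qq> = perp \<qq>"
  by (rule parabolicD(2)[OF parabolic_q])

lemma nil_subset_nilq: "\<nn> \<subseteq> nilradical G \<qq>"
  unfolding nil_perp nilq_perp by (rule perp_antimono[OF q_subset])

lemma nilq_subset_q: "nilradical G \<qq> \<subseteq> \<qq>"
  unfolding nilq_perp by (rule parabolicD(4)[OF parabolic_q])

lemma nilq_subset_p: "nilradical G \<qq> \<subseteq> \<pp>"
  using nilq_subset_q q_subset by blast

lemma nil_subset_q: "\<nn> \<subseteq> \<qq>"
  using nil_subset_nilq nilq_subset_q by blast

section \<open>Dual bases of p/p_+\<close>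

lemma ex_dual_bases: "\<exists>\<xi> \<eta>. is_dual_bases G \<pp> \<xi> \<eta>"
proof -
  obtain xs zs where *: "dual_lists xs zs" "set xs \<subseteq> \<pp>" "set zs \<subseteq> \<pp>"
    "vec.span (set xs \<union> \<nn>) = \<pp>" "vec.span (set zs \<union> \<nn>) = \<pp>"
  proof (rule exists_dual_lists[of \<pp> \<nn> \<pp> \<nn>])
    show "x \<in> \<nn>" if "x \<in> \<pp>" "\<And>z. z \<in> \<pp> \<Longrightarrow> K x z = 0" for x
      using that by (simp add: nil_perp perp_def)
    show "x \<in> \<nn>" if "x \<in> \<pp>" "\<And>z. z \<in> \<pp> \<Longrightarrow> K z x = 0" for x
      using that K_sym by (simp add: nil_perp perp_def)
  qed (use p_subspace nil_subspace nil_subset K_nil in auto)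
  then have "is_dual_bases G \<pp> xs zs" by (simp add: is_dual_bases_def dual_lists_def)
  then show ?thesis by blast
qed

lemma is_dual_dual_bases: "is_dual_bases G \<pp> (fst (dual_bases G \<pp>)) (snd (dual_bases G \<pp>))"
proof -
  have "\<exists>z. case z of (\<xi>, \<eta>) \<Rightarrow> is_dual_bases G \<pp> \<xi> \<eta>" using ex_dual_bases by auto
  from someI_ex[OF this] show ?thesis unfolding dual_bases_def by (simp add: case_prod_unfold)
qed

lemma B_inv_conv:
  "B_inv G \<pp> b = (\<Sum>i<length (fst (dual_bases G \<pp>)). b (fst (dual_bases G \<pp>) ! i) (snd (dual_bases G \<pp>) ! i))"
  by (simp add: B_inv_def Let_def split: prod.split)

lemma B_inv_cong: "(\<And>X Y. X \<in> \<pp> \<Longrightarrow> Y \<in> \<pp> \<Longrightarrow> b X Y = c X Y) \<Longrightarrow> B_inv G \<pp> b = B_inv G \<pp> c"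
  unfolding B_inv_conv using is_dual_dual_bases
  by (intro sum.cong) (auto simp: is_dual_bases_def subset_iff)

lemma is_dual_bases_sym: "is_dual_bases G \<pp> \<xi> \<eta> \<Longrightarrow> is_dual_bases G \<pp> \<eta> \<xi>"
  unfolding is_dual_bases_def by (auto simp: K_sym[of "\<eta> ! _" "\<xi> ! _"])

lemma span_union_list:
  assumes v: "v \<in> vec.span (set as \<union> W)" and W: "vec.subspace W"
  shows "\<exists>c. v - (\<Sum>i<length as. c i *s as ! i) \<in> W"
  using v
proof (induction rule: vec.span_induct_alt)
  case base
  show ?case by (rule exI[of _ "\<lambda>_. 0"]) (simp add: vec.subspace_0 W)
next
  case (step a x y)
  then obtain c where c: "y - (\<Sum>i<length as. c i *s as ! i) \<in> W" by blast
  from step(1) show ?case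
  proof
    assume "x \<in> W"
    then have "a *s x + (y - (\<Sum>i<length as. c i *s as ! i)) \<in> W"
      using c W by (simp add: vec.subspace_add vec.subspace_scale)
    then show ?thesis by (intro exI[of _ c]) (simp add: algebra_simps)
  next
    assume "x \<in> set as"
    then obtain j where j: "j < length as" "x = as ! j" by (auto simp: in_set_conv_nth)
    have "(\<Sum>i<length as. (c i + (if i = j then a else 0)) *s as ! i) =
        (\<Sum>i<length as. c i *s as ! i) + (\<Sum>i<length as. if i = j then a *s x else 0)"
      unfolding sum.distrib[symmetric] using j by (intro sum.cong) (auto simp: vec.scale_left_distrib)
    then have "a *s x + y - (\<Sum>i<length as. (c i + (if i = j then a else 0)) *s as ! i) =
        y - (\<Sum>i<length as. c i *s as ! i)"
      using j by simp
    then show ?thesis using c by (intro exI[of _ "\<lambda>i. c i + (if i = j then a else 0)"]) (simp only:)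
  qed
qed

lemma dual_expand:
  assumes d: "is_dual_bases G \<pp> \<xi> \<eta>" and v: "v \<in> \<pp>"
  shows "v - (\<Sum>i<length \<xi>. K v (\<eta> ! i) *s \<xi> ! i) \<in> \<nn>"
proof -
  have d': "length \<xi> = length \<eta>" "set \<xi> \<subseteq> \<pp>" "set \<eta> \<subseteq> \<pp>" "vec.span (set \<xi> \<union> \<nn>) = \<pp>" "dual_lists \<xi> \<eta>"
    using d by (auto simp: is_dual_bases_def dual_lists_def)
  obtain c where c: "v - (\<Sum>i<length \<xi>. c i *s \<xi> ! i) \<in> \<nn>"
    using span_union_list[of v \<xi> \<nn>] v d'(4) nil_subspace by auto
  have "K v (\<eta> ! j) = c j" if j: "j < length \<xi>" for j
  proof -
    have "K (v - (\<Sum>i<length \<xi>. c i *s \<xi> ! i)) (\<eta> ! j) = 0"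
      using c K_nil d' j by (metis nth_mem subsetD)
    then show ?thesis using dual_lists_expand(1)[OF d'(5) j] by (simp add: K_diff_left)
  qed
  then show ?thesis using c by simp
qed

text \<open>Linear maps on p/p_+, given on representatives in p. Only for such maps is a sum over
  representatives of dual bases independent of all choices. Nothing is said about values outside
  p.\<close>

definition null_linear where
  "null_linear f \<longleftrightarrow> (\<forall>X\<in>\<pp>. \<forall>Y\<in>\<pp>. f (X + Y) = f X + (f Y :: 'v)) \<and>
     (\<forall>X\<in>\<pp>. \<forall>a. f (a *s X) = s a (f X)) \<and> (\<forall>X\<in>\<nn>. f X = 0)"

lemma null_linear_sum:
  assumes f: "null_linear f" and g: "\<And>i. i \<in> A \<Longrightarrow> g i \<in> \<pp>"
  shows "f (\<Sum>i\<in>A. c i *s g i) = (\<Sum>i\<in>A. s (c i) (f (g i)))"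
  using g
proof (induction A rule: infinite_finite_induct)
  case (insert x F)
  then show ?case using f
    by (simp add: null_linear_def p_sum p_scale)
qed (use f nil_subspace in \<open>auto simp: null_linear_def vec.subspace_0\<close>)

lemma null_linear_expand:
  assumes f: "null_linear f" and d: "is_dual_bases G \<pp> \<xi> \<eta>" and v: "v \<in> \<pp>"
  shows "f v = (\<Sum>i<length \<xi>. s (K v (\<eta> ! i)) (f (\<xi> ! i)))"
proof -
  have p: "\<xi> ! i \<in> \<pp>" if "i < length \<xi>" for i
    using d that by (auto simp: is_dual_bases_def)
  let ?w = "\<Sum>i<length \<xi>. K v (\<eta> ! i) *s \<xi> ! i"
  have "f ((v - ?w) + ?w) = f (v - ?w) + f ?w"
    using f dual_expand[OF d v] nil_subset p
    by (intro f[unfolded null_linear_def, THEN conjunct1, rule_format] p_sum p_scale) auto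
  also have "f (v - ?w) = 0" using f dual_expand[OF d v] by (simp add: null_linear_def)
  also have "f ?w = (\<Sum>i<length \<xi>. s (K v (\<eta> ! i)) (f (\<xi> ! i)))"
    using p by (intro null_linear_sum[OF f]) auto
  finally show ?thesis by simp
qed

lemma B_inv_expand:
  assumes f: "null_linear f" and v: "v \<in> \<pp>"
  shows "B_inv G \<pp> (\<lambda>X Y. s (K v Y) (f X)) = f v"
    and "B_inv G \<pp> (\<lambda>X Y. s (K v X) (f Y)) = f v"
proof -
  note d = is_dual_dual_bases and d' = is_dual_bases_sym[OF is_dual_dual_bases]
  have l: "length (snd (dual_bases G \<pp>)) = length (fst (dual_bases G \<pp>))"
    using d by (simp add: is_dual_bases_def)
  show "B_inv G \<pp> (\<lambda>X Y. s (K v Y) (f X)) = f v"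
    unfolding B_inv_conv null_linear_expand[OF f d v] ..
  show "B_inv G \<pp> (\<lambda>X Y. s (K v X) (f Y)) = f v"
    unfolding B_inv_conv null_linear_expand[OF f d' v] l ..
qed

definition null_bilinear where
  "null_bilinear b \<longleftrightarrow> (\<forall>X\<in>\<pp>. null_linear (b X)) \<and> (\<forall>Y\<in>\<pp>. null_linear (\<lambda>X. b X Y))"

text \<open>Expanding the first slot in the given basis leaves a contraction with \<open>K\<close>,
  which reproduces the dual vector in the second slot. This frees the contraction from the pair
  selected in \<open>dual_bases\<close>.\<close>

lemma B_inv_basis:
  assumes b: "null_bilinear b" and d: "is_dual_bases G \<pp> \<xi> \<eta>"
  shows "B_inv G \<pp> b = (\<Sum>i<length \<xi>. b (\<xi> ! i) (\<eta> ! i))"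
proof -
  have p: "\<xi> ! i \<in> \<pp>" "\<eta> ! i \<in> \<pp>" if "i < length \<xi>" for i
    using d that by (auto simp: is_dual_bases_def)
  have "B_inv G \<pp> b = B_inv G \<pp> (\<lambda>X Y. \<Sum>i<length \<xi>. s (K X (\<eta> ! i)) (b (\<xi> ! i) Y))"
    using b d by (intro B_inv_cong null_linear_expand) (auto simp: null_bilinear_def)
  also have "\<dots> = (\<Sum>i<length \<xi>. B_inv G \<pp> (\<lambda>X Y. s (K (\<eta> ! i) X) (b (\<xi> ! i) Y)))"
    unfolding B_inv_conv K_sym[of "\<eta> ! _"] by (rule sum.swap)
  also have "\<dots> = (\<Sum>i<length \<xi>. b (\<xi> ! i) (\<eta> ! i))"
    using b p by (intro sum.cong B_inv_expand(2)) (auto simp: null_bilinear_def)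
  finally show ?thesis .
qed

text \<open>By symmetry of \<open>K\<close> the exchanged lists are dual bases again, and the
  contraction does not depend on the pair.\<close>

lemma B_inv_swap:
  assumes b: "null_bilinear b"
  shows "B_inv G \<pp> (\<lambda>X Y. b Y X) = B_inv G \<pp> b"
proof -
  have d: "is_dual_bases G \<pp> (snd (dual_bases G \<pp>)) (fst (dual_bases G \<pp>))"
    by (rule is_dual_bases_sym[OF is_dual_dual_bases])
  have l: "length (snd (dual_bases G \<pp>)) = length (fst (dual_bases G \<pp>))"
    using d by (simp add: is_dual_bases_def)
  show ?thesis
    unfolding B_inv_basis[OF b d] B_inv_conv[of "\<lambda>X Y. b Y X"] l ..
qed

text \<open>Invariance of the Casimir tensor under \<open>ad U\<close>, with the first slot flipped.\<close>

lemma B_inv_invariant: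
  assumes b: "null_bilinear b" and U: "U \<in> \<pp>"
  shows "B_inv G \<pp> (\<lambda>X Y. b \<lbrakk>Y, U\<rbrakk> X) = - B_inv G \<pp> (\<lambda>X Y. b X \<lbrakk>Y, U\<rbrakk>)"
proof -
  define \<xi> \<eta> where xe: "\<xi> = fst (dual_bases G \<pp>)" "\<eta> = snd (dual_bases G \<pp>)"
  have d: "is_dual_bases G \<pp> \<xi> \<eta>" unfolding xe by (rule is_dual_dual_bases)
  let ?n = "length \<xi>"
  have p: "\<xi> ! i \<in> \<pp>" "\<eta> ! i \<in> \<pp>" if "i < ?n" for i
    using d that by (auto simp: is_dual_bases_def)
  \<comment> \<open>By invariance of \<open>K\<close> the coefficients of the brackets with U form a
    skew matrix; exchanging the summation indices therefore produces the sign.\<close>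
  have anti: "K \<lbrakk>\<eta> ! i, U\<rbrakk> (\<eta> ! j) = - K \<lbrakk>\<eta> ! j, U\<rbrakk> (\<eta> ! i)" for i j
    using K_invariant[of "\<eta> ! i" U "\<eta> ! j"] br_anticomm[of U "\<eta> ! j"] K_sym[of "\<eta> ! i"] by simp
  have "B_inv G \<pp> (\<lambda>X Y. b \<lbrakk>Y, U\<rbrakk> X) = (\<Sum>i<?n. \<Sum>j<?n. s (K \<lbrakk>\<eta> ! i, U\<rbrakk> (\<eta> ! j)) (b (\<xi> ! j) (\<xi> ! i)))"
    unfolding B_inv_conv xe[symmetric] using b d p U
    by (intro sum.cong null_linear_expand[of "\<lambda>V. b V (\<xi> ! _)"]) (auto simp: null_bilinear_def)
  also have "\<dots> = (\<Sum>j<?n. \<Sum>i<?n. s (K \<lbrakk>\<eta> ! i, U\<rbrakk> (\<eta> ! j)) (b (\<xi> ! j) (\<xi> ! i)))"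
    by (rule sum.swap)
  also have "\<dots> = - (\<Sum>j<?n. \<Sum>i<?n. s (K \<lbrakk>\<eta> ! j, U\<rbrakk> (\<eta> ! i)) (b (\<xi> ! j) (\<xi> ! i)))"
    unfolding sum_negf[symmetric] by (subst anti) simp
  also have "(\<Sum>j<?n. \<Sum>i<?n. s (K \<lbrakk>\<eta> ! j, U\<rbrakk> (\<eta> ! i)) (b (\<xi> ! j) (\<xi> ! i))) = B_inv G \<pp> (\<lambda>X Y. b X \<lbrakk>Y, U\<rbrakk>)"
    unfolding B_inv_conv xe[symmetric] using b d p U
    by (intro sum.cong null_linear_expand[symmetric]) (auto simp: null_bilinear_def)
  finally show ?thesis .
qed

section \<open>Dual bases of p/q and q_+/p_+\<close>

definition rel_dual :: "('k ^ 'd) list \<Rightarrow> ('k ^ 'd) list \<Rightarrow> bool" where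
  "rel_dual Xs Zs \<longleftrightarrow> dual_lists Xs Zs \<and> set Xs \<subseteq> \<pp> \<and> set Zs \<subseteq> nilradical G \<qq> \<and>
     vec.span (set Xs \<union> \<qq>) = \<pp> \<and> vec.span (set Zs \<union> \<nn>) = nilradical G \<qq>"

lemma ex_rel_dual: "\<exists>Xs Zs. rel_dual Xs Zs"
proof -
  obtain xs zs where "dual_lists xs zs" "set xs \<subseteq> \<pp>" "set zs \<subseteq> nilradical G \<qq>"
    "vec.span (set xs \<union> \<qq>) = \<pp>" "vec.span (set zs \<union> \<nn>) = nilradical G \<qq>"
  proof (rule exists_dual_lists[of \<pp> \<qq> "nilradical G \<qq>" \<nn>])
    show "x \<in> \<qq>" if "\<And>z. z \<in> nilradical G \<qq> \<Longrightarrow> K x z = 0" for x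
      using that parabolicD(3)[OF parabolic_q] unfolding nilq_perp by (auto simp: perp_def)
    show "z \<in> \<nn>" if "\<And>x. x \<in> \<pp> \<Longrightarrow> K x z = 0" for z
      using that K_sym by (simp add: nil_perp perp_def)
    show "K x z = 0" if "x \<in> \<qq>" "z \<in> nilradical G \<qq>" for x z
      using that K_sym unfolding nilq_perp by (simp add: perp_def)
  qed (use p_subspace nil_subspace q_subspace q_subset nil_subset_nilq subspace_perp nilq_perp in auto)
  then show ?thesis unfolding rel_dual_def by blast
qed

lemma K_q_nilq: "X \<in> \<qq> \<Longrightarrow> Z \<in> nilradical G \<qq> \<Longrightarrow> K X Z = 0" "X \<in> \<qq> \<Longrightarrow> Z \<in> nilradical G \<qq> \<Longrightarrow> K Z X = 0"
  using K_sym unfolding nilq_perp by (auto simp: perp_def)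

lemma rel_dual_length: "rel_dual Xs Zs \<Longrightarrow> length Zs = length Xs"
  by (simp add: rel_dual_def dual_lists_def)

lemma rel_dual_expand:
  assumes d: "rel_dual Xs Zs" and v: "v \<in> \<pp>"
  shows "v - (\<Sum>i<length Xs. K v (Zs ! i) *s Xs ! i) \<in> \<qq>"
proof -
  have d': "length Xs = length Zs" "set Zs \<subseteq> nilradical G \<qq>" "vec.span (set Xs \<union> \<qq>) = \<pp>" "dual_lists Xs Zs"
    using d by (auto simp: rel_dual_def dual_lists_def)
  obtain c where c: "v - (\<Sum>i<length Xs. c i *s Xs ! i) \<in> \<qq>"
    using span_union_list[of v Xs \<qq>] v d'(3) q_subspace by auto
  have "K v (Zs ! j) = c j" if j: "j < length Xs" for j
  proof -
    have "K (v - (\<Sum>i<length Xs. c i *s Xs ! i)) (Zs ! j) = 0"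
      using c K_q_nilq d' j by (metis nth_mem subsetD)
    then show ?thesis using dual_lists_expand(1)[OF d'(4) j] by (simp add: K_diff_left)
  qed
  then show ?thesis using c by simp
qed

lemma rel_dual_expand_right:
  assumes d: "rel_dual Xs Zs" and v: "v \<in> nilradical G \<qq>"
  shows "v - (\<Sum>i<length Xs. K (Xs ! i) v *s Zs ! i) \<in> \<nn>"
proof -
  have d': "length Xs = length Zs" "set Xs \<subseteq> \<pp>" "vec.span (set Zs \<union> \<nn>) = nilradical G \<qq>" "dual_lists Xs Zs"
    using d by (auto simp: rel_dual_def dual_lists_def)
  obtain c where c: "v - (\<Sum>i<length Xs. c i *s Zs ! i) \<in> \<nn>"
    using span_union_list[of v Zs \<nn>] v d'(1,3) nil_subspace by auto
  have "K (Xs ! j) v = c j" if j: "j < length Xs" for j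
  proof -
    have "K (Xs ! j) (v - (\<Sum>i<length Xs. c i *s Zs ! i)) = 0"
      using c K_nil d' j by (metis nth_mem subsetD)
    then show ?thesis using dual_lists_expand(2)[OF d'(4) j] by (simp add: K_diff_right)
  qed
  then show ?thesis using c by simp
qed

lemma null_linear_rel_expand:
  assumes f: "null_linear f" and fq: "\<And>X. X \<in> \<qq> \<Longrightarrow> f X = 0" and d: "rel_dual Xs Zs" and v: "v \<in> \<pp>"
  shows "f v = (\<Sum>i<length Xs. s (K v (Zs ! i)) (f (Xs ! i)))"
proof -
  have p: "Xs ! i \<in> \<pp>" if "i < length Xs" for i
    using d that by (auto simp: rel_dual_def)
  let ?w = "\<Sum>i<length Xs. K v (Zs ! i) *s Xs ! i"
  have "f ((v - ?w) + ?w) = f (v - ?w) + f ?w"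
    using f rel_dual_expand[OF d v] q_subset p
    by (intro f[unfolded null_linear_def, THEN conjunct1, rule_format] p_sum p_scale) auto
  also have "f (v - ?w) = 0" using fq rel_dual_expand[OF d v] by simp
  also have "f ?w = (\<Sum>i<length Xs. s (K v (Zs ! i)) (f (Xs ! i)))"
    using p by (intro null_linear_sum[OF f]) auto
  finally show ?thesis by simp
qed

text \<open>Expanding the second slot modulo q leaves only the \<open>Xs ! i\<close>, with
  coefficients \<open>K Y (Zs ! i)\<close>; contracting these places \<open>Zs ! i\<close> into the
  first slot. So the duals of the remaining directions never enter.\<close>

lemma B_inv_rel:
  assumes b: "null_bilinear b" and bq: "\<And>X Y. X \<in> \<pp> \<Longrightarrow> Y \<in> \<qq> \<Longrightarrow> b X Y = 0" and d: "rel_dual Xs Zs"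
  shows "B_inv G \<pp> b = (\<Sum>i<length Xs. b (Zs ! i) (Xs ! i))"
proof -
  have p: "Xs ! i \<in> \<pp>" "Zs ! i \<in> \<pp>" if "i < length Xs" for i
    using d that rel_dual_length[OF d] nilq_subset_p by (auto simp: rel_dual_def subset_iff)
  have "B_inv G \<pp> b = B_inv G \<pp> (\<lambda>X Y. \<Sum>i<length Xs. s (K Y (Zs ! i)) (b X (Xs ! i)))"
    using b d bq by (intro B_inv_cong null_linear_rel_expand) (auto simp: null_bilinear_def)
  also have "\<dots> = (\<Sum>i<length Xs. B_inv G \<pp> (\<lambda>X Y. s (K (Zs ! i) Y) (b X (Xs ! i))))"
    unfolding B_inv_conv K_sym[of "Zs ! _"] by (rule sum.swap)
  also have "\<dots> = (\<Sum>i<length Xs. b (Zs ! i) (Xs ! i))"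
    using b p by (intro sum.cong B_inv_expand(1)) (auto simp: null_bilinear_def)
  finally show ?thesis .
qed

text \<open>For \<open>W \<in> \<qq>\<^sub>+\<close> the pairing of \<open>W\<close> with this sum is the trace of \<open>ad W\<close> on \<open>\<qq>\<^sub>+/\<pp>\<^sub>+\<close>, which is nilpotent.\<close>

lemma rel_dual_bracket_sum:
  assumes d: "rel_dual Xs Zs"
  shows "(\<Sum>i<length Xs. \<lbrakk>Zs ! i, Xs ! i\<rbrakk>) \<in> \<qq>"
proof -
  have p: "Xs ! i \<in> \<pp>" "Zs ! i \<in> nilradical G \<qq>" if "i < length Xs" for i
    using d that rel_dual_length[OF d] by (auto simp: rel_dual_def)
  have nq: "vec.subspace (nilradical G \<qq>)" unfolding nilq_perp by (rule subspace_perp)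
  have nilq_br: "\<lbrakk>X, Z\<rbrakk> \<in> nilradical G \<qq>" if "X \<in> nilradical G \<qq>" "Z \<in> nilradical G \<qq>" for X Z
    using parabolicD(6)[OF parabolic_q, of X Z] that nilq_subset_q nilq_perp by auto
  obtain m where m: "\<And>Z V. Z \<in> nilradical G \<qq> \<Longrightarrow> (br G Z ^^ m) V = 0"
    using parabolicD(5)[OF parabolic_q] unfolding nilq_perp by blast
  have "K (\<Sum>i<length Xs. \<lbrakk>Zs ! i, Xs ! i\<rbrakk>) W = 0" if W: "W \<in> nilradical G \<qq>" for W
  proof -
    \<comment> \<open>T induces \<open>ad W\<close> on q_+/p_+, but is defined on the whole Lie
      algebra: the coefficients with respect to the Zs are read off by pairing with the Xs, which
      makes sense for every V. This turns a trace over a quotient into the trace of a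
      matrix.\<close>
    define T where "T V = (\<Sum>i<length Xs. K (Xs ! i) \<lbrakk>W, V\<rbrakk> *s Zs ! i)" for V
    have linT: "Vector_Spaces.linear (*s) (*s) T"
      by unfold_locales
        (simp_all add: T_def br_add_right br_scale_right K_add_right K_scale_right vec.scale_left_distrib
          sum.distrib vec.scale_sum_right)
    have Tn: "T V = 0" if "V \<in> \<nn>" for V
      unfolding T_def using that nil_br W nilq_subset_p K_nil p by (intro sum.neutral) (auto simp: subset_iff)
    have TV: "T V \<in> nilradical G \<qq>" for V
      unfolding T_def using p nq by (intro vec.subspace_sum vec.subspace_scale) auto
    have br_pow: "(br G W ^^ j) V \<in> nilradical G \<qq>" if "V \<in> nilradical G \<qq>" for j V
      using that nilq_br[OF W] by (induction j) auto
    have T_pow: "(T ^^ j) V - (br G W ^^ j) V \<in> \<nn>" if V: "V \<in> nilradical G \<qq>" for j V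
    proof (induction j)
      case (Suc j)
      let ?A = "(T ^^ j) V" and ?B = "(br G W ^^ j) V"
      have "T (?A - ?B) = 0" by (rule Tn[OF Suc])
      then have "T ?A = T ?B"
        using module_hom.diff[OF module_hom_iff_linear[THEN iffD2, OF linT], of ?A ?B] by simp
      moreover have "\<lbrakk>W, ?B\<rbrakk> - T ?B \<in> \<nn>"
        unfolding T_def using rel_dual_expand_right[OF d nilq_br[OF W br_pow[OF V]]] .
      ultimately show ?case
        using vec.subspace_neg[OF nil_subspace, of "\<lbrakk>W, ?B\<rbrakk> - T ?B"] by simp
    qed (simp add: vec.subspace_0 nil_subspace)
    \<comment> \<open>One step leads into q_+, m further steps into p_+, and T annihilates
      p_+.\<close>
    have "(T ^^ (Suc m + 1)) V = 0" for V
    proof -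
      have "(T ^^ m) (T V) \<in> \<nn>" using T_pow[OF TV, of m V] m[OF W] by simp
      then show ?thesis using Tn unfolding funpow_add by simp
    qed
    then have "tr T = 0" by (rule trace_nilpotent[OF linT])
    moreover have "tr T = (\<Sum>i<length Xs. K (Xs ! i) \<lbrakk>W, Zs ! i\<rbrakk>)"
    proof -
      \<comment> \<open>T is a sum of maps of rank one, whose traces are immediate.\<close>
      have "tr (\<lambda>V. f V *s z) = f z" if f: "\<And>x y. f (x + y) = f x + f y" "\<And>a x. f (a *s x) = a * f x"
        for f and z :: "'k ^ 'd"
      proof -
        have s: "f (sum g A) = (\<Sum>i\<in>A. f (g i))" for g :: "'d \<Rightarrow> 'k ^ 'd" and A
          using f(2)[of 0 0] by (induction A rule: infinite_finite_induct) (auto simp: f)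
        have "f z = f (\<Sum>j\<in>UNIV. z $ j *s axis j 1)" by (simp add: basis_expansion)
        then show ?thesis by (simp add: s f trace_def matrix_def mult.commute)
      qed
      then show ?thesis
        unfolding T_def tr_sum by (simp add: br_add_right br_scale_right K_add_right K_scale_right)
    qed
    moreover have "K \<lbrakk>Zs ! i, Xs ! i\<rbrakk> W = K (Xs ! i) \<lbrakk>W, Zs ! i\<rbrakk>" for i
      using K_invariant'[of "Zs ! i" "Xs ! i" W] br_anticomm[of W "Zs ! i"] by simp
    ultimately show ?thesis by (simp add: K_sum_left)
  qed
  then show ?thesis
    using parabolicD(3)[OF parabolic_q] unfolding nilq_perp by (auto simp: perp_def)
qed

end

section \<open>Operators on multilinear maps\<close>

lemma omit_Cons_0 [simp]: "omit {0} (x # xs) = xs"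
  by (simp add: omit_def nths_Cons nths_all)

lemma omit_Cons_Suc [simp]: "omit {Suc i} (x # xs) = x # omit {i} xs"
  by (simp add: omit_def nths_Cons Compl_eq)

lemma omit_Cons_0_Suc [simp]: "omit {0, Suc j} (x # xs) = omit {j} xs"
  by (simp add: omit_def nths_Cons Compl_eq)

lemma omit_Cons_Suc_Suc [simp]: "omit {Suc i, Suc j} (x # xs) = x # omit {i, j} xs"
proof -
  have "{k. Suc k \<in> - {Suc i, Suc j}} = - {i, j}" by auto
  then show ?thesis by (simp add: omit_def nths_Cons)
qed

lemma set_omit: "set (omit I xs) \<subseteq> set xs"
  unfolding omit_def by (rule set_nths_subset)

lemma length_omit_1: "i < length xs \<Longrightarrow> length (omit {i} xs) = length xs - 1"
proof (induction xs arbitrary: i)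
  case (Cons x xs)
  then show ?case by (cases i) auto
qed simp

lemma length_omit_2: "i < j \<Longrightarrow> j < length xs \<Longrightarrow> length (omit {i, j} xs) = length xs - 2"
proof (induction xs arbitrary: i j)
  case (Cons x xs)
  then obtain j' where j: "j = Suc j'" by (cases j) auto
  show ?case
  proof (cases i)
    case 0
    then show ?thesis using Cons.prems j length_omit_1[of j' xs] by simp
  next
    case (Suc i')
    then show ?thesis using Cons j by auto
  qed
qed simp

lemma sum_lessThan_Suc_pairs:
  "(\<Sum>j<Suc n. \<Sum>i<j. f i j) = (\<Sum>j<n. f 0 (Suc j)) + (\<Sum>j<n. \<Sum>i<j. f (Suc i) (Suc j) :: 'v::comm_monoid_add)"
proof -
  have "(\<Sum>j<Suc n. \<Sum>i<j. f i j) = (\<Sum>j<n. \<Sum>i<Suc j. f i (Suc j))"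
    by (subst sum.lessThan_Suc_shift) simp
  also have "\<dots> = (\<Sum>j<n. f 0 (Suc j) + (\<Sum>i<j. f (Suc i) (Suc j)))"
    by (simp add: sum.lessThan_Suc_shift del: sum.lessThan_Suc)
  finally show ?thesis by (simp add: sum.distrib)
qed

section \<open>The action of the Lie algebra on the arguments\<close>

context leibniz_bracket begin

text \<open>The dual of the adjoint action, extended to multilinear maps;
  \<open>adj_conv_sum\<close> is the closed form. Peeling off the first argument fits the insertion
  operators, so that identities between operators become inductions on the list of arguments with
  the form left arbitrary.\<close>

primrec adj :: "'k ^ 'd \<Rightarrow> (('k, 'd) vec list \<Rightarrow> 'v::ab_group_add) \<Rightarrow> ('k, 'd) vec list \<Rightarrow> 'v" where
  "adj X \<phi> [] = 0"
| "adj X \<phi> (y # ys) = adj X (\<lambda>zs. \<phi> (y # zs)) ys - \<phi> (\<lbrakk>X, y\<rbrakk> # ys)"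

lemma adj_conv_sum: "adj X \<phi> xs = - (\<Sum>i<length xs. \<phi> (xs[i := \<lbrakk>X, xs ! i\<rbrakk>]))"
  by (induction xs arbitrary: \<phi>) (simp_all add: sum.lessThan_Suc_shift del: sum.lessThan_Suc)

lemma adj_hom:
  assumes "f 0 = 0" "\<And>v w. f (v - w) = f v - f w"
  shows "adj X (\<lambda>zs. f (\<phi> zs)) xs = f (adj X \<phi> xs)"
  by (induction xs arbitrary: \<phi>) (simp_all add: assms)

lemma adj_add: "adj X (\<lambda>zs. \<phi> zs + \<psi> zs) xs = adj X \<phi> xs + adj X \<psi> xs"
  by (induction xs arbitrary: \<phi> \<psi>) simp_all

lemma adj_diff: "adj X (\<lambda>zs. \<phi> zs - \<psi> zs) xs = adj X \<phi> xs - adj X \<psi> xs"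
  by (induction xs arbitrary: \<phi> \<psi>) simp_all

lemma adj_uminus: "adj X (\<lambda>zs. - \<phi> zs) xs = - adj X \<phi> xs"
  by (rule adj_hom) simp_all

lemma adj_zero [simp]: "adj X (\<lambda>zs. 0) xs = 0"
  by (induction xs) simp_all

end

context rel_algebra begin

lemma p_minus [intro]: "X \<in> \<pp> \<Longrightarrow> - X \<in> \<pp>"
  using vec.subspace_neg[OF p_subspace] .

lemma r_zero [simp]: "X \<in> \<pp> \<Longrightarrow> r X 0 = 0"
  using r_add[of X 0 0] by simp

lemma r_uminus [simp]: "X \<in> \<pp> \<Longrightarrow> r X (- v) = - r X v"
  using r_add[of X "- v" v] by (simp add: eq_neg_iff_add_eq_0)

lemma r_diff: "X \<in> \<pp> \<Longrightarrow> r X (v - w) = r X v - r X w"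
  using r_add[of X v "- w"] by simp

lemma r_scaleR: "X \<in> \<pp> \<Longrightarrow> r X (c *\<^sub>R v) = c *\<^sub>R r X v"
  using r_scale[of X "of_real c" v] by (simp add: s_real)

lemma adj_cong:
  assumes "X \<in> \<pp>" "set xs \<subseteq> \<pp>" "\<And>zs. set zs \<subseteq> \<pp> \<Longrightarrow> \<phi> zs = \<psi> zs"
  shows "adj X \<phi> xs = adj X \<psi> xs"
  using assms(2,3)
proof (induction xs arbitrary: \<phi> \<psi>)
  case (Cons y ys)
  have "adj X (\<lambda>zs. \<phi> (y # zs)) ys = adj X (\<lambda>zs. \<psi> (y # zs)) ys"
    using Cons.prems by (intro Cons.IH) auto
  moreover have "\<phi> (\<lbrakk>X, y\<rbrakk> # ys) = \<psi> (\<lbrakk>X, y\<rbrakk> # ys)"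
    using Cons.prems assms(1) by (intro Cons.prems(2)) auto
  ultimately show ?case by simp
qed simp

lemma adj_r: "Y \<in> \<pp> \<Longrightarrow> adj X (\<lambda>zs. r Y (\<phi> zs)) xs = r Y (adj X \<phi> xs)"
  by (rule adj_hom) (simp_all add: r_diff)

lemma adj_s: "adj X (\<lambda>zs. s a (\<phi> zs)) xs = s a (adj X \<phi> xs)"
  by (rule adj_hom) (simp_all add: S.scale_right_diff_distrib)

section \<open>Multilinear, alternating and relative maps\<close>

abbreviation ins where "ins X \<phi> \<equiv> (\<lambda>xs. \<phi> (X # xs))"

text \<open>The length of the list is left open, so inserting an argument stays within the class and
  operators that change the degree need no bookkeeping. The degree enters only through
  \<open>forms_iff\<close>.\<close>

definition mlin where
  "mlin \<phi> \<longleftrightarrow> (\<forall>xs ys. set xs \<subseteq> \<pp> \<longrightarrow> set ys \<subseteq> \<pp> \<longrightarrow>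
     (\<forall>X\<in>\<pp>. \<forall>Y\<in>\<pp>. \<phi> (xs @ (X + Y) # ys) = \<phi> (xs @ X # ys) + (\<phi> (xs @ Y # ys) :: 'v)) \<and>
     (\<forall>X\<in>\<pp>. \<forall>a. \<phi> (xs @ (a *s X) # ys) = s a (\<phi> (xs @ X # ys))))"

definition vanish where
  "vanish W \<phi> \<longleftrightarrow> (\<forall>xs ys. set xs \<subseteq> \<pp> \<longrightarrow> set ys \<subseteq> \<pp> \<longrightarrow> (\<forall>X\<in>W. \<phi> (xs @ X # ys) = (0 :: 'v)))"

text \<open>Equal neighbours are the condition that survives inductions over the list. For
  multilinear maps it implies vanishing on any two equal arguments,
  \<open>alt_distinct\<close>.\<close>

definition alt where
  "alt \<phi> \<longleftrightarrow> (\<forall>xs ys. set xs \<subseteq> \<pp> \<longrightarrow> set ys \<subseteq> \<pp> \<longrightarrow> (\<forall>X\<in>\<pp>. \<phi> (xs @ X # X # ys) = (0 :: 'v)))"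

lemma mlin_D:
  assumes "mlin \<phi>" "set xs \<subseteq> \<pp>" "set ys \<subseteq> \<pp>" "X \<in> \<pp>"
  shows "Y \<in> \<pp> \<Longrightarrow> \<phi> (xs @ (X + Y) # ys) = \<phi> (xs @ X # ys) + \<phi> (xs @ Y # ys)"
    and "\<phi> (xs @ (a *s X) # ys) = s a (\<phi> (xs @ X # ys))"
  using assms unfolding mlin_def by blast+

lemma mlin_D0:
  assumes "mlin \<phi>" "set ys \<subseteq> \<pp>" "X \<in> \<pp>"
  shows "Y \<in> \<pp> \<Longrightarrow> \<phi> ((X + Y) # ys) = \<phi> (X # ys) + \<phi> (Y # ys)"
    and "\<phi> ((a *s X) # ys) = s a (\<phi> (X # ys))"
  using mlin_D[OF assms(1) _ assms(2,3), of "[]"] by auto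

lemma vanishD: "vanish W \<phi> \<Longrightarrow> set xs \<subseteq> \<pp> \<Longrightarrow> set ys \<subseteq> \<pp> \<Longrightarrow> X \<in> W \<Longrightarrow> \<phi> (xs @ X # ys) = 0"
  unfolding vanish_def by blast

lemma vanishD0: "vanish W \<phi> \<Longrightarrow> set ys \<subseteq> \<pp> \<Longrightarrow> X \<in> W \<Longrightarrow> \<phi> (X # ys) = 0"
  using vanishD[of W \<phi> "[]" ys X] by simp

lemma vanish_mono: "vanish W \<phi> \<Longrightarrow> V \<subseteq> W \<Longrightarrow> vanish V \<phi>"
  unfolding vanish_def by blast

lemma altD: "alt \<phi> \<Longrightarrow> set xs \<subseteq> \<pp> \<Longrightarrow> set ys \<subseteq> \<pp> \<Longrightarrow> X \<in> \<pp> \<Longrightarrow> \<phi> (xs @ X # X # ys) = 0"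
  unfolding alt_def by blast

lemma alt_swap:
  assumes m: "mlin \<phi>" and a: "alt \<phi>" and p: "set xs \<subseteq> \<pp>" "set ys \<subseteq> \<pp>" "X \<in> \<pp>" "Y \<in> \<pp>"
  shows "\<phi> (xs @ X # Y # ys) = - \<phi> (xs @ Y # X # ys)"
proof -
  have "\<phi> (xs @ (X + Y) # (X + Y) # ys) = 0" using a p by (intro altD) auto
  moreover have "\<phi> (xs @ (X + Y) # (X + Y) # ys) = \<phi> (xs @ X # (X + Y) # ys) + \<phi> (xs @ Y # (X + Y) # ys)"
    using m p by (intro mlin_D) auto
  moreover have "\<phi> ((xs @ [X]) @ (X + Y) # ys) = \<phi> ((xs @ [X]) @ X # ys) + \<phi> ((xs @ [X]) @ Y # ys)"
    using m p by (intro mlin_D) auto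
  moreover have "\<phi> ((xs @ [Y]) @ (X + Y) # ys) = \<phi> ((xs @ [Y]) @ X # ys) + \<phi> ((xs @ [Y]) @ Y # ys)"
    using m p by (intro mlin_D) auto
  moreover have "\<phi> (xs @ X # X # ys) = 0" "\<phi> (xs @ Y # Y # ys) = 0" using a p by (auto intro!: altD)
  ultimately show ?thesis by (simp add: eq_neg_iff_add_eq_0)
qed

lemma alt_swap0:
  assumes "mlin \<phi>" "alt \<phi>" "set ys \<subseteq> \<pp>" "X \<in> \<pp>" "Y \<in> \<pp>"
  shows "\<phi> (X # Y # ys) = - \<phi> (Y # X # ys)"
  using alt_swap[OF assms(1,2) _ assms(3-5), of "[]"] by simp

lemma mlin_ins [simp]: "mlin \<phi> \<Longrightarrow> X \<in> \<pp> \<Longrightarrow> mlin (ins X \<phi>)"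
  unfolding mlin_def by (metis append_Cons insert_subset list.set(2))

lemma vanish_ins [simp]: "vanish W \<phi> \<Longrightarrow> X \<in> \<pp> \<Longrightarrow> vanish W (ins X \<phi>)"
  unfolding vanish_def by (metis append_Cons insert_subset list.set(2))

lemma alt_ins [simp]: "alt \<phi> \<Longrightarrow> X \<in> \<pp> \<Longrightarrow> alt (ins X \<phi>)"
  unfolding alt_def by (metis append_Cons insert_subset list.set(2))

lemma alt_move:
  assumes "mlin \<phi>" "alt \<phi>" "set xs \<subseteq> \<pp>" "W \<in> \<pp>" "j < length xs"
  shows "\<phi> (xs[j := W]) = (- 1) ^ j *\<^sub>R \<phi> (W # omit {j} xs)"
  using assms
proof (induction xs arbitrary: j \<phi>)
  case (Cons x xs)
  show ?case
  proof (cases j)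
    case (Suc i)
    have om: "set (omit {i} xs) \<subseteq> \<pp>" using set_omit[of "{i}" xs] Cons.prems by auto
    have "\<phi> (x # xs[i := W]) = (- 1) ^ i *\<^sub>R \<phi> (x # W # omit {i} xs)"
      using Cons.prems Suc Cons.IH[of "ins x \<phi>" i] by simp
    also have "\<phi> (x # W # omit {i} xs) = - \<phi> (W # x # omit {i} xs)"
      using Cons.prems om by (intro alt_swap0) auto
    finally show ?thesis using Suc by simp
  qed simp
qed simp

lemma alt_distinct:
  assumes "mlin \<phi>" "alt \<phi>" "set as \<subseteq> \<pp>" "set bs \<subseteq> \<pp>" "set cs \<subseteq> \<pp>" "X \<in> \<pp>"
  shows "\<phi> (as @ X # bs @ X # cs) = 0"
  using assms(3-)
proof (induction bs arbitrary: as)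
  case Nil
  then show ?case using assms(2) by (simp add: altD)
next
  case (Cons b bs)
  have "\<phi> (as @ X # b # (bs @ X # cs)) = - \<phi> (as @ b # X # (bs @ X # cs))"
    using Cons.prems by (intro alt_swap assms(1,2)) auto
  then show ?case using Cons.IH[of "as @ [b]"] Cons.prems by simp
qed

text \<open>Passes from conditions on list positions to conditions on a decomposition of the list,
  the shape that goes with recursion.\<close>

lemma forms_iff:
  "\<phi> \<in> forms \<pp> \<qq> s k \<longleftrightarrow>
     (\<forall>xs. \<not> (length xs = k \<and> set xs \<subseteq> \<pp>) \<longrightarrow> \<phi> xs = 0) \<and> mlin \<phi> \<and> alt \<phi> \<and> vanish \<qq> \<phi>"
proof (intro iffI conjI)
  assume f: "\<phi> \<in> forms \<pp> \<qq> s k"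
  then have supp: "\<phi> xs = 0" if "\<not> (length xs = k \<and> set xs \<subseteq> \<pp>)" for xs
    using that unfolding forms_def by blast
  then show "\<forall>xs. \<not> (length xs = k \<and> set xs \<subseteq> \<pp>) \<longrightarrow> \<phi> xs = 0" by blast
  have F: "\<And>i X Y. i < k \<Longrightarrow> X \<in> \<pp> \<Longrightarrow> Y \<in> \<pp> \<Longrightarrow> \<phi> (xs[i := X + Y]) = \<phi> (xs[i := X]) + \<phi> (xs[i := Y])"
      "\<And>i X a. i < k \<Longrightarrow> X \<in> \<pp> \<Longrightarrow> \<phi> (xs[i := a *s X]) = s a (\<phi> (xs[i := X]))"
      "\<And>i j. i < k \<Longrightarrow> j < k \<Longrightarrow> i \<noteq> j \<Longrightarrow> xs ! i = xs ! j \<Longrightarrow> \<phi> xs = 0"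
      "set xs \<inter> \<qq> \<noteq> {} \<Longrightarrow> \<phi> xs = 0" if "length xs = k" "set xs \<subseteq> \<pp>" for xs
    using f that unfolding forms_def by blast+
  show "mlin \<phi>"
    unfolding mlin_def
  proof (intro allI impI conjI ballI)
    fix xs ys X Y assume p: "set xs \<subseteq> \<pp>" "set ys \<subseteq> \<pp>" "X \<in> \<pp>" "Y \<in> \<pp>"
    show "\<phi> (xs @ (X + Y) # ys) = \<phi> (xs @ X # ys) + \<phi> (xs @ Y # ys)"
    proof (cases "length (xs @ X # ys) = k")
      case True
      then show ?thesis using F(1)[of "xs @ X # ys" "length xs" X Y] p by auto
    next
      case False
      then show ?thesis using supp by simp
    qed
  next
    fix xs ys X a assume p: "set xs \<subseteq> \<pp>" "set ys \<subseteq> \<pp>" "X \<in> \<pp>"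
    show "\<phi> (xs @ (a *s X) # ys) = s a (\<phi> (xs @ X # ys))"
    proof (cases "length (xs @ X # ys) = k")
      case True
      then show ?thesis using F(2)[of "xs @ X # ys" "length xs" X a] p by auto
    next
      case False
      then show ?thesis using supp by simp
    qed
  qed
  show "alt \<phi>"
    unfolding alt_def
  proof (intro allI impI ballI)
    fix xs ys X assume p: "set xs \<subseteq> \<pp>" "set ys \<subseteq> \<pp>" "X \<in> \<pp>"
    show "\<phi> (xs @ X # X # ys) = 0"
    proof (cases "length (xs @ X # X # ys) = k")
      case True
      then show ?thesis
        using F(3)[of "xs @ X # X # ys" "length xs" "Suc (length xs)"] p by (auto simp: nth_append)
    next
      case False
      then show ?thesis using supp by simp
    qed
  qed
  show "vanish \<qq> \<phi>"
    unfolding vanish_def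
  proof (intro allI impI ballI)
    fix xs ys X assume p: "set xs \<subseteq> \<pp>" "set ys \<subseteq> \<pp>" "X \<in> \<qq>"
    show "\<phi> (xs @ X # ys) = 0"
    proof (cases "length (xs @ X # ys) = k")
      case True
      then show ?thesis using F(4)[of "xs @ X # ys"] p q_subset by auto
    next
      case False
      then show ?thesis using supp by simp
    qed
  qed
next
  assume f: "(\<forall>xs. \<not> (length xs = k \<and> set xs \<subseteq> \<pp>) \<longrightarrow> \<phi> xs = 0) \<and> mlin \<phi> \<and> alt \<phi> \<and> vanish \<qq> \<phi>"
  then have m: "mlin \<phi>" and a: "alt \<phi>" and v: "vanish \<qq> \<phi>" by auto
  have td: "set (take i xs) \<subseteq> \<pp>" "set (drop i xs) \<subseteq> \<pp>" if "set xs \<subseteq> \<pp>" for i and xs :: "('k, 'd) vec list"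
    using that set_take_subset set_drop_subset by fast+
  show "\<phi> \<in> forms \<pp> \<qq> s k"
    unfolding forms_def mem_Collect_eq
  proof (intro conjI allI impI ballI)
    fix xs :: "('k, 'd) vec list" assume "\<not> (length xs = k \<and> set xs \<subseteq> \<pp>)"
    then show "\<phi> xs = 0" using f by blast
  next
    fix xs i X Y assume "length xs = k \<and> set xs \<subseteq> \<pp>" "i < k" "X \<in> \<pp>" "Y \<in> \<pp>"
    then show "\<phi> (xs[i := X + Y]) = \<phi> (xs[i := X]) + \<phi> (xs[i := Y])"
      by (simp add: upd_conv_take_nth_drop mlin_D[OF m] td)
  next
    fix xs i X a assume "length xs = k \<and> set xs \<subseteq> \<pp>" "i < k" "X \<in> \<pp>"
    then show "\<phi> (xs[i := a *s X]) = s a (\<phi> (xs[i := X]))"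
      by (simp add: upd_conv_take_nth_drop mlin_D[OF m] td)
  next
    fix xs i j assume xs: "length xs = k \<and> set xs \<subseteq> \<pp>" and ij: "i < k" "j < k" "i \<noteq> j \<and> xs ! i = xs ! j"
    have *: "\<phi> xs = 0" if ij: "i < j" "j < k" "xs ! i = xs ! j" for i j
    proof -
      have "xs = take j xs @ xs ! j # drop (Suc j) xs" using xs ij by (simp add: id_take_nth_drop[symmetric])
      moreover have "take j xs = take i xs @ xs ! i # drop (Suc i) (take j xs)"
        using id_take_nth_drop[of i "take j xs"] xs ij by simp
      ultimately have "xs = take i xs @ xs ! i # drop (Suc i) (take j xs) @ xs ! i # drop (Suc j) xs"
        using ij by (metis append.assoc append_Cons)
      moreover have "\<phi> (take i xs @ xs ! i # drop (Suc i) (take j xs) @ xs ! i # drop (Suc j) xs) = 0"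
        by (rule alt_distinct[OF m a]) (use xs ij in \<open>auto dest!: in_set_dropD in_set_takeD\<close>)
      ultimately show ?thesis by metis
    qed
    show "\<phi> xs = 0" using *[of i j] *[of j i] ij by (metis linorder_neqE_nat)
  next
    fix xs assume xs: "length xs = k \<and> set xs \<subseteq> \<pp>" and "set xs \<inter> \<qq> \<noteq> {}"
    then obtain X where "X \<in> set xs" "X \<in> \<qq>" by blast
    then obtain as bs where "xs = as @ X # bs" by (meson split_list)
    then show "\<phi> xs = 0" using vanishD[OF v, of as bs X] xs \<open>X \<in> \<qq>\<close> by simp
  qed
qed

lemma mlin_add: "mlin \<phi> \<Longrightarrow> mlin \<psi> \<Longrightarrow> mlin (\<lambda>xs. \<phi> xs + \<psi> xs)"
  unfolding mlin_def by (simp add: S.scale_right_distrib)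

lemma mlin_r: "mlin \<phi> \<Longrightarrow> X \<in> \<pp> \<Longrightarrow> mlin (\<lambda>xs. r X (\<phi> xs))"
  unfolding mlin_def by (simp add: r_add r_scale)

lemma mlin_s: "mlin \<phi> \<Longrightarrow> mlin (\<lambda>xs. s c (\<phi> xs))"
  unfolding mlin_def by (simp add: S.scale_right_distrib mult.commute)

lemma mlin_scaleR: "mlin \<phi> \<Longrightarrow> mlin (\<lambda>xs. c *\<^sub>R \<phi> xs)"
  unfolding s_real[symmetric] by (rule mlin_s)

lemma vanish_add: "vanish W \<phi> \<Longrightarrow> vanish W \<psi> \<Longrightarrow> vanish W (\<lambda>xs. \<phi> xs + \<psi> xs)"
  unfolding vanish_def by simp

lemma vanish_r: "vanish W \<phi> \<Longrightarrow> X \<in> \<pp> \<Longrightarrow> vanish W (\<lambda>xs. r X (\<phi> xs))"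
  unfolding vanish_def by simp

lemma alt_add: "alt \<phi> \<Longrightarrow> alt \<psi> \<Longrightarrow> alt (\<lambda>xs. \<phi> xs + \<psi> xs)"
  unfolding alt_def by simp

lemma alt_r: "alt \<phi> \<Longrightarrow> X \<in> \<pp> \<Longrightarrow> alt (\<lambda>xs. r X (\<phi> xs))"
  unfolding alt_def by simp

lemma alt_scaleR: "alt \<phi> \<Longrightarrow> alt (\<lambda>xs. c *\<^sub>R \<phi> xs)"
  unfolding alt_def by simp

lemma adj_mlin_cong_add:
  assumes "V \<in> \<pp>" "set ys \<subseteq> \<pp>" "\<And>zs. set zs \<subseteq> \<pp> \<Longrightarrow> \<theta> zs = \<phi> zs + \<psi> zs"
  shows "adj V \<theta> ys = adj V \<phi> ys + adj V \<psi> ys"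
  using adj_cong[OF assms] unfolding adj_add .

lemma mlin_adj:
  assumes "mlin \<phi>" and V: "V \<in> \<pp>"
  shows "mlin (adj V \<phi>)"
  unfolding mlin_def
proof (intro allI impI conjI ballI)
  fix xs ys X Y assume p: "set xs \<subseteq> \<pp>" "set ys \<subseteq> \<pp>" "X \<in> \<pp>" "Y \<in> \<pp>"
  show "adj V \<phi> (xs @ (X + Y) # ys) = adj V \<phi> (xs @ X # ys) + adj V \<phi> (xs @ Y # ys)"
    using assms(1) p(1)
  proof (induction xs arbitrary: \<phi>)
    case Nil
    have "adj V (ins (X + Y) \<phi>) ys = adj V (ins X \<phi>) ys + adj V (ins Y \<phi>) ys"
      using Nil p V by (intro adj_mlin_cong_add) (auto intro: mlin_D0)
    then show ?case using Nil p V by (simp add: br_add_right mlin_D0 p_br)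
  next
    case (Cons x xs)
    then have x: "x \<in> \<pp>" "\<lbrakk>V, x\<rbrakk> \<in> \<pp>" using V by auto
    have "\<phi> ((\<lbrakk>V, x\<rbrakk> # xs) @ (X + Y) # ys) = \<phi> ((\<lbrakk>V, x\<rbrakk> # xs) @ X # ys) + \<phi> ((\<lbrakk>V, x\<rbrakk> # xs) @ Y # ys)"
      using Cons.prems p x by (intro mlin_D) auto
    then show ?case using Cons.IH[of "ins x \<phi>"] Cons.prems x by simp
  qed
next
  fix xs ys X a assume p: "set xs \<subseteq> \<pp>" "set ys \<subseteq> \<pp>" "X \<in> \<pp>"
  show "adj V \<phi> (xs @ (a *s X) # ys) = s a (adj V \<phi> (xs @ X # ys))"
    using assms(1) p(1)
  proof (induction xs arbitrary: \<phi>)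
    case Nil
    have "adj V (ins (a *s X) \<phi>) ys = adj V (\<lambda>zs. s a (\<phi> (X # zs))) ys"
      using Nil p V by (intro adj_cong) (auto intro: mlin_D0)
    then show ?case using Nil p V
      by (simp add: br_scale_right mlin_D0 p_br adj_s S.scale_right_diff_distrib)
  next
    case (Cons x xs)
    then have x: "x \<in> \<pp>" "\<lbrakk>V, x\<rbrakk> \<in> \<pp>" using V by auto
    have "\<phi> ((\<lbrakk>V, x\<rbrakk> # xs) @ (a *s X) # ys) = s a (\<phi> ((\<lbrakk>V, x\<rbrakk> # xs) @ X # ys))"
      using Cons.prems p x by (intro mlin_D) auto
    then show ?case using Cons.IH[of "ins x \<phi>"] Cons.prems x by (simp add: S.scale_right_diff_distrib)
  qed
qed

lemma vanish_adj:
  assumes "vanish W \<phi>" and V: "V \<in> \<pp>" and W: "W \<subseteq> \<pp>" "\<And>X. X \<in> W \<Longrightarrow> \<lbrakk>V, X\<rbrakk> \<in> W"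
  shows "vanish W (adj V \<phi>)"
  unfolding vanish_def
proof (intro allI impI ballI)
  fix xs ys X assume p: "set xs \<subseteq> \<pp>" "set ys \<subseteq> \<pp>" "X \<in> W"
  show "adj V \<phi> (xs @ X # ys) = 0"
    using assms(1) p(1)
  proof (induction xs arbitrary: \<phi>)
    case Nil
    have "adj V (ins X \<phi>) ys = adj V (\<lambda>_. 0) ys"
      using Nil p V by (intro adj_cong) (auto intro: vanishD0)
    then show ?case using vanishD0[OF Nil(1) p(2) W(2)[OF p(3)]] by simp
  next
    case (Cons x xs)
    then have x: "x \<in> \<pp>" "\<lbrakk>V, x\<rbrakk> \<in> \<pp>" using V by auto
    have "\<phi> ((\<lbrakk>V, x\<rbrakk> # xs) @ X # ys) = 0"
      using Cons.prems p x by (intro vanishD) auto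
    then show ?case using Cons.IH[of "ins x \<phi>"] Cons.prems x by simp
  qed
qed

lemma vanish_nil_adj: "vanish \<nn> \<phi> \<Longrightarrow> V \<in> \<pp> \<Longrightarrow> vanish \<nn> (adj V \<phi>)"
  by (intro vanish_adj nil_subset nil_br)

lemma alt_adj:
  assumes "mlin \<phi>" "alt \<phi>" and V: "V \<in> \<pp>"
  shows "alt (adj V \<phi>)"
  unfolding alt_def
proof (intro allI impI ballI)
  fix xs ys X assume p: "set xs \<subseteq> \<pp>" "set ys \<subseteq> \<pp>" "X \<in> \<pp>"
  show "adj V \<phi> (xs @ X # X # ys) = 0"
    using assms(1,2) p(1)
  proof (induction xs arbitrary: \<phi>)
    case Nil
    have "adj V (\<lambda>zs. \<phi> (X # X # zs)) ys = adj V (\<lambda>_. 0) ys"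
      using Nil p V by (intro adj_cong) (auto intro: altD[of _ "[]", simplified])
    moreover have "\<phi> (X # \<lbrakk>V, X\<rbrakk> # ys) = - \<phi> (\<lbrakk>V, X\<rbrakk> # X # ys)"
      using Nil p V by (intro alt_swap0) auto
    ultimately show ?case by simp
  next
    case (Cons x xs)
    then have x: "x \<in> \<pp>" "\<lbrakk>V, x\<rbrakk> \<in> \<pp>" using V by auto
    have "\<phi> ((\<lbrakk>V, x\<rbrakk> # xs) @ X # X # ys) = 0"
      using Cons.prems p x by (intro altD) auto
    then show ?case using Cons.IH[of "ins x \<phi>"] Cons.prems x by simp
  qed
qed

lemma adj_left:
  assumes "mlin \<phi>" and X: "X \<in> \<pp>" and xs: "set xs \<subseteq> \<pp>"
  shows "Y \<in> \<pp> \<Longrightarrow> adj (X + Y) \<phi> xs = adj X \<phi> xs + adj Y \<phi> xs"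
    and "adj (a *s X) \<phi> xs = s a (adj X \<phi> xs)"
    and "vanish \<nn> \<phi> \<Longrightarrow> X \<in> \<nn> \<Longrightarrow> adj X \<phi> xs = 0"
proof -
  show "adj (X + Y) \<phi> xs = adj X \<phi> xs + adj Y \<phi> xs" if "Y \<in> \<pp>"
    using assms(1) xs
    by (induction xs arbitrary: \<phi>) (simp_all add: br_add_left mlin_D0 X that p_br)
  show "adj (a *s X) \<phi> xs = s a (adj X \<phi> xs)"
    using assms(1) xs
    by (induction xs arbitrary: \<phi>) (simp_all add: br_scale_left mlin_D0 X p_br S.scale_right_diff_distrib)
  show "adj X \<phi> xs = 0" if "vanish \<nn> \<phi>" "X \<in> \<nn>"
    using assms(1) that(1) xs
    by (induction xs arbitrary: \<phi>) (simp_all add: vanishD0 that(2) nil_br')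
qed

lemma adj_adj:
  assumes "mlin \<phi>" and XY: "X \<in> \<pp>" "Y \<in> \<pp>" and xs: "set xs \<subseteq> \<pp>"
  shows "adj X (adj Y \<phi>) xs - adj Y (adj X \<phi>) xs = adj \<lbrakk>X, Y\<rbrakk> \<phi> xs"
  using assms(1) xs
proof (induction xs arbitrary: \<phi>)
  case (Cons z zs)
  then have z: "z \<in> \<pp>" "set zs \<subseteq> \<pp>" by auto
  have "\<lbrakk>X, \<lbrakk>Y, z\<rbrakk>\<rbrakk> = \<lbrakk>\<lbrakk>X, Y\<rbrakk>, z\<rbrakk> + \<lbrakk>Y, \<lbrakk>X, z\<rbrakk>\<rbrakk>" by (rule leibniz)
  then have "\<phi> (\<lbrakk>X, \<lbrakk>Y, z\<rbrakk>\<rbrakk> # zs) = \<phi> (\<lbrakk>\<lbrakk>X, Y\<rbrakk>, z\<rbrakk> # zs) + \<phi> (\<lbrakk>Y, \<lbrakk>X, z\<rbrakk>\<rbrakk> # zs)"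
    using mlin_D0(1)[OF Cons.prems(1) z(2)] z(1) XY by (simp add: p_br)
  then show ?case
    using Cons.IH[of "ins z \<phi>"] Cons.prems z by (simp add: adj_diff algebra_simps)
qed simp

text \<open>The operator \<open>L_X\<close> of the overview, \<open>r\<close> being
  \<open>R_X\<close>. On multilinear maps it is a representation of p,
  \<open>lact_lact\<close>.\<close>

definition lact where "lact X \<phi> xs = r X (\<phi> xs) + adj X \<phi> xs"

lemma lact_Cons: "lact X \<phi> (x # xs) = lact X (ins x \<phi>) xs - \<phi> (\<lbrakk>X, x\<rbrakk> # xs)"
  by (simp add: lact_def)

lemma lact_add: "X \<in> \<pp> \<Longrightarrow> lact X (\<lambda>zs. \<phi> zs + \<psi> zs) xs = lact X \<phi> xs + lact X \<psi> xs"
  by (simp add: lact_def adj_add r_add)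

lemma lact_cong:
  assumes "X \<in> \<pp>" "set xs \<subseteq> \<pp>" "\<And>zs. set zs \<subseteq> \<pp> \<Longrightarrow> \<phi> zs = \<psi> zs"
  shows "lact X \<phi> xs = lact X \<psi> xs"
  using adj_cong[OF assms] assms by (simp add: lact_def)

lemma lact_lact:
  assumes "mlin \<phi>" "X \<in> \<pp>" "Y \<in> \<pp>" "set xs \<subseteq> \<pp>"
  shows "lact X (lact Y \<phi>) xs - lact Y (lact X \<phi>) xs = lact \<lbrakk>X, Y\<rbrakk> \<phi> xs"
proof -
  have "lact X (lact Y \<phi>) xs = r X (r Y (\<phi> xs)) + r X (adj Y \<phi> xs) + r Y (adj X \<phi> xs) + adj X (adj Y \<phi>) xs"
    if "X \<in> \<pp>" "Y \<in> \<pp>" for X Y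
    using that unfolding lact_def by (simp add: adj_add adj_r r_add)
  then show ?thesis
    using assms adj_adj[OF assms] by (simp add: lact_def r_br algebra_simps)
qed

lemma mlin_lact: "mlin \<phi> \<Longrightarrow> X \<in> \<pp> \<Longrightarrow> mlin (lact X \<phi>)"
  using mlin_add[OF mlin_r mlin_adj] by (simp add: lact_def[abs_def])

lemma vanish_nil_lact: "vanish \<nn> \<phi> \<Longrightarrow> X \<in> \<pp> \<Longrightarrow> vanish \<nn> (lact X \<phi>)"
  using vanish_add[OF vanish_r vanish_nil_adj] by (simp add: lact_def[abs_def])

lemma alt_lact: "mlin \<phi> \<Longrightarrow> alt \<phi> \<Longrightarrow> X \<in> \<pp> \<Longrightarrow> alt (lact X \<phi>)"
  using alt_add[OF alt_r alt_adj] by (simp add: lact_def[abs_def])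

lemma null_linear_r: "null_linear (\<lambda>X. r X v)"
  using r_add_left r_scale_left r_null by (simp add: null_linear_def)

lemma null_linear_adj: "mlin \<phi> \<Longrightarrow> vanish \<nn> \<phi> \<Longrightarrow> set xs \<subseteq> \<pp> \<Longrightarrow> null_linear (\<lambda>X. adj X \<phi> xs)"
  using adj_left nil_subset unfolding null_linear_def by blast

lemma null_linear_add: "null_linear f \<Longrightarrow> null_linear g \<Longrightarrow> null_linear (\<lambda>X. f X + g X)"
  by (simp add: null_linear_def S.scale_right_distrib)

lemma null_linear_lact: "mlin \<phi> \<Longrightarrow> vanish \<nn> \<phi> \<Longrightarrow> set xs \<subseteq> \<pp> \<Longrightarrow> null_linear (\<lambda>X. lact X \<phi> xs)"
  unfolding lact_def by (intro null_linear_add null_linear_r null_linear_adj)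

lemma null_linear_ins: "mlin \<phi> \<Longrightarrow> vanish \<nn> \<phi> \<Longrightarrow> set xs \<subseteq> \<pp> \<Longrightarrow> null_linear (\<lambda>X. \<phi> (X # xs))"
  using mlin_D0 vanishD0 nil_subset unfolding null_linear_def by blast

lemma null_linear_comp_r: "null_linear f \<Longrightarrow> Y \<in> \<pp> \<Longrightarrow> null_linear (\<lambda>X. r Y (f X))"
  by (simp add: null_linear_def r_add r_scale)

end

section \<open>The codifferential\<close>

text \<open>The Leibniz determinant for a size that is a term, here the length of a list, rather
  than a type.\<close>

definition ndet :: "nat \<Rightarrow> (nat \<Rightarrow> nat \<Rightarrow> 'a::comm_ring_1) \<Rightarrow> 'a" where
  "ndet n M = (\<Sum>\<sigma> | \<sigma> permutes {..<n}. of_int (sign \<sigma>) * (\<Prod>i<n. M i (\<sigma> i)))"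

text \<open>Expansion along row 0. A permutation taking 0 to b is the transposition of 0 and b after
  a permutation fixing 0. Accordingly column b is not deleted but replaced by column 0, and every
  term except the first carries the same sign.\<close>

lemma ndet_Suc:
  "ndet (Suc n) M = M 0 0 * ndet n (\<lambda>i j. M (Suc i) (Suc j)) -
     (\<Sum>b<n. M 0 (Suc b) * ndet n (\<lambda>i j. M (Suc i) (if j = b then 0 else Suc j)))"
proof -
  let ?A = "{..<n}" and ?B = "Suc ` {..<n}"
  define f where "f \<sigma> = of_int (sign \<sigma>) * (\<Prod>i<Suc n. M i (\<sigma> i))" for \<sigma>
  have ins: "{..<Suc n} = insert 0 ?B" by (rule lessThan_Suc_eq_insert_0)
  have bijS: "bij_betw Suc ?A ?B" by (simp add: bij_betw_def)
  have bijP: "bij_betw (\<lambda>x. x - 1) ?B ?A" by (rule bij_betw_byWitness[of _ Suc]) auto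
  have reindex: "(\<Sum>q | q permutes ?B. h q) = (\<Sum>q | q permutes ?A. h (map_permutation ?A Suc q))"
    for h :: "(nat \<Rightarrow> nat) \<Rightarrow> 'a"
  proof (rule sum.reindex_bij_witness[of _ "map_permutation ?A Suc" "map_permutation ?B (\<lambda>x. x - 1)"])
    fix q assume "q \<in> {q. q permutes ?B}"
    then show "map_permutation ?A Suc (map_permutation ?B (\<lambda>x. x - 1) q) = q"
      by (intro map_permutation_compose_inv[OF bijP]) auto
  next
    fix q assume "q \<in> {q. q permutes ?B}"
    then show "map_permutation ?B (\<lambda>x. x - 1) q \<in> {q. q permutes ?A}"
      using map_permutation_permutes[OF bijP] by auto
    show "h (map_permutation ?A Suc (map_permutation ?B (\<lambda>x. x - 1) q)) = h q"
      using \<open>q \<in> {q. q permutes ?B}\<close> by (subst map_permutation_compose_inv[OF bijP]) auto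
  next
    fix q assume "q \<in> {q. q permutes ?A}"
    then show "map_permutation ?B (\<lambda>x. x - 1) (map_permutation ?A Suc q) = q"
      by (intro map_permutation_compose_inv[OF bijS]) auto
  next
    fix q assume "q \<in> {q. q permutes ?A}"
    then show "map_permutation ?A Suc q \<in> {q. q permutes ?B}"
      using map_permutation_permutes[OF bijS] by auto
  qed
  have summand: "f (Transposition.transpose 0 b \<circ> map_permutation ?A Suc q) =
      (if b = 0 then 1 else - 1) * M 0 b *
      (of_int (sign q) * (\<Prod>i<n. M (Suc i) (if Suc (q i) = b then 0 else Suc (q i))))"
    if q: "q permutes ?A" and b: "b \<in> insert 0 ?B" for q b
  proof -
    let ?q = "map_permutation ?A Suc q"
    have qB: "?q permutes ?B" by (rule map_permutation_permutes[OF bijS q])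
    have q0: "?q 0 = 0" using qB by (simp add: permutes_not_in)
    have qS: "?q (Suc i) = Suc (q i)" if "i < n" for i
      using map_permutation_apply[of Suc ?A i q] that by simp
    have "sign (Transposition.transpose 0 b \<circ> ?q) = sign (Transposition.transpose 0 b :: nat \<Rightarrow> nat) * sign ?q"
      using qB permutes_imp_permutation by (intro sign_compose permutation_swap_id) blast
    also have "sign ?q = sign q" by (rule sign_map_permutation) (use q in auto)
    finally have sg: "(of_int (sign (Transposition.transpose 0 b \<circ> ?q)) :: 'a) = (if b = 0 then 1 else - 1) * of_int (sign q)"
      by (simp add: sign_swap_id del: o_apply)
    have "(\<Prod>i<Suc n. M i ((Transposition.transpose 0 b \<circ> ?q) i)) = M 0 b * (\<Prod>i<n. M (Suc i) (Transposition.transpose 0 b (Suc (q i))))"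
      by (subst prod.lessThan_Suc_shift) (simp add: q0 qS)
    also have "(\<Prod>i<n. M (Suc i) (Transposition.transpose 0 b (Suc (q i)))) =
        (\<Prod>i<n. M (Suc i) (if Suc (q i) = b then 0 else Suc (q i)))"
      by (intro prod.cong) (auto simp: Transposition.transpose_def)
    finally show ?thesis unfolding f_def sg by (simp add: mult_ac)
  qed
  have "ndet (Suc n) M = (\<Sum>b\<in>insert 0 ?B. \<Sum>q | q permutes ?B. f (Transposition.transpose 0 b \<circ> q))"
    using sum_over_permutations_insert[of ?B 0 f] unfolding ndet_def f_def[symmetric] ins[symmetric] by simp
  also have "\<dots> = (\<Sum>b\<in>insert 0 ?B. \<Sum>q | q permutes ?A. (if b = 0 then 1 else - 1) * M 0 b *
      (of_int (sign q) * (\<Prod>i<n. M (Suc i) (if Suc (q i) = b then 0 else Suc (q i)))))"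
    unfolding reindex by (intro sum.cong refl summand) auto
  also have "\<dots> = (\<Sum>b\<in>insert 0 ?B. (if b = 0 then 1 else - 1) * M 0 b *
      ndet n (\<lambda>i j. M (Suc i) (if Suc j = b then 0 else Suc j)))"
    unfolding ndet_def sum_distrib_left ..
  also have "\<dots> = M 0 0 * ndet n (\<lambda>i j. M (Suc i) (Suc j)) +
      (\<Sum>b<n. - (M 0 (Suc b) * ndet n (\<lambda>i j. M (Suc i) (if j = b then 0 else Suc j))))"
    by (subst sum.insert) (auto simp: sum.reindex)
  finally show ?thesis by (simp add: sum_negf)
qed

context rel_algebra begin

text \<open>The wedge product with \<open>Z \<in> \<qq>\<^sub>+\<close>, viewed as the element \<open>B(Z, _)\<close> of $(\mathfrak p/\mathfrak q)^*$.\<close>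

primrec eps :: "'k ^ 'd \<Rightarrow> (('k, 'd) vec list \<Rightarrow> 'v) \<Rightarrow> ('k, 'd) vec list \<Rightarrow> 'v" where
  "eps Z \<psi> [] = 0"
| "eps Z \<psi> (x # xs) = s (K Z x) (\<psi> xs) - eps Z (\<lambda>zs. \<psi> (x # zs)) xs"

lemma eps_hom:
  assumes "f 0 = 0" "\<And>v w. f (v - w) = f v - f w" "\<And>a v. f (s a v) = s a (f v)"
  shows "eps Z (\<lambda>zs. f (\<psi> zs)) xs = f (eps Z \<psi> xs)"
  by (induction xs arbitrary: \<psi>) (simp_all add: assms)

lemma eps_add: "eps Z (\<lambda>zs. \<phi> zs + \<psi> zs) xs = eps Z \<phi> xs + eps Z \<psi> xs"
  by (induction xs arbitrary: \<phi> \<psi>) (simp_all add: S.scale_right_distrib)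

lemma eps_diff: "eps Z (\<lambda>zs. \<phi> zs - \<psi> zs) xs = eps Z \<phi> xs - eps Z \<psi> xs"
  by (induction xs arbitrary: \<phi> \<psi>) (simp_all add: S.scale_right_diff_distrib)

lemma eps_s: "eps Z (\<lambda>zs. s a (\<psi> zs)) xs = s a (eps Z \<psi> xs)"
  by (rule eps_hom) (simp_all add: S.scale_right_diff_distrib mult.commute)

lemma eps_scaleR: "eps Z (\<lambda>zs. c *\<^sub>R \<psi> zs) xs = c *\<^sub>R eps Z \<psi> xs"
  unfolding s_real[symmetric] by (rule eps_s)

lemma eps_uminus: "eps Z (\<lambda>zs. - \<psi> zs) xs = - eps Z \<psi> xs"
  by (rule eps_hom) simp_all

lemma eps_r: "X \<in> \<pp> \<Longrightarrow> eps Z (\<lambda>zs. r X (\<psi> zs)) xs = r X (eps Z \<psi> xs)"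
  by (rule eps_hom) (simp_all add: r_diff r_scale)

lemma eps_zero [simp]: "eps Z (\<lambda>zs. 0) xs = 0"
  by (induction xs) simp_all

lemma eps_sum: "eps Z (\<lambda>zs. \<Sum>i\<in>A. \<psi> i zs) xs = (\<Sum>i\<in>A. eps Z (\<psi> i) xs)"
  by (induction A rule: infinite_finite_induct) (simp_all add: eps_add)

lemma eps_B_inv: "eps Z (\<lambda>zs. B_inv G \<pp> (\<lambda>U V. b U V zs)) xs = B_inv G \<pp> (\<lambda>U V. eps Z (b U V) xs)"
  unfolding B_inv_conv by (rule eps_sum)

lemma eps_cong:
  assumes "set xs \<subseteq> \<pp>" "\<And>zs. set zs \<subseteq> \<pp> \<Longrightarrow> \<phi> zs = \<psi> zs"
  shows "eps Z \<phi> xs = eps Z \<psi> xs"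
  using assms
proof (induction xs arbitrary: \<phi> \<psi>)
  case (Cons y ys)
  have "eps Z (\<lambda>zs. \<phi> (y # zs)) ys = eps Z (\<lambda>zs. \<psi> (y # zs)) ys"
    using Cons.prems by (intro Cons.IH) auto
  then show ?case using Cons.prems by auto
qed simp

lemma eps_anticomm: "eps Z (eps W \<psi>) xs = - eps W (eps Z \<psi>) xs"
proof (induction xs arbitrary: \<psi>)
  case (Cons x xs)
  show ?case using Cons[of "ins x \<psi>"] by (simp add: eps_diff eps_s)
qed simp

text \<open>A derivation rule: invariance of \<open>K\<close> makes the action on the one-form
  \<open>K Z\<close> the action on Z.\<close>

lemma adj_eps: "adj W (eps Z \<psi>) xs = eps Z (adj W \<psi>) xs + eps \<lbrakk>W, Z\<rbrakk> \<psi> xs"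
proof (induction xs arbitrary: \<psi>)
  case (Cons x xs)
  show ?case
    using Cons[of "ins x \<psi>"] K_invariant'[of W Z x] by (simp add: adj_diff adj_s eps_diff)
qed simp

lemma mlin_eps:
  assumes "mlin \<psi>"
  shows "mlin (eps Z \<psi>)"
  unfolding mlin_def
proof (intro allI impI conjI ballI)
  fix xs ys X Y assume p: "set xs \<subseteq> \<pp>" "set ys \<subseteq> \<pp>" "X \<in> \<pp>" "Y \<in> \<pp>"
  show "eps Z \<psi> (xs @ (X + Y) # ys) = eps Z \<psi> (xs @ X # ys) + eps Z \<psi> (xs @ Y # ys)"
    using assms p(1)
  proof (induction xs arbitrary: \<psi>)
    case Nil
    have "eps Z (ins (X + Y) \<psi>) ys = eps Z (\<lambda>zs. \<psi> (X # zs) + \<psi> (Y # zs)) ys"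
      using Nil p by (intro eps_cong) (auto intro: mlin_D0)
    then show ?case by (simp add: eps_add K_add_right S.scale_left_distrib)
  next
    case (Cons x xs)
    then show ?case using Cons.IH[of "ins x \<psi>"] p by (simp add: mlin_D S.scale_right_distrib)
  qed
next
  fix xs ys X a assume p: "set xs \<subseteq> \<pp>" "set ys \<subseteq> \<pp>" "X \<in> \<pp>"
  show "eps Z \<psi> (xs @ (a *s X) # ys) = s a (eps Z \<psi> (xs @ X # ys))"
    using assms p(1)
  proof (induction xs arbitrary: \<psi>)
    case Nil
    have "eps Z (ins (a *s X) \<psi>) ys = eps Z (\<lambda>zs. s a (\<psi> (X # zs))) ys"
      using Nil p by (intro eps_cong) (auto intro: mlin_D0)
    then show ?case by (simp add: eps_s K_scale_right S.scale_right_diff_distrib)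
  next
    case (Cons x xs)
    then show ?case using Cons.IH[of "ins x \<psi>"] p
      by (simp add: mlin_D S.scale_right_diff_distrib mult.commute)
  qed
qed

lemma alt_eps:
  assumes "alt \<psi>"
  shows "alt (eps Z \<psi>)"
  unfolding alt_def
proof (intro allI impI ballI)
  fix xs ys X assume p: "set xs \<subseteq> \<pp>" "set ys \<subseteq> \<pp>" "X \<in> \<pp>"
  show "eps Z \<psi> (xs @ X # X # ys) = 0"
    using assms p(1)
  proof (induction xs arbitrary: \<psi>)
    case Nil
    have "eps Z (\<lambda>zs. \<psi> (X # X # zs)) ys = eps Z (\<lambda>_. 0) ys"
      using Nil p by (intro eps_cong) (auto intro: altD[of _ "[]", simplified])
    then show ?case by simp
  next
    case (Cons x xs)
    then show ?case using Cons.IH[of "ins x \<psi>"] p by (simp add: altD)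
  qed
qed

lemma vanish_eps:
  assumes "vanish W \<psi>" "\<And>X. X \<in> W \<Longrightarrow> K Z X = 0"
  shows "vanish W (eps Z \<psi>)"
  unfolding vanish_def
proof (intro allI impI ballI)
  fix xs ys X assume p: "set xs \<subseteq> \<pp>" "set ys \<subseteq> \<pp>" "X \<in> W"
  show "eps Z \<psi> (xs @ X # ys) = 0"
    using assms(1) p(1)
  proof (induction xs arbitrary: \<psi>)
    case Nil
    have "eps Z (ins X \<psi>) ys = eps Z (\<lambda>_. 0) ys"
      using Nil p by (intro eps_cong) (auto intro: vanishD0)
    then show ?case using assms(2) p by simp
  next
    case (Cons x xs)
    then show ?case using Cons.IH[of "ins x \<psi>"] p by (simp add: vanishD)
  qed
qed

text \<open>Replacing a column in \<open>ndet_Suc\<close> means replacing an argument of the smaller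
  wedge product; this turns the resulting sum into the recursion of \<open>eps\<close>.\<close>

lemma eps_ins_sum:
  assumes "mlin \<psi>" "alt \<psi>" "x \<in> \<pp>" "set xs \<subseteq> \<pp>"
  shows "(\<Sum>i<length xs. s (K Z (xs ! i)) (\<psi> (xs[i := x]))) = eps Z (ins x \<psi>) xs"
  using assms
proof (induction xs arbitrary: \<psi>)
  case (Cons y ys)
  have "eps Z (\<lambda>zs. \<psi> (y # x # zs)) ys = eps Z (\<lambda>zs. - \<psi> (x # y # zs)) ys"
    using Cons.prems by (intro eps_cong alt_swap0) auto
  moreover have "(\<Sum>i<length ys. s (K Z (ys ! i)) (\<psi> (y # ys[i := x]))) = eps Z (\<lambda>zs. \<psi> (y # x # zs)) ys"
    using Cons.IH[of "ins y \<psi>"] Cons.prems by simp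
  ultimately show ?case
    by (simp add: sum.lessThan_Suc_shift eps_uminus del: sum.lessThan_Suc)
qed simp

lemma mlin_cong: "mlin \<psi> \<Longrightarrow> (\<And>xs. set xs \<subseteq> \<pp> \<Longrightarrow> \<phi> xs = \<psi> xs) \<Longrightarrow> mlin \<phi>"
  unfolding mlin_def by (simp add: p_add p_scale)

lemma alt_cong: "alt \<psi> \<Longrightarrow> (\<And>xs. set xs \<subseteq> \<pp> \<Longrightarrow> \<phi> xs = \<psi> xs) \<Longrightarrow> alt \<phi>"
  unfolding alt_def by simp

lemma vanish_cong: "W \<subseteq> \<pp> \<Longrightarrow> vanish W \<psi> \<Longrightarrow> (\<And>xs. set xs \<subseteq> \<pp> \<Longrightarrow> \<phi> xs = \<psi> xs) \<Longrightarrow> vanish W \<phi>"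
  unfolding vanish_def by (simp add: subset_iff)

section \<open>Decomposable elements\<close>

lemma wedge_Nil: "wedge G \<pp> s [] v = (\<lambda>xs. if xs = [] then v else 0)"
proof -
  have "{\<sigma>. \<sigma> permutes ({} :: nat set)} = {id}" by (simp only: permutes_empty singleton_conv)
  then show ?thesis
    by (auto simp: wedge_def fun_eq_iff simp del: permutes_empty)
qed

lemma wedge_supp: "\<not> (length xs = length Zs \<and> set xs \<subseteq> \<pp>) \<Longrightarrow> wedge G \<pp> s Zs v xs = 0"
  unfolding wedge_def by (rule if_not_P)

lemma wedge_ndet:
  assumes "length xs = length Zs" "set xs \<subseteq> \<pp>"
  shows "wedge G \<pp> s Zs v xs = s (ndet (length Zs) (\<lambda>i j. K (Zs ! i) (xs ! j))) v"
  using assms by (simp add: wedge_def ndet_def)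

text \<open>The expansion of the determinant along its first row is the recursion of
  \<open>eps\<close>. Multilinearity and alternation of the shorter product are hypotheses, since
  \<open>wedge_class\<close> proves them by an induction that runs on this very formula.\<close>

lemma wedge_Cons_aux:
  assumes "mlin (wedge G \<pp> s Zs v)" "alt (wedge G \<pp> s Zs v)" and p: "set xs \<subseteq> \<pp>"
  shows "wedge G \<pp> s (Z # Zs) v xs = eps Z (wedge G \<pp> s Zs v) xs"
proof (cases xs)
  case Nil
  then show ?thesis by (simp add: wedge_supp)
next
  case (Cons x ys)
  show ?thesis
  proof (cases "length ys = length Zs")
    case True
    let ?n = "length Zs"
    have nd: "ndet ?n (\<lambda>i j. K (Zs ! i) ((x # ys) ! (if j = b then 0 else Suc j))) =
        ndet ?n (\<lambda>i j. K (Zs ! i) (ys[b := x] ! j))" if "b < ?n" for b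
    proof -
      have "(\<Prod>i<?n. K (Zs ! i) ((x # ys) ! (if \<sigma> i = b then 0 else Suc (\<sigma> i)))) =
          (\<Prod>i<?n. K (Zs ! i) (ys[b := x] ! \<sigma> i))" if "\<sigma> permutes {..<?n}" for \<sigma>
        using that \<open>b < ?n\<close> True permutes_in_image[OF that] by (intro prod.cong) (auto simp: nth_list_update)
      then show ?thesis unfolding ndet_def by (intro sum.cong) auto
    qed
    have up: "set (ys[b := x]) \<subseteq> \<pp>" for b
      using p Cons set_update_subset_insert[of ys b x] by auto
    have "wedge G \<pp> s (Z # Zs) v xs =
        s (K Z x * ndet ?n (\<lambda>i j. K (Zs ! i) (ys ! j)) -
           (\<Sum>b<?n. K Z (ys ! b) * ndet ?n (\<lambda>i j. K (Zs ! i) (ys[b := x] ! j)))) v"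
      using p True Cons by (simp add: wedge_ndet ndet_Suc nd)
    also have "\<dots> = s (K Z x) (wedge G \<pp> s Zs v ys) -
        (\<Sum>b<?n. s (K Z (ys ! b)) (wedge G \<pp> s Zs v (ys[b := x])))"
      using p True Cons up by (simp add: wedge_ndet S.scale_left_diff_distrib S.scale_sum_left)
    also have "(\<Sum>b<?n. s (K Z (ys ! b)) (wedge G \<pp> s Zs v (ys[b := x]))) =
        eps Z (ins x (wedge G \<pp> s Zs v)) ys"
      using eps_ins_sum[OF assms(1,2), of x ys Z] p Cons True by simp
    finally show ?thesis using Cons by simp
  next
    case False
    have "eps Z (ins x (wedge G \<pp> s Zs v)) ys = 0"
      using eps_ins_sum[OF assms(1,2), of x ys Z] p Cons False by (simp add: wedge_supp)
    then show ?thesis using False Cons by (simp add: wedge_supp)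
  qed
qed

lemma wedge_class: "mlin (wedge G \<pp> s Zs v) \<and> alt (wedge G \<pp> s Zs v)"
proof (induction Zs)
  case Nil
  then show ?case by (simp add: wedge_Nil mlin_def alt_def)
next
  case (Cons Z Zs)
  then show ?case
    using mlin_cong[OF mlin_eps wedge_Cons_aux] alt_cong[OF alt_eps wedge_Cons_aux] by blast
qed

lemma wedge_Cons: "set xs \<subseteq> \<pp> \<Longrightarrow> wedge G \<pp> s (Z # Zs) v xs = eps Z (wedge G \<pp> s Zs v) xs"
  using wedge_Cons_aux wedge_class by blast

lemma vanish_wedge:
  assumes "W \<subseteq> \<pp>" "\<And>X Z. X \<in> W \<Longrightarrow> Z \<in> set Zs \<Longrightarrow> K Z X = 0"
  shows "vanish W (wedge G \<pp> s Zs v)"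
  using assms(2)
proof (induction Zs)
  case Nil
  then show ?case by (simp add: wedge_Nil vanish_def)
next
  case (Cons Z Zs)
  then show ?case by (intro vanish_cong[OF assms(1) vanish_eps wedge_Cons]) auto
qed

lemma wedge_forms: "set Zs \<subseteq> nilradical G \<qq> \<Longrightarrow> wedge G \<pp> s Zs v \<in> forms \<pp> \<qq> s (length Zs)"
  unfolding forms_iff using wedge_class wedge_supp vanish_wedge[OF q_subset] K_q_nilq by blast

lemma vanish_nil_wedge: "set Zs \<subseteq> \<pp> \<Longrightarrow> vanish \<nn> (wedge G \<pp> s Zs v)"
  using vanish_wedge[OF nil_subset] K_nil by blast

lemma wedge_s: "wedge G \<pp> s Zs (s a v) xs = s a (wedge G \<pp> s Zs v xs)"
  by (simp add: wedge_def mult.commute)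

lemma wedge_r: "X \<in> \<pp> \<Longrightarrow> wedge G \<pp> s Zs (r X v) xs = r X (wedge G \<pp> s Zs v xs)"
  by (simp add: wedge_def r_scale)

lemma wedge_move:
  "j < length Zs \<Longrightarrow> set xs \<subseteq> \<pp> \<Longrightarrow>
    wedge G \<pp> s (Zs[j := W]) v xs = (- 1) ^ j *\<^sub>R wedge G \<pp> s (W # omit {j} Zs) v xs"
proof (induction Zs arbitrary: j xs)
  case (Cons Z Zs)
  show ?case
  proof (cases j)
    case (Suc i)
    have "wedge G \<pp> s (Z # Zs[i := W]) v xs = eps Z (\<lambda>xs. (- 1) ^ i *\<^sub>R eps W (wedge G \<pp> s (omit {i} Zs) v) xs) xs"
      using Cons Suc by (simp add: wedge_Cons cong: eps_cong)
    also have "\<dots> = - ((- 1) ^ i *\<^sub>R eps W (eps Z (wedge G \<pp> s (omit {i} Zs) v)) xs)"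
      by (simp add: eps_scaleR eps_anticomm[of Z W])
    also have "\<dots> = (- 1) ^ j *\<^sub>R wedge G \<pp> s (W # omit {j} (Z # Zs)) v xs"
      using Cons.prems Suc by (simp add: wedge_Cons cong: eps_cong)
    finally show ?thesis using Suc by simp
  qed simp
qed simp

lemma adj_wedge:
  "set xs \<subseteq> \<pp> \<Longrightarrow> W \<in> \<pp> \<Longrightarrow>
    adj W (wedge G \<pp> s Zs v) xs = (\<Sum>j<length Zs. wedge G \<pp> s (Zs[j := \<lbrakk>W, Zs ! j\<rbrakk>]) v xs)"
proof (induction Zs arbitrary: xs)
  case Nil
  show ?case by (cases xs) (simp_all add: wedge_Nil)
next
  case (Cons Z Zs)
  have "adj W (wedge G \<pp> s (Z # Zs) v) xs = adj W (eps Z (wedge G \<pp> s Zs v)) xs"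
    using Cons.prems by (intro adj_cong wedge_Cons) auto
  also have "\<dots> = eps Z (adj W (wedge G \<pp> s Zs v)) xs + eps \<lbrakk>W, Z\<rbrakk> (wedge G \<pp> s Zs v) xs"
    by (rule adj_eps)
  also have "eps Z (adj W (wedge G \<pp> s Zs v)) xs =
      eps Z (\<lambda>xs. \<Sum>j<length Zs. wedge G \<pp> s (Zs[j := \<lbrakk>W, Zs ! j\<rbrakk>]) v xs) xs"
    using Cons by (intro eps_cong) auto
  also have "\<dots> = (\<Sum>j<length Zs. wedge G \<pp> s (Z # Zs[j := \<lbrakk>W, Zs ! j\<rbrakk>]) v xs)"
    using Cons.prems by (simp add: eps_sum wedge_Cons)
  finally show ?case
    using Cons.prems by (simp add: sum.lessThan_Suc_shift wedge_Cons del: sum.lessThan_Suc)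
qed

text \<open>On relative forms only the part of \<open>X\<close> in a complement of \<open>\<qq>\<close> contributes to \<open>cdf\<close>, and then \<open>Y\<close> runs
  through \<open>\<qq>\<^sub>+\<close>. The factor 1/2 and the second copy of the action on \<open>V\<close> in \<open>mact\<close> reflect that every bracket
  \<open>[Z\<^sub>i, Z\<^sub>j]\<close> is counted twice.\<close>

definition mact where "mact X \<phi> xs = r X (\<phi> xs) + lact X \<phi> xs"

definition cdf where
  "cdf \<phi> xs = (if set xs \<subseteq> \<pp> then - (1 / 2) *\<^sub>R B_inv G \<pp> (\<lambda>X Y. mact Y (ins X \<phi>) xs) else 0)"

lemma mact_conv: "mact X \<phi> xs = r X (\<phi> xs) + r X (\<phi> xs) + adj X \<phi> xs"
  by (simp add: mact_def lact_def)

lemma mact_add: "X \<in> \<pp> \<Longrightarrow> mact X (\<lambda>zs. \<phi> zs + \<psi> zs) xs = mact X \<phi> xs + mact X \<psi> xs"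
  by (simp add: mact_conv adj_add r_add)

lemma mact_diff: "X \<in> \<pp> \<Longrightarrow> mact X (\<lambda>zs. \<phi> zs - \<psi> zs) xs = mact X \<phi> xs - mact X \<psi> xs"
  by (simp add: mact_conv adj_diff r_diff)

lemma mact_s: "X \<in> \<pp> \<Longrightarrow> mact X (\<lambda>zs. s a (\<phi> zs)) xs = s a (mact X \<phi> xs)"
  by (simp add: mact_conv adj_s r_scale S.scale_right_distrib)

lemma mact_cong:
  assumes "X \<in> \<pp>" "set xs \<subseteq> \<pp>" "\<And>zs. set zs \<subseteq> \<pp> \<Longrightarrow> \<phi> zs = \<psi> zs"
  shows "mact X \<phi> xs = mact X \<psi> xs"
  using adj_cong[OF assms] assms by (simp add: mact_conv)

lemma mact_eps: "W \<in> \<pp> \<Longrightarrow> mact W (eps Z \<psi>) xs = eps Z (mact W \<psi>) xs + eps \<lbrakk>W, Z\<rbrakk> \<psi> xs"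
  unfolding mact_conv by (simp add: adj_eps eps_add eps_r)

lemma cdf_cong:
  assumes "set xs \<subseteq> \<pp>" "\<And>zs. set zs \<subseteq> \<pp> \<Longrightarrow> \<phi> zs = \<psi> zs"
  shows "cdf \<phi> xs = cdf \<psi> xs"
proof -
  have "B_inv G \<pp> (\<lambda>X Y. mact Y (ins X \<phi>) xs) = B_inv G \<pp> (\<lambda>X Y. mact Y (ins X \<psi>) xs)"
    using assms by (intro B_inv_cong mact_cong) auto
  then show ?thesis by (simp add: cdf_def)
qed

lemma null_linear_mact: "mlin \<phi> \<Longrightarrow> vanish \<nn> \<phi> \<Longrightarrow> set xs \<subseteq> \<pp> \<Longrightarrow> null_linear (\<lambda>X. mact X \<phi> xs)"
  unfolding mact_def by (intro null_linear_add null_linear_r null_linear_lact)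

lemma mlin_mact: "mlin \<phi> \<Longrightarrow> X \<in> \<pp> \<Longrightarrow> mlin (mact X \<phi>)"
  using mlin_add[OF mlin_r mlin_lact] by (simp add: mact_def[abs_def])

lemma alt_mact: "mlin \<phi> \<Longrightarrow> alt \<phi> \<Longrightarrow> X \<in> \<pp> \<Longrightarrow> alt (mact X \<phi>)"
  using alt_add[OF alt_r alt_lact] by (simp add: mact_def[abs_def])

text \<open>The operator under the contraction replaces each argument x in turn by X, with
  coefficient \<open>K [Y, Z] x = K Y [Z, x]\<close>. Contracting X and Y puts \<open>[Z, x]\<close>
  in the place of x, which is the action of Z up to sign.\<close>

lemma B_inv_eps_ins:
  assumes "mlin \<psi>" "alt \<psi>" "vanish \<nn> \<psi>" and Z: "Z \<in> \<pp>" and p: "set xs \<subseteq> \<pp>"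
  shows "B_inv G \<pp> (\<lambda>X Y. eps \<lbrakk>Y, Z\<rbrakk> (ins X \<psi>) xs) = - adj Z \<psi> xs"
  using assms(1-3) p
proof (induction xs arbitrary: \<psi>)
  case (Cons x xs)
  then have x: "x \<in> \<pp>" "set xs \<subseteq> \<pp>" by auto
  have "B_inv G \<pp> (\<lambda>X Y. eps \<lbrakk>Y, Z\<rbrakk> (ins X \<psi>) (x # xs)) =
      B_inv G \<pp> (\<lambda>X Y. s (K \<lbrakk>Z, x\<rbrakk> Y) (\<psi> (X # xs))) + B_inv G \<pp> (\<lambda>X Y. eps \<lbrakk>Y, Z\<rbrakk> (ins X (ins x \<psi>)) xs)"
    unfolding B_inv_add[symmetric]
  proof (rule B_inv_cong)
    fix X Y assume XY: "X \<in> \<pp>" "Y \<in> \<pp>"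
    have "eps \<lbrakk>Y, Z\<rbrakk> (\<lambda>zs. \<psi> (X # x # zs)) xs = eps \<lbrakk>Y, Z\<rbrakk> (\<lambda>zs. - \<psi> (x # X # zs)) xs"
      using Cons.prems x XY by (intro eps_cong alt_swap0) auto
    then show "eps \<lbrakk>Y, Z\<rbrakk> (ins X \<psi>) (x # xs) =
        s (K \<lbrakk>Z, x\<rbrakk> Y) (\<psi> (X # xs)) + eps \<lbrakk>Y, Z\<rbrakk> (ins X (ins x \<psi>)) xs"
      using K_invariant[of Y Z x] K_sym[of Y] by (simp add: eps_uminus)
  qed
  also have "B_inv G \<pp> (\<lambda>X Y. s (K \<lbrakk>Z, x\<rbrakk> Y) (\<psi> (X # xs))) = \<psi> (\<lbrakk>Z, x\<rbrakk> # xs)"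
    using Cons.prems x Z by (intro B_inv_expand(1) null_linear_ins) auto
  also have "B_inv G \<pp> (\<lambda>X Y. eps \<lbrakk>Y, Z\<rbrakk> (ins X (ins x \<psi>)) xs) = - adj Z (ins x \<psi>) xs"
    using Cons.IH[of "ins x \<psi>"] Cons.prems by simp
  finally show ?case by simp
qed simp

text \<open>The recursion of \<open>cdf\<close>, to be compared with
  \<open>codiff_wedge_Cons\<close>. Moving \<open>mact Y\<close> past \<open>eps Z\<close> adds
  \<open>adj Z\<close> to the term \<open>mact Z\<close>. Together they are \<open>2 lact Z\<close>,
  which is where the factor 1/2 is spent.\<close>

lemma cdf_eps:
  assumes m: "mlin \<psi>" and a: "alt \<psi>" and v: "vanish \<nn> \<psi>" and Z: "Z \<in> \<pp>" and p: "set xs \<subseteq> \<pp>"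
  shows "cdf (eps Z \<psi>) xs = - lact Z \<psi> xs - eps Z (cdf \<psi>) xs"
proof -
  have "B_inv G \<pp> (\<lambda>X Y. mact Y (ins X (eps Z \<psi>)) xs) =
      B_inv G \<pp> (\<lambda>X Y. s (K Z X) (mact Y \<psi> xs)) -
      (B_inv G \<pp> (\<lambda>X Y. eps Z (mact Y (ins X \<psi>)) xs) + B_inv G \<pp> (\<lambda>X Y. eps \<lbrakk>Y, Z\<rbrakk> (ins X \<psi>) xs))"
    unfolding B_inv_add[symmetric] B_inv_diff[symmetric]
    by (rule B_inv_cong) (simp add: mact_diff mact_s mact_eps)
  also have "B_inv G \<pp> (\<lambda>X Y. s (K Z X) (mact Y \<psi> xs)) = mact Z \<psi> xs"
    using m v p Z by (intro B_inv_expand(2) null_linear_mact) auto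
  also have "B_inv G \<pp> (\<lambda>X Y. eps \<lbrakk>Y, Z\<rbrakk> (ins X \<psi>) xs) = - adj Z \<psi> xs"
    by (rule B_inv_eps_ins[OF m a v Z p])
  also have "B_inv G \<pp> (\<lambda>X Y. eps Z (mact Y (ins X \<psi>)) xs) = eps Z (\<lambda>zs. (- 2) *\<^sub>R cdf \<psi> zs) xs"
    unfolding eps_B_inv[symmetric] using p by (intro eps_cong) (auto simp: cdf_def)
  finally have "B_inv G \<pp> (\<lambda>X Y. mact Y (ins X (eps Z \<psi>)) xs) =
      2 *\<^sub>R lact Z \<psi> xs + 2 *\<^sub>R eps Z (cdf \<psi>) xs"
    by (simp only: eps_scaleR mact_conv lact_def) (simp add: scaleR_2 algebra_simps)
  then show ?thesis using p by (simp add: cdf_def scaleR_add_right[symmetric])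
qed

text \<open>Euler's identity: for each argument the dual lists reproduce it once modulo q, where the
  form vanishes, so the sum counts the degree.\<close>

lemma eps_ins_count:
  assumes d: "rel_dual Xs Zs" and f: "mlin \<phi>" "alt \<phi>" "vanish \<qq> \<phi>" and p: "set xs \<subseteq> \<pp>"
  shows "(\<Sum>l<length Xs. eps (Zs ! l) (ins (Xs ! l) \<phi>) xs) = real (length xs) *\<^sub>R \<phi> xs"
  using f p
proof (induction xs arbitrary: \<phi>)
  case (Cons x xs)
  then have x: "x \<in> \<pp>" "set xs \<subseteq> \<pp>" by auto
  have Xp: "Xs ! l \<in> \<pp>" if "l < length Xs" for l using d that by (auto simp: rel_dual_def)
  have "(\<Sum>l<length Xs. eps (Zs ! l) (ins (Xs ! l) \<phi>) (x # xs)) =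
      (\<Sum>l<length Xs. s (K x (Zs ! l)) (\<phi> (Xs ! l # xs))) + (\<Sum>l<length Xs. eps (Zs ! l) (ins (Xs ! l) (ins x \<phi>)) xs)"
    unfolding sum.distrib[symmetric]
  proof (rule sum.cong[OF refl])
    fix l assume "l \<in> {..<length Xs}"
    then have "eps (Zs ! l) (\<lambda>zs. \<phi> (Xs ! l # x # zs)) xs = eps (Zs ! l) (\<lambda>zs. - \<phi> (x # Xs ! l # zs)) xs"
      using Cons.prems x Xp by (intro eps_cong alt_swap0) auto
    then show "eps (Zs ! l) (ins (Xs ! l) \<phi>) (x # xs) =
        s (K x (Zs ! l)) (\<phi> (Xs ! l # xs)) + eps (Zs ! l) (ins (Xs ! l) (ins x \<phi>)) xs"
      by (simp add: K_sym[of x] eps_uminus)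
  qed
  also have "(\<Sum>l<length Xs. s (K x (Zs ! l)) (\<phi> (Xs ! l # xs))) = \<phi> (x # xs)"
    using Cons.prems x vanish_mono[OF Cons.prems(3) nil_subset_q]
    by (intro null_linear_rel_expand[OF _ _ d, symmetric] null_linear_ins) (auto intro: vanishD0)
  also have "(\<Sum>l<length Xs. eps (Zs ! l) (ins (Xs ! l) (ins x \<phi>)) xs) = real (length xs) *\<^sub>R \<phi> (x # xs)"
    using Cons.IH[of "ins x \<phi>"] Cons.prems by simp
  finally show ?case by (simp add: scaleR_add_left)
qed simp

text \<open>Finite sums of decomposable elements. Scalars are absorbed into the coefficient v, and
  the induction rule is tailored to maps prescribed on decomposable elements.\<close>

inductive_set wspan :: "nat \<Rightarrow> (('k, 'd) vec list \<Rightarrow> 'v) set" for k where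
  zero: "(\<lambda>_. 0) \<in> wspan k"
| step: "length Zs = k \<Longrightarrow> set Zs \<subseteq> nilradical G \<qq> \<Longrightarrow> \<psi> \<in> wspan k \<Longrightarrow>
    (\<lambda>xs. wedge G \<pp> s Zs v xs + \<psi> xs) \<in> wspan k"

lemma wspan_supp: "\<psi> \<in> wspan k \<Longrightarrow> \<not> (length xs = k \<and> set xs \<subseteq> \<pp>) \<Longrightarrow> \<psi> xs = 0"
  by (induction rule: wspan.induct) (auto simp: wedge_supp)

lemma wspan_add: "\<phi> \<in> wspan k \<Longrightarrow> \<psi> \<in> wspan k \<Longrightarrow> (\<lambda>xs. \<phi> xs + \<psi> xs) \<in> wspan k"
proof (induction rule: wspan.induct)
  case (step Zs \<theta> v)
  then show ?case using wspan.step[OF step(1,2), of "\<lambda>xs. \<theta> xs + \<psi> xs" v] by (simp add: add.assoc)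
qed simp

lemma wspan_s: "\<phi> \<in> wspan k \<Longrightarrow> (\<lambda>xs. s a (\<phi> xs)) \<in> wspan k"
proof (induction rule: wspan.induct)
  case (step Zs \<theta> v)
  then show ?case
    using wspan.step[OF step(1,2,4), of "s a v"] by (simp add: wedge_s S.scale_right_distrib)
qed (simp add: wspan.zero)

lemma wspan_sum: "finite A \<Longrightarrow> (\<And>i. i \<in> A \<Longrightarrow> \<phi> i \<in> wspan k) \<Longrightarrow> (\<lambda>xs. \<Sum>i\<in>A. \<phi> i xs) \<in> wspan k"
proof (induction A rule: finite_induct)
  case (insert x F)
  then show ?case using wspan_add[of "\<phi> x" k "\<lambda>xs. \<Sum>i\<in>F. \<phi> i xs"] by simp
qed (simp add: wspan.zero)

text \<open>Equality can be demanded on lists from p only: members of \<open>wspan\<close> vanish on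
  all other lists, whereas \<open>eps\<close> may not.\<close>

lemma wspan_eps:
  "\<psi> \<in> wspan k \<Longrightarrow> Z \<in> nilradical G \<qq> \<Longrightarrow> \<exists>\<theta>\<in>wspan (Suc k). \<forall>xs. set xs \<subseteq> \<pp> \<longrightarrow> \<theta> xs = eps Z \<psi> xs"
proof (induction rule: wspan.induct)
  case zero
  then show ?case by (intro bexI[of _ "\<lambda>_. 0"]) (auto simp: wspan.zero)
next
  case (step Zs \<psi> v)
  then obtain \<theta> where t: "\<theta> \<in> wspan (Suc k)" "\<And>xs. set xs \<subseteq> \<pp> \<Longrightarrow> \<theta> xs = eps Z \<psi> xs" by blast
  have "(\<lambda>xs. wedge G \<pp> s (Z # Zs) v xs + \<theta> xs) \<in> wspan (Suc k)"
    using step t by (intro wspan.step) auto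
  then show ?case by (rule bexI[rotated]) (simp add: wedge_Cons t eps_add)
qed

lemma forms_ins: "\<phi> \<in> forms \<pp> \<qq> s (Suc k) \<Longrightarrow> X \<in> \<pp> \<Longrightarrow> ins X \<phi> \<in> forms \<pp> \<qq> s k"
  unfolding forms_iff by simp

text \<open>By Euler's identity a form of degree k + 1 is 1/(k + 1) times the sum of the products of
  \<open>Zs ! l\<close> with its insertions, and the latter are sums of decomposable elements by
  induction.\<close>

lemma forms_wspan: "\<phi> \<in> forms \<pp> \<qq> s k \<Longrightarrow> \<phi> \<in> wspan k"
proof (induction k arbitrary: \<phi>)
  case 0
  then have "\<phi> xs = wedge G \<pp> s [] (\<phi> []) xs + 0" for xs
    unfolding forms_iff wedge_Nil by (cases xs) auto
  then have "\<phi> = (\<lambda>xs. wedge G \<pp> s [] (\<phi> []) xs + 0)" by blast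
  then show ?case using wspan.step[of "[]" 0 "\<lambda>_. 0" "\<phi> []"] wspan.zero by simp
next
  case (Suc k)
  obtain Xs Zs where d: "rel_dual Xs Zs" using ex_rel_dual by blast
  have XZ: "Xs ! l \<in> \<pp>" "Zs ! l \<in> nilradical G \<qq>" if "l < length Xs" for l
    using d that rel_dual_length[OF d] by (auto simp: rel_dual_def)
  have "\<exists>\<theta>\<in>wspan (Suc k). \<forall>xs. set xs \<subseteq> \<pp> \<longrightarrow> \<theta> xs = eps (Zs ! l) (ins (Xs ! l) \<phi>) xs"
    if "l < length Xs" for l
    using XZ[OF that] Suc by (intro wspan_eps Suc.IH forms_ins) auto
  then obtain \<theta> where t: "\<And>l. l < length Xs \<Longrightarrow> \<theta> l \<in> wspan (Suc k)"
    "\<And>l xs. l < length Xs \<Longrightarrow> set xs \<subseteq> \<pp> \<Longrightarrow> \<theta> l xs = eps (Zs ! l) (ins (Xs ! l) \<phi>) xs"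
    by metis
  define \<psi> where "\<psi> = (\<lambda>xs. s (of_real (1 / real (Suc k))) (\<Sum>l<length Xs. \<theta> l xs))"
  have \<psi>: "\<psi> \<in> wspan (Suc k)"
    unfolding \<psi>_def using t by (intro wspan_s wspan_sum) auto
  have "\<phi> xs = \<psi> xs" for xs
  proof (cases "length xs = Suc k \<and> set xs \<subseteq> \<pp>")
    case True
    then have "\<psi> xs = (1 / real (Suc k)) *\<^sub>R (real (length xs) *\<^sub>R \<phi> xs)"
      unfolding \<psi>_def s_real using Suc.prems t(2)
      by (subst eps_ins_count[OF d, of \<phi> xs, symmetric]) (auto simp: forms_iff)
    then show ?thesis using True by simp
  next
    case False
    then show ?thesis using wspan_supp[OF \<psi> False] Suc.prems by (auto simp: forms_iff)
  qed
  then have "\<phi> = \<psi>" by blast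
  then show ?case using \<psi> by simp
qed

lemma wspan_forms: "\<psi> \<in> wspan k \<Longrightarrow> \<psi> \<in> forms \<pp> \<qq> s k"
proof (induction rule: wspan.induct)
  case zero
  then show ?case by (simp add: forms_iff mlin_def alt_def vanish_def)
next
  case (step Zs \<psi> v)
  have "wedge G \<pp> s Zs v \<in> forms \<pp> \<qq> s k" using wedge_forms step(1,2) by blast
  then show ?case using step(4) unfolding forms_iff by (simp add: mlin_add alt_add vanish_add)
qed

end

locale rel_rep = rel_algebra G \<pp> \<qq> s "inf_action G P \<rho>"
  for G :: "('k::{real_normed_field,euclidean_space}, 'd::finite, 'x::topological_space) lie_group"
    and \<pp> \<qq> :: "('k ^ 'd) set" and P :: "'x set" and s :: "'k \<Rightarrow> 'v::euclidean_space \<Rightarrow> 'v"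
    and \<rho> :: "'x \<Rightarrow> 'v \<Rightarrow> 'v"
begin

abbreviation rr where "rr \<equiv> inf_action G P \<rho>"

text \<open>The term in which Z acts on v and the brackets of Z with the other factors make up
  \<open>- lact Z\<close>: the brackets, moved back to their places, are the derivation
  \<open>adj Z\<close> of the product. The remaining terms keep Z as a factor, at the cost of one
  sign.\<close>

lemma codiff_wedge_Cons:
  assumes Z: "Z \<in> \<pp>" and Zs: "set Zs \<subseteq> \<pp>" and p: "set xs \<subseteq> \<pp>"
  shows "codiff_wedge G \<pp> P s \<rho> (Z # Zs) v xs =
    - lact Z (wedge G \<pp> s Zs v) xs - eps Z (codiff_wedge G \<pp> P s \<rho> Zs v) xs"
proof -
  let ?w = "wedge G \<pp> s" and ?n = "length Zs"
  have "(\<Sum>i<Suc ?n. (- 1) ^ Suc i *\<^sub>R ?w (omit {i} (Z # Zs)) (rr ((Z # Zs) ! i) v) xs) =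
      - lact Z (?w Zs v) xs + adj Z (?w Zs v) xs -
      eps Z (\<lambda>xs. \<Sum>i<?n. (- 1) ^ Suc i *\<^sub>R ?w (omit {i} Zs) (rr (Zs ! i) v) xs) xs"
    using p Z
    by (simp add: sum.lessThan_Suc_shift eps_sum eps_scaleR eps_uminus wedge_Cons sum_negf wedge_r lact_def
        del: sum.lessThan_Suc)
  moreover have "(\<Sum>j<Suc ?n. \<Sum>i<j. (- 1) ^ (i + j) *\<^sub>R
        ?w (\<lbrakk>(Z # Zs) ! i, (Z # Zs) ! j\<rbrakk> # omit {i, j} (Z # Zs)) v xs) =
      - adj Z (?w Zs v) xs -
      eps Z (\<lambda>xs. \<Sum>j<?n. \<Sum>i<j. (- 1) ^ (i + j) *\<^sub>R ?w (\<lbrakk>Zs ! i, Zs ! j\<rbrakk> # omit {i, j} Zs) v xs) xs"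
  proof -
    have "?w (A # Z # Bs) v xs = - eps Z (?w (A # Bs) v) xs" for A Bs
      using p by (simp add: wedge_Cons eps_anticomm[of A Z] cong: eps_cong)
    then show ?thesis
      unfolding sum_lessThan_Suc_pairs adj_wedge[OF p Z]
      by (simp add: wedge_move[OF _ p] eps_sum eps_scaleR eps_uminus sum_negf)
  qed
  ultimately show ?thesis
    unfolding codiff_wedge_def by (simp add: eps_add)
qed

text \<open>Both sides obey the same recursion in the first factor and vanish in degree 0.\<close>

lemma cdf_wedge: "set Zs \<subseteq> \<pp> \<Longrightarrow> set xs \<subseteq> \<pp> \<Longrightarrow>
  cdf (wedge G \<pp> s Zs v) xs = codiff_wedge G \<pp> P s \<rho> Zs v xs"
proof (induction Zs arbitrary: xs)
  case Nil
  have "mact Y (ins X (wedge G \<pp> s [] v)) xs = 0" if "Y \<in> \<pp>" for X Y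
    using that by (simp add: wedge_Nil mact_conv)
  then have "B_inv G \<pp> (\<lambda>X Y. mact Y (ins X (wedge G \<pp> s [] v)) xs) = B_inv G \<pp> (\<lambda>X Y. 0)"
    by (intro B_inv_cong) auto
  then show ?case by (simp add: cdf_def codiff_wedge_def)
next
  case (Cons Z Zs)
  have "cdf (wedge G \<pp> s (Z # Zs) v) xs = cdf (eps Z (wedge G \<pp> s Zs v)) xs"
    using Cons.prems by (intro cdf_cong wedge_Cons) auto
  also have "\<dots> = - lact Z (wedge G \<pp> s Zs v) xs - eps Z (cdf (wedge G \<pp> s Zs v)) xs"
    using Cons.prems wedge_class vanish_nil_wedge by (intro cdf_eps) auto
  also have "eps Z (cdf (wedge G \<pp> s Zs v)) xs = eps Z (codiff_wedge G \<pp> P s \<rho> Zs v) xs"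
    using Cons by (intro eps_cong) auto
  finally show ?case using codiff_wedge_Cons Cons.prems by simp
qed

lemma codiff_wedge_supp: "\<not> set xs \<subseteq> \<pp> \<Longrightarrow> codiff_wedge G \<pp> P s \<rho> Zs v xs = 0"
  by (simp add: codiff_wedge_def wedge_supp)

lemma cdf_add: "cdf (\<lambda>xs. \<phi> xs + \<psi> xs) xs = cdf \<phi> xs + cdf \<psi> xs"
proof -
  have "B_inv G \<pp> (\<lambda>X Y. mact Y (ins X (\<lambda>xs. \<phi> xs + \<psi> xs)) xs) =
      B_inv G \<pp> (\<lambda>X Y. mact Y (ins X \<phi>) xs + mact Y (ins X \<psi>) xs)"
    by (intro B_inv_cong mact_add)
  then show ?thesis by (simp add: cdf_def B_inv_add scaleR_add_right)
qed

lemma cdf_s: "cdf (\<lambda>xs. s a (\<phi> xs)) xs = s a (cdf \<phi> xs)"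
proof -
  have "B_inv G \<pp> (\<lambda>X Y. mact Y (ins X (\<lambda>xs. s a (\<phi> xs))) xs) = B_inv G \<pp> (\<lambda>X Y. s a (mact Y (ins X \<phi>) xs))"
    by (intro B_inv_cong mact_s)
  also have "\<dots> = s a (B_inv G \<pp> (\<lambda>X Y. mact Y (ins X \<phi>) xs))"
    by (rule B_inv_hom) (simp_all add: S.scale_right_distrib)
  finally show ?thesis by (simp add: cdf_def s_scaleR)
qed

text \<open>The decomposable elements span, so the choice in the definition of \<open>codiff\<close> is no choice.\<close>

lemma codiff_eq_cdf:
  assumes \<phi>: "\<phi> \<in> forms \<pp> \<qq> s k"
  shows "codiff G \<pp> \<qq> P s \<rho> k \<phi> = cdf \<phi>"
proof -
  define CP where "CP \<delta> \<longleftrightarrow>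
     (\<forall>\<phi>\<in>forms \<pp> \<qq> s k. \<forall>\<psi>\<in>forms \<pp> \<qq> s k.
        \<delta> (\<lambda>xs. \<phi> xs + \<psi> xs) = (\<lambda>xs. \<delta> \<phi> xs + \<delta> \<psi> xs)) \<and>
     (\<forall>\<phi>\<in>forms \<pp> \<qq> s k. \<forall>a. \<delta> (\<lambda>xs. s a (\<phi> xs)) = (\<lambda>xs. s a (\<delta> \<phi> xs))) \<and>
     (\<forall>Zs v. length Zs = k \<and> set Zs \<subseteq> nilradical G \<qq> \<longrightarrow>
        \<delta> (wedge G \<pp> s Zs v) = codiff_wedge G \<pp> P s \<rho> Zs v)" for \<delta>
  have "cdf (wedge G \<pp> s Zs v) xs = codiff_wedge G \<pp> P s \<rho> Zs v xs" if "set Zs \<subseteq> nilradical G \<qq>" for Zs v xs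
  proof (cases "set xs \<subseteq> \<pp>")
    case True
    then show ?thesis using cdf_wedge[OF subset_trans[OF that nilq_subset_p]] by blast
  next
    case False
    then show ?thesis using codiff_wedge_supp[OF False] by (simp add: cdf_def)
  qed
  then have cp: "CP cdf" unfolding CP_def by (simp add: fun_eq_iff cdf_add cdf_s)
  have "codiff G \<pp> \<qq> P s \<rho> k = (SOME \<delta>. CP \<delta>)" unfolding codiff_def CP_def ..
  then have cp': "CP (codiff G \<pp> \<qq> P s \<rho> k)" using someI[of CP, OF cp] by simp
  have z: "\<delta> (\<lambda>_. 0) = (\<lambda>_. 0)" if "CP \<delta>" for \<delta>
  proof -
    have "\<forall>a. \<delta> (\<lambda>xs. s a (\<phi> xs)) = (\<lambda>xs. s a (\<delta> \<phi> xs))" using that \<phi> unfolding CP_def by blast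
    from this[rule_format, of 0] show ?thesis by simp
  qed
  have "\<phi> \<in> wspan k" by (rule forms_wspan[OF \<phi>])
  then show ?thesis
  proof (induction rule: wspan.induct)
    case zero
    then show ?case using z cp cp' by simp
  next
    case (step Zs \<psi> v)
    have "wedge G \<pp> s Zs v \<in> forms \<pp> \<qq> s k" "\<psi> \<in> forms \<pp> \<qq> s k"
      using wedge_forms wspan_forms step(1-3) by auto
    then have "\<delta> (\<lambda>xs. wedge G \<pp> s Zs v xs + \<psi> xs) = (\<lambda>xs. codiff_wedge G \<pp> P s \<rho> Zs v xs + \<delta> \<psi> xs)"
      if "CP \<delta>" for \<delta> using that step(1,2) unfolding CP_def by simp
    then show ?case using cp cp' step(4) by simp
  qed
qed

end

section \<open>Calculus on manifolds\<close>

text \<open>The mean value theorem, applied in the direction v and then in the direction w,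
  evaluates the mixed difference by one mixed derivative at a point nearby. The difference itself is
  symmetric in v and w.\<close>

lemma second_difference:
  fixes p :: "'e::real_normed_vector \<Rightarrow> real"
  assumes p: "\<And>x. x \<in> ball z R \<Longrightarrow> (p has_derivative p' x) (at x)"
    and pv: "\<And>x. x \<in> ball z R \<Longrightarrow> ((\<lambda>x. p' x v) has_derivative pv x) (at x)"
    and h: "h > 0" "h * (norm v + norm w) < R"
  shows "\<exists>y. dist y z \<le> h * (norm v + norm w) \<and>
    p (z + h *\<^sub>R v + h *\<^sub>R w) - p (z + h *\<^sub>R v) - p (z + h *\<^sub>R w) + p z = h * h * pv y w"
proof -
  have dz: "dist (z + a *\<^sub>R v + b *\<^sub>R w) z \<le> h * (norm v + norm w)" if "0 \<le> a" "a \<le> h" "0 \<le> b" "b \<le> h" for a b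
  proof -
    have "norm (a *\<^sub>R v + b *\<^sub>R w) \<le> a * norm v + b * norm w"
      using norm_triangle_ineq[of "a *\<^sub>R v" "b *\<^sub>R w"] that by simp
    also have "\<dots> \<le> h * norm v + h * norm w"
      using that by (intro add_mono mult_right_mono) auto
    finally show ?thesis by (simp add: dist_norm algebra_simps)
  qed
  then have inB: "z + a *\<^sub>R v + b *\<^sub>R w \<in> ball z R" if "0 \<le> a" "a \<le> h" "0 \<le> b" "b \<le> h" for a b
    using that h(2) by (force simp: dist_commute)
  have D1: "((\<lambda>a. p (z + a *\<^sub>R v + b *\<^sub>R w)) has_field_derivative p' (z + a *\<^sub>R v + b *\<^sub>R w) v) (at a)"
    if "0 \<le> a" "a \<le> h" "0 \<le> b" "b \<le> h" for a b
  proof -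
    note P = p[OF inB[OF that]]
    have "((\<lambda>a. p (z + a *\<^sub>R v + b *\<^sub>R w)) has_derivative (\<lambda>t. p' (z + a *\<^sub>R v + b *\<^sub>R w) (t *\<^sub>R v))) (at a)"
      by (rule has_derivative_compose[where f = "\<lambda>a. z + a *\<^sub>R v + b *\<^sub>R w", OF _ P])
         (auto intro!: derivative_eq_intros)
    then show ?thesis
      unfolding has_field_derivative_def
      by (rule has_derivative_eq_rhs) (simp add: linear_cmul[OF has_derivative_linear[OF P]] fun_eq_iff)
  qed
  have D2: "((\<lambda>b. p' (z + a *\<^sub>R v + b *\<^sub>R w) v) has_field_derivative pv (z + a *\<^sub>R v + b *\<^sub>R w) w) (at b)"
    if "0 \<le> a" "a \<le> h" "0 \<le> b" "b \<le> h" for a b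
  proof -
    note P = pv[OF inB[OF that]]
    have "((\<lambda>b. p' (z + a *\<^sub>R v + b *\<^sub>R w) v) has_derivative (\<lambda>t. pv (z + a *\<^sub>R v + b *\<^sub>R w) (t *\<^sub>R w))) (at b)"
      by (rule has_derivative_compose[where f = "\<lambda>b. z + a *\<^sub>R v + b *\<^sub>R w", OF _ P])
         (auto intro!: derivative_eq_intros)
    then show ?thesis
      unfolding has_field_derivative_def
      by (rule has_derivative_eq_rhs) (simp add: linear_cmul[OF has_derivative_linear[OF P]] fun_eq_iff)
  qed
  have "\<exists>a>0. a < h \<and> (p (z + h *\<^sub>R v + h *\<^sub>R w) - p (z + h *\<^sub>R v + 0 *\<^sub>R w)) -
      (p (z + 0 *\<^sub>R v + h *\<^sub>R w) - p (z + 0 *\<^sub>R v + 0 *\<^sub>R w)) =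
      (h - 0) * (p' (z + a *\<^sub>R v + h *\<^sub>R w) v - p' (z + a *\<^sub>R v + 0 *\<^sub>R w) v)"
    using h by (intro MVT2[of 0 h "\<lambda>a. p (z + a *\<^sub>R v + h *\<^sub>R w) - p (z + a *\<^sub>R v + 0 *\<^sub>R w)"]
        DERIV_diff D1) auto
  then obtain a where a: "0 < a" "a < h" and e1: "p (z + h *\<^sub>R v + h *\<^sub>R w) - p (z + h *\<^sub>R v) - p (z + h *\<^sub>R w) + p z =
      h * (p' (z + a *\<^sub>R v + h *\<^sub>R w) v - p' (z + a *\<^sub>R v + 0 *\<^sub>R w) v)" by auto
  have "\<exists>b>0. b < h \<and> p' (z + a *\<^sub>R v + h *\<^sub>R w) v - p' (z + a *\<^sub>R v + 0 *\<^sub>R w) v =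
      (h - 0) * pv (z + a *\<^sub>R v + b *\<^sub>R w) w"
    using h a by (intro MVT2[of 0 h "\<lambda>b. p' (z + a *\<^sub>R v + b *\<^sub>R w) v"] D2) auto
  then obtain b where b: "0 < b" "b < h" and e2: "p' (z + a *\<^sub>R v + h *\<^sub>R w) v - p' (z + a *\<^sub>R v + 0 *\<^sub>R w) v =
      h * pv (z + a *\<^sub>R v + b *\<^sub>R w) w" by auto
  show ?thesis
    using e1 e2 dz[of a b] a b by (intro exI[of _ "z + a *\<^sub>R v + b *\<^sub>R w"]) auto
qed

text \<open>Both mixed derivatives, taken at points close to z, are the same difference quotient;
  continuity does the rest. The hypotheses speak about the derivative in fixed directions, which is
  the information contained in \<open>Ck_on\<close>.\<close>

lemma symmetric_second_derivative_real:
  fixes p :: "'e::real_normed_vector \<Rightarrow> real"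
  assumes S: "open S" "z \<in> S"
    and p: "\<And>x. x \<in> S \<Longrightarrow> (p has_derivative p' x) (at x)"
    and pv: "\<And>x. x \<in> S \<Longrightarrow> ((\<lambda>x. p' x v) has_derivative pv x) (at x)"
    and pw: "\<And>x. x \<in> S \<Longrightarrow> ((\<lambda>x. p' x w) has_derivative pw x) (at x)"
    and cv: "continuous_on S (\<lambda>x. pv x w)" and cw: "continuous_on S (\<lambda>x. pw x v)"
  shows "pv z w = pw z v"
proof (rule ccontr)
  assume ne: "pv z w \<noteq> pw z v"
  define e where "e = \<bar>pv z w - pw z v\<bar> / 2"
  have e: "e > 0" using ne by (simp add: e_def)
  obtain R where R: "R > 0" "ball z R \<subseteq> S" using S openE by blast
  have "isCont (\<lambda>x. pv x w) z" "isCont (\<lambda>x. pw x v) z"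
    using cv cw S continuous_on_eq_continuous_at by blast+
  then obtain r1 r2 where r: "r1 > 0" "\<And>y. dist y z < r1 \<Longrightarrow> dist (pv y w) (pv z w) < e"
      "r2 > 0" "\<And>y. dist y z < r2 \<Longrightarrow> dist (pw y v) (pw z v) < e"
    using e unfolding continuous_at_eps_delta by metis
  define m where "m = min R (min r1 r2)"
  have m: "m > 0" using R r by (simp add: m_def)
  define h where "h = m / (norm v + norm w + 1)"
  have h0: "h > 0" using m by (simp add: h_def add_nonneg_pos)
  have hm: "h * (norm v + norm w) < m"
  proof -
    have "h * (norm v + norm w) < h * (norm v + norm w + 1)" using h0 by simp
    also have "\<dots> = m" unfolding h_def
      by (metis add_nonneg_pos add_nonneg_nonneg norm_ge_zero zero_less_one less_irrefl nonzero_eq_divide_eq)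
    finally show ?thesis .
  qed
  have "\<exists>y. dist y z \<le> h * (norm v + norm w) \<and>
    p (z + h *\<^sub>R v + h *\<^sub>R w) - p (z + h *\<^sub>R v) - p (z + h *\<^sub>R w) + p z = h * h * pv y w"
    by (rule second_difference[of z R p p' v pv]) (use p pv R h0 hm m_def in auto)
  then obtain y where y: "dist y z < m"
    "p (z + h *\<^sub>R v + h *\<^sub>R w) - p (z + h *\<^sub>R v) - p (z + h *\<^sub>R w) + p z = h * h * pv y w"
    using hm by force
  have "\<exists>y. dist y z \<le> h * (norm w + norm v) \<and>
    p (z + h *\<^sub>R w + h *\<^sub>R v) - p (z + h *\<^sub>R w) - p (z + h *\<^sub>R v) + p z = h * h * pw y v"
    by (rule second_difference[of z R p p' w pw]) (use p pw R h0 hm m_def in \<open>auto simp: add.commute\<close>)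
  then obtain y' where y': "dist y' z < m"
    "p (z + h *\<^sub>R w + h *\<^sub>R v) - p (z + h *\<^sub>R w) - p (z + h *\<^sub>R v) + p z = h * h * pw y' v"
    using hm by (force simp: add.commute)
  have "z + h *\<^sub>R w + h *\<^sub>R v = z + h *\<^sub>R v + h *\<^sub>R w" by simp
  then have "p (z + h *\<^sub>R w + h *\<^sub>R v) = p (z + h *\<^sub>R v + h *\<^sub>R w)" by (rule arg_cong)
  then have "h * h * pv y w = h * h * pw y' v" using y(2) y'(2) by linarith
  then have "pv y w = pw y' v" using h0 by simp
  moreover have "dist (pv y w) (pv z w) < e" "dist (pw y' v) (pw z v) < e"
    using r y y' by (auto simp: m_def)
  ultimately have "dist (pv z w) (pw z v) < e + e"
    by (metis add_strict_mono dist_commute dist_triangle_lt)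
  then show False by (simp add: e_def dist_real_def)
qed

lemma Ck_on_2D:
  assumes "Ck_on 2 f S"
  shows "x \<in> S \<Longrightarrow> (f has_derivative frechet_derivative f (at x)) (at x)"
    and "x \<in> S \<Longrightarrow> ((\<lambda>x. frechet_derivative f (at x) v) has_derivative
      frechet_derivative (\<lambda>x. frechet_derivative f (at x) v) (at x)) (at x)"
    and "continuous_on S (\<lambda>x. frechet_derivative (\<lambda>x. frechet_derivative f (at x) v) (at x) w)"
  using assms by (auto simp: numeral_2_eq_2 frechet_derivative_works)

lemma symmetric_second_derivative:
  fixes f :: "'e::real_normed_vector \<Rightarrow> 'f::euclidean_space"
  assumes f: "Ck_on 2 f S" and S: "open S" "z \<in> S"
  shows "frechet_derivative (\<lambda>x. frechet_derivative f (at x) v) (at z) w =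
         frechet_derivative (\<lambda>x. frechet_derivative f (at x) w) (at z) v"
proof (rule euclidean_eqI)
  fix b :: 'f assume "b \<in> Basis"
  note D = Ck_on_2D[OF f]
  show "frechet_derivative (\<lambda>x. frechet_derivative f (at x) v) (at z) w \<bullet> b =
        frechet_derivative (\<lambda>x. frechet_derivative f (at x) w) (at z) v \<bullet> b"
    by (rule symmetric_second_derivative_real[OF S, where p = "\<lambda>x. f x \<bullet> b" and p' = "\<lambda>x v. frechet_derivative f (at x) v \<bullet> b"
          and pv = "\<lambda>x w. frechet_derivative (\<lambda>x. frechet_derivative f (at x) v) (at x) w \<bullet> b"
          and pw = "\<lambda>x v. frechet_derivative (\<lambda>x. frechet_derivative f (at x) w) (at x) v \<bullet> b"])
      (auto intro!: has_derivative_inner_left D continuous_on_inner continuous_on_const)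
qed

lemma linear_Basis_expand:
  fixes f :: "'e::euclidean_space \<Rightarrow> 'f::real_vector"
  assumes "linear f"
  shows "f w = (\<Sum>b\<in>Basis. (w \<bullet> b) *\<^sub>R f b)"
proof -
  have "f w = f (\<Sum>b\<in>Basis. (w \<bullet> b) *\<^sub>R b)" by (simp add: euclidean_representation)
  then show ?thesis by (simp only: linear_sum[OF assms] linear_cmul[OF assms])
qed

text \<open>\<open>Ck_on\<close> controls the derivative of f on a fixed vector. Expanding the
  moving vector \<open>w y\<close> in an orthonormal basis reduces to that case.\<close>

lemma differentiable_frechet_derivative_apply:
  fixes f :: "'e::euclidean_space \<Rightarrow> 'f::real_normed_vector" and z :: "'g::real_normed_vector \<Rightarrow> 'e"
  assumes f: "Ck_on 2 f S" and S: "open S" "z x \<in> S"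
    and z: "z differentiable (at x)" and w: "w differentiable (at x)"
  shows "(\<lambda>y. frechet_derivative f (at (z y)) (w y)) differentiable (at x)"
proof -
  have "(\<lambda>y. frechet_derivative f (at y) b) differentiable (at (z x))" for b
    using Ck_on_2D(2)[OF f S(2), of b] by (auto simp: differentiable_def)
  then have "(\<lambda>y. frechet_derivative f (at (z y)) b) differentiable (at x)" for b
    using differentiable_chain_at[OF z, of "\<lambda>y. frechet_derivative f (at y) b" for b] by (simp add: o_def)
  moreover have "(\<lambda>y. w y \<bullet> b) differentiable (at x)" for b
    using w has_derivative_inner_left unfolding differentiable_def by blast
  ultimately have "(\<lambda>y. \<Sum>b\<in>Basis. (w y \<bullet> b) *\<^sub>R frechet_derivative f (at (z y)) b) differentiable (at x)"
    by (intro differentiable_sum differentiable_scaleR) auto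
  then obtain D where D: "((\<lambda>y. \<Sum>b\<in>Basis. (w y \<bullet> b) *\<^sub>R frechet_derivative f (at (z y)) b) has_derivative D) (at x)"
    by (auto simp: differentiable_def)
  have "isCont z x" using z differentiable_imp_continuous_within by blast
  then have "\<forall>\<^sub>F y in at x. z y \<in> S"
    using S by (auto simp: isCont_def dest: topological_tendstoD)
  then have ev: "\<forall>\<^sub>F y in at x. (\<Sum>b\<in>Basis. (w y \<bullet> b) *\<^sub>R frechet_derivative f (at (z y)) b) =
      frechet_derivative f (at (z y)) (w y)"
    by eventually_elim (rule linear_Basis_expand[symmetric, OF has_derivative_linear[OF Ck_on_2D(1)[OF f]]])
  have "((\<lambda>y. frechet_derivative f (at (z y)) (w y)) has_derivative D) (at x)"
    by (rule has_derivative_transform_eventually[OF D ev])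
       (use linear_Basis_expand[symmetric, OF has_derivative_linear[OF Ck_on_2D(1)[OF f S(2)]]] in auto)
  then show ?thesis by (auto simp: differentiable_def)
qed

text \<open>A product rule for a curve of linear maps known to be differentiable at each vector
  only; finite dimension again permits an expansion in a basis.\<close>

lemma has_vector_derivative_linear_apply:
  fixes F :: "real \<Rightarrow> 'e::euclidean_space \<Rightarrow> 'f::real_normed_vector"
  assumes lin: "\<And>t. linear (F t)" and F: "\<And>y. ((\<lambda>t. F t y) has_vector_derivative F' y) (at a)"
    and x: "(x has_vector_derivative x') (at a)"
  shows "((\<lambda>t. F t (x t)) has_vector_derivative F' (x a) + F a x') (at a)"
proof -
  have e: "F t y = (\<Sum>b\<in>Basis. (y \<bullet> b) *\<^sub>R F t b)" for t y
    by (rule linear_Basis_expand[OF lin])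
  have xb: "((\<lambda>t. x t \<bullet> b) has_vector_derivative x' \<bullet> b) (at a)" for b
    by (rule bounded_linear.has_vector_derivative[OF bounded_linear_inner_left x])
  have *: "((\<lambda>t. c t *\<^sub>R F t b) has_vector_derivative (c a *\<^sub>R F' b + c' *\<^sub>R F a b)) (at a)"
    if "(c has_vector_derivative c') (at a)" for c b and c' :: real
    using has_vector_derivative_scaleR[OF that[folded has_real_derivative_iff_has_vector_derivative] F[of b]] by simp
  have "((\<lambda>t. \<Sum>b\<in>Basis. (x a \<bullet> b) *\<^sub>R F t b) has_vector_derivative (\<Sum>b\<in>Basis. (x a \<bullet> b) *\<^sub>R F' b)) (at a)"
    by (intro has_vector_derivative_sum bounded_linear.has_vector_derivative[OF bounded_linear_scaleR_right F])
  \<comment> \<open>Linearity of \<open>F'\<close> is not among the hypotheses; the required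
    expansion follows from uniqueness of derivatives.\<close>
  then have F'e: "F' (x a) = (\<Sum>b\<in>Basis. (x a \<bullet> b) *\<^sub>R F' b)"
    using vector_derivative_unique_at F[of "x a"] unfolding e[of _ "x a", symmetric] by blast
  have "((\<lambda>t. \<Sum>b\<in>Basis. (x t \<bullet> b) *\<^sub>R F t b) has_vector_derivative
      (\<Sum>b\<in>Basis. (x a \<bullet> b) *\<^sub>R F' b + (x' \<bullet> b) *\<^sub>R F a b)) (at a)"
    by (intro has_vector_derivative_sum * xb)
  then show ?thesis
    unfolding e[symmetric] sum.distrib F'e e[of a x', symmetric] .
qed

section \<open>Derivatives and velocities in charts\<close>

definition top_atlas :: "('x::topological_space, 'e::topological_space) atlas \<Rightarrow> bool" where
  "top_atlas A \<longleftrightarrow> (\<forall>(U, c)\<in>A. open U \<and> open (c ` U) \<and> homeomorphism U (c ` U) c (inv_into U c)) \<and>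
     (\<Union>(U, c)\<in>A. U) = UNIV"

lemma is_manifold_top_atlas: "is_manifold M \<Longrightarrow> top_atlas (charts M)"
  unfolding is_manifold_def top_atlas_def by blast

lemma top_atlas_vec [simp]: "top_atlas vec_atlas"
proof -
  have "inv_into UNIV (\<lambda>v. v) = (\<lambda>v::'a. v)" using inv_id by (simp add: id_def)
  then show ?thesis by (auto simp: top_atlas_def vec_atlas_def homeomorphism_def)
qed

lemma chart_at_vec: "chart_at vec_atlas x = (UNIV, \<lambda>v. v)"
proof -
  have "\<exists>C. C \<in> vec_atlas \<and> x \<in> fst C" by (auto simp: vec_atlas_def)
  from someI_ex[OF this] show ?thesis unfolding chart_at_def by (simp add: vec_atlas_def)
qed

lemma coord_vec [simp]: "coord vec_atlas x = (\<lambda>v. v)"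
  by (simp add: coord_def chart_at_vec)

lemma coord_inv_vec [simp]: "coord_inv vec_atlas x = (\<lambda>v. v)"
  using inv_id by (simp add: coord_inv_def chart_at_vec id_def)

lemma charts_vec_manifold [simp]: "charts (vec_manifold s) = vec_atlas" "mscale (vec_manifold s) = s"
  by (simp_all add: vec_manifold_def)

definition dom_at where "dom_at A x = fst (chart_at A x)"

lemma top_atlasD:
  assumes "top_atlas A" "(U, c) \<in> A"
  shows "open U" "open (c ` U)" "continuous_on U c" "continuous_on (c ` U) (inv_into U c)"
    "y \<in> U \<Longrightarrow> inv_into U c (c y) = y" "z \<in> c ` U \<Longrightarrow> inv_into U c z \<in> U" "z \<in> c ` U \<Longrightarrow> c (inv_into U c z) = z"
proof -
  have *: "open U \<and> open (c ` U) \<and> homeomorphism U (c ` U) c (inv_into U c)"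
    using assms unfolding top_atlas_def by blast
  then show "open U" "open (c ` U)" by auto
  show "continuous_on U c" "continuous_on (c ` U) (inv_into U c)"
    using * by (auto simp: homeomorphism_def)
  show "inv_into U c (c y) = y" if "y \<in> U" using * that by (auto simp: homeomorphism_def)
  show "inv_into U c z \<in> U" if "z \<in> c ` U" using that by (rule inv_into_into)
  show "c (inv_into U c z) = z" if "z \<in> c ` U" using that by (rule f_inv_into_f)
qed

lemma chart_at_in:
  assumes "top_atlas A"
  shows "(dom_at A x, coord A x) \<in> A" "x \<in> dom_at A x"
proof -
  have "x \<in> (\<Union>(U, c)\<in>A. U)" using assms unfolding top_atlas_def by simp
  then have "\<exists>C. C \<in> A \<and> x \<in> fst C" by auto
  from someI_ex[OF this] have "chart_at A x \<in> A \<and> x \<in> fst (chart_at A x)"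
    unfolding chart_at_def .
  then show "(dom_at A x, coord A x) \<in> A" "x \<in> dom_at A x"
    by (auto simp: dom_at_def coord_def)
qed

lemma coord_inv_conv: "coord_inv A x = inv_into (dom_at A x) (coord A x)"
  by (simp add: coord_inv_def dom_at_def coord_def)

lemmas chart_atD = top_atlasD[OF _ chart_at_in(1), folded coord_inv_conv]

lemma coord_inv_coord [simp]: "top_atlas A \<Longrightarrow> coord_inv A x (coord A x x) = x"
  by (rule chart_atD(5)) (auto simp: chart_at_in)

lemma isCont_coord: "top_atlas A \<Longrightarrow> y \<in> dom_at A x \<Longrightarrow> isCont (coord A x) y"
  using chart_atD(1,3)[of A x] by (simp add: continuous_on_eq_continuous_at)

lemma isCont_coord_inv: "top_atlas A \<Longrightarrow> isCont (coord_inv A x) (coord A x x)"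
  using chart_atD(2,4)[of A x] chart_at_in(2)[of A x] continuous_on_eq_continuous_at by blast

text \<open>Continuity is a separate condition because it keeps the values of f inside the chart
  domain at \<open>f x\<close>; outside of it \<open>coord\<close> is arbitrary, and
  differentiability of the coordinate expression alone would say little.\<close>

definition mdiff :: "('x::t2_space, 'e::real_normed_vector) atlas \<Rightarrow>
    ('y::t2_space, 'f::real_normed_vector) atlas \<Rightarrow> ('x \<Rightarrow> 'y) \<Rightarrow> 'x \<Rightarrow> bool" where
  "mdiff A B f x \<longleftrightarrow> isCont f x \<and>
     (coord B (f x) \<circ> f \<circ> coord_inv A x) differentiable (at (coord A x x))"

lemma mdiff_has_derivative:
  "mdiff A B f x \<Longrightarrow> ((\<lambda>z. coord B (f x) (f (coord_inv A x z))) has_derivative mderiv A B f x) (at (coord A x x))"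
  unfolding mdiff_def mderiv_def by (simp add: frechet_derivative_works o_def)

lemma mderiv_eqI:
  "((\<lambda>z. coord B (f x) (f (coord_inv A x z))) has_derivative D) (at (coord A x x)) \<Longrightarrow> mderiv A B f x = D"
  unfolding mderiv_def by (simp add: o_def frechet_derivative_at[symmetric])

lemma linear_mderiv: "mdiff A B f x \<Longrightarrow> linear (mderiv A B f x)"
  using mdiff_has_derivative has_derivative_linear by blast

lemma eventually_at_of_open: "open S \<Longrightarrow> isCont f x \<Longrightarrow> f x \<in> S \<Longrightarrow> \<forall>\<^sub>F y in at x. f y \<in> S"
  by (auto simp: isCont_def dest: topological_tendstoD)

lemma isCont_at_coord:
  assumes "top_atlas A" "isCont f x"
  shows "isCont (\<lambda>z. f (coord_inv A x z)) (coord A x x)"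
  using isCont_o2[OF isCont_coord_inv[OF assms(1), of x], of f] assms by simp

lemma mdiff_compose:
  assumes A: "top_atlas A" and B: "top_atlas B"
    and f: "mdiff A B f x" and g: "mdiff B C g (f x)"
  shows "mdiff A C (\<lambda>x. g (f x)) x"
    and "mderiv A C (\<lambda>x. g (f x)) x = (\<lambda>v. mderiv B C g (f x) (mderiv A B f x v))"
proof -
  have cf: "isCont f x" and cg: "isCont g (f x)" using f g by (auto simp: mdiff_def)
  have "\<forall>\<^sub>F z in at (coord A x x). f (coord_inv A x z) \<in> dom_at B (f x)"
    by (rule eventually_at_of_open[OF chart_atD(1)[OF B B] isCont_at_coord[OF A cf]])
       (simp add: A B chart_at_in)
  then have ev: "\<forall>\<^sub>F z in at (coord A x x). coord C (g (f x)) (g (coord_inv B (f x) (coord B (f x) (f (coord_inv A x z))))) =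
      coord C (g (f x)) (g (f (coord_inv A x z)))"
    by eventually_elim (simp add: chart_atD[OF B B])
  have D: "((\<lambda>z. coord C (g (f x)) (g (coord_inv B (f x) (coord B (f x) (f (coord_inv A x z)))))) has_derivative
      (\<lambda>v. mderiv B C g (f x) (mderiv A B f x v))) (at (coord A x x))"
    by (rule has_derivative_compose[OF mdiff_has_derivative[OF f]]) (simp add: A mdiff_has_derivative[OF g])
  have *: "((\<lambda>z. coord C (g (f x)) (g (f (coord_inv A x z)))) has_derivative
      (\<lambda>v. mderiv B C g (f x) (mderiv A B f x v))) (at (coord A x x))"
    by (rule has_derivative_transform_eventually[OF D ev]) (simp_all add: A B)
  then show "mderiv A C (\<lambda>x. g (f x)) x = (\<lambda>v. mderiv B C g (f x) (mderiv A B f x v))"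
    by (rule mderiv_eqI)
  show "mdiff A C (\<lambda>x. g (f x)) x"
    unfolding mdiff_def using * isCont_o2[OF cf cg] by (auto simp: differentiable_def o_def)
qed

lemma mdiff_cong:
  assumes A: "top_atlas A" and f: "mdiff A B f x" and W: "open W" "x \<in> W" "\<And>y. y \<in> W \<Longrightarrow> f y = g y"
  shows "mdiff A B g x" and "mderiv A B g x = mderiv A B f x"
proof -
  have cf: "isCont f x" using f by (auto simp: mdiff_def)
  have "\<forall>\<^sub>F y in nhds x. f y = g y" using W eventually_nhds by blast
  then have cg: "isCont g x" using cf isCont_cong by blast
  have gx: "g x = f x" using W by simp
  have "\<forall>\<^sub>F z in at (coord A x x). coord_inv A x z \<in> W"
    by (rule eventually_at_of_open[OF W(1) isCont_coord_inv[OF A]]) (simp add: A W)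
  then have ev: "\<forall>\<^sub>F z in at (coord A x x). coord B (f x) (f (coord_inv A x z)) = coord B (f x) (g (coord_inv A x z))"
    by eventually_elim (simp add: W)
  have *: "((\<lambda>z. coord B (f x) (g (coord_inv A x z))) has_derivative mderiv A B f x) (at (coord A x x))"
    by (rule has_derivative_transform_eventually[OF mdiff_has_derivative[OF f] ev]) (simp_all add: A W)
  then show "mderiv A B g x = mderiv A B f x"
    by (intro mderiv_eqI) (simp add: gx)
  show "mdiff A B g x" unfolding mdiff_def using * cg by (auto simp: differentiable_def o_def gx)
qed

lemma mdiff_ident:
  assumes A: "top_atlas A"
  shows "mdiff A A (\<lambda>x. x) x" "mderiv A A (\<lambda>x. x) x = (\<lambda>v. v)"
proof -
  have "\<forall>\<^sub>F z in at (coord A x x). z \<in> coord A x ` dom_at A x"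
    by (rule eventually_at_of_open[where f = "\<lambda>z. z", OF chart_atD(2)[OF A A]]) (auto simp: chart_at_in A)
  then have ev: "\<forall>\<^sub>F z in at (coord A x x). z = coord A x (coord_inv A x z)"
    by eventually_elim (simp add: chart_atD[OF A A])
  have *: "((\<lambda>z. coord A x (coord_inv A x z)) has_derivative (\<lambda>v. v)) (at (coord A x x))"
    by (rule has_derivative_transform_eventually[OF has_derivative_ident ev]) (simp_all add: A)
  then show "mderiv A A (\<lambda>x. x) x = (\<lambda>v. v)" by (rule mderiv_eqI)
  show "mdiff A A (\<lambda>x. x) x" unfolding mdiff_def using * by (auto simp: differentiable_def o_def)
qed

lemma has_velocity_compose:
  assumes A: "top_atlas A" and c: "has_velocity A c t v" and f: "mdiff A B f (c t)"
  shows "has_velocity B (\<lambda>t. f (c t)) t (mderiv A B f (c t) v)"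
proof -
  have cc: "isCont c t" and dc: "((\<lambda>t'. coord A (c t) (c t')) has_derivative (\<lambda>r. r *\<^sub>R v)) (at t)"
    using c by (auto simp: has_velocity_def has_vector_derivative_def o_def)
  have cf: "isCont f (c t)" using f by (simp add: mdiff_def)
  have "\<forall>\<^sub>F r in at t. c r \<in> dom_at A (c t)"
    by (rule eventually_at_of_open[OF chart_atD(1)[OF A A] cc]) (simp add: A chart_at_in)
  then have ev: "\<forall>\<^sub>F r in at t. coord B (f (c t)) (f (coord_inv A (c t) (coord A (c t) (c r)))) = coord B (f (c t)) (f (c r))"
    by eventually_elim (simp add: chart_atD[OF A A])
  have "((\<lambda>r. coord B (f (c t)) (f (coord_inv A (c t) (coord A (c t) (c r))))) has_derivative
      (\<lambda>r. mderiv A B f (c t) (r *\<^sub>R v))) (at t)"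
    by (rule has_derivative_compose[OF dc]) (rule mdiff_has_derivative[OF f])
  then have "((\<lambda>r. coord B (f (c t)) (f (c r))) has_derivative (\<lambda>r. mderiv A B f (c t) (r *\<^sub>R v))) (at t)"
    by (rule has_derivative_transform_eventually[OF _ ev]) (simp_all add: A)
  then show ?thesis
    unfolding has_velocity_def has_vector_derivative_def
    using isCont_o2[OF cc cf] by (simp add: o_def linear_cmul[OF linear_mderiv[OF f]])
qed

lemma has_velocity_vec: "has_velocity vec_atlas c t v \<longleftrightarrow> (c has_vector_derivative v) (at t)"
  unfolding has_velocity_def using has_vector_derivative_continuous by (auto simp: o_def)

lemma has_velocity_cong:
  assumes "has_velocity A c t v" "\<forall>\<^sub>F r in nhds t. c r = d r"
  shows "has_velocity A d t v"
proof -
  have t: "c t = d t" using assms(2) eventually_nhds_x_imp_x by blast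
  have "((coord A (d t) \<circ> d) has_vector_derivative v) (at t) \<longleftrightarrow> ((coord A (d t) \<circ> c) has_vector_derivative v) (at t)"
    using assms(2) by (intro has_vector_derivative_cong_ev) (auto elim: eventually_mono simp: t)
  moreover have "isCont c t \<longleftrightarrow> isCont d t" using assms(2) by (rule isCont_cong)
  ultimately show ?thesis using assms(1) by (simp add: has_velocity_def t)
qed

lemma open_coord_image:
  assumes A: "top_atlas A" and Uc: "(U, c) \<in> A" and W: "open W" "W \<subseteq> U"
  shows "open (c ` W)"
proof -
  note D = top_atlasD[OF A Uc]
  have "c ` W = c ` U \<inter> inv_into U c -` W"
    using W(2) D(5) by (auto simp: subset_iff image_iff)
  then show ?thesis
    using continuous_open_preimage[OF D(4) D(2) W(1)] by simp
qed

lemma ksmooth_onD: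
  assumes "ksmooth_on s t f S" "x \<in> S"
  shows "(f has_derivative frechet_derivative f (at x)) (at x)"
    and "frechet_derivative f (at x) (s a v) = t a (frechet_derivative f (at x) v)"
    and "Ck_on n f S"
proof -
  have "Ck_on (Suc 0) f S" using assms(1) by (simp add: ksmooth_on_def)
  then show "(f has_derivative frechet_derivative f (at x)) (at x)"
    using assms(2) by (simp add: frechet_derivative_works)
qed (use assms in \<open>auto simp: ksmooth_on_def\<close>)

lemma smooth_map_local:
  assumes A: "top_atlas (charts M)" and B: "top_atlas (charts N)"
    and f: "smooth_map M N S f" and x: "x \<in> S"
  obtains W F where "open W" "x \<in> W" "\<And>y. y \<in> S \<Longrightarrow> y \<in> W \<Longrightarrow> F y = f y"
    "mdiff (charts M) (charts N) F x"
    "\<And>a v. mderiv (charts M) (charts N) F x (mscale M a v) = mscale N a (mderiv (charts M) (charts N) F x v)"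
proof -
  obtain W F where WF: "open W \<and> x \<in> W \<and> (\<forall>y\<in>S \<inter> W. F y = f y) \<and> continuous_on W F \<and>
     (\<forall>(U, c)\<in>charts M. \<forall>(V, d)\<in>charts N.
       ksmooth_on (mscale M) (mscale N) (d \<circ> F \<circ> inv_into U c) (c ` (W \<inter> U \<inter> F -` V)))"
    using bspec[OF f[unfolded smooth_map_def] x] by (elim exE)
  then have W: "open W" "x \<in> W" "\<And>y. y \<in> S \<inter> W \<Longrightarrow> F y = f y" "continuous_on W F"
    and sm: "\<And>U c V d. (U, c) \<in> charts M \<Longrightarrow> (V, d) \<in> charts N \<Longrightarrow>
       ksmooth_on (mscale M) (mscale N) (d \<circ> F \<circ> inv_into U c) (c ` (W \<inter> U \<inter> F -` V))"
    by fast+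
  let ?A = "charts M" and ?B = "charts N"
  have mem: "coord ?A x x \<in> coord ?A x ` (W \<inter> dom_at ?A x \<inter> F -` dom_at ?B (F x))"
    using W chart_at_in(2)[OF A, of x] chart_at_in(2)[OF B, of "F x"] by (intro imageI) simp
  note D = ksmooth_onD[OF sm[OF chart_at_in(1)[OF A, of x] chart_at_in(1)[OF B, of "F x"], folded coord_inv_conv] mem]
  have "isCont F x" using W by (simp add: continuous_on_eq_continuous_at)
  then have md: "mdiff ?A ?B F x" using D(1) by (auto simp: mdiff_def differentiable_def)
  moreover have "mderiv ?A ?B F x = frechet_derivative (coord ?B (F x) \<circ> F \<circ> coord_inv ?A x) (at (coord ?A x x))"
    by (simp add: mderiv_def)
  ultimately show thesis using that[of W F] W D(2) by simp
qed

lemma smooth_map_mdiff: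
  assumes A: "top_atlas (charts M)" and B: "top_atlas (charts N)" and f: "smooth_map M N UNIV f"
  shows "mdiff (charts M) (charts N) f x"
    and "mderiv (charts M) (charts N) f x (mscale M a v) = mscale N a (mderiv (charts M) (charts N) f x v)"
proof -
  obtain W F where W: "open W" "x \<in> W" "\<And>y. y \<in> UNIV \<Longrightarrow> y \<in> W \<Longrightarrow> F y = f y"
    "mdiff (charts M) (charts N) F x"
    "\<And>a v. mderiv (charts M) (charts N) F x (mscale M a v) = mscale N a (mderiv (charts M) (charts N) F x v)"
    using smooth_map_local[OF A B f UNIV_I] by blast
  show "mdiff (charts M) (charts N) f x"
    by (rule mdiff_cong(1)[OF A W(4,1,2)]) (simp add: W)
  show "mderiv (charts M) (charts N) f x (mscale M a v) = mscale N a (mderiv (charts M) (charts N) f x v)"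
    using mdiff_cong(2)[OF A W(4,1,2), of f] W by simp
qed

section \<open>Products of manifolds\<close>

lemma charts_prod_manifold:
  "charts (prod_manifold M N) = {(U \<times> V, map_prod c d) | U c V d. (U, c) \<in> charts M \<and> (V, d) \<in> charts N}"
  by (simp add: prod_manifold_def)

lemma inv_into_map_prod:
  assumes "inj_on c U" "inj_on d V" "a \<in> c ` U" "b \<in> d ` V"
  shows "inv_into (U \<times> V) (map_prod c d) (a, b) = (inv_into U c a, inv_into V d b)"
proof (rule inv_into_f_eq)
  show "inj_on (map_prod c d) (U \<times> V)" using assms by (auto simp: inj_on_def)
qed (use assms in \<open>auto simp: inv_into_into f_inv_into_f\<close>)

text \<open>The chart that \<open>chart_at\<close> selects on a product need not be a product of selected charts, so the
  coordinates of the factors appear explicitly.\<close>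

lemma smooth_map_prod_local:
  assumes A: "top_atlas (charts M)" and B: "top_atlas (charts N)" and C: "top_atlas (charts L)"
    and f: "smooth_map (prod_manifold M N) L S f" and xy: "(x, y) \<in> S"
  obtains W F Z H where "open W" "(x, y) \<in> W" "\<And>p. p \<in> S \<Longrightarrow> p \<in> W \<Longrightarrow> F p = f p" "continuous_on W F"
    "open Z" "(coord (charts M) x x, coord (charts N) y y) \<in> Z"
    "\<And>a b. (a, b) \<in> Z \<Longrightarrow> a \<in> coord (charts M) x ` dom_at (charts M) x \<and> b \<in> coord (charts N) y ` dom_at (charts N) y \<and>
       (coord_inv (charts M) x a, coord_inv (charts N) y b) \<in> W \<and>
       F (coord_inv (charts M) x a, coord_inv (charts N) y b) \<in> dom_at (charts L) (f (x, y))"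
    "ksmooth_on (\<lambda>a (v, w). (mscale M a v, mscale N a w)) (mscale L) H Z"
    "\<And>a b. (a, b) \<in> Z \<Longrightarrow> H (a, b) =
       coord (charts L) (f (x, y)) (F (coord_inv (charts M) x a, coord_inv (charts N) y b))"
proof -
  obtain W F where WF: "open W \<and> (x, y) \<in> W \<and> (\<forall>y\<in>S \<inter> W. F y = f y) \<and> continuous_on W F \<and>
     (\<forall>(U, c)\<in>charts (prod_manifold M N). \<forall>(V, d)\<in>charts L.
       ksmooth_on (mscale (prod_manifold M N)) (mscale L) (d \<circ> F \<circ> inv_into U c) (c ` (W \<inter> U \<inter> F -` V)))"
    using bspec[OF f[unfolded smooth_map_def] xy] by (elim exE)
  then have W: "open W" "(x, y) \<in> W" "\<And>p. p \<in> S \<inter> W \<Longrightarrow> F p = f p" "continuous_on W F"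
    and sm: "\<And>U c V d. (U, c) \<in> charts (prod_manifold M N) \<Longrightarrow> (V, d) \<in> charts L \<Longrightarrow>
       ksmooth_on (mscale (prod_manifold M N)) (mscale L) (d \<circ> F \<circ> inv_into U c) (c ` (W \<inter> U \<inter> F -` V))"
    by fast+
  define U c where U: "U = dom_at (charts M) x" and c: "c = coord (charts M) x"
  define V d where V: "V = dom_at (charts N) y" and d: "d = coord (charts N) y"
  define T e where T: "T = dom_at (charts L) (f (x, y))" and e: "e = coord (charts L) (f (x, y))"
  have Uc: "(U, c) \<in> charts M" "x \<in> U" and Vd: "(V, d) \<in> charts N" "y \<in> V" and Te: "(T, e) \<in> charts L" "f (x, y) \<in> T"
    using chart_at_in A B C by (auto simp: U c V d T e)
  note DU = top_atlasD[OF A Uc(1)] and DV = top_atlasD[OF B Vd(1)] and DT = top_atlasD[OF C Te(1)]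
  have cd: "(U \<times> V, map_prod c d) \<in> charts (prod_manifold M N)"
    using Uc Vd by (auto simp: charts_prod_manifold)
  define Z where "Z = map_prod c d ` (W \<inter> (U \<times> V) \<inter> F -` T)"
  have inj: "inj_on c U" "inj_on d V" using DU(5) DV(5) by (metis inj_onI)+
  have FT: "open (W \<inter> F -` T)" using continuous_open_preimage[OF W(4,1) DT(1)] .
  have inv_eq: "inv_into (U \<times> V) (map_prod c d) (a, b) = (inv_into U c a, inv_into V d b)"
    if "(a, b) \<in> Z" for a b
    using that by (intro inv_into_map_prod inj) (auto simp: Z_def)
  \<comment> \<open>As a preimage under a continuous map, Z is seen to be open.\<close>
  have Zeq: "Z = (c ` U \<times> d ` V) \<inter> (\<lambda>(a, b). (inv_into U c a, inv_into V d b)) -` (W \<inter> F -` T)"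
  proof
    show "Z \<subseteq> (c ` U \<times> d ` V) \<inter> (\<lambda>(a, b). (inv_into U c a, inv_into V d b)) -` (W \<inter> F -` T)"
      unfolding Z_def using DU(5) DV(5) by auto
    show "(c ` U \<times> d ` V) \<inter> (\<lambda>(a, b). (inv_into U c a, inv_into V d b)) -` (W \<inter> F -` T) \<subseteq> Z"
    proof
      fix q assume q: "q \<in> (c ` U \<times> d ` V) \<inter> (\<lambda>(a, b). (inv_into U c a, inv_into V d b)) -` (W \<inter> F -` T)"
      obtain a b where ab: "q = (a, b)" by force
      have "q = map_prod c d (inv_into U c a, inv_into V d b)" "(inv_into U c a, inv_into V d b) \<in> W \<inter> (U \<times> V) \<inter> F -` T"
        using q DU(6,7) DV(6,7) unfolding ab by auto
      then show "q \<in> Z" unfolding Z_def by blast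
    qed
  qed
  have "continuous_on (c ` U \<times> d ` V) (\<lambda>q. (inv_into U c (fst q), inv_into V d (snd q)))"
    by (intro continuous_on_Pair continuous_on_compose2[OF DU(4)] continuous_on_compose2[OF DV(4)])
       (auto intro!: continuous_intros)
  then have oZ: "open Z"
    unfolding Zeq case_prod_unfold
    by (rule continuous_open_preimage) (use FT DU(2) DV(2) in \<open>auto intro: open_Times\<close>)
  have memZ: "(c x, d y) \<in> Z" unfolding Z_def using Uc Vd Te W xy by force
  have sZ: "ksmooth_on (\<lambda>a (v, w). (mscale M a v, mscale N a w)) (mscale L) (e \<circ> F \<circ> inv_into (U \<times> V) (map_prod c d)) Z"
    using sm[OF cd Te(1)] by (simp add: Z_def prod_manifold_def)
  show thesis
  proof (rule that[of W F Z])
    show "ksmooth_on (\<lambda>a (v, w). (mscale M a v, mscale N a w)) (mscale L) (e \<circ> F \<circ> inv_into (U \<times> V) (map_prod c d)) Z"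
      by (rule sZ)
    fix a b assume ab: "(a, b) \<in> Z"
    then show "(e \<circ> F \<circ> inv_into (U \<times> V) (map_prod c d)) (a, b) =
        coord (charts L) (f (x, y)) (F (coord_inv (charts M) x a, coord_inv (charts N) y b))"
      unfolding o_apply inv_eq[OF ab] by (simp add: U c V d e coord_inv_conv)
    show "a \<in> coord (charts M) x ` dom_at (charts M) x \<and> b \<in> coord (charts N) y ` dom_at (charts N) y \<and>
       (coord_inv (charts M) x a, coord_inv (charts N) y b) \<in> W \<and>
       F (coord_inv (charts M) x a, coord_inv (charts N) y b) \<in> dom_at (charts L) (f (x, y))"
      using ab unfolding Zeq by (auto simp: U c V d T coord_inv_conv)
  qed (use W oZ memZ c d in auto)
qed

section \<open>Lie groups\<close>

lemma of_real_vec_scale: "of_real c *s x = c *\<^sub>R (x :: 'k::{real_normed_field,euclidean_space} ^ 'n)"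
  by (simp add: vec_eq_iff) (simp add: scaleR_conv_of_real)

lemma vec_linear_imp_linear:
  fixes f :: "'k::{real_normed_field,euclidean_space} ^ 'n \<Rightarrow> 'k ^ 'm"
  assumes "Vector_Spaces.linear (*s) (*s) f"
  shows "linear f"
proof -
  interpret f: Vector_Spaces.linear "(*s)" "(*s)" f by (rule assms)
  show ?thesis
    by (rule linearI) (simp_all add: f.add f.scale of_real_vec_scale[symmetric])
qed

lemma bounded_linear_vec_scale: "bounded_linear ((*s) (a :: 'k::{real_normed_field,euclidean_space}) :: 'k ^ 'n \<Rightarrow> 'k ^ 'n)"
proof -
  have "linear ((*s) a :: 'k ^ 'n \<Rightarrow> 'k ^ 'n)"
    by (rule linearI) (simp_all add: vec_eq_iff distrib_left)
  then show ?thesis by (simp add: linear_conv_bounded_linear)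
qed

lemma subspace_projection:
  fixes T :: "('a::field ^ 'n) set"
  assumes "vec.subspace T"
  obtains p where "Vector_Spaces.linear (*s) (*s) p" "\<And>x. x \<in> T \<Longrightarrow> p x = x" "\<And>x. p x \<in> T"
proof -
  obtain B where B: "B \<subseteq> T" "vec.independent B" "T \<subseteq> vec.span B"
    using vec.maximal_independent_subset by blast
  have sp: "vec.span B = T" using B assms vec.span_minimal by blast
  obtain g where g: "Vector_Spaces.linear (*s) (*s) g" "\<forall>x\<in>B. g x = x" "range g = vec.span ((\<lambda>x. x) ` B)"
    using vec.linear_independent_extend_subspace[OF B(2), of "\<lambda>x. x"] by blast
  interpret g: Vector_Spaces.linear "(*s)" "(*s)" g by (rule g(1))
  have "g x = x" if "x \<in> T" for x
    using that unfolding sp[symmetric]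
    by (induction rule: vec.span_induct_alt) (use g(2) in \<open>auto simp: g.zero g.add g.scale\<close>)
  then show thesis using that[of g] g sp by auto
qed

text \<open>Scalars act on a pair componentwise and fix 0, so a derivative that is linear over the
  ground field on pairs remains so when one component of the tangent vector is set to 0.\<close>

lemma smooth_map_prod_slice:
  assumes A: "top_atlas (charts M)" and B: "top_atlas (charts N)" and C: "top_atlas (charts L)"
    and N0: "\<And>a. mscale N a 0 = 0" and M0: "\<And>a. mscale M a 0 = 0"
    and f: "smooth_map (prod_manifold M N) L S f"
  shows "(\<And>x. (x, y) \<in> S) \<Longrightarrow> mdiff (charts M) (charts L) (\<lambda>x. f (x, y)) x"
    and "(\<And>x. (x, y) \<in> S) \<Longrightarrow> mderiv (charts M) (charts L) (\<lambda>x. f (x, y)) x (mscale M a v) =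
      mscale L a (mderiv (charts M) (charts L) (\<lambda>x. f (x, y)) x v)"
    and "(\<And>y. (x, y) \<in> S) \<Longrightarrow> mdiff (charts N) (charts L) (\<lambda>y. f (x, y)) y"
    and "(\<And>y. (x, y) \<in> S) \<Longrightarrow> mderiv (charts N) (charts L) (\<lambda>y. f (x, y)) y (mscale N a w) =
      mscale L a (mderiv (charts N) (charts L) (\<lambda>y. f (x, y)) y w)"
proof -
  let ?cx = "coord (charts M) x x" and ?cy = "coord (charts N) y y"
  {
    assume S: "\<And>x. (x, y) \<in> S"
    obtain W F Z H where W: "open W" "(x, y) \<in> W" "\<And>p. p \<in> S \<Longrightarrow> p \<in> W \<Longrightarrow> F p = f p" "continuous_on W F"
      and Z: "open Z" "(?cx, ?cy) \<in> Z"
      "\<And>a b. (a, b) \<in> Z \<Longrightarrow> a \<in> coord (charts M) x ` dom_at (charts M) x \<and> b \<in> coord (charts N) y ` dom_at (charts N) y \<and>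
         (coord_inv (charts M) x a, coord_inv (charts N) y b) \<in> W \<and>
         F (coord_inv (charts M) x a, coord_inv (charts N) y b) \<in> dom_at (charts L) (f (x, y))"
      and H: "ksmooth_on (\<lambda>a (v, w). (mscale M a v, mscale N a w)) (mscale L) H Z"
      "\<And>a b. (a, b) \<in> Z \<Longrightarrow> H (a, b) =
         coord (charts L) (f (x, y)) (F (coord_inv (charts M) x a, coord_inv (charts N) y b))"
      by (rule smooth_map_prod_local[OF A B C f S[of x]]) (rule that)
    let ?D = "frechet_derivative H (at (?cx, ?cy))"
    have c1: "isCont (\<lambda>x. (x, y)) x" by (intro continuous_intros)
    have cF: "isCont (\<lambda>x. F (x, y)) x"
      using W continuous_on_eq_continuous_at by (intro isCont_o2[OF c1]) blast
    have "\<forall>\<^sub>F x' in at x. (x', y) \<in> W" by (rule eventually_at_of_open[OF W(1) c1 W(2)])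
    then have "\<forall>\<^sub>F x' in nhds x. (x', y) \<in> W" using W(2) by (simp add: eventually_nhds_conv_at)
    then have evn: "\<forall>\<^sub>F x' in nhds x. F (x', y) = f (x', y)" by eventually_elim (simp add: W(3) S)
    have cf: "isCont (\<lambda>x. f (x, y)) x" by (rule iffD1[OF isCont_cong[OF evn] cF])
    have c2: "isCont (\<lambda>a. (a, ?cy)) ?cx" by (intro continuous_intros)
    have "\<forall>\<^sub>F a in at ?cx. (a, ?cy) \<in> Z" by (rule eventually_at_of_open[OF Z(1) c2 Z(2)])
    then have ev: "\<forall>\<^sub>F a in at ?cx. H (a, ?cy) = coord (charts L) (f (x, y)) (f (coord_inv (charts M) x a, y))"
    proof eventually_elim
      case (elim a)
      then show ?case using H(2)[OF elim] Z(3)[OF elim] W(3)[OF S] B by simp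
    qed
    have Hx: "H (?cx, ?cy) = coord (charts L) (f (x, y)) (f (coord_inv (charts M) x ?cx, y))"
      using H(2)[OF Z(2)] W(3)[OF S W(2)] A B by simp
    have "((\<lambda>a. H (a, ?cy)) has_derivative (\<lambda>v. ?D (v, 0))) (at ?cx)"
      by (rule has_derivative_compose[where f = "\<lambda>a. (a, ?cy)", OF _ ksmooth_onD(1)[OF H(1) Z(2)]])
         (auto intro!: derivative_eq_intros)
    then have *: "((\<lambda>a. coord (charts L) (f (x, y)) (f (coord_inv (charts M) x a, y))) has_derivative (\<lambda>v. ?D (v, 0))) (at ?cx)"
      by (rule has_derivative_transform_eventually[OF _ ev]) (simp_all add: Hx)
    show "mdiff (charts M) (charts L) (\<lambda>x. f (x, y)) x"
      unfolding mdiff_def using cf * by (auto simp: differentiable_def o_def)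
    show "mderiv (charts M) (charts L) (\<lambda>x. f (x, y)) x (mscale M a v) =
      mscale L a (mderiv (charts M) (charts L) (\<lambda>x. f (x, y)) x v)"
      unfolding mderiv_eqI[of "charts L" "\<lambda>x. f (x, y)", OF *]
      using ksmooth_onD(2)[OF H(1) Z(2), of a "(v, 0)"] by (simp add: N0)
  }
  {
    assume S: "\<And>y. (x, y) \<in> S"
    obtain W F Z H where W: "open W" "(x, y) \<in> W" "\<And>p. p \<in> S \<Longrightarrow> p \<in> W \<Longrightarrow> F p = f p" "continuous_on W F"
      and Z: "open Z" "(?cx, ?cy) \<in> Z"
      "\<And>a b. (a, b) \<in> Z \<Longrightarrow> a \<in> coord (charts M) x ` dom_at (charts M) x \<and> b \<in> coord (charts N) y ` dom_at (charts N) y \<and>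
         (coord_inv (charts M) x a, coord_inv (charts N) y b) \<in> W \<and>
         F (coord_inv (charts M) x a, coord_inv (charts N) y b) \<in> dom_at (charts L) (f (x, y))"
      and H: "ksmooth_on (\<lambda>a (v, w). (mscale M a v, mscale N a w)) (mscale L) H Z"
      "\<And>a b. (a, b) \<in> Z \<Longrightarrow> H (a, b) =
         coord (charts L) (f (x, y)) (F (coord_inv (charts M) x a, coord_inv (charts N) y b))"
      by (rule smooth_map_prod_local[OF A B C f S[of y]]) (rule that)
    let ?D = "frechet_derivative H (at (?cx, ?cy))"
    have c1: "isCont (\<lambda>y. (x, y)) y" by (intro continuous_intros)
    have cF: "isCont (\<lambda>y. F (x, y)) y"
      using W continuous_on_eq_continuous_at by (intro isCont_o2[OF c1]) blast
    have "\<forall>\<^sub>F y' in at y. (x, y') \<in> W" by (rule eventually_at_of_open[OF W(1) c1 W(2)])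
    then have "\<forall>\<^sub>F y' in nhds y. (x, y') \<in> W" using W(2) by (simp add: eventually_nhds_conv_at)
    then have evn: "\<forall>\<^sub>F y' in nhds y. F (x, y') = f (x, y')" by eventually_elim (simp add: W(3) S)
    have cf: "isCont (\<lambda>y. f (x, y)) y" by (rule iffD1[OF isCont_cong[OF evn] cF])
    have c2: "isCont (\<lambda>b. (?cx, b)) ?cy" by (intro continuous_intros)
    have "\<forall>\<^sub>F b in at ?cy. (?cx, b) \<in> Z" by (rule eventually_at_of_open[OF Z(1) c2 Z(2)])
    then have ev: "\<forall>\<^sub>F b in at ?cy. H (?cx, b) = coord (charts L) (f (x, y)) (f (x, coord_inv (charts N) y b))"
    proof eventually_elim
      case (elim b)
      then show ?case using H(2)[OF elim] Z(3)[OF elim] W(3)[OF S] A by simp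
    qed
    have Hx: "H (?cx, ?cy) = coord (charts L) (f (x, y)) (f (x, coord_inv (charts N) y ?cy))"
      using H(2)[OF Z(2)] W(3)[OF S W(2)] A B by simp
    have "((\<lambda>b. H (?cx, b)) has_derivative (\<lambda>v. ?D (0, v))) (at ?cy)"
      by (rule has_derivative_compose[where f = "\<lambda>b. (?cx, b)", OF _ ksmooth_onD(1)[OF H(1) Z(2)]])
         (auto intro!: derivative_eq_intros)
    then have *: "((\<lambda>b. coord (charts L) (f (x, y)) (f (x, coord_inv (charts N) y b))) has_derivative (\<lambda>v. ?D (0, v))) (at ?cy)"
      by (rule has_derivative_transform_eventually[OF _ ev]) (simp_all add: Hx)
    show "mdiff (charts N) (charts L) (\<lambda>y. f (x, y)) y"
      unfolding mdiff_def using cf * by (auto simp: differentiable_def o_def)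
    show "mderiv (charts N) (charts L) (\<lambda>y. f (x, y)) y (mscale N a w) =
      mscale L a (mderiv (charts N) (charts L) (\<lambda>y. f (x, y)) y w)"
      unfolding mderiv_eqI[of "charts L" "\<lambda>y. f (x, y)", OF *]
      using ksmooth_onD(2)[OF H(1) Z(2), of a "(0, w)"] by (simp add: M0)
  }
qed

lemma mdiff_vecI:
  assumes A: "top_atlas A" and f: "(\<lambda>z. f (coord_inv A x z)) differentiable (at (coord A x x))"
  shows "mdiff A vec_atlas f x"
proof -
  have "isCont (\<lambda>z. f (coord_inv A x z)) (coord A x x)"
    using f differentiable_imp_continuous_within by blast
  then have c: "isCont (\<lambda>y. f (coord_inv A x (coord A x y))) x"
    by (rule isCont_o2[OF isCont_coord[OF A chart_at_in(2)[OF A]]])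
  have "\<forall>\<^sub>F y in nhds x. y \<in> dom_at A x"
    using chart_atD(1)[OF A A] chart_at_in(2)[OF A] by (rule eventually_nhds_in_open)
  then have evn: "\<forall>\<^sub>F y in nhds x. f (coord_inv A x (coord A x y)) = f y"
    by eventually_elim (simp add: chart_atD[OF A A])
  have "isCont f x" by (rule iffD1[OF isCont_cong[OF evn] c])
  then show ?thesis using f by (simp add: mdiff_def o_def)
qed

lemma mderiv_vec_linear:
  assumes f: "mdiff A vec_atlas f x" and L: "bounded_linear L"
  shows "mdiff A vec_atlas (\<lambda>x. L (f x)) x" "mderiv A vec_atlas (\<lambda>x. L (f x)) x v = L (mderiv A vec_atlas f x v)"
proof -
  have *: "((\<lambda>z. L (f (coord_inv A x z))) has_derivative (\<lambda>v. L (mderiv A vec_atlas f x v))) (at (coord A x x))"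
    using bounded_linear.has_derivative[OF L mdiff_has_derivative[OF f]] by simp
  then show "mderiv A vec_atlas (\<lambda>x. L (f x)) x v = L (mderiv A vec_atlas f x v)"
    using mderiv_eqI[of vec_atlas "\<lambda>x. L (f x)" x A] by simp
  have "isCont f x" using f by (simp add: mdiff_def)
  then have "isCont (\<lambda>x. L (f x)) x" by (rule bounded_linear.isCont[OF L])
  then show "mdiff A vec_atlas (\<lambda>x. L (f x)) x"
    using * by (auto simp: mdiff_def differentiable_def o_def)
qed

lemma mderiv_vec_add:
  assumes f: "mdiff A vec_atlas f x" and g: "mdiff A vec_atlas g x"
  shows "mdiff A vec_atlas (\<lambda>x. f x + g x) x"
    "mderiv A vec_atlas (\<lambda>x. f x + g x) x v = mderiv A vec_atlas f x v + mderiv A vec_atlas g x v"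
proof -
  have *: "((\<lambda>z. f (coord_inv A x z) + g (coord_inv A x z)) has_derivative
      (\<lambda>v. mderiv A vec_atlas f x v + mderiv A vec_atlas g x v)) (at (coord A x x))"
    using has_derivative_add[OF mdiff_has_derivative[OF f] mdiff_has_derivative[OF g]] by simp
  then show "mderiv A vec_atlas (\<lambda>x. f x + g x) x v = mderiv A vec_atlas f x v + mderiv A vec_atlas g x v"
    using mderiv_eqI[of vec_atlas "\<lambda>x. f x + g x" x A] by simp
  show "mdiff A vec_atlas (\<lambda>x. f x + g x) x"
    using * f g by (auto simp: mdiff_def differentiable_def o_def)
qed

lemma mderiv_vec_const:
  "mdiff A vec_atlas (\<lambda>_. c) x" "mderiv A vec_atlas (\<lambda>_. c) x = (\<lambda>_. 0)"
  by (auto simp: mdiff_def o_def intro!: mderiv_eqI)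

lemma ex_curve:
  assumes A: "top_atlas A"
  obtains \<gamma> where "\<gamma> 0 = x" "has_velocity A \<gamma> 0 v"
proof -
  define \<gamma> where "\<gamma> t = coord_inv A x (coord A x x + t *\<^sub>R v)" for t :: real
  have g0: "\<gamma> 0 = x" using A by (simp add: \<gamma>_def)
  have c: "isCont (\<lambda>t. coord A x x + t *\<^sub>R v) 0" by (intro continuous_intros)
  have "isCont \<gamma> 0"
    unfolding \<gamma>_def by (rule isCont_o2[OF c]) (simp add: isCont_coord_inv[OF A])
  moreover have "((\<lambda>t. coord A x (\<gamma> t)) has_vector_derivative v) (at 0)"
  proof -
    have "\<forall>\<^sub>F t in at 0. coord A x x + t *\<^sub>R v \<in> coord A x ` dom_at A x"
      by (rule eventually_at_of_open[OF chart_atD(2)[OF A A] c]) (simp add: A chart_at_in)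
    then have ev: "\<forall>\<^sub>F t in at 0. coord A x x + t *\<^sub>R v = coord A x (\<gamma> t)"
      by eventually_elim (simp add: \<gamma>_def chart_atD[OF A A])
    have "((\<lambda>t. coord A x x + t *\<^sub>R v) has_derivative (\<lambda>t. t *\<^sub>R v)) (at 0)"
      by (auto intro!: derivative_eq_intros)
    then show ?thesis
      unfolding has_vector_derivative_def
      by (rule has_derivative_transform_eventually[OF _ ev]) (simp_all add: g0)
  qed
  ultimately have "has_velocity A \<gamma> 0 v" by (simp add: has_velocity_def g0 o_def)
  then show thesis using that g0 by blast
qed

section \<open>The adjoint representation and its derivative\<close>

locale lie_grp =
  fixes G :: "('k::{real_normed_field,euclidean_space}, 'd::finite, 'x::{t2_space,second_countable_topology}) lie_group"
  assumes lie: "is_lie_group G"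
begin

abbreviation \<A> where "\<A> \<equiv> charts G"
abbreviation one ("\<e>") where "\<e> \<equiv> gone G"
abbreviation mult (infixl "\<cdot>" 70) where "g \<cdot> h \<equiv> gmul G g h"

lemma atlas [simp]: "top_atlas \<A>"
  using lie is_manifold_top_atlas by (auto simp: is_lie_group_def)

lemma mscale_G [simp]: "mscale G = (*s)"
  using lie by (simp add: is_lie_group_def)

lemma grp: "Groups.group (gmul G) (gone G) (ginv G)"
  using lie by (simp add: is_lie_group_def)

lemma assoc: "g \<cdot> h \<cdot> k = g \<cdot> (h \<cdot> k)"
  using grp by (simp add: Groups.group_def semigroup_def)

lemma one_left [simp]: "\<e> \<cdot> g = g"
  by (rule group.group_left_neutral[OF grp])

lemma inv_left [simp]: "ginv G g \<cdot> g = \<e>"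
  by (rule group.left_inverse[OF grp])

lemma inv_right [simp]: "g \<cdot> ginv G g = \<e>"
  by (rule group.right_inverse[OF grp])

lemma one_right [simp]: "g \<cdot> \<e> = g"
  by (metis assoc inv_left inv_right one_left)

lemma inv_mult: "ginv G (g \<cdot> h) = ginv G h \<cdot> ginv G g"
  by (metis assoc inv_left inv_right one_left one_right)

lemma inv_one [simp]: "ginv G \<e> = \<e>"
  by (metis inv_left one_right)

lemma smooth_mult: "smooth_map (prod_manifold G G) G UNIV (\<lambda>(g, h). g \<cdot> h)"
  using lie by (simp add: is_lie_group_def)

lemma mdiff_mult:
  "mdiff \<A> \<A> (\<lambda>k. k \<cdot> h) g" "mdiff \<A> \<A> (\<lambda>k. g \<cdot> k) h"
  "mderiv \<A> \<A> (\<lambda>k. k \<cdot> h) g (a *s v) = a *s mderiv \<A> \<A> (\<lambda>k. k \<cdot> h) g v"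
  "mderiv \<A> \<A> (\<lambda>k. g \<cdot> k) h (a *s v) = a *s mderiv \<A> \<A> (\<lambda>k. g \<cdot> k) h v"
  using smooth_map_prod_slice[OF atlas atlas atlas _ _ smooth_mult, of h g]
    smooth_map_prod_slice[OF atlas atlas atlas _ _ smooth_mult, of g h] by simp_all

lemma mdiff_inv: "mdiff \<A> \<A> (ginv G) g"
  using smooth_map_mdiff(1)[OF atlas atlas, of "ginv G"] lie by (simp add: is_lie_group_def)

abbreviation conj where "conj g h \<equiv> g \<cdot> h \<cdot> ginv G g"

lemma mdiff_conj: "mdiff \<A> \<A> (conj g) h"
  and mderiv_conj: "mderiv \<A> \<A> (conj g) h =
    (\<lambda>v. mderiv \<A> \<A> (\<lambda>k. k \<cdot> ginv G g) (g \<cdot> h) (mderiv \<A> \<A> (\<lambda>k. g \<cdot> k) h v))"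
  using mdiff_compose[OF atlas atlas mdiff_mult(2) mdiff_mult(1)] by auto

lemma linear_Ad: "Vector_Spaces.linear (*s) (*s) (Ad G g)"
proof -
  have lin: "linear (Ad G g)" unfolding Ad_def by (rule linear_mderiv[OF mdiff_conj])
  have "Ad G g (a *s v) = a *s Ad G g v" for a v
    unfolding Ad_def mderiv_conj by (simp add: mdiff_mult)
  then show ?thesis
    using linear_add[OF lin] by unfold_locales auto
qed

lemma linear_Ad_real: "linear (Ad G g)"
  by (rule vec_linear_imp_linear[OF linear_Ad])

lemma bounded_linear_Ad: "bounded_linear (Ad G g)"
  using linear_Ad_real linear_conv_bounded_linear by blast

lemma Ad_mult: "Ad G (g \<cdot> h) X = Ad G g (Ad G h X)"
proof -
  have "Ad G (g \<cdot> h) = mderiv \<A> \<A> (\<lambda>k. conj g (conj h k)) \<e>"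
    by (simp add: Ad_def inv_mult assoc)
  also have "\<dots> = (\<lambda>v. mderiv \<A> \<A> (conj g) (conj h \<e>) (mderiv \<A> \<A> (conj h) \<e> v))"
    by (rule mdiff_compose(2)[OF atlas atlas mdiff_conj mdiff_conj])
  finally show ?thesis by (simp add: Ad_def)
qed

lemma Ad_one [simp]: "Ad G \<e> X = X"
  using mdiff_ident(2)[OF atlas, of \<e>] by (simp add: Ad_def)

lemma Ad_inv [simp]: "Ad G g (Ad G (ginv G g) X) = X" "Ad G (ginv G g) (Ad G g X) = X"
  by (simp_all add: Ad_mult[symmetric])

text \<open>In a chart at the unit, \<open>Ad g Y\<close> is an expression in the first derivatives of the multiplication,
  which are differentiable in \<open>g\<close>.\<close>

lemma mdiff_Ad: "mdiff \<A> vec_atlas (\<lambda>g. Ad G g Y) \<e>"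
proof (rule mdiff_vecI[OF atlas])
  define c where "c = coord \<A> \<e>"
  define ci where "ci = coord_inv \<A> \<e>"
  define o' where "o' = c \<e>"
  define U where "U = dom_at \<A> \<e>"
  note CU = chart_atD[OF atlas atlas, where x = "\<e>", folded c_def ci_def U_def]
  have eU: "\<e> \<in> U" unfolding U_def by (rule chart_at_in[OF atlas])
  have ci_o: "ci o' = \<e>" by (simp add: ci_def o'_def c_def)
  obtain W F Z H where W: "open W" "(\<e>, \<e>) \<in> W"
      "\<And>p. p \<in> UNIV \<Longrightarrow> p \<in> W \<Longrightarrow> F p = (\<lambda>(g, h). g \<cdot> h) p" "continuous_on W F"
    and Z0: "open Z" "(coord \<A> \<e> \<e>, coord \<A> \<e> \<e>) \<in> Z"
      "\<And>a b. (a, b) \<in> Z \<Longrightarrow> a \<in> coord \<A> \<e> ` dom_at \<A> \<e> \<and> b \<in> coord \<A> \<e> ` dom_at \<A> \<e> \<and>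
        (coord_inv \<A> \<e> a, coord_inv \<A> \<e> b) \<in> W \<and>
        F (coord_inv \<A> \<e> a, coord_inv \<A> \<e> b) \<in> dom_at \<A> ((\<lambda>(g, h). g \<cdot> h) (\<e>, \<e>))"
    and H0: "ksmooth_on (\<lambda>a (v, w). (mscale G a v, mscale G a w)) (mscale G) H Z"
      "\<And>a b. (a, b) \<in> Z \<Longrightarrow> H (a, b) = coord \<A> ((\<lambda>(g, h). g \<cdot> h) (\<e>, \<e>)) (F (coord_inv \<A> \<e> a, coord_inv \<A> \<e> b))"
    by (rule smooth_map_prod_local[OF atlas atlas atlas smooth_mult UNIV_I[of "(\<e>, \<e>)"]]) (rule that)
  note Z = Z0[simplified, folded c_def ci_def U_def, folded o'_def]
    and H = H0(1) H0(2)[simplified, folded c_def ci_def]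
  have Zm: "ci a \<cdot> ci b \<in> U" "H (a, b) = c (ci a \<cdot> ci b)" "a \<in> c ` U" "b \<in> c ` U" "ci (H (a, b)) = ci a \<cdot> ci b"
    if "(a, b) \<in> Z" for a b
    using Z(3)[OF that] W(3)[of "(ci a, ci b)"] H(2)[OF that] CU by auto
  define i where "i a = c (ginv G (ci a))" for a
  have i_o: "i o' = o'" unfolding i_def ci_o by (simp add: o'_def)
  have di: "i differentiable (at o')"
    using mdiff_inv[of \<e>] unfolding mdiff_def by (simp add: i_def[abs_def] c_def ci_def o'_def o_def)
  \<comment> \<open>The derivative at \<open>b = o'\<close> of \<open>H (H (a, b), i a)\<close>, the
    conjugation by \<open>ci a\<close> in coordinates. It is defined for every a and agrees with
    \<open>Ad\<close> as long as the factors and products involved stay in the chart.\<close>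
  define D where "D a = frechet_derivative H (at (a, i a)) (frechet_derivative H (at (a, o')) (0, Y), 0)" for a
  have ck: "Ck_on 2 H Z" by (rule ksmooth_onD(3)[OF H(1) Z(2)])
  have "(\<lambda>a. frechet_derivative H (at (a, o')) (0, Y)) differentiable (at o')"
    using Z by (intro differentiable_frechet_derivative_apply[OF ck]) (auto intro!: differentiable_Pair)
  then have dD: "D differentiable (at o')"
    unfolding D_def using Z di i_o
    by (intro differentiable_frechet_derivative_apply[OF ck]) (auto intro!: differentiable_Pair)
  have ci_i: "isCont i o'" using di differentiable_imp_continuous_within by blast
  have c_inv: "isCont (\<lambda>a. ginv G (ci a)) o'"
    using isCont_at_coord[where f = "ginv G" and x = "\<e>", OF atlas] mdiff_inv[of \<e>] unfolding mdiff_def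
    by (simp add: ci_def o'_def c_def)
  have c1: "isCont (\<lambda>a. (a, i a)) o'" and c2: "isCont (\<lambda>a. (a, o')) o'"
    using ci_i by (auto intro!: continuous_intros)
  have evs: "\<forall>\<^sub>F a in at o'. (a, i a) \<in> Z" "\<forall>\<^sub>F a in at o'. (a, o') \<in> Z" "\<forall>\<^sub>F a in at o'. ginv G (ci a) \<in> U"
    by (rule eventually_at_of_open[OF Z(1) c1] eventually_at_of_open[OF Z(1) c2] eventually_at_of_open[OF CU(1) c_inv],
        simp add: Z i_o eU ci_o)+
  have Ad_D: "Ad G (ci a) Y = D a" if a: "(a, i a) \<in> Z" "(a, o') \<in> Z" "ginv G (ci a) \<in> U" for a
  proof -
    have ca: "c (ci a) = a" using Zm(3)[OF a(1)] CU(7) by auto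
    have Hao: "H (a, o') = a" using Zm(2)[OF a(2)] ci_o ca by simp
    have dH: "((\<lambda>b. H (a, b)) has_derivative (\<lambda>v. frechet_derivative H (at (a, o')) (0, v))) (at o')"
      by (rule has_derivative_compose[where f = "\<lambda>b. (a, b)", OF _ ksmooth_onD(1)[OF H(1) a(2)]])
         (auto intro!: derivative_eq_intros)
    have dH2: "((\<lambda>b. (H (a, b), i a)) has_derivative (\<lambda>v. (frechet_derivative H (at (a, o')) (0, v), 0))) (at o')"
      by (intro has_derivative_Pair dH has_derivative_const)
    have 1: "((\<lambda>b. H (H (a, b), i a)) has_derivative
        (\<lambda>v. frechet_derivative H (at (a, i a)) (frechet_derivative H (at (a, o')) (0, v), 0))) (at o')"
      by (rule has_derivative_compose[OF dH2]) (simp add: Hao ksmooth_onD(1)[OF H(1) a(1)])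
    have c3: "isCont (\<lambda>b. (H (a, b), i a)) o'" using dH2 has_derivative_continuous by blast
    have c4: "isCont (\<lambda>b. (a, b)) o'" by (intro continuous_intros)
    have evZ: "\<forall>\<^sub>F b in at o'. (H (a, b), i a) \<in> Z" "\<forall>\<^sub>F b in at o'. (a, b) \<in> Z"
      by (rule eventually_at_of_open[OF Z(1) c3] eventually_at_of_open[OF Z(1) c4], simp add: a Hao)+
    have val: "H (H (a, b), i a) = c (conj (ci a) (ci b))"
      if "(H (a, b), i a) \<in> Z" "(a, b) \<in> Z" for b
      using Zm(2)[OF that(1)] Zm(5)[OF that(2)] CU(5)[OF a(3)] by (simp add: i_def)
    have ev: "\<forall>\<^sub>F b in at o'. H (H (a, b), i a) = c (conj (ci a) (ci b))"
      using evZ by eventually_elim (rule val)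
    have "((\<lambda>b. c (conj (ci a) (ci b))) has_derivative
        (\<lambda>v. frechet_derivative H (at (a, i a)) (frechet_derivative H (at (a, o')) (0, v), 0))) (at o')"
      by (rule has_derivative_transform_eventually[OF 1 ev]) (use val[of o'] a Hao in auto)
    then have "Ad G (ci a) = (\<lambda>v. frechet_derivative H (at (a, i a)) (frechet_derivative H (at (a, o')) (0, v), 0))"
      unfolding Ad_def by (intro mderiv_eqI) (simp add: c_def ci_def o'_def)
    then show ?thesis by (simp add: D_def)
  qed
  have ev: "\<forall>\<^sub>F a in at o'. D a = Ad G (ci a) Y"
    using evs by eventually_elim (simp add: Ad_D)
  obtain D' where "(D has_derivative D') (at o')" using dD by (auto simp: differentiable_def)
  then have "((\<lambda>a. Ad G (ci a) Y) has_derivative D') (at o')"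
    by (rule has_derivative_transform_eventually[OF _ ev]) (use Ad_D[of o'] Z i_o ci_o eU in auto)
  then show "(\<lambda>z. Ad G (coord_inv \<A> \<e> z) Y) differentiable (at (coord \<A> \<e> \<e>))"
    by (auto simp: differentiable_def ci_def o'_def c_def)
qed

lemma has_velocity_Ad:
  assumes "g 0 = \<e>" "has_velocity \<A> g 0 X"
  shows "((\<lambda>t. Ad G (g t) Y) has_vector_derivative br G X Y) (at 0)"
  using has_velocity_compose[OF atlas assms(2), of vec_atlas "\<lambda>g. Ad G g Y"] mdiff_Ad assms(1)
  by (simp add: has_velocity_vec br_def)

lemma br_linear: "Vector_Spaces.linear (*s) (*s) (br G X)"
proof -
  interpret Ad: Vector_Spaces.linear "(*s)" "(*s)" "Ad G g" for g by (rule linear_Ad)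
  show ?thesis
    by unfold_locales
      (simp_all add: br_def Ad.add Ad.scale mderiv_vec_add[OF mdiff_Ad mdiff_Ad]
        mderiv_vec_linear[OF mdiff_Ad bounded_linear_vec_scale])
qed

lemma br_linear_left: "linear (\<lambda>X. br G X Y)"
  unfolding br_def by (rule linear_mderiv[OF mdiff_Ad])

lemma Ad_br: "Ad G g (br G X Y) = br G (Ad G g X) (Ad G g Y)"
proof -
  have e: "conj g \<e> = \<e>" by simp
  have "br G (Ad G g X) (Ad G g Y) = mderiv \<A> vec_atlas (\<lambda>k. Ad G (conj g k) (Ad G g Y)) \<e> X"
    unfolding br_def Ad_def[of G g]
    using mdiff_compose(2)[OF atlas atlas mdiff_conj[of g \<e>], of vec_atlas "\<lambda>h. Ad G h (mderiv \<A> \<A> (conj g) \<e> Y)"]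
      mdiff_Ad by (simp add: e)
  also have "\<dots> = mderiv \<A> vec_atlas (\<lambda>k. Ad G g (Ad G k Y)) \<e> X"
    by (simp add: Ad_mult)
  also have "\<dots> = Ad G g (br G X Y)"
    unfolding br_def by (rule mderiv_vec_linear(2)[OF mdiff_Ad bounded_linear_Ad])
  finally show ?thesis ..
qed

text \<open>The derivative of \<open>Ad_br\<close> along a curve through the unit with velocity
  X.\<close>

lemma br_leibniz: "br G X (br G Y Z) = br G (br G X Y) Z + br G Y (br G X Z)"
proof -
  obtain \<gamma> where g: "\<gamma> 0 = \<e>" "has_velocity \<A> \<gamma> 0 X" using ex_curve[OF atlas] by blast
  note d = has_velocity_Ad[OF g]
  have "((\<lambda>t. br G (Ad G (\<gamma> t) Y) (Ad G (\<gamma> t) Z)) has_vector_derivative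
      br G (br G X Y) (Ad G (\<gamma> 0) Z) + br G (Ad G (\<gamma> 0) Y) (br G X Z)) (at 0)"
  proof (rule has_vector_derivative_linear_apply[where F = "\<lambda>t. br G (Ad G (\<gamma> t) Y)" and F' = "br G (br G X Y)" and x = "\<lambda>t. Ad G (\<gamma> t) Z"])
    show "linear (br G (Ad G (\<gamma> t) Y))" for t by (rule vec_linear_imp_linear[OF br_linear])
    show "((\<lambda>t. br G (Ad G (\<gamma> t) Y) y) has_vector_derivative br G (br G X Y) y) (at 0)" for y
      using br_linear_left[of y] d[of Y]
      by (intro bounded_linear.has_vector_derivative[of "\<lambda>X. br G X y"]) (auto simp: linear_conv_bounded_linear)
  qed (rule d)
  then have "((\<lambda>t. Ad G (\<gamma> t) (br G Y Z)) has_vector_derivative br G (br G X Y) Z + br G Y (br G X Z)) (at 0)"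
    by (simp add: Ad_br g(1))
  then show ?thesis using d[of "br G Y Z"] vector_derivative_unique_at by blast
qed

lemma leibniz_bracketI: "semisimple G \<Longrightarrow> leibniz_bracket G"
  by (rule leibniz_bracket.intro[OF br_linear linear_add[OF br_linear_left] br_leibniz])

section \<open>Embedded subgroups\<close>

lemma subgroup_chart:
  assumes H: "lie_subgroup G H \<hh>"
  obtains U c T where "open U" "\<e> \<in> U" "open (c ` U)" "inj_on c U" "c \<e> = (0 :: ('k, 'd) vec)" "vec.subspace T"
    "c ` (H \<inter> U) = c ` U \<inter> T" "\<hh> = {X. mderiv \<A> vec_atlas c \<e> X \<in> T}"
    "mdiff \<A> vec_atlas c \<e>" "mdiff vec_atlas \<A> (inv_into U c) 0"
    "\<And>X. mderiv vec_atlas \<A> (inv_into U c) 0 (mderiv \<A> vec_atlas c \<e> X) = X"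
proof -
  obtain U and c :: "'x \<Rightarrow> ('k, 'd) vec" and T where U: "open U" "\<e> \<in> U" "open (c ` U)" "inj_on c U"
    "smooth_map G (vec_manifold (*s)) U c" "smooth_map (vec_manifold (*s)) G (c ` U) (inv_into U c)"
    "c \<e> = 0" "vec.subspace T" "c ` (H \<inter> U) = c ` U \<inter> T" "\<hh> = {X. mderiv \<A> vec_atlas c \<e> X \<in> T}"
    using H unfolding lie_subgroup_def by (elim conjE exE) (rule that)
  have va: "top_atlas (charts (vec_manifold ((*s) :: 'k \<Rightarrow> ('k, 'd) vec \<Rightarrow> ('k, 'd) vec)))" by simp
  obtain W F where W: "open W" "\<e> \<in> W" "\<And>y. y \<in> U \<Longrightarrow> y \<in> W \<Longrightarrow> F y = c y" "mdiff \<A> vec_atlas F \<e>"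
    using smooth_map_local[OF atlas va U(5,2)] by (metis charts_vec_manifold(1))
  have c: "mdiff \<A> vec_atlas c \<e>"
    by (rule mdiff_cong(1)[OF atlas W(4), of "U \<inter> W"]) (use U W in auto)
  have z: "0 \<in> c ` U" using U(2,7) by (metis imageI)
  obtain W' F' where W': "open W'" "0 \<in> W'" "\<And>y. y \<in> c ` U \<Longrightarrow> y \<in> W' \<Longrightarrow> F' y = inv_into U c y" "mdiff vec_atlas \<A> F' 0"
    using smooth_map_local[OF va atlas U(6) z] by (metis charts_vec_manifold(1))
  have i: "mdiff vec_atlas \<A> (inv_into U c) 0"
    by (rule mdiff_cong(1)[OF top_atlas_vec W'(4), of "c ` U \<inter> W'"]) (use U z W' in auto)
  have ie: "inv_into U c 0 = \<e>" using U by (metis inv_into_f_f)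
  have comp: "mdiff \<A> \<A> (\<lambda>x. inv_into U c (c x)) \<e>"
    "mderiv \<A> \<A> (\<lambda>x. inv_into U c (c x)) \<e> = (\<lambda>v. mderiv vec_atlas \<A> (inv_into U c) 0 (mderiv \<A> vec_atlas c \<e> v))"
    using mdiff_compose[OF atlas top_atlas_vec c, of \<A> "inv_into U c"] i U(7) by auto
  have "mderiv \<A> \<A> (\<lambda>x. x) \<e> = mderiv \<A> \<A> (\<lambda>x. inv_into U c (c x)) \<e>"
    by (rule mdiff_cong(2)[OF atlas comp(1) U(1,2)]) (use U in auto)
  then have "mderiv vec_atlas \<A> (inv_into U c) 0 (mderiv \<A> vec_atlas c \<e> X) = X" for X
    using comp(2) mdiff_ident(2)[OF atlas, of \<e>] by metis
  then show thesis using that[of U c T] U c i by blast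
qed

lemma subgroup_curve:
  assumes H: "lie_subgroup G H \<hh>" and X: "X \<in> \<hh>"
  obtains \<gamma> where "\<And>t. \<gamma> t \<in> H" "\<gamma> 0 = \<e>" "has_velocity \<A> \<gamma> 0 X"
proof -
  obtain U c T where U: "open U" "\<e> \<in> U" "open (c ` U)" "inj_on c U" "c \<e> = (0 :: ('k, 'd) vec)" "vec.subspace T"
    "c ` (H \<inter> U) = c ` U \<inter> T" "\<hh> = {X. mderiv \<A> vec_atlas c \<e> X \<in> T}"
    "mdiff \<A> vec_atlas c \<e>" "mdiff vec_atlas \<A> (inv_into U c) 0"
    "\<And>X. mderiv vec_atlas \<A> (inv_into U c) 0 (mderiv \<A> vec_atlas c \<e> X) = X"
    by (rule subgroup_chart[OF H]) (rule that)
  define Y where "Y = mderiv \<A> vec_atlas c \<e> X"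
  have Y: "Y \<in> T" using X U(8) by (simp add: Y_def)
  \<comment> \<open>Outside the chart the curve jumps to the unit, so that it stays in H for all t;
    its velocity at 0 only depends on small t.\<close>
  define \<gamma> where "\<gamma> t = (if t *\<^sub>R Y \<in> c ` U then inv_into U c (t *\<^sub>R Y) else \<e>)" for t :: real
  have z: "0 \<in> c ` U" using U(2,5) by (metis imageI)
  have eH: "\<e> \<in> H" using H by (simp add: lie_subgroup_def)
  have "\<gamma> t \<in> H" for t
  proof (cases "t *\<^sub>R Y \<in> c ` U")
    case True
    have "t *\<^sub>R Y \<in> T" using Y vec.subspace_scale[OF U(6) Y, of "of_real t"] by (simp add: of_real_vec_scale)
    then obtain h where "h \<in> H \<inter> U" "t *\<^sub>R Y = c h" using True U(7) by blast
    then show ?thesis using True U(4) by (simp add: \<gamma>_def)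
  qed (simp add: \<gamma>_def eH)
  moreover have g0: "\<gamma> 0 = \<e>" using z U by (simp add: \<gamma>_def) (metis inv_into_f_f)
  moreover have "has_velocity \<A> \<gamma> 0 X"
  proof (rule has_velocity_cong)
    have "has_velocity vec_atlas (\<lambda>t. t *\<^sub>R Y) 0 Y"
      unfolding has_velocity_vec has_vector_derivative_def by (auto intro!: derivative_eq_intros)
    from has_velocity_compose[OF top_atlas_vec this, of \<A> "inv_into U c"]
    show "has_velocity \<A> (\<lambda>t. inv_into U c (t *\<^sub>R Y)) 0 X" using U(10,11) by (simp add: Y_def)
    have "isCont (\<lambda>t. t *\<^sub>R Y) 0" by (intro continuous_intros)
    then have "\<forall>\<^sub>F t in at 0. t *\<^sub>R Y \<in> c ` U"
      by (rule eventually_at_of_open[OF U(3)]) (use z in simp)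
    then have "\<forall>\<^sub>F t in nhds 0. t *\<^sub>R Y \<in> c ` U" using z by (simp add: eventually_nhds_conv_at)
    then show "\<forall>\<^sub>F t in nhds 0. inv_into U c (t *\<^sub>R Y) = \<gamma> t"
      by eventually_elim (simp add: \<gamma>_def)
  qed
  ultimately show thesis using that by blast
qed

text \<open>In the slice chart the curve runs inside T. A linear projection onto T fixes the curve
  near 0, hence also its derivative.\<close>

lemma subgroup_velocity:
  assumes H: "lie_subgroup G H \<hh>" and g: "\<And>t. \<gamma> t \<in> H" "\<gamma> 0 = \<e>" "has_velocity \<A> \<gamma> 0 X"
  shows "X \<in> \<hh>"
proof -
  obtain U c T where U: "open U" "\<e> \<in> U" "open (c ` U)" "inj_on c U" "c \<e> = (0 :: ('k, 'd) vec)" "vec.subspace T"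
    "c ` (H \<inter> U) = c ` U \<inter> T" "\<hh> = {X. mderiv \<A> vec_atlas c \<e> X \<in> T}"
    "mdiff \<A> vec_atlas c \<e>" "mdiff vec_atlas \<A> (inv_into U c) 0"
    "\<And>X. mderiv vec_atlas \<A> (inv_into U c) 0 (mderiv \<A> vec_atlas c \<e> X) = X"
    by (rule subgroup_chart[OF H]) (rule that)
  define Y where "Y = mderiv \<A> vec_atlas c \<e> X"
  have d: "((\<lambda>t. c (\<gamma> t)) has_vector_derivative Y) (at 0)"
    using has_velocity_compose[OF atlas g(3), of vec_atlas c] U(9) g(2) by (simp add: has_velocity_vec Y_def)
  obtain p where p: "Vector_Spaces.linear (*s) (*s) p" "\<And>x. x \<in> T \<Longrightarrow> p x = x" "\<And>x. p x \<in> T"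
    using subspace_projection[OF U(6)] by blast
  have bl: "bounded_linear p" using vec_linear_imp_linear[OF p(1)] by (simp add: linear_conv_bounded_linear)
  have "isCont \<gamma> 0" using g(3) by (simp add: has_velocity_def)
  then have "\<forall>\<^sub>F t in at 0. \<gamma> t \<in> U" by (rule eventually_at_of_open[OF U(1)]) (simp add: g U)
  then have ev: "\<forall>\<^sub>F t in at 0. c (\<gamma> t) = p (c (\<gamma> t))"
  proof eventually_elim
    case (elim t)
    then have "c (\<gamma> t) \<in> T" using g(1) U(7) by blast
    then show ?case using p(2) by simp
  qed
  have "c (\<gamma> 0) \<in> T" using vec.subspace_0[OF U(6)] by (simp add: g U)
  then have "((\<lambda>t. p (c (\<gamma> t))) has_vector_derivative Y) (at 0)"
    using d unfolding has_vector_derivative_def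
    by (intro has_derivative_transform_eventually[OF _ ev]) (auto simp: p)
  then have "p Y = Y"
    using bounded_linear.has_vector_derivative[OF bl d] vector_derivative_unique_at by blast
  then show ?thesis using U(8) p(3) Y_def by (metis mem_Collect_eq)
qed

lemma Ad_subgroup:
  assumes H: "lie_subgroup G H \<hh>" and g: "g \<in> H" and X: "X \<in> \<hh>"
  shows "Ad G g X \<in> \<hh>"
proof -
  obtain \<gamma> where c: "\<And>t. \<gamma> t \<in> H" "\<gamma> 0 = \<e>" "has_velocity \<A> \<gamma> 0 X" using subgroup_curve[OF H X] by blast
  show ?thesis
  proof (rule subgroup_velocity[OF H])
    show "conj g (\<gamma> t) \<in> H" for t using H g c(1) by (simp add: lie_subgroup_def)
    show "conj g (\<gamma> 0) = \<e>" by (simp add: c)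
    show "has_velocity \<A> (\<lambda>t. conj g (\<gamma> t)) 0 (Ad G g X)"
      using has_velocity_compose[OF atlas c(3) mdiff_conj, of g] c(2) by (simp add: Ad_def)
  qed
qed

end

section \<open>The infinitesimal representation\<close>

locale rel_setup =
  fixes G :: "('k::{real_normed_field,euclidean_space}, 'd::finite, 'x::{t2_space,second_countable_topology}) lie_group"
    and \<pp> \<qq> :: "('k ^ 'd) set" and P :: "'x set" and s :: "'k \<Rightarrow> 'v::euclidean_space \<Rightarrow> 'v"
    and \<rho> :: "'x \<Rightarrow> 'v \<Rightarrow> 'v"
  assumes rel_type: "relative_type G \<pp> \<qq> P" and tractor: "relative_tractor G \<pp> P s \<rho>"
begin

sublocale lie_grp G
  using rel_type by unfold_locales (simp add: relative_type_def)

sublocale leibniz_bracket G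
  by (rule leibniz_bracketI) (use rel_type in \<open>simp add: relative_type_def\<close>)

lemma P_subgroup: "lie_subgroup G P \<pp>"
  using rel_type by (simp add: relative_type_def)

lemma P_mult: "g \<in> P \<Longrightarrow> h \<in> P \<Longrightarrow> g \<cdot> h \<in> P"
  and P_one: "\<e> \<in> P"
  and P_inv: "g \<in> P \<Longrightarrow> ginv G g \<in> P"
  using P_subgroup by (auto simp: lie_subgroup_def)

lemma rep: "representation G P s \<rho>"
  using tractor by (simp add: relative_tractor_def)

lemma ks: "kspace s"
  using rep by (simp add: representation_def)

lemma rho_one [simp]: "\<rho> \<e> v = v"
  using rep by (simp add: representation_def)

lemma rho_mult: "g \<in> P \<Longrightarrow> h \<in> P \<Longrightarrow> \<rho> (g \<cdot> h) v = \<rho> g (\<rho> h v)"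
  using rep by (simp add: representation_def)

lemma rho_inv [simp]: "g \<in> P \<Longrightarrow> \<rho> g (\<rho> (ginv G g) v) = v" "g \<in> P \<Longrightarrow> \<rho> (ginv G g) (\<rho> g v) = v"
  by (simp_all add: rho_mult[symmetric] P_inv)

lemma rho_linear: "g \<in> P \<Longrightarrow> Vector_Spaces.linear s s (\<rho> g)"
  using rep by (simp add: representation_def)

lemma rho_add: "g \<in> P \<Longrightarrow> \<rho> g (v + w) = \<rho> g v + \<rho> g w"
  and rho_scale: "g \<in> P \<Longrightarrow> \<rho> g (s a v) = s a (\<rho> g v)"
  using Vector_Spaces.linear.axioms(3)[OF rho_linear] by (auto simp: module_hom_axioms_def module_hom_def)

lemma rho_linear_real: "g \<in> P \<Longrightarrow> linear (\<rho> g)"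
  using rho_add rho_scale[of g "of_real _"] ks by (intro linearI) (auto simp: kspace_def)

lemma rho_bounded_linear: "g \<in> P \<Longrightarrow> bounded_linear (\<rho> g)"
  using rho_linear_real by (simp add: linear_conv_bounded_linear)

text \<open>Smoothness on the subset P provides an extension to a neighbourhood of the unit, whose
  derivative D is linear over the ground field on the whole Lie algebra. Elements of p are
  velocities of curves in P, so D gives the unique value described by \<open>THE\<close> in
  \<open>inf_action\<close>.\<close>

lemma inf_action_ext:
  obtains D where "linear D" "\<And>a X. D (a *s X) = s a (D X)" "\<And>X. X \<in> \<pp> \<Longrightarrow> inf_action G P \<rho> X v = D X"
    "\<And>X \<gamma>. (\<And>t. \<gamma> t \<in> P) \<Longrightarrow> \<gamma> 0 = \<e> \<Longrightarrow> has_velocity \<A> \<gamma> 0 X \<Longrightarrow>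
      ((\<lambda>t. \<rho> (\<gamma> t) v) has_vector_derivative D X) (at 0)"
proof -
  have sm: "smooth_map G (vec_manifold s) P (\<lambda>g. \<rho> g v)"
    using rep by (simp add: representation_def)
  have va: "top_atlas (charts (vec_manifold s))" by simp
  obtain W F where W: "open W" "\<e> \<in> W" "\<And>g. g \<in> P \<Longrightarrow> g \<in> W \<Longrightarrow> F g = \<rho> g v"
    "mdiff \<A> (charts (vec_manifold s)) F \<e>"
    "\<And>a X. mderiv \<A> (charts (vec_manifold s)) F \<e> (mscale G a X) =
      mscale (vec_manifold s) a (mderiv \<A> (charts (vec_manifold s)) F \<e> X)"
    by (rule smooth_map_local[OF atlas va sm P_one]) (rule that)
  define D where "D = mderiv \<A> vec_atlas F \<e>"
  have md: "mdiff \<A> vec_atlas F \<e>" using W(4) by simp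
  have vel: "((\<lambda>t. \<rho> (\<gamma> t) v) has_vector_derivative D X) (at 0)"
    if g: "\<And>t. \<gamma> t \<in> P" "\<gamma> 0 = \<e>" "has_velocity \<A> \<gamma> 0 X" for X \<gamma>
    unfolding has_velocity_vec[symmetric]
  proof (rule has_velocity_cong)
    show "has_velocity vec_atlas (\<lambda>t. F (\<gamma> t)) 0 (D X)"
      using has_velocity_compose[OF atlas g(3), of vec_atlas F] md g(2) by (simp add: D_def)
    have "\<forall>\<^sub>F t in at 0. \<gamma> t \<in> W"
      by (rule eventually_at_of_open[OF W(1)]) (use g W in \<open>auto simp: has_velocity_def\<close>)
    then have "\<forall>\<^sub>F t in nhds 0. \<gamma> t \<in> W" using g W by (simp add: eventually_nhds_conv_at)
    then show "\<forall>\<^sub>F t in nhds 0. F (\<gamma> t) = \<rho> (\<gamma> t) v"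
      by eventually_elim (simp add: W(3) g(1))
  qed
  have eq: "inf_action G P \<rho> X v = D X" if X: "X \<in> \<pp>" for X
    unfolding inf_action_def
  proof (rule the_equality)
    show "\<forall>g. (\<forall>t. g t \<in> P) \<and> g 0 = \<e> \<and> has_velocity \<A> g 0 X \<longrightarrow>
      ((\<lambda>t. \<rho> (g t) v) has_vector_derivative D X) (at 0)" using vel by blast
    obtain \<gamma> where g: "\<And>t. \<gamma> t \<in> P" "\<gamma> 0 = \<e>" "has_velocity \<A> \<gamma> 0 X"
      using subgroup_curve[OF P_subgroup X] by blast
    fix w assume "\<forall>g. (\<forall>t. g t \<in> P) \<and> g 0 = \<e> \<and> has_velocity \<A> g 0 X \<longrightarrow>
      ((\<lambda>t. \<rho> (g t) v) has_vector_derivative w) (at 0)"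
    then have "((\<lambda>t. \<rho> (\<gamma> t) v) has_vector_derivative w) (at 0)" using g by blast
    then show "w = D X" using vel[OF g] vector_derivative_unique_at by blast
  qed
  show thesis
  proof (rule that[of D])
    show "linear D" unfolding D_def by (rule linear_mderiv[OF md])
    show "D (a *s X) = s a (D X)" for a X using W(5)[of a X] by (simp add: D_def)
  qed (use eq vel in auto)
qed

lemma inf_action_curve:
  assumes "\<And>t. \<gamma> t \<in> P" "\<gamma> 0 = \<e>" "has_velocity \<A> \<gamma> 0 X"
  shows "((\<lambda>t. \<rho> (\<gamma> t) v) has_vector_derivative inf_action G P \<rho> X v) (at 0)"
proof -
  have X: "X \<in> \<pp>" by (rule subgroup_velocity[OF P_subgroup assms])
  show ?thesis by (rule inf_action_ext[of v]) (use assms X in metis)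
qed

lemma inf_action_eqI:
  assumes "\<And>t. \<gamma> t \<in> P" "\<gamma> 0 = \<e>" "has_velocity \<A> \<gamma> 0 X" "((\<lambda>t. \<rho> (\<gamma> t) v) has_vector_derivative w) (at 0)"
  shows "inf_action G P \<rho> X v = w"
  using inf_action_curve[OF assms(1-3), of v] assms(4) vector_derivative_unique_at by blast

lemma inf_action_hom:
  assumes X: "X \<in> \<pp>" and L: "bounded_linear L" "\<And>g. g \<in> P \<Longrightarrow> \<rho> g (L v) = L (\<rho> g v)"
  shows "inf_action G P \<rho> X (L v) = L (inf_action G P \<rho> X v)"
proof -
  obtain \<gamma> where g: "\<And>t. \<gamma> t \<in> P" "\<gamma> 0 = \<e>" "has_velocity \<A> \<gamma> 0 X"
    using subgroup_curve[OF P_subgroup X] by blast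
  show ?thesis
    by (rule inf_action_eqI[OF g])
       (use bounded_linear.has_vector_derivative[OF L(1) inf_action_curve[OF g, of v]] L(2) g(1) in simp)
qed

lemma inf_action_add:
  assumes X: "X \<in> \<pp>"
  shows "inf_action G P \<rho> X (v + w) = inf_action G P \<rho> X v + inf_action G P \<rho> X w"
proof -
  obtain \<gamma> where g: "\<And>t. \<gamma> t \<in> P" "\<gamma> 0 = \<e>" "has_velocity \<A> \<gamma> 0 X"
    using subgroup_curve[OF P_subgroup X] by blast
  show ?thesis
    by (rule inf_action_eqI[OF g])
       (use has_vector_derivative_add[OF inf_action_curve[OF g, of v] inf_action_curve[OF g, of w]] g(1)
        in \<open>simp add: rho_add\<close>)
qed

lemma kspace_bounded_linear:
  assumes "kspace (t :: 'c::real_normed_field \<Rightarrow> 'v \<Rightarrow> 'v)"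
  shows "bounded_linear (t a)"
proof -
  interpret t: vector_space t using assms by (simp add: kspace_def)
  have "t a (c *\<^sub>R v) = c *\<^sub>R t a v" for c v
  proof -
    have tr: "t (of_real r) w = r *\<^sub>R w" for r w using assms by (simp add: kspace_def)
    have "t a (t (of_real c) v) = t (of_real c) (t a v)" by (simp add: mult.commute)
    then show ?thesis unfolding tr .
  qed
  then have "linear (t a)" by (intro linearI) (simp_all add: t.scale_right_distrib)
  then show ?thesis by (simp add: linear_conv_bounded_linear)
qed

lemma inf_action_linear:
  assumes X: "X \<in> \<pp>"
  shows "linear (inf_action G P \<rho> X)"
proof (rule linearI)
  show "inf_action G P \<rho> X (c *\<^sub>R v) = c *\<^sub>R inf_action G P \<rho> X v" for c v
    by (rule inf_action_hom[OF X bounded_linear_scaleR_right]) (simp add: linear_cmul[OF rho_linear_real])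
qed (rule inf_action_add[OF X])

lemma inf_action_bounded_linear: "X \<in> \<pp> \<Longrightarrow> bounded_linear (inf_action G P \<rho> X)"
  using inf_action_linear by (simp add: linear_conv_bounded_linear)

lemma inf_action_Ad:
  assumes X: "X \<in> \<pp>" and h: "h \<in> P"
  shows "inf_action G P \<rho> (Ad G h X) v = \<rho> h (inf_action G P \<rho> X (\<rho> (ginv G h) v))"
proof -
  obtain \<gamma> where g: "\<And>t. \<gamma> t \<in> P" "\<gamma> 0 = \<e>" "has_velocity \<A> \<gamma> 0 X"
    using subgroup_curve[OF P_subgroup X] by blast
  show ?thesis
  proof (rule inf_action_eqI)
    show "conj h (\<gamma> t) \<in> P" for t using g h by (intro P_mult P_inv)
    show "conj h (\<gamma> 0) = \<e>" by (simp add: g)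
    show "has_velocity \<A> (\<lambda>t. conj h (\<gamma> t)) 0 (Ad G h X)"
      using has_velocity_compose[OF atlas g(3) mdiff_conj, of h] g(2) by (simp add: Ad_def)
    show "((\<lambda>t. \<rho> (conj h (\<gamma> t)) v) has_vector_derivative \<rho> h (inf_action G P \<rho> X (\<rho> (ginv G h) v))) (at 0)"
      using bounded_linear.has_vector_derivative[OF rho_bounded_linear[OF h] inf_action_curve[OF g]] g(1) h
      by (simp add: rho_mult P_mult P_inv)
  qed
qed

text \<open>Results from differentiating the constant curve that arises when \<open>rho g\<close> is
  applied after \<open>rho\<close> of the inverse of g; the derivative of the inversion never has to
  be computed.\<close>

lemma rho_inv_curve:
  assumes g: "\<And>t. \<gamma> t \<in> P" "\<gamma> 0 = \<e>" "has_velocity \<A> \<gamma> 0 X"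
  shows "((\<lambda>t. \<rho> (ginv G (\<gamma> t)) v) has_vector_derivative - inf_action G P \<rho> X v) (at 0)"
proof -
  have g': "ginv G (\<gamma> t) \<in> P" "ginv G (\<gamma> 0) = \<e>" for t using g by (auto simp: P_inv)
  obtain X' where v': "has_velocity \<A> (\<lambda>t. ginv G (\<gamma> t)) 0 X'"
    using has_velocity_compose[OF atlas g(3) mdiff_inv] by blast
  note d = inf_action_curve[OF g'(1) g'(2) v']
  have "((\<lambda>t. \<rho> (\<gamma> t) (\<rho> (ginv G (\<gamma> t)) v)) has_vector_derivative
      inf_action G P \<rho> X (\<rho> (ginv G (\<gamma> 0)) v) + \<rho> (\<gamma> 0) (inf_action G P \<rho> X' v)) (at 0)"
    by (rule has_vector_derivative_linear_apply[where F = "\<lambda>t. \<rho> (\<gamma> t)" and F' = "inf_action G P \<rho> X"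
          and x = "\<lambda>t. \<rho> (ginv G (\<gamma> t)) v"])
       (use rho_linear_real g inf_action_curve d in auto)
  then have "((\<lambda>t. v) has_vector_derivative inf_action G P \<rho> X v + inf_action G P \<rho> X' v) (at 0)"
    using g by simp
  then have "inf_action G P \<rho> X v + inf_action G P \<rho> X' v = 0"
    using has_vector_derivative_const vector_derivative_unique_at by blast
  then have "inf_action G P \<rho> X' v = - inf_action G P \<rho> X v"
    by (simp add: eq_neg_iff_add_eq_0 add.commute)
  then show ?thesis using d[of v] by simp
qed

text \<open>The derivative of \<open>inf_action_Ad\<close> along a curve in P with velocity X. On
  one side the linear extension D is applied to \<open>Ad\<close>, on the other side the product
  rule acts on the outer and the inner factor.\<close>

lemma inf_action_br:
  assumes X: "X \<in> \<pp>" and Y: "Y \<in> \<pp>" and XY: "br G X Y \<in> \<pp>"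
  shows "inf_action G P \<rho> (br G X Y) v =
    inf_action G P \<rho> X (inf_action G P \<rho> Y v) - inf_action G P \<rho> Y (inf_action G P \<rho> X v)"
proof -
  obtain \<gamma> where g: "\<And>t. \<gamma> t \<in> P" "\<gamma> 0 = \<e>" "has_velocity \<A> \<gamma> 0 X"
    using subgroup_curve[OF P_subgroup X] by blast
  obtain D where D: "linear D" "\<And>X. X \<in> \<pp> \<Longrightarrow> inf_action G P \<rho> X v = D X"
    using inf_action_ext[of v] by metis
  have bD: "bounded_linear D" using D(1) by (simp add: linear_conv_bounded_linear)
  have AdY: "Ad G (\<gamma> t) Y \<in> \<pp>" for t by (rule Ad_subgroup[OF P_subgroup g(1) Y])
  have 1: "((\<lambda>t. D (Ad G (\<gamma> t) Y)) has_vector_derivative D (br G X Y)) (at 0)"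
    by (rule bounded_linear.has_vector_derivative[OF bD has_velocity_Ad[OF g(2,3)]])
  have w: "((\<lambda>t. inf_action G P \<rho> Y (\<rho> (ginv G (\<gamma> t)) v)) has_vector_derivative
      inf_action G P \<rho> Y (- inf_action G P \<rho> X v)) (at 0)"
    by (rule bounded_linear.has_vector_derivative[OF inf_action_bounded_linear[OF Y] rho_inv_curve[OF g]])
  have "((\<lambda>t. \<rho> (\<gamma> t) (inf_action G P \<rho> Y (\<rho> (ginv G (\<gamma> t)) v))) has_vector_derivative
      inf_action G P \<rho> X (inf_action G P \<rho> Y (\<rho> (ginv G (\<gamma> 0)) v)) +
      \<rho> (\<gamma> 0) (inf_action G P \<rho> Y (- inf_action G P \<rho> X v))) (at 0)"
    by (rule has_vector_derivative_linear_apply[where F = "\<lambda>t. \<rho> (\<gamma> t)" and F' = "inf_action G P \<rho> X"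
          and x = "\<lambda>t. inf_action G P \<rho> Y (\<rho> (ginv G (\<gamma> t)) v)"])
       (use rho_linear_real g inf_action_curve w in auto)
  then have "((\<lambda>t. D (Ad G (\<gamma> t) Y)) has_vector_derivative
      inf_action G P \<rho> X (inf_action G P \<rho> Y v) + inf_action G P \<rho> Y (- inf_action G P \<rho> X v)) (at 0)"
    using g by (simp add: D(2)[OF AdY, symmetric] inf_action_Ad[OF Y])
  then have "D (br G X Y) = inf_action G P \<rho> X (inf_action G P \<rho> Y v) + inf_action G P \<rho> Y (- inf_action G P \<rho> X v)"
    using 1 vector_derivative_unique_at by blast
  then show ?thesis using D(2)[OF XY] linear_neg[OF inf_action_linear[OF Y]] by simp
qed

sublocale rel_rep G \<pp> \<qq> P s \<rho>
proof
  show pp: "parabolic G \<pp>" and "parabolic G \<qq>" "\<qq> \<subseteq> \<pp>"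
    using rel_type by (auto simp: relative_type_def)
  show "kspace s" by (rule ks)
  interpret s: vector_space s using ks by (simp add: kspace_def)
  fix X Y v w a assume X: "X \<in> \<pp>"
  show "inf_action G P \<rho> X (v + w) = inf_action G P \<rho> X v + inf_action G P \<rho> X w"
    by (rule inf_action_add[OF X])
  show "inf_action G P \<rho> X (s a v) = s a (inf_action G P \<rho> X v)"
    by (rule inf_action_hom[OF X kspace_bounded_linear[OF ks]]) (rule rho_scale)
  have pscale: "a *s X \<in> \<pp>"
    using X parabolicD(1)[OF pp] by (auto simp: subalgebra_def vec.subspace_scale)
  obtain D where D: "linear D" "\<And>a X. D (a *s X) = s a (D X)" "\<And>X. X \<in> \<pp> \<Longrightarrow> inf_action G P \<rho> X v = D X"
    using inf_action_ext[of v] by metis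
  show "inf_action G P \<rho> (a *s X) v = s a (inf_action G P \<rho> X v)"
    using D X pscale by simp
  assume Y: "Y \<in> \<pp>"
  have padd: "X + Y \<in> \<pp>"
    using X Y parabolicD(1)[OF pp] by (auto simp: subalgebra_def vec.subspace_add)
  show "inf_action G P \<rho> (X + Y) v = inf_action G P \<rho> X v + inf_action G P \<rho> Y v"
    using D X Y padd by (simp add: linear_add)
  show "inf_action G P \<rho> (br G X Y) v =
    inf_action G P \<rho> X (inf_action G P \<rho> Y v) - inf_action G P \<rho> Y (inf_action G P \<rho> X v)"
    using X Y parabolicD(1)[OF pp] by (intro inf_action_br) (auto simp: subalgebra_def)
next
  fix X v assume X: "X \<in> nilradical G \<pp>"
  have H: "lie_subgroup G (exp_image G (nilradical G \<pp>)) (nilradical G \<pp>)"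
    and sub: "exp_image G (nilradical G \<pp>) \<subseteq> P"
    using rel_type by (auto simp: relative_type_def)
  obtain \<gamma> where g: "\<And>t. \<gamma> t \<in> exp_image G (nilradical G \<pp>)" "\<gamma> 0 = \<e>" "has_velocity \<A> \<gamma> 0 X"
    using subgroup_curve[OF H X] by blast
  show "inf_action G P \<rho> X v = 0"
  proof (rule inf_action_eqI)
    show "\<gamma> t \<in> P" for t using g(1) sub by blast
    have "\<rho> (\<gamma> t) v = v" for t using tractor g(1) by (simp add: relative_tractor_def)
    then show "((\<lambda>t. \<rho> (\<gamma> t) v) has_vector_derivative 0) (at 0)" by simp
  qed (use g in auto)
qed

section \<open>Invariance under the group P\<close>

lemma Ad_p: "g \<in> P \<Longrightarrow> X \<in> \<pp> \<Longrightarrow> Ad G g X \<in> \<pp>"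
  by (rule Ad_subgroup[OF P_subgroup])

lemma K_Ad: "K (Ad G g X) (Ad G g Y) = K X Y"
proof -
  have "K (Ad G g X) (Ad G g Y) = tr (\<lambda>Z. Ad G g \<lbrakk>X, \<lbrakk>Y, Ad G (ginv G g) Z\<rbrakk>\<rbrakk>)"
    unfolding killing_def by (simp add: Ad_br)
  also have "\<dots> = tr (\<lambda>Z. \<lbrakk>X, \<lbrakk>Y, Ad G (ginv G g) (Ad G g Z)\<rbrakk>\<rbrakk>)"
    using tr_comm[of "Ad G g" "\<lambda>Z. \<lbrakk>X, \<lbrakk>Y, Ad G (ginv G g) Z\<rbrakk>\<rbrakk>"] linear_Ad
      Vector_Spaces.linear_compose[OF linear_Ad linear_br_br] by (simp add: o_def)
  finally show ?thesis by (simp add: killing_def)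
qed

lemma Ad_nil:
  assumes g: "g \<in> P" and X: "X \<in> \<nn>"
  shows "Ad G g X \<in> \<nn>"
proof -
  have "K (Ad G g X) Y = 0" if Y: "Y \<in> \<pp>" for Y
  proof -
    have "K (Ad G g X) (Ad G g (Ad G (ginv G g) Y)) = 0"
      unfolding K_Ad using X Ad_p[OF P_inv[OF g] Y] by (rule K_nil)
    then show ?thesis by simp
  qed
  then show ?thesis by (simp add: nil_perp perp_def)
qed

lemma is_dual_bases_Ad:
  assumes g: "g \<in> P" and d: "is_dual_bases G \<pp> \<xi> \<eta>"
  shows "is_dual_bases G \<pp> (map (Ad G g) \<xi>) (map (Ad G g) \<eta>)"
proof -
  interpret Ad: Vector_Spaces.linear "(*s)" "(*s)" "Ad G g" by (rule linear_Ad)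
  have sp: "vec.span (set (map (Ad G g) as) \<union> \<nn>) = \<pp>" if as: "set as \<subseteq> \<pp>" "vec.span (set as \<union> \<nn>) = \<pp>" for as
  proof
    show "vec.span (set (map (Ad G g) as) \<union> \<nn>) \<subseteq> \<pp>"
      using as g nil_subset Ad_p by (intro vec.span_minimal p_subspace) auto
    show "\<pp> \<subseteq> vec.span (set (map (Ad G g) as) \<union> \<nn>)"
    proof
      fix X assume "X \<in> \<pp>"
      then have "Ad G (ginv G g) X \<in> vec.span (set as \<union> \<nn>)" using Ad_p P_inv g as(2) by simp
      then have "Ad G g (Ad G (ginv G g) X) \<in> vec.span (set (map (Ad G g) as) \<union> \<nn>)"
      proof (induction rule: vec.span_induct_alt)
        case (step c x y)
        have "Ad G g x \<in> set (map (Ad G g) as) \<union> \<nn>" using step(1) Ad_nil[OF g] by auto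
        then show ?case using step(2) by (simp add: Ad.add Ad.scale vec.span_add vec.span_scale vec.span_base)
      qed (simp add: Ad.zero vec.span_zero)
      then show "X \<in> vec.span (set (map (Ad G g) as) \<union> \<nn>)" by simp
    qed
  qed
  have "set \<xi> \<subseteq> \<pp>" "vec.span (set \<xi> \<union> \<nn>) = \<pp>" "set \<eta> \<subseteq> \<pp>" "vec.span (set \<eta> \<union> \<nn>) = \<pp>"
    using d by (auto simp: is_dual_bases_def)
  then have sps: "vec.span (set (map (Ad G g) \<xi>) \<union> \<nn>) = \<pp>" "vec.span (set (map (Ad G g) \<eta>) \<union> \<nn>) = \<pp>"
    using sp by blast+
  show ?thesis
    using d sps g Ad_p unfolding is_dual_bases_def by (auto simp: K_Ad)
qed

text \<open>\<open>Ad g\<close> carries dual bases to dual bases and the contraction is independent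
  of the basis. The argument works on the group, so it covers all components of P.\<close>

lemma casimir_rep_rho:
  assumes g: "g \<in> P"
  shows "\<rho> g (casimir_rep G \<pp> P \<rho> v) = casimir_rep G \<pp> P \<rho> (\<rho> g v)"
proof -
  define \<xi> \<eta> where xe: "\<xi> = fst (dual_bases G \<pp>)" "\<eta> = snd (dual_bases G \<pp>)"
  have d: "is_dual_bases G \<pp> \<xi> \<eta>" unfolding xe by (rule is_dual_dual_bases)
  have p: "\<xi> ! i \<in> \<pp>" "\<eta> ! i \<in> \<pp>" if "i < length \<xi>" for i
    using d that by (auto simp: is_dual_bases_def)
  have "null_bilinear (\<lambda>X Y. rr Y (rr X (\<rho> g v)))"
    unfolding null_bilinear_def using null_linear_r null_linear_comp_r by blast
  from B_inv_basis[OF this is_dual_bases_Ad[OF g d]]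
  have "casimir_rep G \<pp> P \<rho> (\<rho> g v) = (\<Sum>i<length \<xi>. rr (Ad G g (\<eta> ! i)) (rr (Ad G g (\<xi> ! i)) (\<rho> g v)))"
    using d by (simp add: casimir_rep_def is_dual_bases_def)
  also have "\<dots> = (\<Sum>i<length \<xi>. \<rho> g (rr (\<eta> ! i) (rr (\<xi> ! i) v)))"
    using p g by (intro sum.cong) (auto simp: inf_action_Ad)
  also have "\<dots> = \<rho> g (casimir_rep G \<pp> P \<rho> v)"
    unfolding casimir_rep_def B_inv_conv xe linear_sum[OF rho_linear_real[OF g]] ..
  finally show ?thesis ..
qed

end

section \<open>Differentiation along constant vector fields\<close>

text \<open>Differentiability of a scalar function over the ground field: real differentiability if
  that is real, complex differentiability if it is complex. The class is closed under the operations
  in Cramer's rule.\<close>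

definition kd :: "('k \<Rightarrow> 'e \<Rightarrow> 'e) \<Rightarrow> ('e::real_normed_vector \<Rightarrow> 'k::real_normed_field) \<Rightarrow> 'e \<Rightarrow> bool" where
  "kd t g y \<longleftrightarrow> (\<exists>g'. (g has_derivative g') (at y) \<and> (\<forall>a v. g' (t a v) = a * g' v))"

lemma kd_const: "kd t (\<lambda>_. c) y"
  unfolding kd_def by (intro exI[of _ "\<lambda>_. 0"]) auto

lemma kd_add: "kd t f y \<Longrightarrow> kd t g y \<Longrightarrow> kd t (\<lambda>y. f y + g y) y"
proof -
  assume "kd t f y" "kd t g y"
  then obtain f' g' where "(f has_derivative f') (at y)" "\<And>a v. f' (t a v) = a * f' v"
    "(g has_derivative g') (at y)" "\<And>a v. g' (t a v) = a * g' v" unfolding kd_def by blast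
  then show "kd t (\<lambda>y. f y + g y) y"
    unfolding kd_def by (intro exI[of _ "\<lambda>v. f' v + g' v"] conjI has_derivative_add) (auto simp: distrib_left)
qed

lemma kd_mult:
  assumes "kd t f y" "kd t g y"
  shows "kd t (\<lambda>y. f y * g y) y"
proof -
  obtain f' g' where *: "(f has_derivative f') (at y)" "\<And>a v. f' (t a v) = a * f' v"
    "(g has_derivative g') (at y)" "\<And>a v. g' (t a v) = a * g' v" using assms unfolding kd_def by blast
  show ?thesis unfolding kd_def
    using has_derivative_mult[OF *(1,3)]
    by (intro exI[of _ "\<lambda>v. f y * g' v + f' v * g y"]) (auto simp: * algebra_simps)
qed

lemma kd_if: "kd t f y \<Longrightarrow> kd t g y \<Longrightarrow> kd t (\<lambda>y. if b then f y else g y) y"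
  by (cases b) simp_all

lemma kd_sum: "(\<And>i. i \<in> A \<Longrightarrow> kd t (f i) y) \<Longrightarrow> kd t (\<lambda>y. \<Sum>i\<in>A. f i y) y"
  by (induction A rule: infinite_finite_induct) (auto intro: kd_const kd_add)

lemma kd_prod: "(\<And>i. i \<in> A \<Longrightarrow> kd t (f i) y) \<Longrightarrow> kd t (\<lambda>y. \<Prod>i\<in>A. f i y) y"
  by (induction A rule: infinite_finite_induct) (auto intro: kd_const kd_mult)

lemma kd_divide:
  assumes "kd t f y" "kd t g y" "g y \<noteq> 0"
  shows "kd t (\<lambda>y. f y / g y) y"
proof -
  obtain g' where *: "(g has_derivative g') (at y)" "\<And>a v. g' (t a v) = a * g' v" using assms unfolding kd_def by blast
  have "kd t (\<lambda>y. inverse (g y)) y"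
    unfolding kd_def using Deriv.has_derivative_inverse[OF assms(3) *(1)]
    by (intro exI[of _ "\<lambda>v. - (inverse (g y) * g' v * inverse (g y))"]) (auto simp: * algebra_simps)
  then show ?thesis using kd_mult[OF assms(1)] by (simp add: divide_inverse)
qed

lemma kd_det: "(\<And>i j. kd t (\<lambda>y. A y $ i $ j) y) \<Longrightarrow> kd t (\<lambda>y. det (A y :: 'k::real_normed_field ^ 'n ^ 'n)) y"
  unfolding det_def by (intro kd_sum kd_mult kd_const kd_prod)

locale rel_geometry = rel_setup G \<pp> \<qq> P s \<rho>
  for G :: "('k::{real_normed_field,euclidean_space}, 'd::finite, 'x::{t2_space,second_countable_topology}) lie_group"
    and \<pp> \<qq> :: "('k ^ 'd) set" and P :: "'x set" and s :: "'k \<Rightarrow> 'v::euclidean_space \<Rightarrow> 'v"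
    and \<rho> :: "'x \<Rightarrow> 'v \<Rightarrow> 'v" +
  fixes E :: "('k, 'k ^ 'd, 't::{t2_space,second_countable_topology}) manifold"
    and M :: "('k, 'e::real_normed_vector, 'm::{t2_space,second_countable_topology}) manifold"
    and \<pi> :: "'t \<Rightarrow> 'm" and act :: "'t \<Rightarrow> 'x \<Rightarrow> 't" and \<omega> :: "'t \<Rightarrow> 'k ^ 'd \<Rightarrow> 'k ^ 'd"
  assumes geom: "parabolic_geometry G (normalizer G P \<qq>) \<qq> E M \<pi> act \<omega>"
begin

abbreviation \<E> where "\<E> \<equiv> charts E"
abbreviation Q where "Q \<equiv> normalizer G P \<qq>"

lemma is_bundle: "principal_bundle G Q E M \<pi> act" and cartan: "cartan_connection G Q \<qq> E act \<omega>"
  using geom by (auto simp: parabolic_geometry_def)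

lemma manifold_E: "is_manifold E" and mscale_E [simp]: "mscale E = (*s)"
  using is_bundle by (auto simp: principal_bundle_def)

lemma atlas_E [simp]: "top_atlas \<E>"
  by (rule is_manifold_top_atlas[OF manifold_E])

lemma Q_P: "g \<in> Q \<Longrightarrow> g \<in> P"
  by (simp add: normalizer_def)

lemma act_one [simp]: "act u \<e> = u"
  using is_bundle by (simp add: principal_bundle_def)

lemma omega_linear: "Vector_Spaces.linear (*s) (*s) (\<omega> u)" and omega_bij: "bij (\<omega> u)"
  using cartan by (auto simp: cartan_connection_def)

lemma omega_inv [simp]: "\<omega> u (inv (\<omega> u) X) = X" "inv (\<omega> u) (\<omega> u v) = v"
  using omega_bij[of u] by (simp_all add: bij_is_surj surj_f_inv_f bij_is_inj)

lemma omega_add: "\<omega> u (v + w) = \<omega> u v + \<omega> u w" and omega_scale: "\<omega> u (a *s v) = a *s \<omega> u v"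
proof -
  interpret o: Vector_Spaces.linear "(*s)" "(*s)" "\<omega> u" by (rule omega_linear)
  show "\<omega> u (v + w) = \<omega> u v + \<omega> u w" "\<omega> u (a *s v) = a *s \<omega> u v" by (rule o.add o.scale)+
qed

lemma inv_omega_add: "inv (\<omega> u) (X + Y) = inv (\<omega> u) X + inv (\<omega> u) Y"
  by (metis omega_add omega_inv)

lemma inv_omega_scale: "inv (\<omega> u) (a *s X) = a *s inv (\<omega> u) X"
  by (metis omega_scale omega_inv)

text \<open>The operator \<open>D_X\<close> of the overview, for a single component of a
  form.\<close>

definition vf :: "'k ^ 'd \<Rightarrow> ('t \<Rightarrow> 'v) \<Rightarrow> 't \<Rightarrow> 'v" where
  "vf X f u = mderiv \<E> vec_atlas f u (inv (\<omega> u) X)"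

lemma fund_deriv_conv: "fund_deriv E \<omega> \<phi> u (X, i) = vf X (\<lambda>u. \<phi> u i) u"
  by (simp add: fund_deriv_def vf_def)

text \<open>Linearity of the derivative over the ground field makes \<open>vf X f\<close> linear in
  X. Without it a contraction of derivatives would depend on the dual bases in the complex
  case.\<close>

definition cdiff :: "('t \<Rightarrow> 'v) \<Rightarrow> bool" where
  "cdiff f \<longleftrightarrow> (\<forall>u. mdiff \<E> vec_atlas f u \<and>
     (\<forall>a v. mderiv \<E> vec_atlas f u (a *s v) = s a (mderiv \<E> vec_atlas f u v)))"

lemma cdiffD: "cdiff f \<Longrightarrow> mdiff \<E> vec_atlas f u"
  "cdiff f \<Longrightarrow> mderiv \<E> vec_atlas f u (a *s v) = s a (mderiv \<E> vec_atlas f u v)"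
  by (auto simp: cdiff_def)

lemma smooth_cdiff: "smooth_map E (vec_manifold s) UNIV f \<Longrightarrow> cdiff f"
  unfolding cdiff_def
  using smooth_map_mdiff[of E "vec_manifold s" f] by simp

lemma cdiff_add: "cdiff f \<Longrightarrow> cdiff g \<Longrightarrow> cdiff (\<lambda>u. f u + g u)"
  unfolding cdiff_def by (simp add: mderiv_vec_add S.scale_right_distrib)

lemma cdiff_hom: "cdiff f \<Longrightarrow> bounded_linear L \<Longrightarrow> (\<And>a v. L (s a v) = s a (L v)) \<Longrightarrow> cdiff (\<lambda>u. L (f u))"
  unfolding cdiff_def by (simp add: mderiv_vec_linear)

lemma cdiff_const: "cdiff (\<lambda>_. c)"
  unfolding cdiff_def by (simp add: mderiv_vec_const)

lemma cdiff_r: "cdiff f \<Longrightarrow> X \<in> \<pp> \<Longrightarrow> cdiff (\<lambda>u. rr X (f u))"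
  by (rule cdiff_hom[OF _ inf_action_bounded_linear]) (simp_all add: r_scale)

lemma cdiff_uminus: "cdiff f \<Longrightarrow> cdiff (\<lambda>u. - f u)"
  by (rule cdiff_hom) (simp_all add: bounded_linear_minus bounded_linear_ident)

lemma cdiff_sum: "(\<And>i. i \<in> A \<Longrightarrow> cdiff (f i)) \<Longrightarrow> cdiff (\<lambda>u. \<Sum>i\<in>A. f i u)"
  by (induction A rule: infinite_finite_induct) (auto intro: cdiff_const cdiff_add)

lemma vf_left: "cdiff f \<Longrightarrow> vf (X + Y) f u = vf X f u + vf Y f u" "cdiff f \<Longrightarrow> vf (a *s X) f u = s a (vf X f u)"
  by (simp_all add: vf_def inv_omega_add inv_omega_scale cdiffD linear_add[OF linear_mderiv])

lemma vf_add: "cdiff f \<Longrightarrow> cdiff g \<Longrightarrow> vf X (\<lambda>u. f u + g u) u = vf X f u + vf X g u"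
  by (simp add: vf_def mderiv_vec_add cdiffD)

lemma vf_hom: "cdiff f \<Longrightarrow> bounded_linear L \<Longrightarrow> vf X (\<lambda>u. L (f u)) u = L (vf X f u)"
  by (simp add: vf_def mderiv_vec_linear cdiffD)

lemma vf_r: "cdiff f \<Longrightarrow> Y \<in> \<pp> \<Longrightarrow> vf X (\<lambda>u. rr Y (f u)) u = rr Y (vf X f u)"
  by (rule vf_hom[OF _ inf_action_bounded_linear])

lemma vf_uminus: "cdiff f \<Longrightarrow> vf X (\<lambda>u. - f u) u = - vf X f u"
  by (rule vf_hom) (simp_all add: bounded_linear_minus bounded_linear_ident)

lemma vf_diff: "cdiff f \<Longrightarrow> cdiff g \<Longrightarrow> vf X (\<lambda>u. f u - g u) u = vf X f u - vf X g u"
  using vf_add[of f "\<lambda>u. - g u"] by (simp add: vf_uminus cdiff_uminus)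

lemma vf_s: "cdiff f \<Longrightarrow> vf X (\<lambda>u. s a (f u)) u = s a (vf X f u)"
  by (rule vf_hom[OF _ kspace_bounded_linear[OF ks]])

lemma vf_const [simp]: "vf X (\<lambda>_. c) u = 0"
  by (simp add: vf_def mderiv_vec_const)

lemma bounded_bilinear_s: "bounded_bilinear s"
proof -
  have sL: "s (c *\<^sub>R a) v = c *\<^sub>R s a v" for c a v
    using S.scale_scale[of "of_real c" a v] unfolding s_real scaleR_conv_of_real by (rule sym)
  have "bilinear s"
    unfolding bilinear_def
    by (auto intro!: linearI simp: S.scale_right_distrib S.scale_left_distrib s_scaleR sL)
  then show ?thesis by (simp add: bilinear_conv_bounded_bilinear)
qed

lemma transition:
  assumes "(U, c) \<in> \<E>" "(V, d) \<in> \<E>" "y \<in> c ` (U \<inter> V)"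
  shows "(d \<circ> inv_into U c has_derivative frechet_derivative (d \<circ> inv_into U c) (at y)) (at y)"
    and "frechet_derivative (d \<circ> inv_into U c) (at y) (a *s v) = a *s frechet_derivative (d \<circ> inv_into U c) (at y) v"
proof -
  have "ksmooth_on (*s) (*s) (d \<circ> inv_into U c) (c ` (U \<inter> V))"
    using manifold_E assms(1,2) unfolding is_manifold_def mscale_E by blast
  from ksmooth_onD(1,2)[OF this assms(3)] show
    "(d \<circ> inv_into U c has_derivative frechet_derivative (d \<circ> inv_into U c) (at y)) (at y)"
    "frechet_derivative (d \<circ> inv_into U c) (at y) (a *s v) = a *s frechet_derivative (d \<circ> inv_into U c) (at y) v"
    by auto
qed

lemma chart_maps:
  assumes Uc: "(U, c) \<in> \<E>" and u: "u \<in> U"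
  shows "mdiff \<E> vec_atlas c u" "mdiff vec_atlas \<E> (inv_into U c) (c u)"
    "mderiv vec_atlas \<E> (inv_into U c) (c u) (a *s v) = a *s mderiv vec_atlas \<E> (inv_into U c) (c u) v"
    "mderiv \<E> vec_atlas c u (mderiv vec_atlas \<E> (inv_into U c) (c u) v) = v"
    "mderiv vec_atlas \<E> (inv_into U c) (c u) (mderiv \<E> vec_atlas c u w) = w"
proof -
  note D = top_atlasD[OF atlas_E Uc]
  note cu = chart_at_in[OF atlas_E, of u]
  have icu: "inv_into U c (c u) = u" by (rule D(5)[OF u])
  have cont: "isCont c u" "isCont (inv_into U c) (c u)"
    using D u by (auto simp: continuous_on_eq_continuous_at)
  show c: "mdiff \<E> vec_atlas c u"
    using transition(1)[OF cu(1) Uc, of "coord \<E> u u"] cont cu(2) u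
    by (auto simp: mdiff_def differentiable_def coord_inv_conv o_def)
  have ci': "mdiff vec_atlas \<E> (inv_into U c) (c u) \<and>
    mderiv vec_atlas \<E> (inv_into U c) (c u) = frechet_derivative (coord \<E> u \<circ> inv_into U c) (at (c u))"
    using transition(1)[OF Uc cu(1), of "c u"] cont cu(2) u
    by (auto simp: mdiff_def mderiv_def differentiable_def icu o_def)
  then show ci: "mdiff vec_atlas \<E> (inv_into U c) (c u)" by blast
  show "mderiv vec_atlas \<E> (inv_into U c) (c u) (a *s v) = a *s mderiv vec_atlas \<E> (inv_into U c) (c u) v"
    using ci' transition(2)[OF Uc cu(1), of "c u"] cu(2) u by auto
  have c': "mdiff \<E> vec_atlas c (inv_into U c (c u))" and ci2: "mdiff vec_atlas \<E> (inv_into U c) (c u)"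
    using c ci by (simp_all add: icu)
  note m1 = mdiff_compose[OF top_atlas_vec atlas_E ci2 c'] and m2 = mdiff_compose[OF atlas_E top_atlas_vec c ci2]
  have "mderiv vec_atlas vec_atlas (\<lambda>x. x) (c u) = mderiv vec_atlas vec_atlas (\<lambda>y. c (inv_into U c y)) (c u)"
    by (rule mdiff_cong(2)[OF top_atlas_vec m1(1) D(2)]) (use u D(7) in auto)
  then show "mderiv \<E> vec_atlas c u (mderiv vec_atlas \<E> (inv_into U c) (c u) v) = v"
    using m1(2) mdiff_ident(2)[OF top_atlas_vec, of "c u"] by (metis icu)
  have "mderiv \<E> \<E> (\<lambda>x. x) u = mderiv \<E> \<E> (\<lambda>x. inv_into U c (c x)) u"
    by (rule mdiff_cong(2)[OF atlas_E m2(1) D(1)]) (use u D(5) in auto)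
  then show "mderiv vec_atlas \<E> (inv_into U c) (c u) (mderiv \<E> vec_atlas c u w) = w"
    using m2(2) mdiff_ident(2)[OF atlas_E, of u] by metis
qed

text \<open>By Cramer's rule the coordinates of the constant vector field of X are quotients of
  determinants in the coefficients of \<open>omega\<close>, so they inherit differentiability over
  the ground field.\<close>

lemma vf_frame:
  assumes X: "(U, c) \<in> \<E>"
  obtains \<Lambda> where "\<And>y j. y \<in> c ` U \<Longrightarrow> kd (*s) (\<lambda>y. \<Lambda> y $ j) y"
    "\<And>u. u \<in> U \<Longrightarrow> inv (\<omega> u) X = mderiv vec_atlas \<E> (inv_into U c) (c u) (\<Lambda> (c u))"
proof -
  note D = top_atlasD[OF atlas_E X(1)]
  define L where "L y v = \<omega> (inv_into U c y) (mderiv vec_atlas \<E> (inv_into U c) y v)" for y v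
  define A where "A y = matrix (L y)" for y
  define \<Lambda> where "\<Lambda> y = (\<chi> k. det (\<chi> i j. if j = k then X $ i else A y $ i $ j) / det (A y))" for y
  have ks: "ksmooth_on (*s) (*s) (\<lambda>y. L y v) (c ` U)" for v
    using cartan X unfolding cartan_connection_def L_def by blast
  have L: "Vector_Spaces.linear (*s) (*s) (L y)" "inj (L y)" if y: "y \<in> c ` U" for y
  proof -
    obtain u where u: "u \<in> U" "y = c u" using y by blast
    note cm = chart_maps[OF X u(1)]
    have icu: "inv_into U c (c u) = u" by (rule D(5)[OF u(1)])
    show "Vector_Spaces.linear (*s) (*s) (L y)"
      by unfold_locales (simp_all add: L_def u(2) icu linear_add[OF linear_mderiv[OF cm(2)]] cm(3) omega_add omega_scale)
    show "inj (L y)"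
    proof (rule injI)
      fix v w assume "L y v = L y w"
      then have "mderiv vec_atlas \<E> (inv_into U c) (c u) v = mderiv vec_atlas \<E> (inv_into U c) (c u) w"
        unfolding L_def u(2) icu using omega_inv(2) by metis
      then show "v = w" using cm(4) by metis
    qed
  qed
  have Aw: "A y *v v = L y v" if "y \<in> c ` U" for y v
    unfolding A_def by (rule matrix_works[OF L(1)[OF that]])
  have dA: "det (A y) \<noteq> 0" if "y \<in> c ` U" for y
  proof -
    have "inj ((*v) (A y))" using L(2)[OF that] Aw[OF that] by (simp add: inj_def)
    then show ?thesis
      using matrix_left_invertible_injective invertible_left_inverse invertible_det_nz by blast
  qed
  have kA: "kd (*s) (\<lambda>y. A y $ i $ j) y" if y: "y \<in> c ` U" for y i j
  proof -
    have bl: "bounded_linear (\<lambda>x :: 'k ^ 'd. x $ i)" by (rule bounded_linear_vec_nth)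
    show ?thesis
      unfolding kd_def A_def matrix_def
      using bounded_linear.has_derivative[OF bl ksmooth_onD(1)[OF ks y]] ksmooth_onD(2)[OF ks y, of "axis j 1"]
      by (intro exI[of _ "\<lambda>v. frechet_derivative (\<lambda>y. L y (axis j 1)) (at y) v $ i"]) simp
  qed
  have kL: "kd (*s) (\<lambda>y. \<Lambda> y $ j) y" if y: "y \<in> c ` U" for y j
    unfolding \<Lambda>_def vec_lambda_beta
    using kA[OF y] dA[OF y] by (intro kd_divide kd_det) (simp_all add: kd_const kd_if)
  have "inv (\<omega> u) X = mderiv vec_atlas \<E> (inv_into U c) (c u) (\<Lambda> (c u))" if u: "u \<in> U" for u
  proof -
    have y: "c u \<in> c ` U" using u by simp
    have "A (c u) *v \<Lambda> (c u) = X" using cramer[OF dA[OF y]] by (simp add: \<Lambda>_def)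
    then have "L (c u) (\<Lambda> (c u)) = X" using Aw[OF y] by simp
    then show ?thesis unfolding L_def D(5)[OF u] by (metis omega_inv(2))
  qed
  then show thesis using that kL by blast
qed

text \<open>In a chart \<open>vf X f\<close> is the sum of the partial derivatives of f times the
  coordinates of the constant field. \<open>ksmooth_on\<close> asserts linearity over the ground
  field for first derivatives only; for the second derivatives that occur here it has to be
  transported.\<close>

lemma cdiff_vf:
  assumes f: "smooth_map E (vec_manifold s) UNIV f"
  shows "cdiff (vf X f)"
proof -
  have "mdiff \<E> vec_atlas (vf X f) u0 \<and>
      (\<forall>a v. mderiv \<E> vec_atlas (vf X f) u0 (a *s v) = s a (mderiv \<E> vec_atlas (vf X f) u0 v))" for u0
  proof -
    define U where "U = dom_at \<E> u0"
    define c where "c = coord \<E> u0"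
    have Uc: "(U, c) \<in> \<E>" and uU: "u0 \<in> U" using chart_at_in[OF atlas_E] by (auto simp: U_def c_def)
    define ci where "ci = inv_into U c"
    note D = top_atlasD[OF atlas_E Uc, folded ci_def]
    obtain W F where WF: "open W \<and> u0 \<in> W \<and> (\<forall>y\<in>UNIV \<inter> W. F y = f y) \<and> continuous_on W F \<and>
      (\<forall>(U, c)\<in>\<E>. \<forall>(V, d)\<in>charts (vec_manifold s).
       ksmooth_on (mscale E) (mscale (vec_manifold s)) (d \<circ> F \<circ> inv_into U c) (c ` (W \<inter> U \<inter> F -` V)))"
      using bspec[OF f[unfolded smooth_map_def] UNIV_I, of u0] by (elim exE)
    define O' where "O' = c ` (W \<inter> U)"
    define h where "h y = F (ci y)" for y
    have W: "open W" "u0 \<in> W" "\<And>y. y \<in> W \<Longrightarrow> F y = f y" using WF by auto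
    have "(UNIV, \<lambda>v. v) \<in> charts (vec_manifold s)" by (simp add: vec_atlas_def)
    then have "ksmooth_on (mscale E) (mscale (vec_manifold s)) ((\<lambda>v. v) \<circ> F \<circ> inv_into U c) (c ` (W \<inter> U \<inter> F -` UNIV))"
      using WF Uc by blast
    then have kh: "ksmooth_on (*s) s h O'"
      by (simp add: O'_def h_def[abs_def] ci_def o_def)
    have oO: "open O'" unfolding O'_def using W D(1) by (intro open_coord_image[OF atlas_E Uc]) auto
    have O'U: "y \<in> c ` U" "ci y \<in> W" "ci y \<in> U" "c (ci y) = y" if "y \<in> O'" for y
      using that D(5-7) unfolding O'_def by auto
    have y0: "c u0 \<in> O'" using W uU by (simp add: O'_def)
    obtain \<Lambda> where \<Lambda>: "\<And>y j. y \<in> c ` U \<Longrightarrow> kd (*s) (\<lambda>y. \<Lambda> y $ j) y"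
      "\<And>u. u \<in> U \<Longrightarrow> inv (\<omega> u) X = mderiv vec_atlas \<E> (inv_into U c) (c u) (\<Lambda> (c u))"
      using vf_frame[OF Uc] by blast
    let ?Dh = "\<lambda>y. frechet_derivative h (at y)"
    note kD = ksmooth_onD[OF kh]
    have fmd: "mdiff \<E> vec_atlas f u" for u
      using smooth_cdiff[OF f] by (rule cdiffD)
    have val: "vf X f (ci y) = (\<Sum>j\<in>UNIV. s (\<Lambda> y $ j) (?Dh y (axis j 1)))" if y: "y \<in> O'" for y
    proof -
      note yU = O'U[OF y]
      have cm: "mdiff vec_atlas \<E> ci y" using chart_maps(2)[OF Uc yU(3)] by (simp add: yU(4) ci_def[symmetric])
      have "vf X f (ci y) = mderiv \<E> vec_atlas f (ci y) (mderiv vec_atlas \<E> ci y (\<Lambda> y))"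
        using \<Lambda>(2)[OF yU(3)] yU(4) by (simp add: vf_def ci_def)
      also have "\<dots> = mderiv vec_atlas vec_atlas (\<lambda>y. f (ci y)) y (\<Lambda> y)"
        using mdiff_compose(2)[OF top_atlas_vec atlas_E cm fmd] by simp
      also have "mderiv vec_atlas vec_atlas (\<lambda>y. f (ci y)) y = mderiv vec_atlas vec_atlas h y"
      proof (rule mdiff_cong(2)[OF top_atlas_vec _ oO y])
        show "mdiff vec_atlas vec_atlas h y"
          using kD(1)[OF y] has_derivative_continuous by (auto simp: mdiff_def differentiable_def o_def)
        show "h y = f (ci y)" if "y \<in> O'" for y using W(3) O'U(2)[OF that] by (simp add: h_def)
      qed
      also have "mderiv vec_atlas vec_atlas h y = ?Dh y" by (simp add: mderiv_def o_def)
      also have "?Dh y (\<Lambda> y) = ?Dh y (\<Sum>j\<in>UNIV. \<Lambda> y $ j *s axis j 1)" by (simp add: basis_expansion)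
      also have "\<dots> = (\<Sum>j\<in>UNIV. s (\<Lambda> y $ j) (?Dh y (axis j 1)))"
        by (simp add: linear_sum[OF has_derivative_linear[OF kD(1)[OF y]]] kD(2)[OF y])
      finally show ?thesis .
    qed
    let ?y = "c u0"
    have ck: "Ck_on 2 h O'" by (rule kD(3)[OF y0])
    let ?D2 = "\<lambda>j. frechet_derivative (\<lambda>y. ?Dh y (axis j 1)) (at ?y)"
    \<comment> \<open>Symmetry of second derivatives moves the scalar into the slot of the first
      derivative, which is linear over the ground field, and back.\<close>
    have D2k: "?D2 j (a *s w) = s a (?D2 j w)" for j a w
    proof -
      have "?D2 j (a *s w) = frechet_derivative (\<lambda>y. ?Dh y (a *s w)) (at ?y) (axis j 1)"
        by (rule symmetric_second_derivative[OF ck oO y0])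
      also have "frechet_derivative (\<lambda>y. ?Dh y (a *s w)) (at ?y) = (\<lambda>v. s a (frechet_derivative (\<lambda>y. ?Dh y w) (at ?y) v))"
      proof (rule frechet_derivative_at[symmetric])
        have 1: "((\<lambda>y. s a (?Dh y w)) has_derivative (\<lambda>v. s a (frechet_derivative (\<lambda>y. ?Dh y w) (at ?y) v))) (at ?y)"
          by (rule bounded_linear.has_derivative[OF kspace_bounded_linear[OF ks] Ck_on_2D(2)[OF ck y0]])
        show "((\<lambda>y. ?Dh y (a *s w)) has_derivative (\<lambda>v. s a (frechet_derivative (\<lambda>y. ?Dh y w) (at ?y) v))) (at ?y)"
          by (rule has_derivative_transform_within_open[OF 1 oO y0]) (simp add: kD(2))
      qed
      also have "frechet_derivative (\<lambda>y. ?Dh y w) (at ?y) (axis j 1) = ?D2 j w"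
        by (rule symmetric_second_derivative[OF ck oO y0])
      finally show ?thesis .
    qed
    obtain \<Lambda>' where \<Lambda>': "\<And>j. ((\<lambda>y. \<Lambda> y $ j) has_derivative \<Lambda>' j) (at ?y)" "\<And>j a v. \<Lambda>' j (a *s v) = a * \<Lambda>' j v"
      using \<Lambda>(1)[of ?y] uU unfolding kd_def by (metis imageI)
    define T where "T w = (\<Sum>j\<in>UNIV. s (\<Lambda> ?y $ j) (?D2 j w) + s (\<Lambda>' j w) (?Dh ?y (axis j 1)))" for w
    have "((\<lambda>y. \<Sum>j\<in>UNIV. s (\<Lambda> y $ j) (?Dh y (axis j 1))) has_derivative T) (at ?y)"
      unfolding T_def
      by (intro has_derivative_sum bounded_bilinear.FDERIV[OF bounded_bilinear_s] \<Lambda>'(1) Ck_on_2D(2)[OF ck y0])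
    then have T: "((\<lambda>y. vf X f (ci y)) has_derivative T) (at ?y)"
      by (rule has_derivative_transform_within_open[OF _ oO y0]) (simp add: val)
    have ci_conv: "coord_inv \<E> u0 = ci" by (simp add: coord_inv_conv ci_def U_def c_def)
    have "mdiff \<E> vec_atlas (vf X f) u0"
      using T by (intro mdiff_vecI[OF atlas_E]) (auto simp: ci_conv c_def differentiable_def)
    moreover have "mderiv \<E> vec_atlas (vf X f) u0 = T"
      using T by (intro mderiv_eqI) (simp add: ci_conv c_def)
    moreover have "T (a *s w) = s a (T w)" for a w
      by (simp add: T_def D2k \<Lambda>'(2) S.scale_sum_right S.scale_right_distrib mult.commute)
    ultimately show ?thesis by simp
  qed
  then show ?thesis by (simp add: cdiff_def)
qed

lemma mdiff_act: "g \<in> Q \<Longrightarrow> mdiff \<E> \<E> (\<lambda>u. act u g) u"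
proof -
  assume g: "g \<in> Q"
  have "smooth_map (prod_manifold E G) E (UNIV \<times> Q) (\<lambda>(u, g). act u g)"
    using is_bundle by (simp add: principal_bundle_def)
  from smooth_map_prod_slice(1)[OF atlas_E atlas atlas_E _ _ this, of g u] g show ?thesis by simp
qed

lemma inv_omega_act:
  assumes g: "g \<in> Q"
  shows "inv (\<omega> (act u g)) X = mderiv \<E> \<E> (\<lambda>u. act u g) u (inv (\<omega> u) (Ad G g X))"
proof -
  have "\<omega> (act u g) (mderiv \<E> \<E> (\<lambda>u. act u g) u (inv (\<omega> u) (Ad G g X))) = X"
    using cartan g by (simp add: cartan_connection_def)
  then show ?thesis by (metis omega_inv(2))
qed

section \<open>Equivariance and derivatives in the direction of q\<close>

definition equivar :: "('t \<Rightarrow> ('k, 'd) vec list \<Rightarrow> 'v) \<Rightarrow> bool" where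
  "equivar \<phi> \<longleftrightarrow> (\<forall>u. \<forall>g\<in>Q. \<forall>xs. set xs \<subseteq> \<pp> \<longrightarrow>
     \<phi> (act u g) xs = \<rho> (ginv G g) (\<phi> u (map (Ad G g) xs)))"

text \<open>The direction of the derivative becomes an additional first argument. In this form the
  derivative of an equivariant map is of the same kind, and \<open>equivar_vf\<close> applies to it
  as well. The value 0 on the empty list respects equivariance.\<close>

definition dd :: "('t \<Rightarrow> ('k, 'd) vec list \<Rightarrow> 'v) \<Rightarrow> 't \<Rightarrow> ('k, 'd) vec list \<Rightarrow> 'v" where
  "dd \<phi> u xs = (case xs of [] \<Rightarrow> 0 | X # ys \<Rightarrow> vf X (\<lambda>u. \<phi> u ys) u)"

lemma dd_Cons [simp]: "dd \<phi> u (X # xs) = vf X (\<lambda>u. \<phi> u xs) u"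
  by (simp add: dd_def)

lemma rho_zero: "g \<in> P \<Longrightarrow> \<rho> g 0 = 0"
  using linear_0[OF rho_linear_real] .

lemma equivar_dd:
  assumes e: "equivar \<phi>" and c: "\<And>xs. cdiff (\<lambda>u. \<phi> u xs)"
  shows "equivar (dd \<phi>)"
  unfolding equivar_def
proof (intro allI ballI impI)
  fix u g and xs :: "('k, 'd) vec list" assume g: "g \<in> Q" and xs: "set xs \<subseteq> \<pp>"
  have gi: "ginv G g \<in> P" using g Q_P P_inv by blast
  show "dd \<phi> (act u g) xs = \<rho> (ginv G g) (dd \<phi> u (map (Ad G g) xs))"
  proof (cases xs)
    case Nil
    then show ?thesis by (simp add: dd_def rho_zero gi)
  next
    case (Cons X ys)
    have "vf X (\<lambda>u. \<phi> u ys) (act u g) =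
        mderiv \<E> vec_atlas (\<lambda>u. \<phi> (act u g) ys) u (inv (\<omega> u) (Ad G g X))"
      unfolding vf_def inv_omega_act[OF g]
      using mdiff_compose(2)[OF atlas_E atlas_E mdiff_act[OF g] cdiffD(1)[OF c[of ys]]] by simp
    also have "(\<lambda>u. \<phi> (act u g) ys) = (\<lambda>u. \<rho> (ginv G g) (\<phi> u (map (Ad G g) ys)))"
      using e g xs Cons by (auto simp: equivar_def)
    also have "mderiv \<E> vec_atlas (\<lambda>u. \<rho> (ginv G g) (\<phi> u (map (Ad G g) ys))) u (inv (\<omega> u) (Ad G g X)) =
        \<rho> (ginv G g) (vf (Ad G g X) (\<lambda>u. \<phi> u (map (Ad G g) ys)) u)"
      unfolding vf_def by (rule mderiv_vec_linear(2)[OF cdiffD(1)[OF c] rho_bounded_linear[OF gi]])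
    finally show ?thesis using Cons by simp
  qed
qed

lemma mlin_Ad_derivative:
  assumes m: "mlin \<phi>" and g: "\<And>t. \<gamma> t \<in> P" "\<gamma> 0 = \<e>" "has_velocity \<A> \<gamma> 0 Z" and Z: "Z \<in> \<pp>" and xs: "set xs \<subseteq> \<pp>"
  shows "((\<lambda>t. \<phi> (map (Ad G (\<gamma> t)) xs)) has_vector_derivative - adj Z \<phi> xs) (at 0)"
  using m xs
proof (induction xs arbitrary: \<phi>)
  case (Cons x xs)
  obtain p where p: "Vector_Spaces.linear (*s) (*s) p" "\<And>x. x \<in> \<pp> \<Longrightarrow> p x = x" "\<And>x. p x \<in> \<pp>"
    using subspace_projection[OF p_subspace] by blast
  interpret p: Vector_Spaces.linear "(*s)" "(*s)" p by (rule p(1))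
  have xp: "x \<in> \<pp>" "set xs \<subseteq> \<pp>" using Cons.prems by auto
  have Adp: "Ad G (\<gamma> t) y \<in> \<pp>" if "y \<in> \<pp>" for t y using Ad_p[OF g(1) that] .
  then have Adxs: "set (map (Ad G (\<gamma> t)) xs) \<subseteq> \<pp>" for t using xp by auto
  have "((\<lambda>t. \<phi> (p (Ad G (\<gamma> t) x) # map (Ad G (\<gamma> t)) xs)) has_vector_derivative
      - adj Z (ins (p (Ad G (\<gamma> 0) x)) \<phi>) xs + \<phi> (p \<lbrakk>Z, x\<rbrakk> # map (Ad G (\<gamma> 0)) xs)) (at 0)"
  proof (rule has_vector_derivative_linear_apply[where F = "\<lambda>t y. \<phi> (p y # map (Ad G (\<gamma> t)) xs)"
        and F' = "\<lambda>y. - adj Z (ins (p y) \<phi>) xs" and x = "\<lambda>t. Ad G (\<gamma> t) x"])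
    show "linear (\<lambda>y. \<phi> (p y # map (Ad G (\<gamma> t)) xs))" for t
      using mlin_D0[OF Cons.prems(1) Adxs p(3)] p(3)
      by (intro linearI) (simp_all add: p.add p.scale of_real_vec_scale[symmetric] s_real)
    show "((\<lambda>t. \<phi> (p y # map (Ad G (\<gamma> t)) xs)) has_vector_derivative - adj Z (ins (p y) \<phi>) xs) (at 0)" for y
      using Cons.IH[of "ins (p y) \<phi>"] Cons.prems p(3) by simp
    show "((\<lambda>t. Ad G (\<gamma> t) x) has_vector_derivative \<lbrakk>Z, x\<rbrakk>) (at 0)"
      by (rule has_velocity_Ad[OF g(2,3)])
  qed
  moreover have "map (Ad G \<e>) xs = xs" by (simp add: map_idI)
  ultimately show ?case using p(2) Adp[OF xp(1)] xp(1) p_br[OF Z xp(1)] g(2) by simp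
qed simp

text \<open>For Z in q the constant vector field is the fundamental one, so the derivative may be
  taken along the orbit of a curve in Q with velocity Z. Equivariance turns this into a derivative
  of the action on values and arguments.\<close>

lemma equivar_vf:
  assumes e: "equivar \<phi>" and c: "cdiff (\<lambda>u. \<phi> u xs)" and m: "mlin (\<phi> u)" and Z: "Z \<in> \<qq>" and xs: "set xs \<subseteq> \<pp>"
  shows "vf Z (\<lambda>u. \<phi> u xs) u = - lact Z (\<phi> u) xs"
proof -
  have Zp: "Z \<in> \<pp>" using Z q_subset by blast
  have "lie_subgroup G Q \<qq>" using rel_type by (simp add: relative_type_def)
  then obtain \<gamma> where g: "\<And>t. \<gamma> t \<in> Q" "\<gamma> 0 = \<e>" "has_velocity \<A> \<gamma> 0 Z"
    using subgroup_curve[OF _ Z] by blast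
  have gP: "\<gamma> t \<in> P" for t using g Q_P by blast
  have "has_velocity \<E> (\<lambda>t. act u (\<gamma> t)) 0 (inv (\<omega> u) Z)"
    using cartan g Z unfolding cartan_connection_def by blast
  from has_velocity_compose[OF atlas_E this, of vec_atlas "\<lambda>u. \<phi> u xs"]
  have 1: "((\<lambda>t. \<phi> (act u (\<gamma> t)) xs) has_vector_derivative vf Z (\<lambda>u. \<phi> u xs) u) (at 0)"
    using cdiffD(1)[OF c] by (simp add: g vf_def has_velocity_vec)
  have "((\<lambda>t. \<rho> (ginv G (\<gamma> t)) (\<phi> u (map (Ad G (\<gamma> t)) xs))) has_vector_derivative
      - rr Z (\<phi> u (map (Ad G (\<gamma> 0)) xs)) + \<rho> (ginv G (\<gamma> 0)) (- adj Z (\<phi> u) xs)) (at 0)"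
  proof (rule has_vector_derivative_linear_apply[where F = "\<lambda>t. \<rho> (ginv G (\<gamma> t))" and F' = "\<lambda>y. - rr Z y"
        and x = "\<lambda>t. \<phi> u (map (Ad G (\<gamma> t)) xs)"])
    show "linear (\<rho> (ginv G (\<gamma> t)))" for t by (rule rho_linear_real[OF P_inv[OF gP]])
    show "((\<lambda>t. \<rho> (ginv G (\<gamma> t)) y) has_vector_derivative - rr Z y) (at 0)" for y
      by (rule rho_inv_curve[OF gP g(2,3)])
    show "((\<lambda>t. \<phi> u (map (Ad G (\<gamma> t)) xs)) has_vector_derivative - adj Z (\<phi> u) xs) (at 0)"
      by (rule mlin_Ad_derivative[OF m gP g(2,3) Zp xs])
  qed
  moreover have "map (Ad G \<e>) xs = xs" by (simp add: map_idI)
  ultimately have "((\<lambda>t. \<phi> (act u (\<gamma> t)) xs) has_vector_derivative - lact Z (\<phi> u) xs) (at 0)"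
    using e g xs by (simp add: equivar_def lact_def)
  then show ?thesis using 1 vector_derivative_unique_at by blast
qed

end

section \<open>The Laplacian\<close>

context rel_geometry begin

lemma dual_bases_in_p:
  "i < length (fst (dual_bases G \<pp>)) \<Longrightarrow> fst (dual_bases G \<pp>) ! i \<in> \<pp>"
  "i < length (fst (dual_bases G \<pp>)) \<Longrightarrow> snd (dual_bases G \<pp>) ! i \<in> \<pp>"
  using is_dual_dual_bases by (auto simp: is_dual_bases_def)

lemma mlin_zero: "mlin (\<lambda>_. 0)"
  by (simp add: mlin_def)

lemma mlin_B_inv:
  assumes "\<And>X Y. X \<in> \<pp> \<Longrightarrow> Y \<in> \<pp> \<Longrightarrow> mlin (b X Y)"
  shows "mlin (\<lambda>xs. B_inv G \<pp> (\<lambda>X Y. b X Y xs))"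
proof -
  have sum: "mlin (\<lambda>xs. \<Sum>i\<in>A. f i xs)" if "\<And>i. i \<in> A \<Longrightarrow> mlin (f i)" for f and A :: "nat set"
    using that by (induction A rule: infinite_finite_induct) (simp_all add: mlin_zero mlin_add)
  show ?thesis unfolding B_inv_conv by (rule sum) (use assms dual_bases_in_p in auto)
qed

lemma alt_B_inv:
  assumes "\<And>X Y. X \<in> \<pp> \<Longrightarrow> Y \<in> \<pp> \<Longrightarrow> alt (b X Y)"
  shows "alt (\<lambda>xs. B_inv G \<pp> (\<lambda>X Y. b X Y xs))"
  using assms dual_bases_in_p unfolding B_inv_conv alt_def by (auto intro!: sum.neutral)

lemma cdf_class:
  assumes "mlin \<phi>" "alt \<phi>"
  shows "mlin (cdf \<phi>)" "alt (cdf \<phi>)"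
proof -
  let ?b = "\<lambda>xs. - (1 / 2) *\<^sub>R B_inv G \<pp> (\<lambda>X Y. mact Y (ins X \<phi>) xs)"
  have "mlin ?b" by (intro mlin_scaleR mlin_B_inv mlin_mact mlin_ins assms)
  moreover have "alt ?b" by (intro alt_scaleR alt_B_inv alt_mact mlin_ins alt_ins assms)
  moreover have "cdf \<phi> xs = ?b xs" if "set xs \<subseteq> \<pp>" for xs using that by (simp add: cdf_def)
  ultimately show "mlin (cdf \<phi>)" "alt (cdf \<phi>)" using mlin_cong alt_cong by blast+
qed

lemma cdiff_B_inv:
  "(\<And>X Y. X \<in> \<pp> \<Longrightarrow> Y \<in> \<pp> \<Longrightarrow> cdiff (b X Y)) \<Longrightarrow> cdiff (\<lambda>u. B_inv G \<pp> (\<lambda>X Y. b X Y u))"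
  unfolding B_inv_conv using dual_bases_in_p by (intro cdiff_sum) auto

lemma cdiff_adj: "(\<And>zs. cdiff (\<lambda>u. \<phi> u zs)) \<Longrightarrow> cdiff (\<lambda>u. adj X (\<phi> u) xs)"
  unfolding adj_conv_sum by (intro cdiff_uminus cdiff_sum)

lemma cdiff_lact: "(\<And>zs. cdiff (\<lambda>u. \<phi> u zs)) \<Longrightarrow> X \<in> \<pp> \<Longrightarrow> cdiff (\<lambda>u. lact X (\<phi> u) xs)"
  unfolding lact_def by (intro cdiff_add cdiff_r cdiff_adj)

lemma cdiff_mact: "(\<And>zs. cdiff (\<lambda>u. \<phi> u zs)) \<Longrightarrow> X \<in> \<pp> \<Longrightarrow> cdiff (\<lambda>u. mact X (\<phi> u) xs)"
  unfolding mact_def by (intro cdiff_add cdiff_r cdiff_lact)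

lemma vf_adj: "(\<And>zs. cdiff (\<lambda>u. \<phi> u zs)) \<Longrightarrow>
  vf X (\<lambda>u. adj Y (\<phi> u) xs) u = adj Y (\<lambda>zs. vf X (\<lambda>u. \<phi> u zs) u) xs"
  by (induction xs arbitrary: \<phi>) (simp_all add: vf_diff cdiff_adj)

lemma vf_lact: "(\<And>zs. cdiff (\<lambda>u. \<phi> u zs)) \<Longrightarrow> Y \<in> \<pp> \<Longrightarrow>
  vf X (\<lambda>u. lact Y (\<phi> u) xs) u = lact Y (\<lambda>zs. vf X (\<lambda>u. \<phi> u zs) u) xs"
  unfolding lact_def by (simp add: vf_add cdiff_r cdiff_adj vf_r vf_adj)

lemma vf_mact: "(\<And>zs. cdiff (\<lambda>u. \<phi> u zs)) \<Longrightarrow> Y \<in> \<pp> \<Longrightarrow>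
  vf X (\<lambda>u. mact Y (\<phi> u) xs) u = mact Y (\<lambda>zs. vf X (\<lambda>u. \<phi> u zs) u) xs"
  unfolding mact_def by (simp add: vf_add cdiff_r cdiff_lact vf_r vf_lact)

lemma mlin_vf:
  assumes "\<And>u. mlin (\<phi> u)" "\<And>zs. cdiff (\<lambda>u. \<phi> u zs)"
  shows "mlin (\<lambda>zs. vf X (\<lambda>u. \<phi> u zs) u)"
  unfolding mlin_def
proof (intro allI impI conjI ballI)
  fix xs ys U V assume p: "set xs \<subseteq> \<pp>" "set ys \<subseteq> \<pp>" "U \<in> \<pp>" "V \<in> \<pp>"
  have "(\<lambda>u. \<phi> u (xs @ (U + V) # ys)) = (\<lambda>u. \<phi> u (xs @ U # ys) + \<phi> u (xs @ V # ys))"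
    using mlin_D(1)[OF assms(1)] p by blast
  then show "vf X (\<lambda>u. \<phi> u (xs @ (U + V) # ys)) u = vf X (\<lambda>u. \<phi> u (xs @ U # ys)) u + vf X (\<lambda>u. \<phi> u (xs @ V # ys)) u"
    by (simp add: vf_add assms)
next
  fix xs ys U a assume p: "set xs \<subseteq> \<pp>" "set ys \<subseteq> \<pp>" "U \<in> \<pp>"
  have "(\<lambda>u. \<phi> u (xs @ (a *s U) # ys)) = (\<lambda>u. s a (\<phi> u (xs @ U # ys)))"
    using mlin_D(2)[OF assms(1)] p by blast
  then show "vf X (\<lambda>u. \<phi> u (xs @ (a *s U) # ys)) u = s a (vf X (\<lambda>u. \<phi> u (xs @ U # ys)) u)"
    by (simp add: vf_s assms)
qed

lemma alt_vf: "(\<And>u. alt (\<phi> u)) \<Longrightarrow> alt (\<lambda>zs. vf X (\<lambda>u. \<phi> u zs) u)"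
  unfolding alt_def by simp

lemma vanish_vf: "(\<And>u. vanish W (\<phi> u)) \<Longrightarrow> vanish W (\<lambda>zs. vf X (\<lambda>u. \<phi> u zs) u)"
  unfolding vanish_def by simp

text \<open>The exterior derivative, written recursively by means of Cartan's formula for the insertion of
  the first argument.\<close>

primrec dl :: "('k, 'd) vec list \<Rightarrow> ('t \<Rightarrow> ('k, 'd) vec list \<Rightarrow> 'v) \<Rightarrow> 't \<Rightarrow> 'v" where
  "dl [] \<phi> u = 0"
| "dl (x # xs) \<phi> u = vf x (\<lambda>u. \<phi> u xs) u + lact x (\<phi> u) xs - dl xs (\<lambda>u zs. \<phi> u (x # zs)) u"

text \<open>Sorting by the index 0: the brackets with x, moved back to their slots, complete the
  action of x on the values to \<open>lact x\<close>. All other terms contain x as an argument; for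
  the bracket terms the sign arises from exchanging x with the bracket in front of it.\<close>

lemma d_twisted_dl:
  assumes "\<And>u. mlin (\<phi> u)" "\<And>u. alt (\<phi> u)" "set xs \<subseteq> \<pp>"
  shows "d_twisted G \<pp> P E \<omega> \<rho> \<phi> u xs = dl xs \<phi> u"
proof -
  have "(\<Sum>i<length xs. (- 1) ^ i *\<^sub>R vf (xs ! i) (\<lambda>u. \<phi> u (omit {i} xs)) u) +
     (\<Sum>i<length xs. (- 1) ^ i *\<^sub>R rr (xs ! i) (\<phi> u (omit {i} xs))) +
     (\<Sum>j<length xs. \<Sum>i<j. (- 1) ^ (i + j) *\<^sub>R \<phi> u (\<lbrakk>xs ! i, xs ! j\<rbrakk> # omit {i, j} xs)) = dl xs \<phi> u"
    using assms
  proof (induction xs arbitrary: \<phi>)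
    case (Cons x xs)
    then have x: "x \<in> \<pp>" "set xs \<subseteq> \<pp>" by auto
    have adj: "(\<Sum>j<length xs. (- 1) ^ j *\<^sub>R \<phi> u (\<lbrakk>x, xs ! j\<rbrakk> # omit {j} xs)) = - adj x (\<phi> u) xs"
      unfolding adj_conv_sum minus_minus using x p_br[OF x(1)] alt_move[OF Cons.prems(1,2) x(2)]
      by (intro sum.cong) (auto simp: subset_iff)
    have sw: "\<phi> u (\<lbrakk>xs ! i, xs ! j\<rbrakk> # x # omit {i, j} xs) = - \<phi> u (x # \<lbrakk>xs ! i, xs ! j\<rbrakk> # omit {i, j} xs)"
      if "i < j" "j < length xs" for i j
      using that x set_omit[of "{i, j}" xs] by (intro alt_swap0 Cons.prems) (auto simp: subset_iff)
    have sw': "(\<Sum>j<length xs. \<Sum>i<j. (- 1) ^ (i + j) *\<^sub>R \<phi> u (\<lbrakk>xs ! i, xs ! j\<rbrakk> # x # omit {i, j} xs)) =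
      - (\<Sum>j<length xs. \<Sum>i<j. (- 1) ^ (i + j) *\<^sub>R \<phi> u (x # \<lbrakk>xs ! i, xs ! j\<rbrakk> # omit {i, j} xs))"
      unfolding sum_negf[symmetric] using sw by (intro sum.cong) auto
    have IH: "dl xs (\<lambda>u zs. \<phi> u (x # zs)) u =
      (\<Sum>i<length xs. (- 1) ^ i *\<^sub>R vf (xs ! i) (\<lambda>u. \<phi> u (x # omit {i} xs)) u) +
      (\<Sum>i<length xs. (- 1) ^ i *\<^sub>R rr (xs ! i) (\<phi> u (x # omit {i} xs))) +
      (\<Sum>j<length xs. \<Sum>i<j. (- 1) ^ (i + j) *\<^sub>R \<phi> u (x # \<lbrakk>xs ! i, xs ! j\<rbrakk> # omit {i, j} xs))"
      using Cons.IH[of "\<lambda>u. ins x (\<phi> u)"] Cons.prems x by simp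
    show ?case
      unfolding list.size(4) add_0_right One_nat_def add_Suc_right sum_lessThan_Suc_pairs
      by (simp add: sum.lessThan_Suc_shift sum_negf adj sw' IH lact_def del: sum.lessThan_Suc)
  qed simp
  then show ?thesis using assms(3) unfolding d_twisted_def fund_deriv_conv by simp
qed

lemma dl_cong:
  assumes "\<And>u zs. set zs \<subseteq> \<pp> \<Longrightarrow> \<phi> u zs = \<psi> u zs" "set xs \<subseteq> \<pp>"
  shows "dl xs \<phi> u = dl xs \<psi> u"
  using assms
proof (induction xs arbitrary: \<phi> \<psi>)
  case (Cons x xs)
  then have x: "x \<in> \<pp>" "set xs \<subseteq> \<pp>" by auto
  have "dl xs (\<lambda>u zs. \<phi> u (x # zs)) u = dl xs (\<lambda>u zs. \<psi> u (x # zs)) u"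
    using Cons.prems by (intro Cons.IH) auto
  moreover have "lact x (\<phi> u) xs = lact x (\<psi> u) xs"
    using Cons.prems x by (intro lact_cong) auto
  moreover have "(\<lambda>u. \<phi> u xs) = (\<lambda>u. \<psi> u xs)" using Cons.prems x by auto
  ultimately show ?case by simp
qed simp

lemma dl_add:
  assumes "\<And>zs. cdiff (\<lambda>u. \<phi> u zs)" "\<And>zs. cdiff (\<lambda>u. \<psi> u zs)" "set xs \<subseteq> \<pp>"
  shows "dl xs (\<lambda>u zs. \<phi> u zs + \<psi> u zs) u = dl xs \<phi> u + dl xs \<psi> u"
  using assms by (induction xs arbitrary: \<phi> \<psi>) (simp_all add: vf_add lact_add)

lemma lact_hom:
  assumes "X \<in> \<pp>" "\<And>v w. L (v - w) = L v - L w" "\<And>v. rr X (L v) = L (rr X v)"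
  shows "lact X (\<lambda>zs. L (\<phi> zs)) xs = L (lact X \<phi> xs)"
proof -
  have L0: "L 0 = 0" using assms(2)[of 0 0] by simp
  have Lm: "L (- v) = - L v" for v using assms(2)[of 0 v] L0 by simp
  have "L (v + w) = L v + L w" for v w using assms(2)[of v "- w"] Lm by simp
  then show ?thesis unfolding lact_def by (simp add: assms(3) adj_hom[of L] L0 assms(2))
qed

lemma dl_hom:
  assumes "\<And>zs. cdiff (\<lambda>u. \<phi> u zs)" "set xs \<subseteq> \<pp>" "bounded_linear L"
    "\<And>X v. X \<in> \<pp> \<Longrightarrow> rr X (L v) = L (rr X v)"
  shows "dl xs (\<lambda>u zs. L (\<phi> u zs)) u = L (dl xs \<phi> u)"
proof -
  note L = bounded_linear.linear[OF assms(3)]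
  show ?thesis
    using assms(1,2)
    by (induction xs arbitrary: \<phi>)
      (simp_all add: vf_hom[OF _ assms(3)] assms(4) lact_hom linear_0[OF L] linear_add[OF L] linear_diff[OF L])
qed

lemma dl_s: "(\<And>zs. cdiff (\<lambda>u. \<phi> u zs)) \<Longrightarrow> set xs \<subseteq> \<pp> \<Longrightarrow> dl xs (\<lambda>u zs. s a (\<phi> u zs)) u = s a (dl xs \<phi> u)"
  by (rule dl_hom[OF _ _ kspace_bounded_linear[OF ks]]) (simp_all add: r_scale)

lemma dl_scaleR: "(\<And>zs. cdiff (\<lambda>u. \<phi> u zs)) \<Longrightarrow> set xs \<subseteq> \<pp> \<Longrightarrow> dl xs (\<lambda>u zs. c *\<^sub>R \<phi> u zs) u = c *\<^sub>R dl xs \<phi> u"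
  by (rule dl_hom[OF _ _ bounded_linear_scaleR_right]) (simp_all add: r_scaleR)

lemma dl_uminus: "(\<And>zs. cdiff (\<lambda>u. \<phi> u zs)) \<Longrightarrow> set xs \<subseteq> \<pp> \<Longrightarrow> dl xs (\<lambda>u zs. - \<phi> u zs) u = - dl xs \<phi> u"
  by (rule dl_hom) (simp_all add: bounded_linear_minus bounded_linear_ident)

lemma dl_diff:
  assumes "\<And>zs. cdiff (\<lambda>u. \<phi> u zs)" "\<And>zs. cdiff (\<lambda>u. \<psi> u zs)" "set xs \<subseteq> \<pp>"
  shows "dl xs (\<lambda>u zs. \<phi> u zs - \<psi> u zs) u = dl xs \<phi> u - dl xs \<psi> u"
  using dl_add[of \<phi> "\<lambda>u zs. - \<psi> u zs"] assms by (simp add: dl_uminus cdiff_uminus)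

lemma dl_zero: "set xs \<subseteq> \<pp> \<Longrightarrow> dl xs (\<lambda>u zs. 0) u = 0"
  by (induction xs) (simp_all add: lact_def)

lemma dl_B_inv:
  assumes "\<And>X Y zs. X \<in> \<pp> \<Longrightarrow> Y \<in> \<pp> \<Longrightarrow> cdiff (\<lambda>u. b X Y u zs)" "set xs \<subseteq> \<pp>"
  shows "dl xs (\<lambda>u zs. B_inv G \<pp> (\<lambda>X Y. b X Y u zs)) u = B_inv G \<pp> (\<lambda>X Y. dl xs (b X Y) u)"
proof -
  have sum: "dl xs (\<lambda>u zs. \<Sum>i\<in>A. f i u zs) u = (\<Sum>i\<in>A. dl xs (f i) u)"
    if "\<And>i zs. i \<in> A \<Longrightarrow> cdiff (\<lambda>u. f i u zs)" for f and A :: "nat set"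
    using that
  proof (induction A rule: infinite_finite_induct)
    case (insert i A)
    then show ?case using dl_add[of "f i" "\<lambda>u zs. \<Sum>i\<in>A. f i u zs" xs u] assms(2) by (simp add: cdiff_sum)
  qed (simp_all add: dl_zero assms(2))
  show ?thesis unfolding B_inv_conv by (rule sum) (use assms(1) dual_bases_in_p in auto)
qed

lemma mlin_dl:
  assumes "\<And>u. mlin (\<phi> u)" "\<And>zs. cdiff (\<lambda>u. \<phi> u zs)"
  shows "mlin (\<lambda>xs. dl xs \<phi> u)"
  unfolding mlin_def
proof (intro allI impI conjI ballI)
  fix xs ys X Y assume p: "set xs \<subseteq> \<pp>" "set ys \<subseteq> \<pp>" "X \<in> \<pp>" "Y \<in> \<pp>"
  show "dl (xs @ (X + Y) # ys) \<phi> u = dl (xs @ X # ys) \<phi> u + dl (xs @ Y # ys) \<phi> u"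
    using p(1) assms
  proof (induction xs arbitrary: \<phi>)
    case Nil
    have "dl ys (\<lambda>u zs. \<phi> u ((X + Y) # zs)) u = dl ys (\<lambda>u zs. \<phi> u (X # zs) + \<phi> u (Y # zs)) u"
      using p Nil by (intro dl_cong mlin_D0) auto
    then show ?case using Nil p by (simp add: dl_add vf_left lact_def adj_left r_add_left)
  next
    case (Cons x xs)
    then have x: "x \<in> \<pp>" "set xs \<subseteq> \<pp>" by auto
    show ?case
      using mlin_D(1)[OF mlin_vf[OF Cons.prems(2,3), of x u] x(2) p(2,3,4)]
        mlin_D(1)[OF mlin_lact[OF Cons.prems(2)[of u] x(1)] x(2) p(2,3,4)]
        Cons.IH[of "\<lambda>u zs. \<phi> u (x # zs)"] Cons.prems x by simp
  qed
next
  fix xs ys X a assume p: "set xs \<subseteq> \<pp>" "set ys \<subseteq> \<pp>" "X \<in> \<pp>"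
  show "dl (xs @ (a *s X) # ys) \<phi> u = s a (dl (xs @ X # ys) \<phi> u)"
    using p(1) assms
  proof (induction xs arbitrary: \<phi>)
    case Nil
    have "dl ys (\<lambda>u zs. \<phi> u ((a *s X) # zs)) u = dl ys (\<lambda>u zs. s a (\<phi> u (X # zs))) u"
      using p Nil by (intro dl_cong mlin_D0) auto
    then show ?case using Nil p
      by (simp add: dl_s vf_left lact_def adj_left r_scale_left S.scale_right_distrib S.scale_right_diff_distrib)
  next
    case (Cons x xs)
    then have x: "x \<in> \<pp>" "set xs \<subseteq> \<pp>" by auto
    show ?case
      using mlin_D(2)[OF mlin_vf[OF Cons.prems(2,3), of x u] x(2) p(2,3)]
        mlin_D(2)[OF mlin_lact[OF Cons.prems(2)[of u] x(1)] x(2) p(2,3)]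
        Cons.IH[of "\<lambda>u zs. \<phi> u (x # zs)"] Cons.prems x
      by (simp add: S.scale_right_distrib S.scale_right_diff_distrib)
  qed
qed

lemma mlin_zero_entry: "mlin \<phi> \<Longrightarrow> set ys \<subseteq> \<pp> \<Longrightarrow> \<phi> (0 # ys) = 0"
  using mlin_D0(2)[of \<phi> ys 0 0] by simp

lemma alt_dl:
  assumes "\<And>u. mlin (\<phi> u)" "\<And>u. alt (\<phi> u)" "\<And>zs. cdiff (\<lambda>u. \<phi> u zs)"
  shows "alt (\<lambda>xs. dl xs \<phi> u)"
  unfolding alt_def
proof (intro allI impI ballI)
  fix xs ys X assume p: "set xs \<subseteq> \<pp>" "set ys \<subseteq> \<pp>" "X \<in> \<pp>"
  show "dl (xs @ X # X # ys) \<phi> u = 0"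
    using p(1) assms
  proof (induction xs arbitrary: \<phi>)
    case Nil
    \<comment> \<open>With X inserted twice the two derivatives along X cancel, and the two actions
      of X differ by the entry \<open>[X, X] = 0\<close>.\<close>
    have "dl ys (\<lambda>u zs. \<phi> u (X # X # zs)) u = dl ys (\<lambda>u zs. 0) u"
      using p Nil altD[OF Nil(3), of "[]"] by (intro dl_cong) auto
    then show ?case using p Nil by (simp add: lact_Cons dl_zero mlin_zero_entry)
  next
    case (Cons x xs)
    then have x: "x \<in> \<pp>" "set xs \<subseteq> \<pp>" by auto
    show ?case
      using altD[OF alt_vf[of \<phi> x u, OF Cons.prems(3)] x(2) p(2,3)]
        altD[OF alt_lact[OF Cons.prems(2)[of u] Cons.prems(3)[of u] x(1)] x(2) p(2,3)]
        Cons.IH[of "\<lambda>u zs. \<phi> u (x # zs)"] Cons.prems x by simp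
  qed
qed


section \<open>The commutator of the exterior derivative with L + R\<close>

definition comm_dm where
  "comm_dm Z \<phi> xs u = dl xs (\<lambda>u. mact Z (\<phi> u)) u - mact Z (\<lambda>zs. dl zs \<phi> u) xs"

text \<open>The two parts of L, on values and on arguments, commute with each other. So the extra
  copy of R contributes just the commutator of R with itself, next to that of L.\<close>

lemma lact_mact:
  assumes "mlin \<phi>" "y \<in> \<pp>" "Z \<in> \<pp>" "set xs \<subseteq> \<pp>"
  shows "lact y (mact Z \<phi>) xs - mact Z (lact y \<phi>) xs = - rr \<lbrakk>Z, y\<rbrakk> (\<phi> xs) - lact \<lbrakk>Z, y\<rbrakk> \<phi> xs"
proof -
  have "lact y (mact Z \<phi>) xs = rr y (rr Z (\<phi> xs)) + rr Z (adj y \<phi> xs) + lact y (lact Z \<phi>) xs"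
    using assms(2,3) by (simp add: mact_def[abs_def] lact_add) (simp add: lact_def adj_r)
  moreover have "mact Z (lact y \<phi>) xs = rr Z (rr y (\<phi> xs)) + rr Z (adj y \<phi> xs) + lact Z (lact y \<phi>) xs"
    using assms(2,3) by (simp add: mact_def lact_def r_add)
  ultimately show ?thesis
    using lact_lact[OF assms(1,3,2,4)] r_br[OF assms(3,2), of "\<phi> xs"] by (simp add: algebra_simps)
qed

lemma mact_Cons: "mact Z \<phi> (y # ys) = mact Z (ins y \<phi>) ys - \<phi> (\<lbrakk>Z, y\<rbrakk> # ys)"
  by (simp add: mact_def lact_Cons)

text \<open>The action of Z has constant coefficients and passes through the derivative along y,
  hence no commutator of vector fields arises. The term with L at \<open>[Z, y]\<close> from
  \<open>lact_mact\<close> cancels against the one where Z acts on the argument y; of the latter a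
  derivative along \<open>[Z, y]\<close> survives, and of the former a copy of R.\<close>

lemma comm_dm_Cons:
  assumes m: "\<And>u. mlin (\<phi> u)" and c: "\<And>zs. cdiff (\<lambda>u. \<phi> u zs)" and Z: "Z \<in> \<pp>" and y: "y \<in> \<pp>" and ys: "set ys \<subseteq> \<pp>"
  shows "comm_dm Z \<phi> (y # ys) u =
    vf \<lbrakk>Z, y\<rbrakk> (\<lambda>u. \<phi> u ys) u - rr \<lbrakk>Z, y\<rbrakk> (\<phi> u ys) - comm_dm Z (\<lambda>u. ins y (\<phi> u)) ys u"
proof -
  have 1: "dl ys (\<lambda>u zs. mact Z (\<phi> u) (y # zs)) u =
      dl ys (\<lambda>u. mact Z (ins y (\<phi> u))) u - dl ys (\<lambda>u zs. \<phi> u (\<lbrakk>Z, y\<rbrakk> # zs)) u"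
    unfolding mact_Cons using c Z ys by (intro dl_diff cdiff_mact)
  have 2: "mact Z (\<lambda>zs. dl zs \<phi> u) (y # ys) =
      mact Z (\<lambda>zs. vf y (\<lambda>u. \<phi> u zs) u) ys + mact Z (lact y (\<phi> u)) ys - mact Z (\<lambda>zs. dl zs (\<lambda>u. ins y (\<phi> u)) u) ys -
      (vf \<lbrakk>Z, y\<rbrakk> (\<lambda>u. \<phi> u ys) u + lact \<lbrakk>Z, y\<rbrakk> (\<phi> u) ys - dl ys (\<lambda>u zs. \<phi> u (\<lbrakk>Z, y\<rbrakk> # zs)) u)"
    unfolding mact_Cons using Z by (simp add: mact_diff mact_add)
  have 3: "vf y (\<lambda>u. mact Z (\<phi> u) ys) u = mact Z (\<lambda>zs. vf y (\<lambda>u. \<phi> u zs) u) ys"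
    by (rule vf_mact[OF c Z])
  show ?thesis
    unfolding comm_dm_def dl.simps 1 2 3 using lact_mact[OF m y Z ys, of u] by (simp add: algebra_simps)
qed

lemma comm_dm_Nil: "Z \<in> \<pp> \<Longrightarrow> comm_dm Z \<phi> [] u = 0"
  by (simp add: comm_dm_def mact_conv)

text \<open>Exchanging two inserted arguments changes the sign on lists from p only, so linearity
  has to be combined with congruence on such lists.\<close>

lemma comm_dm_cong:
  assumes "\<And>u zs. set zs \<subseteq> \<pp> \<Longrightarrow> \<phi> u zs = - \<psi> u zs" "\<And>zs. cdiff (\<lambda>u. \<psi> u zs)" "Z \<in> \<pp>" "set xs \<subseteq> \<pp>"
  shows "comm_dm Z \<phi> xs u = - comm_dm Z \<psi> xs u"
proof -
  have m: "mact Z (\<lambda>zs. - \<theta> zs) ys = - mact Z \<theta> ys" for \<theta> ys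
    using assms(3) by (simp add: mact_conv adj_uminus)
  have "dl xs (\<lambda>u. mact Z (\<phi> u)) u = dl xs (\<lambda>u zs. - mact Z (\<psi> u) zs) u"
    unfolding m[symmetric] using assms by (intro dl_cong mact_cong)
  also have "\<dots> = - dl xs (\<lambda>u. mact Z (\<psi> u)) u"
    using assms by (intro dl_uminus cdiff_mact)
  finally have 1: "dl xs (\<lambda>u. mact Z (\<phi> u)) u = - dl xs (\<lambda>u. mact Z (\<psi> u)) u" .
  have "dl zs \<phi> u = - dl zs \<psi> u" if "set zs \<subseteq> \<pp>" for zs
    using dl_cong[of \<phi> "\<lambda>u zs. - \<psi> u zs" zs u] dl_uminus[of \<psi> zs u] assms that by simp
  then have "mact Z (\<lambda>zs. dl zs \<phi> u) xs = mact Z (\<lambda>zs. - dl zs \<psi> u) xs"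
    using assms by (intro mact_cong)
  then show ?thesis using 1 by (simp add: comm_dm_def m)
qed

lemma null_bilinear_vf_ins:
  assumes m: "\<And>u. mlin (\<phi> u)" and c: "\<And>zs. cdiff (\<lambda>u. \<phi> u zs)" and v: "\<And>u. vanish \<nn> (\<phi> u)"
    and n: "\<And>X zs. X \<in> \<nn> \<Longrightarrow> set zs \<subseteq> \<pp> \<Longrightarrow> vf X (\<lambda>u. \<phi> u zs) u = 0" and xs: "set xs \<subseteq> \<pp>"
  shows "null_bilinear (\<lambda>U V. vf U (\<lambda>u. \<phi> u (V # xs)) u)"
  unfolding null_bilinear_def
proof (intro conjI ballI)
  fix U assume "U \<in> \<pp>"
  show "null_linear (\<lambda>V. vf U (\<lambda>u. \<phi> u (V # xs)) u)"
    by (rule null_linear_ins[OF mlin_vf[OF m c] vanish_vf[OF v] xs])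
next
  fix V assume V: "V \<in> \<pp>"
  show "null_linear (\<lambda>U. vf U (\<lambda>u. \<phi> u (V # xs)) u)"
    unfolding null_linear_def using n[of _ "V # xs"] V xs by (simp add: vf_left c)
qed

text \<open>Invariance of the Casimir tensor shifts the bracket with an argument y from the
  direction of the derivative, or of R, to the inserted argument. There these terms reassemble to
  the action \<open>adj Y\<close> on the arguments.\<close>

lemma B_inv_comm_dm:
  assumes m: "\<And>u. mlin (\<phi> u)" and a: "\<And>u. alt (\<phi> u)" and c: "\<And>zs. cdiff (\<lambda>u. \<phi> u zs)"
    and v: "\<And>u. vanish \<nn> (\<phi> u)"
    and n: "\<And>X zs. X \<in> \<nn> \<Longrightarrow> set zs \<subseteq> \<pp> \<Longrightarrow> vf X (\<lambda>u. \<phi> u zs) u = 0" and xs: "set xs \<subseteq> \<pp>"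
  shows "B_inv G \<pp> (\<lambda>X Y. comm_dm Y (\<lambda>u. ins X (\<phi> u)) xs u) =
    B_inv G \<pp> (\<lambda>X Y. adj Y (\<lambda>zs. vf X (\<lambda>u. \<phi> u zs) u - rr X (\<phi> u zs)) xs)"
  using assms
proof (induction xs arbitrary: \<phi>)
  case Nil
  have "B_inv G \<pp> (\<lambda>X Y. comm_dm Y (\<lambda>u. ins X (\<phi> u)) [] u) = B_inv G \<pp> (\<lambda>X Y. 0)"
    by (intro B_inv_cong comm_dm_Nil)
  then show ?case by simp
next
  case (Cons y ys)
  note m = Cons.prems(1) and a = Cons.prems(2) and c = Cons.prems(3) and v = Cons.prems(4) and n = Cons.prems(5)
  have y: "y \<in> \<pp>" "set ys \<subseteq> \<pp>" using Cons.prems(6) by auto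
  have "B_inv G \<pp> (\<lambda>X Y. comm_dm Y (\<lambda>u. ins X (\<phi> u)) (y # ys) u) =
      B_inv G \<pp> (\<lambda>X Y. vf \<lbrakk>Y, y\<rbrakk> (\<lambda>u. \<phi> u (X # ys)) u) - B_inv G \<pp> (\<lambda>X Y. rr \<lbrakk>Y, y\<rbrakk> (\<phi> u (X # ys))) +
      B_inv G \<pp> (\<lambda>X Y. comm_dm Y (\<lambda>u. ins X (ins y (\<phi> u))) ys u)"
    unfolding B_inv_add[symmetric] B_inv_diff[symmetric]
  proof (rule B_inv_cong)
    fix X Y assume XY: "X \<in> \<pp>" "Y \<in> \<pp>"
    have "comm_dm Y (\<lambda>u zs. \<phi> u (X # y # zs)) ys u = - comm_dm Y (\<lambda>u zs. \<phi> u (y # X # zs)) ys u"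
      using XY y c by (intro comm_dm_cong alt_swap0[OF m a])
    then show "comm_dm Y (\<lambda>u. ins X (\<phi> u)) (y # ys) u =
        vf \<lbrakk>Y, y\<rbrakk> (\<lambda>u. \<phi> u (X # ys)) u - rr \<lbrakk>Y, y\<rbrakk> (\<phi> u (X # ys)) + comm_dm Y (\<lambda>u. ins X (ins y (\<phi> u))) ys u"
      using comm_dm_Cons[of "\<lambda>u. ins X (\<phi> u)" Y y ys u] XY y m c by simp
  qed
  also have "B_inv G \<pp> (\<lambda>X Y. vf \<lbrakk>Y, y\<rbrakk> (\<lambda>u. \<phi> u (X # ys)) u) = - B_inv G \<pp> (\<lambda>X Y. vf X (\<lambda>u. \<phi> u (\<lbrakk>Y, y\<rbrakk> # ys)) u)"
    by (rule B_inv_invariant[OF null_bilinear_vf_ins[OF m c v n y(2)] y(1)])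
  also have "B_inv G \<pp> (\<lambda>X Y. rr \<lbrakk>Y, y\<rbrakk> (\<phi> u (X # ys))) = - B_inv G \<pp> (\<lambda>X Y. rr X (\<phi> u (\<lbrakk>Y, y\<rbrakk> # ys)))"
    using null_linear_r null_linear_comp_r[OF null_linear_ins[OF m v y(2)]] y(1)
    by (intro B_inv_invariant) (auto simp: null_bilinear_def)
  also have "B_inv G \<pp> (\<lambda>X Y. comm_dm Y (\<lambda>u. ins X (ins y (\<phi> u))) ys u) =
      B_inv G \<pp> (\<lambda>X Y. adj Y (\<lambda>zs. vf X (\<lambda>u. \<phi> u (y # zs)) u - rr X (\<phi> u (y # zs))) ys)"
    using m a c v n y by (intro Cons.IH) auto
  also have "- B_inv G \<pp> (\<lambda>X Y. vf X (\<lambda>u. \<phi> u (\<lbrakk>Y, y\<rbrakk> # ys)) u) - - B_inv G \<pp> (\<lambda>X Y. rr X (\<phi> u (\<lbrakk>Y, y\<rbrakk> # ys))) +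
      B_inv G \<pp> (\<lambda>X Y. adj Y (\<lambda>zs. vf X (\<lambda>u. \<phi> u (y # zs)) u - rr X (\<phi> u (y # zs))) ys) =
      B_inv G \<pp> (\<lambda>X Y. adj Y (\<lambda>zs. vf X (\<lambda>u. \<phi> u zs) u - rr X (\<phi> u zs)) (y # ys))"
    unfolding B_inv_uminus[symmetric] B_inv_diff[symmetric] B_inv_add[symmetric]
    by (rule B_inv_cong) simp
  finally show ?case .
qed

section \<open>Relative forms\<close>

context
  fixes k \<phi> assumes \<phi>: "\<phi> \<in> rel_forms G \<pp> \<qq> P E act s \<rho> k"
begin

lemma form_D:
  "\<phi> u \<in> forms \<pp> \<qq> s k" "mlin (\<phi> u)" "alt (\<phi> u)" "vanish \<qq> (\<phi> u)" "vanish \<nn> (\<phi> u)"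
  "\<not> (length xs = k \<and> set xs \<subseteq> \<pp>) \<Longrightarrow> \<phi> u xs = 0"
proof -
  show f: "\<phi> u \<in> forms \<pp> \<qq> s k" using \<phi> by (simp add: rel_forms_def)
  then show "mlin (\<phi> u)" "alt (\<phi> u)" and v: "vanish \<qq> (\<phi> u)"
    and "\<not> (length xs = k \<and> set xs \<subseteq> \<pp>) \<Longrightarrow> \<phi> u xs = 0" unfolding forms_iff by blast+
  show "vanish \<nn> (\<phi> u)" by (rule vanish_mono[OF v nil_subset_q])
qed

lemma form_smooth: "smooth_map E (vec_manifold s) UNIV (\<lambda>u. \<phi> u xs)"
  using \<phi> by (simp add: rel_forms_def)

lemma form_cdiff: "cdiff (\<lambda>u. \<phi> u xs)"
  by (rule smooth_cdiff[OF form_smooth])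

lemma form_cdiff_vf: "cdiff (\<lambda>u. vf X (\<lambda>u. \<phi> u xs) u)"
  by (rule cdiff_vf[OF form_smooth])

lemma form_equivar: "equivar \<phi>"
  using \<phi> unfolding rel_forms_def equivar_def by blast

lemma form_vf_q: "Z \<in> \<qq> \<Longrightarrow> set xs \<subseteq> \<pp> \<Longrightarrow> vf Z (\<lambda>u. \<phi> u xs) u = - lact Z (\<phi> u) xs"
  by (rule equivar_vf[OF form_equivar form_cdiff form_D(2)])

lemma lact_nil: "X \<in> \<nn> \<Longrightarrow> set xs \<subseteq> \<pp> \<Longrightarrow> lact X (\<phi> u) xs = 0"
  using null_linear_lact[OF form_D(2,5)] by (simp add: null_linear_def)

lemma form_vf_nil: "X \<in> \<nn> \<Longrightarrow> set xs \<subseteq> \<pp> \<Longrightarrow> vf X (\<lambda>u. \<phi> u xs) u = 0"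
  using form_vf_q[of X xs u] nil_subset_q lact_nil by auto

lemma mlin_dd: "mlin (dd \<phi> u)"
  unfolding mlin_def
proof (intro allI impI conjI ballI)
  fix xs ys X Y assume p: "set xs \<subseteq> \<pp>" "set ys \<subseteq> \<pp>" "X \<in> \<pp>" "Y \<in> \<pp>"
  show "dd \<phi> u (xs @ (X + Y) # ys) = dd \<phi> u (xs @ X # ys) + dd \<phi> u (xs @ Y # ys)"
  proof (cases xs)
    case Nil
    then show ?thesis by (simp add: vf_left form_cdiff)
  next
    case (Cons z zs)
    then show ?thesis using mlin_D(1)[OF mlin_vf[of \<phi> z u, OF form_D(2) form_cdiff] _ p(2,3,4), of zs] p(1) by simp
  qed
next
  fix xs ys X a assume p: "set xs \<subseteq> \<pp>" "set ys \<subseteq> \<pp>" "X \<in> \<pp>"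
  show "dd \<phi> u (xs @ (a *s X) # ys) = s a (dd \<phi> u (xs @ X # ys))"
  proof (cases xs)
    case Nil
    then show ?thesis by (simp add: vf_left form_cdiff)
  next
    case (Cons z zs)
    then show ?thesis using mlin_D(2)[OF mlin_vf[of \<phi> z u, OF form_D(2) form_cdiff] _ p(2,3), of zs] p(1) by simp
  qed
qed

text \<open>Equivariance of the derivative of the form, with its direction W treated as one more
  argument; the bracket is the action of U on W.\<close>

lemma form_vf_vf:
  assumes U: "U \<in> \<qq>" and W: "W \<in> \<pp>" and xs: "set xs \<subseteq> \<pp>"
  shows "vf U (\<lambda>u. vf W (\<lambda>u. \<phi> u xs) u) u =
    vf \<lbrakk>U, W\<rbrakk> (\<lambda>u. \<phi> u xs) u - lact U (\<lambda>zs. vf W (\<lambda>u. \<phi> u zs) u) xs"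
proof -
  have "vf U (\<lambda>u. dd \<phi> u (W # xs)) u = - lact U (dd \<phi> u) (W # xs)"
    using W xs form_cdiff_vf by (intro equivar_vf[OF equivar_dd[OF form_equivar form_cdiff] _ mlin_dd U]) auto
  then show ?thesis by (simp add: lact_Cons)
qed

text \<open>The total Lie derivative along the vector field of \<open>W\<close>; it vanishes for \<open>W \<in> \<qq>\<close> by equivariance.\<close>

definition tlie where "tlie W xs u = vf W (\<lambda>u. \<phi> u xs) u + lact W (\<phi> u) xs"

lemma tlie_q: "W \<in> \<qq> \<Longrightarrow> set xs \<subseteq> \<pp> \<Longrightarrow> tlie W xs u = 0"
  by (simp add: tlie_def form_vf_q)

lemma cdiff_tlie: "W \<in> \<pp> \<Longrightarrow> cdiff (\<lambda>u. tlie W xs u)"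
  unfolding tlie_def using form_cdiff_vf form_cdiff by (intro cdiff_add cdiff_lact)

lemma null_linear_tlie: "set xs \<subseteq> \<pp> \<Longrightarrow> null_linear (\<lambda>W. tlie W xs u)"
  unfolding tlie_def using form_vf_nil
  by (intro null_linear_add null_linear_lact form_D) (auto simp: null_linear_def vf_left form_cdiff)

lemma mlin_tlie: "W \<in> \<pp> \<Longrightarrow> mlin (\<lambda>xs. tlie W xs u)"
  unfolding tlie_def using form_D form_cdiff by (intro mlin_add mlin_vf mlin_lact)

lemma vanish_tlie: "W \<in> \<pp> \<Longrightarrow> vanish \<nn> (\<lambda>xs. tlie W xs u)"
  unfolding tlie_def using form_D by (intro vanish_add vanish_vf vanish_nil_lact)

text \<open>With T for \<open>tlie\<close> this reads \<open>[T_U, T_W] = T_[U, W]\<close>, where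
  the product \<open>T_W T_U\<close> is absent because \<open>T_U\<close> annihilates the
  form.\<close>

lemma tlie_tlie:
  assumes U: "U \<in> \<qq>" and W: "W \<in> \<pp>" and xs: "set xs \<subseteq> \<pp>"
  shows "vf U (\<lambda>u. tlie W xs u) u + lact U (\<lambda>zs. tlie W zs u) xs = tlie \<lbrakk>U, W\<rbrakk> xs u"
proof -
  have Up: "U \<in> \<pp>" using U q_subset by blast
  have "vf U (\<lambda>u. tlie W xs u) u = vf U (\<lambda>u. vf W (\<lambda>u. \<phi> u xs) u) u + lact W (\<lambda>zs. vf U (\<lambda>u. \<phi> u zs) u) xs"
    unfolding tlie_def using W by (simp add: vf_add form_cdiff_vf form_cdiff cdiff_lact vf_lact)
  also have "lact W (\<lambda>zs. vf U (\<lambda>u. \<phi> u zs) u) xs = lact W (\<lambda>zs. - lact U (\<phi> u) zs) xs"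
    using W xs form_vf_q[OF U] by (intro lact_cong)
  also have "\<dots> = - lact W (lact U (\<phi> u)) xs"
    using W by (intro lact_hom) auto
  finally have "vf U (\<lambda>u. tlie W xs u) u = vf \<lbrakk>U, W\<rbrakk> (\<lambda>u. \<phi> u xs) u -
      lact U (\<lambda>zs. vf W (\<lambda>u. \<phi> u zs) u) xs - lact W (lact U (\<phi> u)) xs"
    by (simp add: form_vf_vf[OF U W xs])
  moreover have "lact U (\<lambda>zs. tlie W zs u) xs = lact U (\<lambda>zs. vf W (\<lambda>u. \<phi> u zs) u) xs + lact U (lact W (\<phi> u)) xs"
    unfolding tlie_def by (rule lact_add[OF Up])
  ultimately show ?thesis
    using lact_lact[OF form_D(2) Up W xs, of u] by (simp add: tlie_def)
qed

lemma null_bilinear_lact_vf: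
  assumes xs: "set xs \<subseteq> \<pp>"
  shows "null_bilinear (\<lambda>U W. lact U (\<lambda>zs. vf W (\<lambda>u. \<phi> u zs) u) xs)"
  unfolding null_bilinear_def
proof (intro conjI ballI)
  fix U assume U: "U \<in> \<pp>"
  have "lact U (\<lambda>zs. vf W (\<lambda>u. \<phi> u zs) u) xs = 0" if "W \<in> \<nn>" for W
    using lact_cong[OF U xs, of "\<lambda>zs. vf W (\<lambda>u. \<phi> u zs) u" "\<lambda>_. 0"] form_vf_nil[OF that] U by (simp add: lact_def)
  then show "null_linear (\<lambda>W. lact U (\<lambda>zs. vf W (\<lambda>u. \<phi> u zs) u) xs)"
    unfolding null_linear_def using U
    by (auto simp: vf_left form_cdiff lact_add r_scale S.scale_right_diff_distrib intro!: lact_hom)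
next
  fix W assume "W \<in> \<pp>"
  show "null_linear (\<lambda>U. lact U (\<lambda>zs. vf W (\<lambda>u. \<phi> u zs) u) xs)"
    using form_D form_cdiff xs by (intro null_linear_lact mlin_vf vanish_vf)
qed

lemma null_bilinear_lact_lact:
  assumes xs: "set xs \<subseteq> \<pp>"
  shows "null_bilinear (\<lambda>U W. lact U (lact W (\<phi> u)) xs)"
  unfolding null_bilinear_def
proof (intro conjI ballI)
  fix W assume "W \<in> \<pp>"
  then show "null_linear (\<lambda>U. lact U (lact W (\<phi> u)) xs)"
    using form_D xs by (intro null_linear_lact mlin_lact vanish_nil_lact)
next
  fix U assume U: "U \<in> \<pp>"
  note nl = null_linear_lact[OF form_D(2,5), unfolded null_linear_def]
  have 1: "lact U (lact (X + Y) (\<phi> u)) xs = lact U (lact X (\<phi> u)) xs + lact U (lact Y (\<phi> u)) xs"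
    if "X \<in> \<pp>" "Y \<in> \<pp>" for X Y
    unfolding lact_add[OF U, symmetric] using nl that by (intro lact_cong U xs) blast
  have 2: "lact U (lact (a *s X) (\<phi> u)) xs = s a (lact U (lact X (\<phi> u)) xs)" if "X \<in> \<pp>" for a X
  proof -
    have "lact U (lact (a *s X) (\<phi> u)) xs = lact U (\<lambda>zs. s a (lact X (\<phi> u) zs)) xs"
      using nl that by (intro lact_cong U xs) blast
    also have "\<dots> = s a (lact U (lact X (\<phi> u)) xs)"
      using U by (intro lact_hom) (auto simp: r_scale S.scale_right_diff_distrib)
    finally show ?thesis .
  qed
  have 3: "lact U (lact X (\<phi> u)) xs = 0" if "X \<in> \<nn>" for X
    using lact_cong[OF U xs, of "lact X (\<phi> u)" "\<lambda>_. 0"] lact_nil[OF that] U by (simp add: lact_def)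
  show "null_linear (\<lambda>W. lact U (lact W (\<phi> u)) xs)"
    unfolding null_linear_def using 1 2 3 by blast
qed

lemma B_inv_tlie_tlie:
  assumes xs: "set xs \<subseteq> \<pp>"
  shows "B_inv G \<pp> (\<lambda>U W. vf U (\<lambda>u. tlie W xs u) u + lact U (\<lambda>zs. tlie W zs u) xs) = 0"
proof -
  define b where "b U W = vf U (\<lambda>u. tlie W xs u) u + lact U (\<lambda>zs. tlie W zs u) xs" for U W
  \<comment> \<open>For W in q, \<open>tlie W\<close> vanishes at every point, so its derivative
    along an arbitrary U vanishes too.\<close>
  have zero: "b U W = 0" if "W \<in> \<qq>" "U \<in> \<pp>" for U W
    using lact_cong[OF that(2) xs, of "\<lambda>zs. tlie W zs u" "\<lambda>_. 0"] that tlie_q xs by (simp add: b_def lact_def)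
  have nl: "null_linear (\<lambda>W. tlie W zs u)" if "set zs \<subseteq> \<pp>" for zs u
    by (rule null_linear_tlie[OF that])
  have "null_bilinear b"
    unfolding null_bilinear_def
  proof (intro conjI ballI)
    fix U assume U: "U \<in> \<pp>"
    have "b U (X + Y) = b U X + b U Y" if XY: "X \<in> \<pp>" "Y \<in> \<pp>" for X Y
    proof -
      have "(\<lambda>u. tlie (X + Y) xs u) = (\<lambda>u. tlie X xs u + tlie Y xs u)"
        using nl[OF xs] XY unfolding null_linear_def by blast
      moreover have "lact U (\<lambda>zs. tlie (X + Y) zs u) xs = lact U (\<lambda>zs. tlie X zs u + tlie Y zs u) xs"
        using nl XY unfolding null_linear_def by (intro lact_cong U xs) blast
      ultimately show ?thesis using XY U by (simp add: b_def vf_add cdiff_tlie lact_add)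
    qed
    moreover have "b U (a *s X) = s a (b U X)" if X: "X \<in> \<pp>" for a X
    proof -
      have "(\<lambda>u. tlie (a *s X) xs u) = (\<lambda>u. s a (tlie X xs u))"
        using nl[OF xs] X unfolding null_linear_def by blast
      moreover have "lact U (\<lambda>zs. tlie (a *s X) zs u) xs = lact U (\<lambda>zs. s a (tlie X zs u)) xs"
        using nl X unfolding null_linear_def by (intro lact_cong U xs) blast
      moreover have "lact U (\<lambda>zs. s a (tlie X zs u)) xs = s a (lact U (\<lambda>zs. tlie X zs u) xs)"
        using U by (intro lact_hom) (auto simp: r_scale S.scale_right_diff_distrib)
      ultimately show ?thesis using X by (simp add: b_def vf_s cdiff_tlie S.scale_right_distrib)
    qed
    ultimately show "null_linear (b U)"
      unfolding null_linear_def using zero U nil_subset_q by blast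
  next
    fix W assume W: "W \<in> \<pp>"
    note l = null_linear_lact[OF mlin_tlie[OF W] vanish_tlie[OF W] xs, of u, unfolded null_linear_def]
    \<comment> \<open>Here the outer direction lies in p_+; \<open>tlie_tlie\<close> reduces the
      value to \<open>[U, W]\<close>, which lies in p_+ again.\<close>
    have "b U W = 0" if "U \<in> \<nn>" for U
    proof -
      have "U \<in> \<qq>" "\<lbrakk>U, W\<rbrakk> \<in> \<qq>" using that nil_br'[OF that W] nil_subset_q by auto
      then show ?thesis unfolding b_def using tlie_tlie[OF _ W xs] tlie_q[OF _ xs] by simp
    qed
    then show "null_linear (\<lambda>U. b U W)"
      unfolding null_linear_def using l cdiff_tlie[OF W]
      by (auto simp: b_def vf_left S.scale_right_distrib)
  qed
  moreover obtain Xs Zs where d: "rel_dual Xs Zs" using ex_rel_dual by blast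
  ultimately have "B_inv G \<pp> b = (\<Sum>i<length Xs. b (Zs ! i) (Xs ! i))"
    using zero by (intro B_inv_rel) auto
  also have "\<dots> = (\<Sum>i<length Xs. s 1 (tlie \<lbrakk>Zs ! i, Xs ! i\<rbrakk> xs u))"
  proof (rule sum.cong[OF refl])
    fix i assume "i \<in> {..<length Xs}"
    then have "Xs ! i \<in> \<pp>" "Zs ! i \<in> \<qq>"
      using d rel_dual_length[OF d] nilq_subset_q by (auto simp: rel_dual_def subset_iff)
    then show "b (Zs ! i) (Xs ! i) = s 1 (tlie \<lbrakk>Zs ! i, Xs ! i\<rbrakk> xs u)"
      using tlie_tlie xs by (simp add: b_def)
  qed
  also have "\<dots> = tlie (\<Sum>i<length Xs. 1 *s \<lbrakk>Zs ! i, Xs ! i\<rbrakk>) xs u"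
    using d rel_dual_length[OF d] nilq_subset_p
    by (intro null_linear_sum[OF nl[OF xs], symmetric] p_br) (auto simp: rel_dual_def subset_iff)
  also have "\<dots> = 0"
    using rel_dual_bracket_sum[OF d] xs by (simp add: tlie_q)
  finally show ?thesis by (simp add: b_def[abs_def])
qed

text \<open>Expanding the vanishing contraction of \<open>tlie\<close> with itself gives the second
  derivatives, two mixed terms and an algebraic term. Derivatives commute with L, and symmetry of
  the Casimir tensor identifies the mixed terms, so the second derivatives equal an expression of
  first order.\<close>

lemma curved_casimir_conv:
  assumes xs: "set xs \<subseteq> \<pp>"
  shows "curved_casimir G \<pp> E \<omega> \<phi> u xs =
    - B_inv G \<pp> (\<lambda>X Y. 2 *\<^sub>R lact Y (\<lambda>zs. vf X (\<lambda>u. \<phi> u zs) u) xs + lact Y (lact X (\<phi> u)) xs)"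
proof -
  have cc: "curved_casimir G \<pp> E \<omega> \<phi> u xs = B_inv G \<pp> (\<lambda>X Y. vf X (\<lambda>u. vf Y (\<lambda>u. \<phi> u xs) u) u)"
    unfolding curved_casimir_def fund_deriv_conv ..
  note B_inv_tlie_tlie[OF xs, of u]
  moreover have "B_inv G \<pp> (\<lambda>U W. vf U (\<lambda>u. tlie W xs u) u + lact U (\<lambda>zs. tlie W zs u) xs) =
     B_inv G \<pp> (\<lambda>X Y. vf X (\<lambda>u. vf Y (\<lambda>u. \<phi> u xs) u) u) + B_inv G \<pp> (\<lambda>X Y. lact Y (\<lambda>zs. vf X (\<lambda>u. \<phi> u zs) u) xs) +
     B_inv G \<pp> (\<lambda>X Y. lact X (\<lambda>zs. vf Y (\<lambda>u. \<phi> u zs) u) xs) + B_inv G \<pp> (\<lambda>X Y. lact X (lact Y (\<phi> u)) xs)"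
    unfolding B_inv_add[symmetric] tlie_def
    by (rule B_inv_cong) (simp add: vf_add form_cdiff_vf form_cdiff cdiff_lact vf_lact lact_add)
  moreover have "B_inv G \<pp> (\<lambda>X Y. lact X (\<lambda>zs. vf Y (\<lambda>u. \<phi> u zs) u) xs) = B_inv G \<pp> (\<lambda>X Y. lact Y (\<lambda>zs. vf X (\<lambda>u. \<phi> u zs) u) xs)"
    by (rule B_inv_swap[OF null_bilinear_lact_vf[OF xs], symmetric])
  moreover have "B_inv G \<pp> (\<lambda>X Y. lact X (lact Y (\<phi> u)) xs) = B_inv G \<pp> (\<lambda>X Y. lact Y (lact X (\<phi> u)) xs)"
    by (rule B_inv_swap[OF null_bilinear_lact_lact[OF xs], symmetric])
  ultimately have "B_inv G \<pp> (\<lambda>X Y. vf X (\<lambda>u. vf Y (\<lambda>u. \<phi> u xs) u) u) + B_inv G \<pp> (\<lambda>X Y. lact Y (\<lambda>zs. vf X (\<lambda>u. \<phi> u zs) u) xs) +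
     B_inv G \<pp> (\<lambda>X Y. lact Y (\<lambda>zs. vf X (\<lambda>u. \<phi> u zs) u) xs) + B_inv G \<pp> (\<lambda>X Y. lact Y (lact X (\<phi> u)) xs) = 0"
    by simp
  then show ?thesis
    unfolding cc scaleR_2 B_inv_add by (simp only: eq_neg_iff_add_eq_0 add.assoc)
qed

text \<open>\<open>codiff\<close> is determined on \<open>forms\<close> only, so the exterior
  derivative must be known to stay there. With X from q in the first slot, Cartan's formula leaves
  the derivative along X plus \<open>lact X\<close>, which cancel by equivariance; alternation
  carries this over to every slot.\<close>

lemma d_twisted_forms: "d_twisted G \<pp> P E \<omega> \<rho> \<phi> u \<in> forms \<pp> \<qq> s (Suc k)"
proof -
  let ?d = "d_twisted G \<pp> P E \<omega> \<rho> \<phi> u"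
  have eq: "?d xs = dl xs \<phi> u" if "set xs \<subseteq> \<pp>" for xs
    by (rule d_twisted_dl[OF form_D(2,3) that])
  have m: "mlin ?d" by (rule mlin_cong[OF mlin_dl[OF form_D(2) form_cdiff] eq])
  have a: "alt ?d" by (rule alt_cong[OF alt_dl[OF form_D(2,3) form_cdiff] eq])
  have q: "?d (X # ys) = 0" if X: "X \<in> \<qq>" and ys: "set ys \<subseteq> \<pp>" for X ys
  proof -
    have "dl ys (\<lambda>u zs. \<phi> u (X # zs)) u = dl ys (\<lambda>u zs. 0) u"
      using vanishD0[OF form_D(4)] X ys by (intro dl_cong)
    then show ?thesis using eq[of "X # ys"] X ys q_subset by (auto simp: dl_zero form_vf_q)
  qed
  have "vanish \<qq> ?d"
    unfolding vanish_def
  proof (intro allI impI ballI)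
    fix xs ys X assume p: "set xs \<subseteq> \<pp>" "set ys \<subseteq> \<pp>" "X \<in> \<qq>"
    let ?l = "xs @ X # ys"
    have l: "set ?l \<subseteq> \<pp>" using p q_subset by auto
    have "?d (?l[length xs := X]) = (- 1) ^ length xs *\<^sub>R ?d (X # omit {length xs} ?l)"
      using p q_subset by (intro alt_move[OF m a l]) auto
    then show "?d ?l = 0" using q[OF p(3) subset_trans[OF set_omit l]] by simp
  qed
  moreover have "?d xs = 0" if n: "\<not> (length xs = Suc k \<and> set xs \<subseteq> \<pp>)" for xs
  proof (cases "set xs \<subseteq> \<pp>")
    case True
    then have len: "length xs \<noteq> Suc k" using n by blast
    have 1: "\<phi> u' (omit {i} xs) = 0" if "i < length xs" for u' i
      using length_omit_1[OF that] len that by (intro form_D(6)) auto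
    have 2: "\<phi> u' (Z # omit {i, j} xs) = 0" if "i < j" "j < length xs" for u' Z i j
      using length_omit_2[OF that] len that by (intro form_D(6)) auto
    show ?thesis
      using True unfolding d_twisted_def fund_deriv_conv by (auto simp: 1 2 subset_iff intro!: sum.neutral)
  qed (simp add: d_twisted_def)
  ultimately show ?thesis using m a unfolding forms_iff by blast
qed

lemma casimir_rep_zero: "casimir_rep G \<pp> P \<rho> 0 = 0"
proof -
  have "casimir_rep G \<pp> P \<rho> 0 = B_inv G \<pp> (\<lambda>X Y. 0)"
    unfolding casimir_rep_def by (rule B_inv_cong) simp
  then show ?thesis by simp
qed

lemma laplacian_formula:
  "laplacian G \<pp> \<qq> P E \<omega> s \<rho> k \<phi> u xs =
    (1 / 2) *\<^sub>R (curved_casimir G \<pp> E \<omega> \<phi> u xs - casimir_rep G \<pp> P \<rho> (\<phi> u xs))"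
proof (cases "set xs \<subseteq> \<pp>")
  \<comment> \<open>If some entry lies outside p, the form, \<open>d_twisted\<close> and
    \<open>cdf\<close> all have the value 0 by convention.\<close>
  case False
  have "laplacian G \<pp> \<qq> P E \<omega> s \<rho> k \<phi> u xs = 0"
    unfolding laplacian_def codiff_eq_cdf[OF d_twisted_forms] using False by (simp add: cdf_def d_twisted_def)
  moreover have "(\<lambda>u. \<phi> u xs) = (\<lambda>u. 0)" "\<phi> u xs = 0" using False form_D(6) by auto
  then have "curved_casimir G \<pp> E \<omega> \<phi> u xs = 0" "casimir_rep G \<pp> P \<rho> (\<phi> u xs) = 0"
    unfolding curved_casimir_def fund_deriv_conv by (simp_all add: casimir_rep_zero)
  ultimately show ?thesis by simp
next
  case xs: True
  let ?V = "\<lambda>X zs. vf X (\<lambda>u. \<phi> u zs) u"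
  have 1: "codiff G \<pp> \<qq> P s \<rho> (Suc k) (d_twisted G \<pp> P E \<omega> \<rho> \<phi> u) xs =
    - (1 / 2) *\<^sub>R B_inv G \<pp> (\<lambda>X Y. mact Y (?V X) xs + mact Y (lact X (\<phi> u)) xs - mact Y (\<lambda>zs. dl zs (\<lambda>u. ins X (\<phi> u)) u) xs)"
  proof -
    have "B_inv G \<pp> (\<lambda>X Y. mact Y (ins X (d_twisted G \<pp> P E \<omega> \<rho> \<phi> u)) xs) =
      B_inv G \<pp> (\<lambda>X Y. mact Y (?V X) xs + mact Y (lact X (\<phi> u)) xs - mact Y (\<lambda>zs. dl zs (\<lambda>u. ins X (\<phi> u)) u) xs)"
    proof (rule B_inv_cong)
      fix X Y assume XY: "X \<in> \<pp>" "Y \<in> \<pp>"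
      have "mact Y (ins X (d_twisted G \<pp> P E \<omega> \<rho> \<phi> u)) xs = mact Y (\<lambda>zs. dl (X # zs) \<phi> u) xs"
        using XY xs by (intro mact_cong d_twisted_dl form_D) auto
      then show "mact Y (ins X (d_twisted G \<pp> P E \<omega> \<rho> \<phi> u)) xs =
        mact Y (?V X) xs + mact Y (lact X (\<phi> u)) xs - mact Y (\<lambda>zs. dl zs (\<lambda>u. ins X (\<phi> u)) u) xs"
        using XY by (simp add: mact_add mact_diff)
    qed
    then show ?thesis unfolding codiff_eq_cdf[OF d_twisted_forms] using xs by (simp add: cdf_def)
  qed
  have 2: "d_twisted G \<pp> P E \<omega> \<rho> (\<lambda>u. codiff G \<pp> \<qq> P s \<rho> k (\<phi> u)) u xs =
    - (1 / 2) *\<^sub>R B_inv G \<pp> (\<lambda>X Y. dl xs (\<lambda>u. mact Y (ins X (\<phi> u))) u)"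
  proof -
    have "d_twisted G \<pp> P E \<omega> \<rho> (\<lambda>u. codiff G \<pp> \<qq> P s \<rho> k (\<phi> u)) u xs = dl xs (\<lambda>u. cdf (\<phi> u)) u"
      unfolding codiff_eq_cdf[OF form_D(1)] by (rule d_twisted_dl[OF cdf_class[OF form_D(2,3)] xs])
    also have "\<dots> = dl xs (\<lambda>u zs. (- (1 / 2)) *\<^sub>R B_inv G \<pp> (\<lambda>X Y. mact Y (ins X (\<phi> u)) zs)) u"
      using xs by (intro dl_cong) (auto simp: cdf_def)
    also have "\<dots> = (- (1 / 2)) *\<^sub>R dl xs (\<lambda>u zs. B_inv G \<pp> (\<lambda>X Y. mact Y (ins X (\<phi> u)) zs)) u"
      using form_cdiff xs by (intro dl_scaleR cdiff_B_inv cdiff_mact) auto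
    also have "dl xs (\<lambda>u zs. B_inv G \<pp> (\<lambda>X Y. mact Y (ins X (\<phi> u)) zs)) u =
        B_inv G \<pp> (\<lambda>X Y. dl xs (\<lambda>u. mact Y (ins X (\<phi> u))) u)"
      using form_cdiff xs by (intro dl_B_inv cdiff_mact) auto
    finally show ?thesis .
  qed
  \<comment> \<open>The mixed term produced by the extra copy of R in \<open>mact\<close> cancels
    against the one left by the commutator.\<close>
  have ar: "B_inv G \<pp> (\<lambda>X Y. rr X (adj Y (\<phi> u) xs)) = B_inv G \<pp> (\<lambda>X Y. rr Y (adj X (\<phi> u) xs))"
    using null_linear_r null_linear_comp_r[OF null_linear_adj[OF form_D(2,5) xs]]
    by (intro B_inv_swap[of "\<lambda>X Y. rr Y (adj X (\<phi> u) xs)"]) (auto simp: null_bilinear_def)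
  have "laplacian G \<pp> \<qq> P E \<omega> s \<rho> k \<phi> u xs =
    - (1 / 2) *\<^sub>R (B_inv G \<pp> (\<lambda>X Y. mact Y (?V X) xs + mact Y (lact X (\<phi> u)) xs) +
      B_inv G \<pp> (\<lambda>X Y. comm_dm Y (\<lambda>u. ins X (\<phi> u)) xs u))"
    unfolding laplacian_def 1 2 comm_dm_def B_inv_add B_inv_diff by (simp add: algebra_simps)
  also have "B_inv G \<pp> (\<lambda>X Y. comm_dm Y (\<lambda>u. ins X (\<phi> u)) xs u) =
      B_inv G \<pp> (\<lambda>X Y. adj Y (\<lambda>zs. ?V X zs - rr X (\<phi> u zs)) xs)"
    using form_D form_cdiff form_vf_nil xs by (intro B_inv_comm_dm)
  \<comment> \<open>On derivatives \<open>mact Y\<close> and \<open>adj Y\<close> add up to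
    \<open>2 lact Y\<close>. On \<open>lact X\<close> of the form, \<open>mact Y\<close> exceeds
    \<open>lact Y\<close> by the action of Y on the values, which splits into the Casimir term and a
    mixed term.\<close>
  also have "B_inv G \<pp> (\<lambda>X Y. mact Y (?V X) xs + mact Y (lact X (\<phi> u)) xs) +
      B_inv G \<pp> (\<lambda>X Y. adj Y (\<lambda>zs. ?V X zs - rr X (\<phi> u zs)) xs) =
      B_inv G \<pp> (\<lambda>X Y. 2 *\<^sub>R lact Y (?V X) xs + lact Y (lact X (\<phi> u)) xs) +
      B_inv G \<pp> (\<lambda>X Y. rr Y (rr X (\<phi> u xs))) + B_inv G \<pp> (\<lambda>X Y. rr Y (adj X (\<phi> u) xs)) -
      B_inv G \<pp> (\<lambda>X Y. rr X (adj Y (\<phi> u) xs))"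
    unfolding B_inv_add[symmetric] B_inv_diff[symmetric]
    by (rule B_inv_cong)
      (simp add: mact_def lact_def adj_diff adj_r r_add scaleR_2 algebra_simps)
  also have "\<dots> = - curved_casimir G \<pp> E \<omega> \<phi> u xs + casimir_rep G \<pp> P \<rho> (\<phi> u xs)"
    unfolding curved_casimir_conv[OF xs] casimir_rep_def ar by simp
  finally show ?thesis by (simp add: algebra_simps)
qed

end

end

section \<open>Irreducible representations\<close>

text \<open>Finite real dimension provides a nonzero polynomial in T, here \<open>ev\<close>, that
  annihilates \<open>v0\<close>. Among all pairs of a nonzero polynomial and a nonzero vector
  annihilated by it, one of least degree is taken. That polynomial has a root c, and by minimality
  its cofactor maps the vector to something nonzero, which is an eigenvector for c.\<close>

lemma ex_eigenvector:
  fixes t :: "complex \<Rightarrow> 'v::euclidean_space \<Rightarrow> 'v" and T :: "'v \<Rightarrow> 'v" and v0 :: 'v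
  assumes ks: "kspace t" and add: "\<And>v w. T (v + w) = T v + T w" and scale: "\<And>a v. T (t a v) = t a (T v)"
    and v0: "v0 \<noteq> 0"
  obtains c v where "v \<noteq> 0" "T v = t c v"
proof -
  interpret t: vector_space t using ks by (simp add: kspace_def)
  have t_real: "t (of_real r) v = r *\<^sub>R v" for r v using ks by (simp add: kspace_def)
  have T0 [simp]: "T 0 = 0" using add[of 0 0] by simp
  define ev where "ev p v = fold_coeffs (\<lambda>a w. t a v + T w) p 0" for p v
  have ev0 [simp]: "ev 0 v = 0" for v by (simp add: ev_def)
  have evC [simp]: "ev (pCons a p) v = t a v + T (ev p v)" for a p v
    by (cases "p = 0 \<and> a = 0") (auto simp: ev_def)
  have ev_add: "ev (p + q) v = ev p v + ev q v" for p q v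
    by (induction p q rule: poly_induct2) (simp_all add: add t.scale_left_distrib)
  have ev_diff: "ev (p - q) v = ev p v - ev q v" for p q v
    using ev_add[of "p - q" q v] by simp
  have ev_smult: "ev (smult a p) v = t a (ev p v)" for a p v
    by (induction p) (simp_all add: scale t.scale_right_distrib)
  have ev_monom: "ev (monom a i) v = t a ((T ^^ i) v)" for a i v
    by (induction i) (simp_all add: monom_0 monom_Suc scale)
  have ev_sum: "ev (\<Sum>i\<in>A. f i) v = (\<Sum>i\<in>A. ev (f i) v)" for f v and A :: "nat set"
    by (induction A rule: infinite_finite_induct) (simp_all add: ev_add)
  let ?n = "DIM('v)"
  \<comment> \<open>There is one iterate more than the real dimension. If two iterates coincide, the
    set of iterates is too small for a count, but their difference is already a relation.\<close>
  have "\<exists>a :: nat \<Rightarrow> real. (\<exists>i\<le>?n. a i \<noteq> 0) \<and> (\<Sum>i\<le>?n. a i *\<^sub>R (T ^^ i) v0) = 0"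
  proof (cases "inj_on (\<lambda>i. (T ^^ i) v0) {..?n}")
    case True
    have "dependent ((\<lambda>i. (T ^^ i) v0) ` {..?n})"
      by (rule dependent_biggerset) (simp add: card_image[OF True])
    then obtain u where u: "\<exists>v\<in>(\<lambda>i. (T ^^ i) v0) ` {..?n}. u v \<noteq> 0" "(\<Sum>v\<in>(\<lambda>i. (T ^^ i) v0) ` {..?n}. u v *\<^sub>R v) = 0"
      by (auto simp: dependent_finite)
    then show ?thesis
      by (intro exI[of _ "\<lambda>i. u ((T ^^ i) v0)"]) (auto simp: sum.reindex[OF True])
  next
    case False
    then obtain i j where ij: "i \<le> ?n" "j \<le> ?n" "i \<noteq> j" "(T ^^ i) v0 = (T ^^ j) v0"
      by (auto simp: inj_on_def)
    have "(\<Sum>l\<le>?n. ((if l = i then 1 else 0) - (if l = j then 1 else 0)) *\<^sub>R (T ^^ l) v0) =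
        (\<Sum>l\<le>?n. if l = i then (T ^^ l) v0 else 0) - (\<Sum>l\<le>?n. if l = j then (T ^^ l) v0 else 0)"
      unfolding sum_subtractf[symmetric] by (intro sum.cong) auto
    then show ?thesis using ij
      by (intro exI[of _ "\<lambda>l. (if l = i then 1 else 0) - (if l = j then 1 else 0)"]) auto
  qed
  then obtain a :: "nat \<Rightarrow> real" and i where a: "i \<le> ?n" "a i \<noteq> 0" "(\<Sum>i\<le>?n. a i *\<^sub>R (T ^^ i) v0) = 0" by blast
  define p0 where "p0 = (\<Sum>i\<le>?n. monom (of_real (a i) :: complex) i)"
  have "coeff p0 i = of_real (a i)" using a(1) by (simp add: p0_def coeff_sum if_distrib cong: if_cong)
  then have p0: "p0 \<noteq> 0" "ev p0 v0 = 0"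
    using a by (auto simp: p0_def ev_sum ev_monom t_real)
  define R where "R d \<longleftrightarrow> (\<exists>p v. p \<noteq> 0 \<and> v \<noteq> 0 \<and> ev p v = 0 \<and> degree p = d)" for d
  have "\<exists>d. R d" unfolding R_def using p0 v0 by blast
  then obtain d where d: "R d" "\<And>d'. d' < d \<Longrightarrow> \<not> R d'" using exists_least_iff[of R] by blast
  then obtain p v where p: "p \<noteq> 0" "v \<noteq> 0" "ev p v = 0" "degree p = d" unfolding R_def by blast
  have "degree p \<noteq> 0"
  proof
    assume "degree p = 0"
    then obtain c where "p = [:c:]" by (metis degree_eq_zeroE)
    then show False using p by simp
  qed
  then have "\<not> constant (poly p)" by (simp add: constant_degree)
  then obtain c where "poly p c = 0" using fundamental_theorem_of_algebra by blast
  then obtain q where q: "p = [:- c, 1:] * q" by (metis dvdE poly_eq_0_iff_dvd)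
  have "q \<noteq> 0" using p(1) q by auto
  moreover have "degree q < d"
    using degree_mult_eq[of "[:- c, 1:]" q] p(4) q \<open>q \<noteq> 0\<close> by (simp del: mult_pCons_left)
  ultimately have w: "ev q v \<noteq> 0" using d(2) p(2) unfolding R_def by blast
  have "T (ev q v) = t c (ev q v)"
    using p(3) unfolding q by (simp add: ev_diff ev_smult)
  then show thesis by (rule that[OF w])
qed

section \<open>Schur's lemma for the Casimir operator\<close>

context rel_setup begin

lemma casimir_rep_add: "casimir_rep G \<pp> P \<rho> (v + w) = casimir_rep G \<pp> P \<rho> v + casimir_rep G \<pp> P \<rho> w"
  unfolding casimir_rep_def B_inv_add[symmetric] by (rule B_inv_cong) (simp add: r_add)

lemma casimir_rep_hom:
  assumes L: "bounded_linear L" "\<And>g v. g \<in> P \<Longrightarrow> \<rho> g (L v) = L (\<rho> g v)"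
  shows "casimir_rep G \<pp> P \<rho> (L v) = L (casimir_rep G \<pp> P \<rho> v)"
proof -
  have "casimir_rep G \<pp> P \<rho> (L v) = B_inv G \<pp> (\<lambda>X Y. L (rr Y (rr X v)))"
    unfolding casimir_rep_def by (rule B_inv_cong) (simp add: inf_action_hom L)
  also have "\<dots> = L (casimir_rep G \<pp> P \<rho> v)"
    unfolding casimir_rep_def
    by (rule B_inv_hom) (simp_all add: linear_0 linear_add bounded_linear.linear[OF L(1)])
  finally show ?thesis .
qed

text \<open>The Casimir operator commutes with P and with complex scalars, so an eigenspace is an
  invariant complex subspace, and irreducibility makes it the whole space.\<close>

lemma casimir_rep_scalar:
  assumes irr: "complex_irreducible P s \<rho> sC"
  obtains c where "\<And>v. casimir_rep G \<pp> P \<rho> v = sC c v"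
    "{c. \<exists>v. v \<noteq> 0 \<and> casimir_rep G \<pp> P \<rho> v = sC c v} = {c}"
proof -
  let ?C = "casimir_rep G \<pp> P \<rho>"
  have kC: "kspace sC" using irr by (simp add: complex_irreducible_def)
  interpret C: vector_space sC using kC by (simp add: kspace_def)
  have rhoC: "\<rho> g (sC a v) = sC a (\<rho> g v)" if "g \<in> P" for g a v
  proof -
    interpret g: Vector_Spaces.linear sC sC "\<rho> g" using irr that by (simp add: complex_irreducible_def)
    show ?thesis by (rule g.scale)
  qed
  have C_sC: "?C (sC a v) = sC a (?C v)" for a v
    by (rule casimir_rep_hom[OF kspace_bounded_linear[OF kC] rhoC])
  obtain v0 :: 'v where "v0 \<noteq> 0" using irr by (auto simp: complex_irreducible_def)
  then obtain c v where cv: "v \<noteq> 0" "?C v = sC c v"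
    by (rule ex_eigenvector[OF kC casimir_rep_add C_sC])
  define W where "W = {w. ?C w = sC c w}"
  have "C.subspace W"
    using C_sC[of 0] by (auto simp: C.subspace_def W_def casimir_rep_add C_sC C.scale_right_distrib mult.commute)
  moreover have "\<rho> g ` W \<subseteq> W" if "g \<in> P" for g
    by (auto simp: W_def rhoC[OF that] casimir_rep_rho[OF that, symmetric])
  ultimately have "W = {0} \<or> W = UNIV" using irr by (simp add: complex_irreducible_def)
  then have all: "?C w = sC c w" for w using cv by (auto simp: W_def)
  have "{c'. \<exists>v. v \<noteq> 0 \<and> ?C v = sC c' v} = {c}"
    using cv by (auto simp: all)
  then show thesis using that all by blast
qed

end

theorem proposition4p14:
  fixes G :: "('k::{real_normed_field,euclidean_space}, 'd::finite,
      'x::{t2_space,second_countable_topology}) lie_group"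
    and \<pp> \<qq> :: "('k ^ 'd) set" and P Q :: "'x set"
    and E :: "('k, 'k ^ 'd, 't::{t2_space,second_countable_topology}) manifold"
    and M :: "('k, 'e::real_normed_vector, 'm::{t2_space,second_countable_topology}) manifold"
    and \<pi> :: "'t \<Rightarrow> 'm" and act :: "'t \<Rightarrow> 'x \<Rightarrow> 't" and \<omega> :: "'t \<Rightarrow> 'k ^ 'd \<Rightarrow> 'k ^ 'd"
    and s :: "'k \<Rightarrow> 'v::euclidean_space \<Rightarrow> 'v" and \<rho> :: "'x \<Rightarrow> 'v \<Rightarrow> 'v"
  assumes "relative_type G \<pp> \<qq> P" and "Q = normalizer G P \<qq>"
    and "parabolic_geometry G Q \<qq> E M \<pi> act \<omega>"
    and "relative_tractor G \<pp> P s \<rho>"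
  shows "(\<forall>k. \<forall>\<phi>\<in>rel_forms G \<pp> \<qq> P E act s \<rho> k.
      laplacian G \<pp> \<qq> P E \<omega> s \<rho> k \<phi> =
        (\<lambda>u xs. (1 / 2) *\<^sub>R (curved_casimir G \<pp> E \<omega> \<phi> u xs - casimir_rep G \<pp> P \<rho> (\<phi> u xs)))) \<and>
    (\<forall>sC. complex_irreducible P s \<rho> sC \<longrightarrow>
      (\<exists>c\<^sub>0::complex. {c. \<exists>v. v \<noteq> 0 \<and> casimir_rep G \<pp> P \<rho> v = sC c v} = {c\<^sub>0} \<and>
        (\<forall>v. casimir_rep G \<pp> P \<rho> v = sC c\<^sub>0 v) \<and>
        (\<forall>k. \<forall>\<phi>\<in>rel_forms G \<pp> \<qq> P E act s \<rho> k.
          laplacian G \<pp> \<qq> P E \<omega> s \<rho> k \<phi> =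
            (\<lambda>u xs. (1 / 2) *\<^sub>R (curved_casimir G \<pp> E \<omega> \<phi> u xs - sC c\<^sub>0 (\<phi> u xs))))))"
proof -
  interpret rel_geometry G \<pp> \<qq> P s \<rho> E M \<pi> act \<omega>
    using assms by unfold_locales simp_all
  have *: "laplacian G \<pp> \<qq> P E \<omega> s \<rho> k \<phi> =
        (\<lambda>u xs. (1 / 2) *\<^sub>R (curved_casimir G \<pp> E \<omega> \<phi> u xs - casimir_rep G \<pp> P \<rho> (\<phi> u xs)))"
    if "\<phi> \<in> rel_forms G \<pp> \<qq> P E act s \<rho> k" for k \<phi>
    using laplacian_formula[OF that] by blast
  moreover have "\<exists>c\<^sub>0::complex. {c. \<exists>v. v \<noteq> 0 \<and> casimir_rep G \<pp> P \<rho> v = sC c v} = {c\<^sub>0} \<and>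
        (\<forall>v. casimir_rep G \<pp> P \<rho> v = sC c\<^sub>0 v) \<and>
        (\<forall>k. \<forall>\<phi>\<in>rel_forms G \<pp> \<qq> P E act s \<rho> k.
          laplacian G \<pp> \<qq> P E \<omega> s \<rho> k \<phi> =
            (\<lambda>u xs. (1 / 2) *\<^sub>R (curved_casimir G \<pp> E \<omega> \<phi> u xs - sC c\<^sub>0 (\<phi> u xs))))"
    if irr: "complex_irreducible P s \<rho> sC" for sC
  proof -
    obtain c where c: "\<And>v. casimir_rep G \<pp> P \<rho> v = sC c v"
      "{c. \<exists>v. v \<noteq> 0 \<and> casimir_rep G \<pp> P \<rho> v = sC c v} = {c}"
      using casimir_rep_scalar[OF irr] by blast
    show ?thesis
      by (rule exI[of _ c], intro conjI allI ballI c) (simp add: * c(1))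
  qed
  ultimately show ?thesis by blast
qed

end
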